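(* The functor $D\colon \mathrm{Sp}^\Sigma(\mathrm{Ch}^+)\to\mathrm{Ch}$, equipped with the natural maps $\phi^{A,B}\colon D(A)\otimes D(B)\to D(A\,\overline{\otimes}\,B)$ given by $$\phi^{A,B}(\xi(a)\otimes\xi(b))=(-1)^{mn+mi}\,\xi(\iota_*(a\otimes b))\qquad (a\in A_{n,i},\ b\in B_{m,j}),$$ is (strong) symmetric monoidal. That is, the maps $\phi^{A,B}$ are natural isomorphisms compatible with the associativity and unit isomorphisms of $\mathrm{Sp}^\Sigma(\mathrm{Ch}^+)$ and $\mathrm{Ch}$ (with unit isomorphism $\mathbb{Z}=\mathbb{Z}[0]\to D(\mathbb{Z}[*])$, $1\mapsto \xi(e_0)$), and for all $A,B\in\mathrm{Sp}^\Sigma(\mathrm{Ch}^+)$ they are compatible with the twist maps: $$D(\tau^{A,B})\circ\phi^{A,B}=\phi^{B,A}\circ\tau^{D(A),D(B)}\colon D(A)\otimes D(B)\to D(B\,\overline{\otimes}\,A).$$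
   Context: Chain complexes. $\mathrm{Ch}$ is the category of ($\mathbb{Z}$-graded) chain complexes of abelian groups, with differential lowering degree by one; $\mathrm{Ch}^+$ is the full subcategory of complexes $C$ with $C_k=0$ for $k<0$. Both are symmetric monoidal with $(A\otimes B)_n=\bigoplus_{i+j=n}A_i\otimes B_j$, $d(a\otimes b)=d(a)\otimes b+(-1)^{|a|}a\otimes d(b)$, $\tau(a\otimes b)=(-1)^{|a||b|}b\otimes a$. For $n\in\mathbb{Z}$, $\mathbb{Z}[n]$ is the complex freely generated by one element $e_n$ in degree $n$, with $d(e_n)=0$. Indexing categories. $\mathcal{J}$ has objects the natural numbers $n=\{0,\dots,n-1\}$ and morphisms the injective functions. It is symmetric monoidal under $n\Box m=n+m$; for $f\colon p\to q$, $g\colon m\to n$, $f\Box g\colon p+m\to q+n$ is $f$ on the first $p$ elements, and $(f\Box g)(i)=g(i-p)+q$ for $p\le i<p+m$. Associators are identities. The twist $\tau^{m,n}\colon m\Box n\to n\Box m$ is $i\mapsto i+n$ for $0\le i<m$ and $i\mapsto i-m$ for $m\le i<m+n$; it has signature $(-1)^{mn}$. $\mathcal{F}\subset\mathcal{J}$ is the subcategory with the same objects and the bijections as morphisms. Since every bijection in $\mathcal{F}$ is a permutation, it has a signature $\mathrm{sgn}$. Symmetric sequences. $\mathrm{SS}(\mathrm{Ch}^+)$ is the category of functors $A\colon\mathcal{F}\to\mathrm{Ch}^+$ with the Day convolution tensor product. Write $A_{n,i}$ for the degree $i$ part of $A_n$. Explicitly, $A\otimes B$ is generated by elements $\theta_*(a\otimes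 b)\in(A\otimes B)_{p,i+j}$ (additive in $a$ and in $b$) for $a\in A_{n,i}$, $b\in B_{m,j}$ and $\theta\colon n\Box m\to p$ a bijection, subject to $(\theta\circ(\alpha\Box\beta))_*(a\otimes b)=\theta_*(\alpha_*(a)\otimes\beta_*(b))$; the action is $\gamma_*(\theta_*(a\otimes b))=(\gamma\circ\theta)_*(a\otimes b)$, and the twist is $\tau^{A,B}(\theta_*(a\otimes b))=(-1)^{ij}(\theta\circ\tau^{m,n})_*(b\otimes a)$. Write $\iota_*(a\otimes b)$ for $\theta_*(a\otimes b)$ with $\theta=\iota$ the identity of $n+m$. Symmetric spectra. $\mathbb{Z}[*]\in\mathrm{SS}(\mathrm{Ch}^+)$ is $n\mapsto\mathbb{Z}[n]$ with $\alpha_*(e_n)=\mathrm{sgn}(\alpha)e_n$ for $\alpha\in\Sigma_n$; it is a commutative monoid under $\mu(\theta_*(e_n\otimes e_m))=\mathrm{sgn}(\theta)e_{n+m}$. $\mathrm{Sp}^\Sigma(\mathrm{Ch}^+)$ is the category of $\mathbb{Z}[*]$-modules in $\mathrm{SS}(\mathrm{Ch}^+)$. Explicitly, a module is a sequence $A_n\in\mathrm{Ch}^+$ with $\Sigma_n$-actions and chain maps $\sigma\colon\mathbb{Z}[k]\otimes A_n\to A_{k+n}$ with $(\alpha\Box\beta)_*\sigma(e_k\otimes a)=\mathrm{sgn}(\alpha)\sigma(e_k\otimes\beta_*(a))$ for $\alpha\in\Sigma_k$, $\beta\in\Sigma_n$, $\sigma(e_0\otimes a)=a$, and $\sigma(e_i\otimes\sigma(e_j\otimes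 a))=\sigma(e_{i+j}\otimes a)$. It is symmetric monoidal under $A\,\overline{\otimes}\,B$, the tensor product over $\mathbb{Z}[*]$ (the coequaliser of the two maps $A\otimes\mathbb{Z}[*]\otimes B\to A\otimes B$), with unit $\mathbb{Z}[*]$ and twist induced by that of $\mathrm{SS}(\mathrm{Ch}^+)$. Explicitly, $A\,\overline{\otimes}\,B$ is the quotient of $A\otimes B$ by the relations $\phi_*(a\otimes\sigma(e_m\otimes b))=(-1)^{im}(\phi\circ(\tau^{m,n}\Box 1_p))_*(\sigma(e_m\otimes a)\otimes b)$ for $a\in A_{n,i}$, $b\in B_{p,k}$, $\phi\in\Sigma_{n+m+p}$, with module structure determined by $\sigma(e_r\otimes\iota_*(a\otimes b))=\iota_*(\sigma(e_r\otimes a)\otimes b)$. The functor $D$. For $A\in\mathrm{Sp}^\Sigma(\mathrm{Ch}^+)$ define $\mathcal{D}(A)\colon\mathcal{J}\to\mathrm{Ch}$ by $\mathcal{D}(A)_n=\mathbb{Z}[-n]\otimes A_n$; for an injection $\alpha\colon n\to m$, let $\rho\colon n\to m$ be $\rho(i)=(m-n)+i$, choose $\alpha'\in\Sigma_m$ with $\alpha'\rho=\alpha$, and put $\alpha_*(e_{-n}\otimes a)=\mathrm{sgn}(\alpha')\,e_{-m}\otimes\alpha'_*\sigma(e_{m-n}\otimes a)$ (independent of the choice of $\alpha'$). Then $D(A)$ is the colimit of $\mathcal{D}(A)$ over $\mathcal{J}$. For $a\in A_{n,k}$, $\xi(a)\in D(A)_{k-n}$ is the image of $e_{-n}\otimes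 a$. So $D(A)$ is generated by the elements $\xi(a)$ (additive in $a$) subject to $\xi(\beta_*(a))=\mathrm{sgn}(\beta)\xi(a)$ for $\beta\in\Sigma_n$ and $\xi(\sigma(e_k\otimes a))=\xi(a)$, with $d\xi(a)=(-1)^n\xi(da)$. The maps $\phi^{A,B}$ in the claim are well-defined chain maps. *)

theory Defs
  imports
    "HOL-Algebra.Free_Abelian_Groups"
    "HOL-Algebra.Elementary_Groups"
    "HOL-Algebra.Generated_Groups"
    "HOL-Combinatorics.Permutations"
begin

text \<open>
  Abelian groups are \<^const>\<open>comm_group\<close>s, so sums are written multiplicatively and
  \<open>c \<cdot> x\<close> is the integer power \<open>x [^] c\<close>; in particular a sign \<open>s\<close> acts as \<open>x [^] s\<close>.
  Equations between maps are only ever required on carriers.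
\<close>

definition ksign :: "int \<Rightarrow> int" where
  "ksign k = (if even k then 1 else -1)"


section \<open>Generators and relations\<close>

definition presented_group :: "'g set \<Rightarrow> ('g \<Rightarrow>\<^sub>0 int) set \<Rightarrow> ('g \<Rightarrow>\<^sub>0 int) set monoid" where
  "presented_group S R = free_Abelian_group S Mod generate (free_Abelian_group S) R"

definition presented_gen :: "'g set \<Rightarrow> ('g \<Rightarrow>\<^sub>0 int) set \<Rightarrow> 'g \<Rightarrow> ('g \<Rightarrow>\<^sub>0 int) set" where
  "presented_gen S R s =
     generate (free_Abelian_group S) R #>\<^bsub>free_Abelian_group S\<^esub> frag_of s"

definition free_lift :: "('b, 'm) monoid_scheme \<Rightarrow> ('g \<Rightarrow> 'b) \<Rightarrow> ('g \<Rightarrow>\<^sub>0 int) \<Rightarrow> 'b" where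
  "free_lift K f x =
     finprod K (\<lambda>s. f s [^]\<^bsub>K\<^esub> Poly_Mapping.lookup x s) (Poly_Mapping.keys x)"

text \<open>
  The map induced on a quotient by a map constant on cosets. All maps below that are specified
  by their values on generators are obtained from it through the following lifts.
\<close>

definition quotient_lift :: "('a \<Rightarrow> 'b) \<Rightarrow> 'a set \<Rightarrow> 'b" where
  "quotient_lift f X = the_elem (f ` X)"

definition presented_lift ::
    "('b, 'm) monoid_scheme \<Rightarrow> ('g \<Rightarrow> 'b) \<Rightarrow> ('g \<Rightarrow>\<^sub>0 int) set \<Rightarrow> 'b" where
  "presented_lift K f = quotient_lift (free_lift K f)"


section \<open>Chain complexes of abelian groups\<close>

record 'a chcx =
  grp :: "int \<Rightarrow> 'a monoid"
  bd :: "int \<Rightarrow> 'a \<Rightarrow> 'a"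

abbreviation elts :: "('a, 'm) chcx_scheme \<Rightarrow> int \<Rightarrow> 'a set" where
  "elts C k \<equiv> carrier (grp C k)"

definition chain_complex :: "'a chcx \<Rightarrow> bool" where
  "chain_complex C \<longleftrightarrow>
     (\<forall>k. comm_group (grp C k)) \<and>
     (\<forall>k. bd C k \<in> hom (grp C k) (grp C (k - 1))) \<and>
     (\<forall>k. \<forall>x \<in> elts C k. bd C (k - 1) (bd C k x) = \<one>\<^bsub>grp C (k - 2)\<^esub>)"

definition nonneg_complex :: "'a chcx \<Rightarrow> bool" where
  "nonneg_complex C \<longleftrightarrow> chain_complex C \<and> (\<forall>k < 0. elts C k = {\<one>\<^bsub>grp C k\<^esub>})"

definition chain_map :: "'a chcx \<Rightarrow> 'b chcx \<Rightarrow> (int \<Rightarrow> 'a \<Rightarrow> 'b) \<Rightarrow> bool" where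
  "chain_map C D f \<longleftrightarrow>
     (\<forall>k. f k \<in> hom (grp C k) (grp D k)) \<and>
     (\<forall>k. \<forall>x \<in> elts C k. f (k - 1) (bd C k x) = bd D k (f k x))"

definition chain_iso :: "'a chcx \<Rightarrow> 'b chcx \<Rightarrow> (int \<Rightarrow> 'a \<Rightarrow> 'b) \<Rightarrow> bool" where
  "chain_iso C D f \<longleftrightarrow> chain_map C D f \<and> (\<forall>k. f k \<in> iso (grp C k) (grp D k))"

definition chain_map_eq :: "'a chcx \<Rightarrow> (int \<Rightarrow> 'a \<Rightarrow> 'b) \<Rightarrow> (int \<Rightarrow> 'a \<Rightarrow> 'b) \<Rightarrow> bool" where
  "chain_map_eq C f g \<longleftrightarrow> (\<forall>k. \<forall>x \<in> elts C k. f k x = g k x)"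

definition chain_comp :: "(int \<Rightarrow> 'b \<Rightarrow> 'c) \<Rightarrow> (int \<Rightarrow> 'a \<Rightarrow> 'b) \<Rightarrow> int \<Rightarrow> 'a \<Rightarrow> 'c"
    (infixr "\<circ>\<^sub>c" 55) where
  "(g \<circ>\<^sub>c f) k = g k \<circ> f k"

definition chain_id :: "int \<Rightarrow> 'a \<Rightarrow> 'a" where
  "chain_id k x = x"

text \<open>\<open>\<int>[n]\<close>; its generator \<open>e\<^sub>n\<close> is the integer \<open>1\<close> in degree \<open>n\<close>.\<close>

definition Zc :: "int \<Rightarrow> int chcx" where
  "Zc n = \<lparr>grp = (\<lambda>k. if k = n then integer_group else singleton_group 0), bd = (\<lambda>k x. 0)\<rparr>"


subsection \<open>The tensor product\<close>

definition tensor_rels ::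
    "('a, 'm) monoid_scheme \<Rightarrow> ('b, 'n) monoid_scheme \<Rightarrow> ('a \<times> 'b \<Rightarrow>\<^sub>0 int) set" where
  "tensor_rels G H =
     {frag_of (a \<otimes>\<^bsub>G\<^esub> a', b) - (frag_of (a, b) + frag_of (a', b)) | a a' b.
        a \<in> carrier G \<and> a' \<in> carrier G \<and> b \<in> carrier H} \<union>
     {frag_of (a, b \<otimes>\<^bsub>H\<^esub> b') - (frag_of (a, b) + frag_of (a, b')) | a b b'.
        a \<in> carrier G \<and> b \<in> carrier H \<and> b' \<in> carrier H}"

definition tensor_group ::
    "('a, 'm) monoid_scheme \<Rightarrow> ('b, 'n) monoid_scheme \<Rightarrow> ('a \<times> 'b \<Rightarrow>\<^sub>0 int) set monoid" where
  "tensor_group G H = presented_group (carrier G \<times> carrier H) (tensor_rels G H)"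

definition tensor_elt ::
    "('a, 'm) monoid_scheme \<Rightarrow> ('b, 'n) monoid_scheme \<Rightarrow> 'a \<Rightarrow> 'b \<Rightarrow> ('a \<times> 'b \<Rightarrow>\<^sub>0 int) set" where
  "tensor_elt G H a b = presented_gen (carrier G \<times> carrier H) (tensor_rels G H) (a, b)"

type_synonym ('a, 'b) ctensor = "int \<times> int \<Rightarrow> ('a \<times> 'b \<Rightarrow>\<^sub>0 int) set"

definition ctensor_grp :: "'a chcx \<Rightarrow> 'b chcx \<Rightarrow> int \<Rightarrow> ('a, 'b) ctensor monoid" where
  "ctensor_grp A B n =
     sum_group {(i, j). i + j = n} (\<lambda>(i, j). tensor_group (grp A i) (grp B j))"

text \<open>\<open>a \<otimes> b\<close> for \<open>a \<in> A\<^sub>i\<close>, \<open>b \<in> B\<^sub>j\<close>, as an element of degree \<open>i + j\<close>.\<close>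

definition ctens :: "'a chcx \<Rightarrow> 'b chcx \<Rightarrow> int \<Rightarrow> int \<Rightarrow> 'a \<Rightarrow> 'b \<Rightarrow> ('a, 'b) ctensor" where
  "ctens A B i j a b =
     (\<lambda>(i', j') \<in> {(i', j'). i' + j' = i + j}.
        if i' = i \<and> j' = j then tensor_elt (grp A i) (grp B j) a b
        else \<one>\<^bsub>tensor_group (grp A i') (grp B j')\<^esub>)"

text \<open>
  The homomorphism from the degree \<open>n\<close> part to \<open>K\<close> with \<open>a \<otimes> b \<mapsto> f i j a b\<close>, for \<open>f\<close> additive
  in \<open>a\<close> and in \<open>b\<close>.
\<close>

definition ctensor_lift ::
    "('c, 'm) monoid_scheme \<Rightarrow> int \<Rightarrow> (int \<Rightarrow> int \<Rightarrow> 'a \<Rightarrow> 'b \<Rightarrow> 'c) \<Rightarrow> ('a, 'b) ctensor \<Rightarrow> 'c" where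
  "ctensor_lift K n f x =
     gfinprod K (\<lambda>(i, j). presented_lift K (\<lambda>(a, b). f i j a b) (x (i, j))) {(i, j). i + j = n}"

definition ctensor :: "'a chcx \<Rightarrow> 'b chcx \<Rightarrow> ('a, 'b) ctensor chcx" where
  "ctensor A B =
     \<lparr>grp = ctensor_grp A B,
      bd = (\<lambda>n. ctensor_lift (ctensor_grp A B (n - 1)) n
        (\<lambda>i j a b. ctens A B (i - 1) j (bd A i a) b
           \<otimes>\<^bsub>ctensor_grp A B (n - 1)\<^esub>
           ctens A B i (j - 1) a (bd B j b) [^]\<^bsub>ctensor_grp A B (n - 1)\<^esub> ksign i))\<rparr>"

definition ctensor_map ::
    "'c chcx \<Rightarrow> 'd chcx \<Rightarrow> (int \<Rightarrow> 'a \<Rightarrow> 'c) \<Rightarrow> (int \<Rightarrow> 'b \<Rightarrow> 'd) \<Rightarrow>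
     int \<Rightarrow> ('a, 'b) ctensor \<Rightarrow> ('c, 'd) ctensor" where
  "ctensor_map A' B' f g n =
     ctensor_lift (ctensor_grp A' B' n) n (\<lambda>i j a b. ctens A' B' i j (f i a) (g j b))"

definition ch_twist ::
    "'a chcx \<Rightarrow> 'b chcx \<Rightarrow> int \<Rightarrow> ('a, 'b) ctensor \<Rightarrow> ('b, 'a) ctensor" where
  "ch_twist A B n =
     ctensor_lift (ctensor_grp B A n) n
       (\<lambda>i j a b. ctens B A j i b a [^]\<^bsub>ctensor_grp B A n\<^esub> ksign (i * j))"

definition ch_assoc ::
    "'a chcx \<Rightarrow> 'b chcx \<Rightarrow> 'c chcx \<Rightarrow>
     int \<Rightarrow> (('a, 'b) ctensor, 'c) ctensor \<Rightarrow> ('a, ('b, 'c) ctensor) ctensor" where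
  "ch_assoc A B C n =
     (let K = ctensor_grp A (ctensor B C) n in
      ctensor_lift K n (\<lambda>q k x c.
        ctensor_lift K q (\<lambda>i j a b.
          ctens A (ctensor B C) i (j + k) a (ctens B C j k b c)) x))"

definition ch_lunit :: "'a chcx \<Rightarrow> int \<Rightarrow> (int, 'a) ctensor \<Rightarrow> 'a" where
  "ch_lunit C n = ctensor_lift (grp C n) n (\<lambda>i j c x. x [^]\<^bsub>grp C n\<^esub> c)"

definition ch_runit :: "'a chcx \<Rightarrow> int \<Rightarrow> ('a, int) ctensor \<Rightarrow> 'a" where
  "ch_runit C n = ctensor_lift (grp C n) n (\<lambda>i j x c. x [^]\<^bsub>grp C n\<^esub> c)"

text \<open>
  The map \<open>\<int>[r] \<otimes> C \<rightarrow> K\<close> in degree \<open>n\<close> with \<open>e\<^sub>r \<otimes> a \<mapsto> h j a\<close> for \<open>a \<in> C\<^sub>j\<close>. In bidegrees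
  \<open>(i, j)\<close> with \<open>i \<noteq> r\<close> the only coefficient is \<open>c = 0\<close>, so \<open>h\<close> plays no role there.
\<close>

definition Zc_lift ::
    "('c, 'm) monoid_scheme \<Rightarrow> int \<Rightarrow> (int \<Rightarrow> 'a \<Rightarrow> 'c) \<Rightarrow> (int, 'a) ctensor \<Rightarrow> 'c" where
  "Zc_lift K n h = ctensor_lift K n (\<lambda>i j c a. h j a [^]\<^bsub>K\<^esub> c)"


section \<open>The indexing categories\<close>

text \<open>
  Morphisms \<open>n \<rightarrow> n\<close> of the category of bijections are the \<open>\<alpha>\<close> with \<open>\<alpha> permutes {..<n}\<close>; there
  are no morphisms between different objects. So in \<open>f \<box> g\<close> only the case of equal source and
  target is needed, and it is extended by the identity.
\<close>

definition box :: "nat \<Rightarrow> nat \<Rightarrow> (nat \<Rightarrow> nat) \<Rightarrow> (nat \<Rightarrow> nat) \<Rightarrow> nat \<Rightarrow> nat" where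
  "box p m f g i = (if i < p then f i else if i < p + m then g (i - p) + p else i)"

definition twist :: "nat \<Rightarrow> nat \<Rightarrow> nat \<Rightarrow> nat" where
  "twist m n i = (if i < m then i + n else if i < m + n then i - m else i)"

definition injection :: "nat \<Rightarrow> nat \<Rightarrow> (nat \<Rightarrow> nat) \<Rightarrow> bool" where
  "injection n m \<alpha> \<longleftrightarrow> inj_on \<alpha> {..<n} \<and> \<alpha> ` {..<n} \<subseteq> {..<m}"


section \<open>Symmetric sequences\<close>

record 'a symseq =
  lev :: "nat \<Rightarrow> 'a chcx"
  pact :: "nat \<Rightarrow> (nat \<Rightarrow> nat) \<Rightarrow> int \<Rightarrow> 'a \<Rightarrow> 'a"

definition symmetric_sequence :: "('a, 'm) symseq_scheme \<Rightarrow> bool" where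
  "symmetric_sequence A \<longleftrightarrow>
     (\<forall>n. nonneg_complex (lev A n)) \<and>
     (\<forall>n \<alpha>. \<alpha> permutes {..<n} \<longrightarrow> chain_map (lev A n) (lev A n) (pact A n \<alpha>)) \<and>
     (\<forall>n. chain_map_eq (lev A n) (pact A n id) chain_id) \<and>
     (\<forall>n \<alpha> \<beta>. \<alpha> permutes {..<n} \<longrightarrow> \<beta> permutes {..<n} \<longrightarrow>
        chain_map_eq (lev A n) (pact A n (\<alpha> \<circ> \<beta>)) (pact A n \<alpha> \<circ>\<^sub>c pact A n \<beta>))"

text \<open>
  \<open>Day_Gen n i a m j b \<theta>\<close> stands for the generator \<open>\<theta>\<^sub>*(a \<otimes> b)\<close> with \<open>a \<in> A\<^bsub>n,i\<^esub>\<close>, \<open>b \<in> B\<^bsub>m,j\<^esub>\<close>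
  of the Day convolution.
\<close>

datatype ('a, 'b) day_gen = Day_Gen nat int 'a nat int 'b "nat \<Rightarrow> nat"

type_synonym ('a, 'b) day = "(('a, 'b) day_gen \<Rightarrow>\<^sub>0 int) set"

definition day_gens ::
    "('a, 'm) symseq_scheme \<Rightarrow> ('b, 'n) symseq_scheme \<Rightarrow> nat \<Rightarrow> int \<Rightarrow> ('a, 'b) day_gen set" where
  "day_gens A B p k =
     {Day_Gen n i a m j b \<theta> | n i a m j b \<theta>.
        n + m = p \<and> i + j = k \<and> a \<in> elts (lev A n) i \<and> b \<in> elts (lev B m) j \<and>
        \<theta> permutes {..<p}}"

definition day_rels ::
    "('a, 'm) symseq_scheme \<Rightarrow> ('b, 'n) symseq_scheme \<Rightarrow> nat \<Rightarrow> int \<Rightarrow>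
     (('a, 'b) day_gen \<Rightarrow>\<^sub>0 int) set" where
  "day_rels A B p k =
     {frag_of (Day_Gen n i (a \<otimes>\<^bsub>grp (lev A n) i\<^esub> a') m j b \<theta>)
        - (frag_of (Day_Gen n i a m j b \<theta>) + frag_of (Day_Gen n i a' m j b \<theta>))
      | n i a a' m j b \<theta>.
        n + m = p \<and> i + j = k \<and> a \<in> elts (lev A n) i \<and> a' \<in> elts (lev A n) i \<and>
        b \<in> elts (lev B m) j \<and> \<theta> permutes {..<p}} \<union>
     {frag_of (Day_Gen n i a m j (b \<otimes>\<^bsub>grp (lev B m) j\<^esub> b') \<theta>)
        - (frag_of (Day_Gen n i a m j b \<theta>) + frag_of (Day_Gen n i a m j b' \<theta>))
      | n i a m j b b' \<theta>.
        n + m = p \<and> i + j = k \<and> a \<in> elts (lev A n) i \<and> b \<in> elts (lev B m) j \<and>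
        b' \<in> elts (lev B m) j \<and> \<theta> permutes {..<p}} \<union>
     {frag_of (Day_Gen n i a m j b (\<theta> \<circ> box n m \<alpha> \<beta>))
        - frag_of (Day_Gen n i (pact A n \<alpha> i a) m j (pact B m \<beta> j b) \<theta>)
      | n i a m j b \<theta> \<alpha> \<beta>.
        n + m = p \<and> i + j = k \<and> a \<in> elts (lev A n) i \<and> b \<in> elts (lev B m) j \<and>
        \<theta> permutes {..<p} \<and> \<alpha> permutes {..<n} \<and> \<beta> permutes {..<m}}"

definition day_grp ::
    "('a, 'm) symseq_scheme \<Rightarrow> ('b, 'n) symseq_scheme \<Rightarrow> nat \<Rightarrow> int \<Rightarrow> ('a, 'b) day monoid" where
  "day_grp A B p k = presented_group (day_gens A B p k) (day_rels A B p k)"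

definition day_elt ::
    "('a, 'm) symseq_scheme \<Rightarrow> ('b, 'n) symseq_scheme \<Rightarrow> (nat \<Rightarrow> nat) \<Rightarrow>
     nat \<Rightarrow> int \<Rightarrow> 'a \<Rightarrow> nat \<Rightarrow> int \<Rightarrow> 'b \<Rightarrow> ('a, 'b) day" where
  "day_elt A B \<theta> n i a m j b =
     presented_gen (day_gens A B (n + m) (i + j)) (day_rels A B (n + m) (i + j))
       (Day_Gen n i a m j b \<theta>)"

definition day_conv ::
    "('a, 'm) symseq_scheme \<Rightarrow> ('b, 'n) symseq_scheme \<Rightarrow> ('a, 'b) day symseq" where
  "day_conv A B =
     \<lparr>lev = (\<lambda>p.
        \<lparr>grp = day_grp A B p,
         bd = (\<lambda>k. presented_lift (day_grp A B p (k - 1))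
           (\<lambda>Day_Gen n i a m j b \<theta> \<Rightarrow>
              day_elt A B \<theta> n (i - 1) (bd (lev A n) i a) m j b
              \<otimes>\<^bsub>day_grp A B p (k - 1)\<^esub>
              day_elt A B \<theta> n i a m (j - 1) (bd (lev B m) j b)
                [^]\<^bsub>day_grp A B p (k - 1)\<^esub> ksign i))\<rparr>),
      pact = (\<lambda>p \<gamma> k. presented_lift (day_grp A B p k)
        (\<lambda>Day_Gen n i a m j b \<theta> \<Rightarrow> day_elt A B (\<gamma> \<circ> \<theta>) n i a m j b))\<rparr>"


section \<open>Symmetric spectra\<close>

text \<open>\<open>sact A k n\<close> is the structure map \<open>\<sigma> : \<int>[k] \<otimes> A\<^sub>n \<rightarrow> A\<^bsub>k+n\<^esub>\<close>.\<close>

record 'a symspec = "'a symseq" +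
  sact :: "nat \<Rightarrow> nat \<Rightarrow> int \<Rightarrow> (int, 'a) ctensor \<Rightarrow> 'a"

text \<open>\<open>\<sigma>(e\<^sub>k \<otimes> a)\<close> for \<open>a \<in> A\<^bsub>n,i\<^esub>\<close>.\<close>

definition sig :: "'a symspec \<Rightarrow> nat \<Rightarrow> nat \<Rightarrow> int \<Rightarrow> 'a \<Rightarrow> 'a" where
  "sig A k n i a = sact A k n (int k + i) (ctens (Zc (int k)) (lev A n) (int k) i 1 a)"

definition symmetric_spectrum :: "'a symspec \<Rightarrow> bool" where
  "symmetric_spectrum A \<longleftrightarrow>
     symmetric_sequence A \<and>
     (\<forall>k n. chain_map (ctensor (Zc (int k)) (lev A n)) (lev A (k + n)) (sact A k n)) \<and>
     (\<forall>k n i \<alpha> \<beta>. \<forall>a \<in> elts (lev A n) i. \<alpha> permutes {..<k} \<longrightarrow> \<beta> permutes {..<n} \<longrightarrow>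
        pact A (k + n) (box k n \<alpha> \<beta>) (int k + i) (sig A k n i a) =
        sig A k n i (pact A n \<beta> i a) [^]\<^bsub>grp (lev A (k + n)) (int k + i)\<^esub> sign \<alpha>) \<and>
     (\<forall>n i. \<forall>a \<in> elts (lev A n) i. sig A 0 n i a = a) \<and>
     (\<forall>k l n i. \<forall>a \<in> elts (lev A n) i.
        sig A k (l + n) (int l + i) (sig A l n i a) = sig A (k + l) n i a)"

definition spectrum_map ::
    "'a symspec \<Rightarrow> 'b symspec \<Rightarrow> (nat \<Rightarrow> int \<Rightarrow> 'a \<Rightarrow> 'b) \<Rightarrow> bool" where
  "spectrum_map A B f \<longleftrightarrow>
     (\<forall>n. chain_map (lev A n) (lev B n) (f n)) \<and>
     (\<forall>n \<alpha>. \<alpha> permutes {..<n} \<longrightarrow>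
        chain_map_eq (lev A n) (f n \<circ>\<^sub>c pact A n \<alpha>) (pact B n \<alpha> \<circ>\<^sub>c f n)) \<and>
     (\<forall>k n i. \<forall>a \<in> elts (lev A n) i.
        f (k + n) (int k + i) (sig A k n i a) = sig B k n i (f n i a))"

definition spectrum_id :: "nat \<Rightarrow> int \<Rightarrow> 'a \<Rightarrow> 'a" where
  "spectrum_id n = chain_id"

definition spectrum_comp ::
    "(nat \<Rightarrow> int \<Rightarrow> 'b \<Rightarrow> 'c) \<Rightarrow> (nat \<Rightarrow> int \<Rightarrow> 'a \<Rightarrow> 'b) \<Rightarrow> nat \<Rightarrow> int \<Rightarrow> 'a \<Rightarrow> 'c"
    (infixr "\<circ>\<^sub>s" 55) where
  "(g \<circ>\<^sub>s f) n = g n \<circ>\<^sub>c f n"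

text \<open>The unit \<open>\<int>[*]\<close>.\<close>

definition Zstar :: "int symspec" where
  "Zstar =
     \<lparr>lev = (\<lambda>n. Zc (int n)),
      pact = (\<lambda>n \<alpha> k c. sign \<alpha> * c),
      sact = (\<lambda>k n t. ctensor_lift (grp (Zc (int (k + n))) t) t (\<lambda>i j c c'. c * c'))\<rparr>"


subsection \<open>The tensor product over \<open>\<int>[*]\<close>\<close>

definition smash_rels ::
    "'a symspec \<Rightarrow> 'b symspec \<Rightarrow> nat \<Rightarrow> int \<Rightarrow> ('a, 'b) day set" where
  "smash_rels A B q t =
     {day_elt A B \<phi> n i a (m + p) (int m + k) (sig B m p k b)
        \<otimes>\<^bsub>day_grp A B q t\<^esub>
        inv\<^bsub>day_grp A B q t\<^esub>
          (day_elt A B (\<phi> \<circ> box (m + n) p (twist m n) id) (m + n) (int m + i) (sig A m n i a) p k b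
             [^]\<^bsub>day_grp A B q t\<^esub> ksign (i * int m))
      | n i a m p k b \<phi>.
        n + m + p = q \<and> i + int m + k = t \<and> a \<in> elts (lev A n) i \<and> b \<in> elts (lev B p) k \<and>
        \<phi> permutes {..<q}}"

definition smash_grp ::
    "'a symspec \<Rightarrow> 'b symspec \<Rightarrow> nat \<Rightarrow> int \<Rightarrow> ('a, 'b) day set monoid" where
  "smash_grp A B q t = day_grp A B q t Mod generate (day_grp A B q t) (smash_rels A B q t)"

definition smash_class ::
    "'a symspec \<Rightarrow> 'b symspec \<Rightarrow> nat \<Rightarrow> int \<Rightarrow> ('a, 'b) day \<Rightarrow> ('a, 'b) day set" where
  "smash_class A B q t x = generate (day_grp A B q t) (smash_rels A B q t) #>\<^bsub>day_grp A B q t\<^esub> x"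

text \<open>The class of \<open>\<theta>\<^sub>*(a \<otimes> b)\<close>.\<close>

definition smash_elt ::
    "'a symspec \<Rightarrow> 'b symspec \<Rightarrow> (nat \<Rightarrow> nat) \<Rightarrow>
     nat \<Rightarrow> int \<Rightarrow> 'a \<Rightarrow> nat \<Rightarrow> int \<Rightarrow> 'b \<Rightarrow> ('a, 'b) day set" where
  "smash_elt A B \<theta> n i a m j b = smash_class A B (n + m) (i + j) (day_elt A B \<theta> n i a m j b)"

definition smash_lift ::
    "('c, 'm) monoid_scheme \<Rightarrow> (('a, 'b) day_gen \<Rightarrow> 'c) \<Rightarrow> ('a, 'b) day set \<Rightarrow> 'c" where
  "smash_lift K f = quotient_lift (presented_lift K f)"

text \<open>
  On all generators the structure map reads
  \<open>\<sigma>(e\<^sub>r \<otimes> \<theta>\<^sub>*(a \<otimes> b)) = (1\<^sub>r \<box> \<theta>)\<^sub>*(\<sigma>(e\<^sub>r \<otimes> a) \<otimes> b)\<close>, as equivariance forces.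
\<close>

definition smash :: "'a symspec \<Rightarrow> 'b symspec \<Rightarrow> ('a, 'b) day set symspec" where
  "smash A B =
     \<lparr>lev = (\<lambda>q.
        \<lparr>grp = smash_grp A B q,
         bd = (\<lambda>t. quotient_lift
           (\<lambda>x. smash_class A B q (t - 1) (bd (lev (day_conv A B) q) t x)))\<rparr>),
      pact = (\<lambda>q \<gamma> t. quotient_lift
        (\<lambda>x. smash_class A B q t (pact (day_conv A B) q \<gamma> t x))),
      sact = (\<lambda>r q t. Zc_lift (smash_grp A B (r + q) t) t
        (\<lambda>_. smash_lift (smash_grp A B (r + q) t)
          (\<lambda>Day_Gen n i a m j b \<theta> \<Rightarrow>
             smash_elt A B (box r q id \<theta>) (r + n) (int r + i) (sig A r n i a) m j b)))\<rparr>"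

definition smash_map ::
    "'c symspec \<Rightarrow> 'd symspec \<Rightarrow> (nat \<Rightarrow> int \<Rightarrow> 'a \<Rightarrow> 'c) \<Rightarrow> (nat \<Rightarrow> int \<Rightarrow> 'b \<Rightarrow> 'd) \<Rightarrow>
     nat \<Rightarrow> int \<Rightarrow> ('a, 'b) day set \<Rightarrow> ('c, 'd) day set" where
  "smash_map A' B' f g q t =
     smash_lift (smash_grp A' B' q t)
       (\<lambda>Day_Gen n i a m j b \<theta> \<Rightarrow> smash_elt A' B' \<theta> n i (f n i a) m j (g m j b))"

definition sp_twist ::
    "'a symspec \<Rightarrow> 'b symspec \<Rightarrow> nat \<Rightarrow> int \<Rightarrow> ('a, 'b) day set \<Rightarrow> ('b, 'a) day set" where
  "sp_twist A B q t =
     smash_lift (smash_grp B A q t)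
       (\<lambda>Day_Gen n i a m j b \<theta> \<Rightarrow>
          smash_elt B A (\<theta> \<circ> twist m n) m j b n i a [^]\<^bsub>smash_grp B A q t\<^esub> ksign (i * j))"

text \<open>
  \<open>\<theta>\<^sub>*(\<theta>'\<^sub>*(a \<otimes> b) \<otimes> c) \<mapsto> (\<theta> \<circ> (\<theta>' \<box> 1))\<^sub>*(a \<otimes> \<iota>\<^sub>*(b \<otimes> c))\<close>, since the associators of the indexing
  category are identities.
\<close>

definition sp_assoc ::
    "'a symspec \<Rightarrow> 'b symspec \<Rightarrow> 'c symspec \<Rightarrow> nat \<Rightarrow> int \<Rightarrow>
     (('a, 'b) day set, 'c) day set \<Rightarrow> ('a, ('b, 'c) day set) day set" where
  "sp_assoc A B C q t =
     (let K = smash_grp A (smash B C) q t in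
      smash_lift K (\<lambda>Day_Gen r l x p k c \<theta> \<Rightarrow>
        smash_lift K (\<lambda>Day_Gen n i a m j b \<theta>' \<Rightarrow>
          smash_elt A (smash B C) (\<theta> \<circ> box r p \<theta>' id) n i a (m + p) (j + k)
            (smash_elt B C id m j b p k c)) x))"

text \<open>\<open>\<theta>\<^sub>*(z \<otimes> a) \<mapsto> \<theta>\<^sub>*\<sigma>(z \<otimes> a)\<close>; the right unit isomorphism is this one after the twist.\<close>

definition sp_lunit :: "'a symspec \<Rightarrow> nat \<Rightarrow> int \<Rightarrow> (int, 'a) day set \<Rightarrow> 'a" where
  "sp_lunit A q t =
     smash_lift (grp (lev A q) t)
       (\<lambda>Day_Gen n i z m j a \<theta> \<Rightarrow>
          pact A q \<theta> t (sact A n m t (ctens (Zc (int n)) (lev A m) i j z a)))"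

definition sp_runit :: "'a symspec \<Rightarrow> nat \<Rightarrow> int \<Rightarrow> ('a, int) day set \<Rightarrow> 'a" where
  "sp_runit A = sp_lunit A \<circ>\<^sub>s sp_twist A Zstar"


section \<open>Colimits over the category of injections\<close>

record 'a jdiagram =
  jobj :: "nat \<Rightarrow> 'a chcx"
  jmap :: "nat \<Rightarrow> nat \<Rightarrow> (nat \<Rightarrow> nat) \<Rightarrow> int \<Rightarrow> 'a \<Rightarrow> 'a"

text \<open>
  The colimit in chain complexes, computed in each degree as the direct sum over all objects
  modulo \<open>x \<sim> \<alpha>\<^sub>* x\<close> for all morphisms \<open>\<alpha>\<close>.
\<close>

definition jsum :: "'a jdiagram \<Rightarrow> int \<Rightarrow> (nat \<Rightarrow> 'a) monoid" where
  "jsum F k = sum_group UNIV (\<lambda>n. grp (jobj F n) k)"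

definition jsum_in :: "'a jdiagram \<Rightarrow> int \<Rightarrow> nat \<Rightarrow> 'a \<Rightarrow> nat \<Rightarrow> 'a" where
  "jsum_in F k n x = (\<lambda>n'. if n' = n then x else \<one>\<^bsub>grp (jobj F n') k\<^esub>)"

definition colim_rels :: "'a jdiagram \<Rightarrow> int \<Rightarrow> (nat \<Rightarrow> 'a) set" where
  "colim_rels F k =
     {jsum_in F k n x \<otimes>\<^bsub>jsum F k\<^esub> inv\<^bsub>jsum F k\<^esub> (jsum_in F k m (jmap F n m \<alpha> k x))
      | n m \<alpha> x. injection n m \<alpha> \<and> x \<in> elts (jobj F n) k}"

definition colim_class :: "'a jdiagram \<Rightarrow> int \<Rightarrow> (nat \<Rightarrow> 'a) \<Rightarrow> (nat \<Rightarrow> 'a) set" where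
  "colim_class F k x = generate (jsum F k) (colim_rels F k) #>\<^bsub>jsum F k\<^esub> x"

definition colim :: "'a jdiagram \<Rightarrow> (nat \<Rightarrow> 'a) set chcx" where
  "colim F =
     \<lparr>grp = (\<lambda>k. jsum F k Mod generate (jsum F k) (colim_rels F k)),
      bd = (\<lambda>k. quotient_lift (\<lambda>x. colim_class F (k - 1) (\<lambda>n. bd (jobj F n) k (x n))))\<rparr>"

definition colim_in :: "'a jdiagram \<Rightarrow> nat \<Rightarrow> int \<Rightarrow> 'a \<Rightarrow> (nat \<Rightarrow> 'a) set" where
  "colim_in F n k x = colim_class F k (jsum_in F k n x)"

definition colim_lift ::
    "('b, 'm) monoid_scheme \<Rightarrow> (nat \<Rightarrow> 'a \<Rightarrow> 'b) \<Rightarrow> (nat \<Rightarrow> 'a) set \<Rightarrow> 'b" where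
  "colim_lift K g = quotient_lift (\<lambda>x. gfinprod K (\<lambda>n. g n (x n)) UNIV)"


section \<open>The functor \<open>D\<close>\<close>

definition perm_ext :: "nat \<Rightarrow> nat \<Rightarrow> (nat \<Rightarrow> nat) \<Rightarrow> nat \<Rightarrow> nat" where
  "perm_ext n m \<alpha> = (SOME \<alpha>'. \<alpha>' permutes {..<m} \<and> (\<forall>i < n. \<alpha>' ((m - n) + i) = \<alpha> i))"

definition D_diagram :: "'a symspec \<Rightarrow> (int, 'a) ctensor jdiagram" where
  "D_diagram A =
     \<lparr>jobj = (\<lambda>n. ctensor (Zc (- int n)) (lev A n)),
      jmap = (\<lambda>n m \<alpha> k.
        (let \<alpha>' = perm_ext n m \<alpha>;
             K = ctensor_grp (Zc (- int m)) (lev A m) k in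
         Zc_lift K k (\<lambda>j a.
           ctens (Zc (- int m)) (lev A m) (- int m) (int (m - n) + j) 1
             (pact A m \<alpha>' (int (m - n) + j) (sig A (m - n) n j a))
           [^]\<^bsub>K\<^esub> sign \<alpha>')))\<rparr>"

type_synonym 'a Dtype = "(nat \<Rightarrow> (int, 'a) ctensor) set"

definition D :: "'a symspec \<Rightarrow> 'a Dtype chcx" where
  "D A = colim (D_diagram A)"

definition D_map ::
    "'b symspec \<Rightarrow> (nat \<Rightarrow> int \<Rightarrow> 'a \<Rightarrow> 'b) \<Rightarrow> int \<Rightarrow> 'a Dtype \<Rightarrow> 'b Dtype" where
  "D_map B f k =
     colim_lift (grp (D B) k) (\<lambda>n x.
       colim_in (D_diagram B) n k (ctensor_map (Zc (- int n)) (lev B n) chain_id (f n) k x))"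

text \<open>\<open>\<xi>(a)\<close> for \<open>a \<in> A\<^bsub>n,i\<^esub>\<close>, an element of degree \<open>i - n\<close>.\<close>

definition xi :: "'a symspec \<Rightarrow> nat \<Rightarrow> int \<Rightarrow> 'a \<Rightarrow> 'a Dtype" where
  "xi A n i a =
     colim_in (D_diagram A) n (i - int n) (ctens (Zc (- int n)) (lev A n) (- int n) i 1 a)"

text \<open>The homomorphism from the degree \<open>k\<close> part of \<open>D(A)\<close> to \<open>K\<close> with \<open>\<xi>(a) \<mapsto> f n i a\<close>.\<close>

definition D_lift ::
    "('b, 'm) monoid_scheme \<Rightarrow> int \<Rightarrow> (nat \<Rightarrow> int \<Rightarrow> 'a \<Rightarrow> 'b) \<Rightarrow> 'a Dtype \<Rightarrow> 'b" where
  "D_lift K k f = colim_lift K (\<lambda>n. Zc_lift K k (f n))"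

definition phi ::
    "'a symspec \<Rightarrow> 'b symspec \<Rightarrow> int \<Rightarrow> ('a Dtype, 'b Dtype) ctensor \<Rightarrow> ('a, 'b) day set Dtype" where
  "phi A B k =
     (let K = grp (D (smash A B)) k in
      ctensor_lift K k (\<lambda>r s u v.
        D_lift K r (\<lambda>n i a.
          D_lift K s (\<lambda>m j b.
            xi (smash A B) (n + m) (i + j) (smash_elt A B id n i a m j b)
            [^]\<^bsub>K\<^esub> ksign (int m * int n + int m * i)) v) u))"

definition D_unit :: "int \<Rightarrow> int \<Rightarrow> int Dtype" where
  "D_unit k c = xi Zstar 0 0 1 [^]\<^bsub>grp (D Zstar) k\<^esub> c"

end

(*
  Every group in sight is described by generators and relations, so a homomorphism out of it is the
  same as a family of values on the generators that is additive and respects the relations, and two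
  homomorphisms agree as soon as they agree on generators. On generators the inverse of \<phi> is
  \<xi>(\<theta>_*(a \<otimes> b)) \<mapsto> sgn(\<theta>) (-1)^{mn+mi} \<xi>(a) \<otimes> \<xi>(b) for a in A_{n,i} and b in B_{m,j}, and every axiom
  of a symmetric monoidal functor becomes an identity between block permutations together with a
  congruence mod 2 between exponents of signs.
*)
theory Submission
  imports Defs
begin


section \<open>Spanning sets, biadditive maps, and the universal properties of quotients,
  presentations and direct sums\<close>

section \<open>Generating sets and universal properties\<close>

text \<open>The sign (-1)^{mn+mi} is the Koszul sign for moving e_{-m} past \<xi>(a): that element
  has degree i - n, and m(i - n) has the parity of mn + mi. The difficulty lies in well-definedness.
  \<open>phi\<close> is a lift inside a lift inside a lift, and every lift reads off the value of a
  map on a coset, so it says nothing until the map is known to be constant there. The inner lift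
  depends on the outer variable, and its additivity in that variable is again an identity between
  homomorphisms. The critical relation is the one defining the tensor product over Z[*]. It moves
  e_l from b to a at the cost of (-1)^{il} and of a block twist. In D, \<xi> turns the block twist
  into its sign (-1)^{ln} and forgets the suspension. The product (-1)^{ln+il} is exactly the change
  of (-1)^{mn+mi} when b in level m is replaced by its suspension in level l + m. The same count of
  signs therefore makes both \<open>phi\<close> and its inverse well defined.\<close>

definition spans :: "('a, 'm) monoid_scheme \<Rightarrow> 'a set \<Rightarrow> bool" where
  "spans G S \<longleftrightarrow> generate G S = carrier G"

text \<open>Biadditive maps are the common input of the lifts below: elementary tensors and the
  generators of the Day convolution are both subject to additivity in each of two variables.\<close>

definition bihom ::
    "('a, 'm) monoid_scheme \<Rightarrow> ('b, 'n) monoid_scheme \<Rightarrow> ('c, 'k) monoid_scheme \<Rightarrow>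
     ('a \<Rightarrow> 'b \<Rightarrow> 'c) \<Rightarrow> bool" where
  "bihom G H K f \<longleftrightarrow>
     (\<forall>b \<in> carrier H. (\<lambda>a. f a b) \<in> hom G K) \<and> (\<forall>a \<in> carrier G. f a \<in> hom H K)"

lemma comm_group_imp_group [simp]: "comm_group G \<Longrightarrow> group G"
  by (simp add: comm_group_def)

lemma spans_carrier: "group G \<Longrightarrow> spans G (carrier G)"
  unfolding spans_def
  using group.generate_incl[of G "carrier G"] by (auto intro: generate.incl)

lemma spans_closed: "spans G S \<Longrightarrow> s \<in> S \<Longrightarrow> s \<in> carrier G"
  unfolding spans_def using generate.incl[of s S G] by simp

lemma group_homI: "group G \<Longrightarrow> group H \<Longrightarrow> f \<in> hom G H \<Longrightarrow> group_hom G H f"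
  by (simp add: group_hom_def group_hom_axioms_def)

lemma hom_inverse:
  assumes "group G" "group H" "f \<in> hom G H" "x \<in> carrier G"
  shows "f (inv\<^bsub>G\<^esub> x) = inv\<^bsub>H\<^esub> (f x)"
  using group_hom.hom_inv[OF group_homI[OF assms(1-3)] assms(4)] .

text \<open>Equality of two homomorphisms passes to products and inverses, so induction over the
  generated subgroup applies. This is the uniqueness half of the universal properties below.\<close>

lemma hom_eq_on_span:
  assumes "group G" "group K" "spans G S" "f \<in> hom G K" "g \<in> hom G K"
    and eq: "\<And>s. s \<in> S \<Longrightarrow> f s = g s" and "x \<in> carrier G"
  shows "f x = g x"
proof -
  have S: "S \<subseteq> carrier G" using spans_closed[OF assms(3)] by blast
  have "x \<in> generate G S" using assms unfolding spans_def by simp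
  then show ?thesis
  proof induction
    case one then show ?case using assms by (metis hom_one)
  next
    case (inv h) then show ?case using assms S by (metis hom_inverse subsetD)
  next
    case (eng h1 h2)
    then have "h1 \<in> carrier G" "h2 \<in> carrier G"
      using S assms(1) by (metis group.generate_in_carrier)+
    with eng show ?case using assms(4,5) by (simp add: hom_mult)
  qed (rule eq)
qed

lemma hom_in_generate:
  assumes "group G" "group H" "f \<in> hom G H" "S \<subseteq> carrier G" "x \<in> generate G S"
  shows "f x \<in> generate H (f ` S)"
  using group_hom.generate_img[OF group_homI[OF assms(1-3)] assms(4)] assms(5) by blast

lemma spans_image:
  assumes "group G" "group H" "f \<in> hom G H" "f ` carrier G = carrier H" "spans G S"
  shows "spans H (f ` S)"
  using group_hom.generate_img[OF group_homI[OF assms(1-3)], of S] assms spans_closed[OF assms(5)]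
  unfolding spans_def by (metis subsetI)

text \<open>Lets a tautological generating set, made from all elements of the factors, be replaced
  by one made from chosen generators of the factors.\<close>

lemma spans_trans:
  assumes "group G" "spans G T" "T \<subseteq> generate G S" "S \<subseteq> carrier G"
  shows "spans G S"
proof -
  have "generate G T \<subseteq> generate G S"
    by (rule group.generate_subgroup_incl[OF assms(1,3)])
       (rule group.generate_is_subgroup[OF assms(1,4)])
  then show ?thesis using assms unfolding spans_def
    by (metis group.generate_incl subset_antisym)
qed

lemma hom_trivial: "group K \<Longrightarrow> (\<lambda>x. \<one>\<^bsub>K\<^esub>) \<in> hom G K"
  by (auto simp: hom_def group.is_monoid monoid.l_one)

lemma hom_pow: 
  assumes "comm_group K" "f \<in> hom G K"
  shows "(\<lambda>x. f x [^]\<^bsub>K\<^esub> (c::int)) \<in> hom G K"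
proof -
  interpret K: comm_group K by fact
  show ?thesis
    using assms(2) by (auto simp: hom_def Pi_iff K.int_pow_distrib)
qed

lemma hom_mult_fun:
  assumes "comm_group K" "f \<in> hom G K" "g \<in> hom G K"
  shows "(\<lambda>x. f x \<otimes>\<^bsub>K\<^esub> g x) \<in> hom G K"
  using assms comm_group.hom_group_mult by blast

lemma hom_compose_fun:
  assumes "f \<in> hom G H" "g \<in> hom H K"
  shows "(\<lambda>x. g (f x)) \<in> hom G K"
  using hom_compose[OF assms] by (simp add: comp_def)

lemma bihomI:
  assumes "\<And>a b. a \<in> carrier G \<Longrightarrow> b \<in> carrier H \<Longrightarrow> f a b \<in> carrier K"
    and "\<And>a a' b. a \<in> carrier G \<Longrightarrow> a' \<in> carrier G \<Longrightarrow> b \<in> carrier H \<Longrightarrow>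
          f (a \<otimes>\<^bsub>G\<^esub> a') b = f a b \<otimes>\<^bsub>K\<^esub> f a' b"
    and "\<And>a b b'. a \<in> carrier G \<Longrightarrow> b \<in> carrier H \<Longrightarrow> b' \<in> carrier H \<Longrightarrow>
          f a (b \<otimes>\<^bsub>H\<^esub> b') = f a b \<otimes>\<^bsub>K\<^esub> f a b'"
  shows "bihom G H K f"
  unfolding bihom_def hom_def using assms by simp

lemma bihom_closed: "bihom G H K f \<Longrightarrow> a \<in> carrier G \<Longrightarrow> b \<in> carrier H \<Longrightarrow> f a b \<in> carrier K"
  unfolding bihom_def hom_def by auto

lemma bihom_hom1: "bihom G H K f \<Longrightarrow> b \<in> carrier H \<Longrightarrow> (\<lambda>a. f a b) \<in> hom G K"
  unfolding bihom_def by auto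

lemma bihom_hom2: "bihom G H K f \<Longrightarrow> a \<in> carrier G \<Longrightarrow> f a \<in> hom H K"
  unfolding bihom_def by auto

lemma bihom_pow:
  "comm_group K \<Longrightarrow> bihom G H K f \<Longrightarrow> bihom G H K (\<lambda>a b. f a b [^]\<^bsub>K\<^esub> (c::int))"
  unfolding bihom_def by (auto intro: hom_pow)

lemma bihom_mult:
  "comm_group K \<Longrightarrow> bihom G H K f \<Longrightarrow> bihom G H K g \<Longrightarrow>
     bihom G H K (\<lambda>a b. f a b \<otimes>\<^bsub>K\<^esub> g a b)"
  unfolding bihom_def by (auto intro: hom_mult_fun)

lemma bihom_compose:
  "bihom G H K f \<Longrightarrow> u \<in> hom G' G \<Longrightarrow> v \<in> hom H' H \<Longrightarrow> w \<in> hom K K' \<Longrightarrow>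
     bihom G' H' K' (\<lambda>a b. w (f (u a) (v b)))"
  unfolding bihom_def hom_def by (simp add: Pi_iff)

lemma bihom_swap: "bihom G H K f \<Longrightarrow> bihom H G K (\<lambda>b a. f a b)"
  unfolding bihom_def by auto

subsection \<open>Quotients\<close>

context comm_group begin

lemma comm_group_Mod: "R \<subseteq> carrier G \<Longrightarrow> comm_group (G Mod generate G R)"
  by (simp add: abelian_FactGroup generate_is_subgroup)

lemma class_hom:
  assumes "R \<subseteq> carrier G"
  shows "(\<lambda>x. generate G R #> x) \<in> hom G (G Mod generate G R)"
  using normal.r_coset_hom_Mod[OF subgroup_imp_normal[OF generate_is_subgroup[OF assms]]] .

lemma class_surj: "(\<lambda>x. generate G R #> x) ` carrier G = carrier (G Mod generate G R)"
  by (simp add: carrier_FactGroup)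

lemma class_relator:
  assumes "R \<subseteq> carrier G" "r \<in> R"
  shows "generate G R #> r = \<one>\<^bsub>G Mod generate G R\<^esub>"
  using assms coset_join2[OF _ generate_is_subgroup[OF assms(1)] generate.incl[OF assms(2)]] by auto

text \<open>Relators are stored as words \<open>x \<otimes> inv y\<close>. Writing x as such a word
  times y shows that the word being a relator makes the classes of x and y equal.\<close>

lemma class_eqI:
  assumes R: "R \<subseteq> carrier G" and "x \<in> carrier G" "y \<in> carrier G" and r: "x \<otimes> inv y \<in> R"
  shows "generate G R #> x = generate G R #> y"
proof -
  have "x = (x \<otimes> inv y) \<otimes> y" using assms by (simp add: m_assoc)
  then have "generate G R #> x = generate G R #> ((x \<otimes> inv y) \<otimes> y)" by simp
  also have "\<dots> = generate G R #> (x \<otimes> inv y) #> y"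
    using assms by (simp add: coset_mult_assoc generate_incl)
  finally show ?thesis using class_relator[OF R r] by simp
qed

lemma spans_Mod:
  assumes "R \<subseteq> carrier G" "spans G S"
  shows "spans (G Mod generate G R) ((\<lambda>x. generate G R #> x) ` S)"
  by (rule spans_image[OF _ _ class_hom class_surj])
     (use assms comm_group_Mod in auto)

text \<open>\<open>quotient_lift\<close> takes the unique element of the image of a coset. The image
  is a singleton because the kernel of \<open>h\<close> is a subgroup containing \<open>R\<close>,
  hence contains the subgroup generated by \<open>R\<close>.\<close>

lemma quotient_lift_class:
  assumes "R \<subseteq> carrier G" "group K" "h \<in> hom G K" "\<And>r. r \<in> R \<Longrightarrow> h r = \<one>\<^bsub>K\<^esub>" "x \<in> carrier G"
  shows "quotient_lift h (generate G R #> x) = h x"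
proof -
  interpret h: group_hom G K h using assms by (simp add: group_homI)
  have "generate G R \<subseteq> kernel G K h"
    by (rule generate_subgroup_incl[OF _ h.subgroup_kernel]) (use assms in \<open>auto simp: kernel_def\<close>)
  then have "h (n \<otimes> x) = h x" if "n \<in> generate G R" for n
    using that assms(5) by (auto simp: kernel_def)
  moreover have "generate G R #> x = (\<lambda>n. n \<otimes> x) ` generate G R"
    by (auto simp: r_coset_def)
  ultimately have "h ` (generate G R #> x) = {h x}"
    using generate.one[of G R] by (auto simp: image_iff)
  then show ?thesis by (simp add: quotient_lift_def)
qed

lemma quotient_lift_hom:
  assumes "R \<subseteq> carrier G" "group K" "h \<in> hom G K" "\<And>r. r \<in> R \<Longrightarrow> h r = \<one>\<^bsub>K\<^esub>"
  shows "quotient_lift h \<in> hom (G Mod generate G R) K"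
proof (rule homI)
  note v = quotient_lift_class[OF assms(1-4)]
  fix X assume "X \<in> carrier (G Mod generate G R)"
  then obtain x where x: "x \<in> carrier G" "X = generate G R #> x"
    by (auto simp flip: class_surj)
  then show "quotient_lift h X \<in> carrier K" using v[of x] hom_carrier[OF assms(3)] by auto
  fix Y assume "Y \<in> carrier (G Mod generate G R)"
  then obtain y where y: "y \<in> carrier G" "Y = generate G R #> y"
    by (auto simp flip: class_surj)
  have "X \<otimes>\<^bsub>G Mod generate G R\<^esub> Y = generate G R #> (x \<otimes> y)"
    using x y hom_mult[OF class_hom[OF assms(1)], of x y] by simp
  then show "quotient_lift h (X \<otimes>\<^bsub>G Mod generate G R\<^esub> Y) = quotient_lift h X \<otimes>\<^bsub>K\<^esub> quotient_lift h Y"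
    using x y v hom_mult[OF assms(3), of x y] by simp
qed

end

subsection \<open>Presentations\<close>

text \<open>Keys outside the support contribute trivial factors. Evaluation over a common finite set
  of keys is what allows the products for \<open>x\<close>, \<open>y\<close> and
  \<open>x + y\<close> to be compared in \<open>free_lift_hom\<close>.\<close>

lemma free_lift_superset:
  assumes "comm_group K" "f \<in> S \<rightarrow> carrier K" "Poly_Mapping.keys x \<subseteq> U" "U \<subseteq> S" "finite U"
  shows "free_lift K f x = finprod K (\<lambda>s. f s [^]\<^bsub>K\<^esub> Poly_Mapping.lookup x s) U"
proof -
  interpret K: comm_group K by fact
  show ?thesis unfolding free_lift_def
    by (rule K.finprod_mono_neutral_cong_left)
       (use assms in \<open>auto simp: in_keys_iff subset_iff Pi_iff\<close>)
qed

lemma free_lift_hom: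
  assumes "comm_group K" "f \<in> S \<rightarrow> carrier K"
  shows "free_lift K f \<in> hom (free_Abelian_group S) K"
proof -
  interpret K: comm_group K by fact
  show ?thesis
  proof (rule homI)
    fix x assume "x \<in> carrier (free_Abelian_group S)"
    then show "free_lift K f x \<in> carrier K" unfolding free_lift_def
      using assms by (auto simp: Pi_iff subset_iff intro!: K.finprod_closed)
    fix y assume y: "y \<in> carrier (free_Abelian_group S)"
    let ?U = "Poly_Mapping.keys x \<union> Poly_Mapping.keys y"
    have U: "finite ?U" "?U \<subseteq> S" "Poly_Mapping.keys (x + y) \<subseteq> ?U"
      using y \<open>x \<in> _\<close> keys_add[of x y] by auto
    have f: "(\<lambda>s. f s [^]\<^bsub>K\<^esub> (c s::int)) \<in> ?U \<rightarrow> carrier K" for c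
      using assms(2) U(2) by (auto simp: Pi_iff)
    have "free_lift K f (x + y)
        = finprod K (\<lambda>s. f s [^]\<^bsub>K\<^esub> Poly_Mapping.lookup x s \<otimes>\<^bsub>K\<^esub> f s [^]\<^bsub>K\<^esub> Poly_Mapping.lookup y s) ?U"
      unfolding free_lift_superset[OF assms U(3,2,1)]
      by (rule K.finprod_cong')
         (use assms(2) U(2) in \<open>auto simp: Poly_Mapping.lookup_add Pi_iff K.int_pow_mult subset_iff\<close>)
    also have "\<dots> = free_lift K f x \<otimes>\<^bsub>K\<^esub> free_lift K f y"
      using free_lift_superset[OF assms _ U(2,1)] K.finprod_multf[OF f f] by simp
    finally show "free_lift K f (x \<otimes>\<^bsub>free_Abelian_group S\<^esub> y) = free_lift K f x \<otimes>\<^bsub>K\<^esub> free_lift K f y"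
      by simp
  qed
qed

lemma free_lift_frag_of:
  assumes "comm_group K" "f s \<in> carrier K"
  shows "free_lift K f (frag_of s) = f s"
proof -
  interpret K: comm_group K by fact
  have "(\<lambda>s'. f s' [^]\<^bsub>K\<^esub> Poly_Mapping.lookup (frag_of s) s') \<in> {s} \<rightarrow> carrier K"
    using assms by simp
  then show ?thesis using assms unfolding free_lift_def
    by (subst K.finprod_cong'[of _ "{s}" "\<lambda>_. f s"]) (auto simp: K.finprod_const)
qed

lemma spans_free: "spans (free_Abelian_group S) (frag_of ` S)"
proof -
  let ?F = "free_Abelian_group S"
  have sub: "frag_of ` S \<subseteq> carrier ?F" by auto
  have *: "Poly_Mapping.keys x \<subseteq> S \<Longrightarrow> x \<in> generate ?F (frag_of ` S)" for x
  proof (erule free_Abelian_group_induct)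
    show "0 \<in> generate ?F (frag_of ` S)" using generate.one[of ?F] by simp
    fix x y assume xy: "Poly_Mapping.keys x \<subseteq> S" "Poly_Mapping.keys y \<subseteq> S"
      "x \<in> generate ?F (frag_of ` S)" "y \<in> generate ?F (frag_of ` S)"
    then have "x \<otimes>\<^bsub>?F\<^esub> inv\<^bsub>?F\<^esub> y \<in> generate ?F (frag_of ` S)"
      using group.generate_m_inv_closed[OF group_free_Abelian_group sub] by (metis generate.eng)
    then show "x - y \<in> generate ?F (frag_of ` S)" using xy by simp
  qed (auto intro: generate.incl)
  show ?thesis unfolding spans_def
    using group.generate_incl[OF group_free_Abelian_group sub] * by auto
qed

context
  fixes S :: "'g set" and R :: "('g \<Rightarrow>\<^sub>0 int) set"
  assumes R: "R \<subseteq> carrier (free_Abelian_group S)"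
begin

interpretation F: comm_group "free_Abelian_group S"
  by (rule abelian_free_Abelian_group)

lemma comm_group_presented: "comm_group (presented_group S R)"
  unfolding presented_group_def by (rule F.comm_group_Mod[OF R])

lemma presented_gen_closed: "s \<in> S \<Longrightarrow> presented_gen S R s \<in> carrier (presented_group S R)"
  unfolding presented_gen_def presented_group_def
  using F.class_surj[of R] by auto

text \<open>Relators occur in two shapes: a difference, which identifies two generators, and the
  three-term shape of \<open>presented_rel2\<close>, which expresses additivity.
  \<open>free_lift_rel1\<close> and \<open>free_lift_rel2\<close> are the counterparts for maps out
  of a presentation.\<close>

lemma presented_rel1:
  assumes "frag_of x - frag_of y \<in> R" "x \<in> S" "y \<in> S"
  shows "presented_gen S R x = presented_gen S R y"
  unfolding presented_gen_def by (rule F.class_eqI[OF R]) (use assms in auto)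

lemma presented_rel2:
  assumes "frag_of x - (frag_of y + frag_of z) \<in> R" "x \<in> S" "y \<in> S" "z \<in> S"
  shows "presented_gen S R x = presented_gen S R y \<otimes>\<^bsub>presented_group S R\<^esub> presented_gen S R z"
proof -
  have yz: "Poly_Mapping.keys (frag_of y + frag_of z) \<subseteq> S"
    using keys_add[of "frag_of y" "frag_of z"] assms by auto
  have "presented_gen S R x = generate (free_Abelian_group S) R #>\<^bsub>free_Abelian_group S\<^esub> (frag_of y + frag_of z)"
    unfolding presented_gen_def
  proof (rule F.class_eqI[OF R])
    have "frag_of x + - (frag_of y + frag_of z) = frag_of x - (frag_of y + frag_of z)" by simp
    then show "frag_of x \<otimes>\<^bsub>free_Abelian_group S\<^esub> inv\<^bsub>free_Abelian_group S\<^esub> (frag_of y + frag_of z) \<in> R"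
      using assms(1) unfolding mult_free_Abelian_group inv_free_Abelian_group[OF yz] by argo
  qed (use assms yz in auto)
  also have "\<dots> = presented_gen S R y \<otimes>\<^bsub>presented_group S R\<^esub> presented_gen S R z"
    unfolding presented_gen_def presented_group_def
    using hom_mult[OF F.class_hom[OF R], of "frag_of y" "frag_of z"] assms by simp
  finally show ?thesis .
qed

lemma spans_presented: "spans (presented_group S R) (presented_gen S R ` S)"
  using F.spans_Mod[OF R spans_free]
  unfolding presented_gen_def presented_group_def by (simp add: image_image)

context
  fixes K :: "('k, 'm) monoid_scheme" and f :: "'g \<Rightarrow> 'k"
  assumes K: "comm_group K" and f: "f \<in> S \<rightarrow> carrier K"
    and rel: "\<And>r. r \<in> R \<Longrightarrow> free_lift K f r = \<one>\<^bsub>K\<^esub>"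
begin

lemma presented_lift_hom: "presented_lift K f \<in> hom (presented_group S R) K"
  unfolding presented_lift_def presented_group_def
  by (rule F.quotient_lift_hom[OF R _ free_lift_hom[OF K f]]) (use K rel in auto)

lemma presented_lift_gen: "s \<in> S \<Longrightarrow> presented_lift K f (presented_gen S R s) = f s"
  unfolding presented_lift_def presented_gen_def
  by (subst F.quotient_lift_class[OF R _ free_lift_hom[OF K f]])
     (use K rel f in \<open>auto simp: Pi_iff intro!: free_lift_frag_of\<close>)

end

end

lemma free_lift_rel1:
  assumes "comm_group K" "f \<in> S \<rightarrow> carrier K" "x \<in> S" "y \<in> S" "f x = f y"
  shows "free_lift K f (frag_of x - frag_of y) = \<one>\<^bsub>K\<^esub>"
proof -
  interpret K: comm_group K by fact
  have e: "frag_of x - frag_of y = frag_of x \<otimes>\<^bsub>free_Abelian_group S\<^esub> inv\<^bsub>free_Abelian_group S\<^esub> (frag_of y)"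
    using assms by simp
  show ?thesis unfolding e
    using assms hom_mult[OF free_lift_hom[OF assms(1,2)], of "frag_of x" "inv\<^bsub>free_Abelian_group S\<^esub> (frag_of y)"]
      hom_inverse[OF _ _ free_lift_hom[OF assms(1,2)], of "frag_of y"]
    by (auto simp: free_lift_frag_of Pi_iff)
qed

lemma free_lift_rel2:
  assumes "comm_group K" "f \<in> S \<rightarrow> carrier K" "x \<in> S" "y \<in> S" "z \<in> S"
    and "f x = f y \<otimes>\<^bsub>K\<^esub> f z"
  shows "free_lift K f (frag_of x - (frag_of y + frag_of z)) = \<one>\<^bsub>K\<^esub>"
proof -
  interpret K: comm_group K by fact
  let ?F = "free_Abelian_group S"
  have yz: "Poly_Mapping.keys (frag_of y + frag_of z) \<subseteq> S"
    using keys_add[of "frag_of y" "frag_of z"] assms by auto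
  have e: "frag_of x - (frag_of y + frag_of z)
      = frag_of x \<otimes>\<^bsub>?F\<^esub> inv\<^bsub>?F\<^esub> (frag_of y \<otimes>\<^bsub>?F\<^esub> frag_of z)"
    using assms yz by simp
  note h = free_lift_hom[OF assms(1,2)]
  have "free_lift K f (frag_of x \<otimes>\<^bsub>?F\<^esub> inv\<^bsub>?F\<^esub> (frag_of y \<otimes>\<^bsub>?F\<^esub> frag_of z))
     = f x \<otimes>\<^bsub>K\<^esub> inv\<^bsub>K\<^esub> (f y \<otimes>\<^bsub>K\<^esub> f z)"
  proof -
    have c: "frag_of x \<in> carrier ?F" "frag_of y \<in> carrier ?F" "frag_of z \<in> carrier ?F"
      "frag_of y \<otimes>\<^bsub>?F\<^esub> frag_of z \<in> carrier ?F"
      using assms yz by simp_all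
    show ?thesis
      using hom_mult[OF h c(1) group.inv_closed[OF group_free_Abelian_group c(4)]]
        hom_inverse[OF _ _ h c(4)] hom_mult[OF h c(2,3)] assms
      by (simp add: free_lift_frag_of Pi_iff del: inv_free_Abelian_group mult_free_Abelian_group)
  qed
  then show ?thesis unfolding e using assms by (simp add: Pi_iff)
qed

subsection \<open>Direct sums\<close>

text \<open>The function is restricted to \<open>I\<close> because elements of
  \<open>sum_group\<close> are extensional; \<open>jsum_in\<close> is the case where
  \<open>I\<close> is the whole type.\<close>

definition sum_in :: "'i set \<Rightarrow> ('i \<Rightarrow> ('a, 'm) monoid_scheme) \<Rightarrow> 'i \<Rightarrow> 'a \<Rightarrow> 'i \<Rightarrow> 'a" where
  "sum_in I G i x = (\<lambda>j\<in>I. if j = i then x else \<one>\<^bsub>G j\<^esub>)"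

lemma comm_group_sum_group:
  assumes "\<And>i. i \<in> I \<Longrightarrow> comm_group (G i)"
  shows "comm_group (sum_group I G)"
proof (rule group.group_comm_groupI)
  show "group (sum_group I G)" using assms by simp
  fix x y assume "x \<in> carrier (sum_group I G)" "y \<in> carrier (sum_group I G)"
  then show "x \<otimes>\<^bsub>sum_group I G\<^esub> y = y \<otimes>\<^bsub>sum_group I G\<^esub> x"
    using assms by (auto simp: carrier_sum_group PiE_iff comm_group_def comm_monoid.m_comm intro!: restrict_ext)
qed

context
  fixes I :: "'i set" and G :: "'i \<Rightarrow> ('a, 'm) monoid_scheme"
  assumes G: "\<And>i. i \<in> I \<Longrightarrow> comm_group (G i)"
begin

lemma sum_in_hom: "i \<in> I \<Longrightarrow> sum_in I G i \<in> hom (G i) (sum_group I G)"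
proof (rule homI)
  assume i: "i \<in> I"
  fix x assume x: "x \<in> carrier (G i)"
  have "finite {j \<in> I. (if j = i then x else \<one>\<^bsub>G j\<^esub>) \<noteq> \<one>\<^bsub>G j\<^esub>}"
    by (rule finite_subset[of _ "{i}"]) auto
  moreover have "\<one>\<^bsub>G j\<^esub> \<in> carrier (G j)" if "j \<in> I" for j
    using G[OF that] by (simp add: comm_group_def group.is_monoid)
  ultimately show "sum_in I G i x \<in> carrier (sum_group I G)"
    using x G by (auto simp: carrier_sum_group sum_in_def cong: conj_cong)
  fix y assume y: "y \<in> carrier (G i)"
  have "\<one>\<^bsub>G j\<^esub> \<otimes>\<^bsub>G j\<^esub> \<one>\<^bsub>G j\<^esub> = \<one>\<^bsub>G j\<^esub>" if "j \<in> I" for j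
    using G[OF that] by (simp add: comm_group_def group.is_monoid)
  then show "sum_in I G i (x \<otimes>\<^bsub>G i\<^esub> y) = sum_in I G i x \<otimes>\<^bsub>sum_group I G\<^esub> sum_in I G i y"
    by (auto simp: sum_in_def intro!: restrict_ext)
qed

lemma spans_sum_group:
  assumes S: "\<And>i. i \<in> I \<Longrightarrow> spans (G i) (S i)"
  shows "spans (sum_group I G) (\<Union>i\<in>I. sum_in I G i ` S i)"
proof -
  let ?X = "\<Union>i\<in>I. sum_in I G i ` S i"
  interpret SG: group "sum_group I G" using G by simp
  have one [simp]: "\<one>\<^bsub>G j\<^esub> \<in> carrier (G j)" if "j \<in> I" for j
    using G[OF that] by (simp add: comm_group_def group.is_monoid)
  have X: "?X \<subseteq> carrier (sum_group I G)"
    using hom_carrier[OF sum_in_hom] spans_closed[OF S] by blast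
  have inX: "sum_in I G i x \<in> generate (sum_group I G) ?X" if i: "i \<in> I" and x: "x \<in> carrier (G i)" for i x
  proof -
    have "x \<in> generate (G i) (S i)" using S[OF i] x by (simp add: spans_def)
    then have "sum_in I G i x \<in> generate (sum_group I G) (sum_in I G i ` S i)"
      by (rule hom_in_generate[OF _ SG.group_axioms sum_in_hom[OF i], rotated 2])
         (use G[OF i] spans_closed[OF S[OF i]] in auto)
    then show ?thesis using SG.mono_generate[of "sum_in I G i ` S i" ?X] i by blast
  qed
  \<comment> \<open>Induction over a finite set containing the support, not over the support itself,
    so that setting one coordinate to the neutral element stays within the induction
    hypothesis.\<close>
  have *: "x \<in> generate (sum_group I G) ?X"
    if "finite U" "x \<in> carrier (sum_group I G)" "{i \<in> I. x i \<noteq> \<one>\<^bsub>G i\<^esub>} \<subseteq> U" for U x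
    using that
  proof (induction U arbitrary: x rule: finite_induct)
    case empty
    then have "x = \<one>\<^bsub>sum_group I G\<^esub>"
      using G by (auto simp: carrier_sum_group PiE_def extensional_def fun_eq_iff)
    then show ?case by (simp only: generate.one)
  next
    case (insert k U)
    show ?case
    proof (cases "k \<in> I")
      case False
      then show ?thesis using insert by auto
    next
      case k: True
      let ?y = "x(k := \<one>\<^bsub>G k\<^esub>)"
      have x: "x \<in> (\<Pi>\<^sub>E i\<in>I. carrier (G i))" "finite {i \<in> I. x i \<noteq> \<one>\<^bsub>G i\<^esub>}"
        using insert.prems G by (auto simp: carrier_sum_group)
      have "?y \<in> (\<Pi>\<^sub>E i\<in>I. carrier (G i))" using x k by (auto simp: PiE_iff extensional_def)
      moreover have "finite {i \<in> I. ?y i \<noteq> \<one>\<^bsub>G i\<^esub>}"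
        by (rule finite_subset[OF _ x(2)]) auto
      ultimately have y: "?y \<in> carrier (sum_group I G)" using G by (auto simp: carrier_sum_group)
      have "x = sum_in I G k (x k) \<otimes>\<^bsub>sum_group I G\<^esub> ?y"
      proof
        fix j show "x j = (sum_in I G k (x k) \<otimes>\<^bsub>sum_group I G\<^esub> ?y) j"
          using x k G[of j] by (auto simp: sum_in_def PiE_iff extensional_def comm_group_def group.is_monoid)
      qed
      moreover have "?y \<in> generate (sum_group I G) ?X"
        by (rule insert.IH[OF y]) (use insert.prems in auto)
      ultimately show ?thesis
        using generate.eng[OF inX[OF k, of "x k"], of ?y] x k by (metis PiE_mem)
    qed
  qed
  have "x \<in> generate (sum_group I G) ?X" if x: "x \<in> carrier (sum_group I G)" for x
  proof (rule *[OF _ x order_refl])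
    show "finite {i \<in> I. x i \<noteq> \<one>\<^bsub>G i\<^esub>}" using x G by (simp add: carrier_sum_group)
  qed
  then show ?thesis unfolding spans_def using SG.generate_incl[OF X] by blast
qed

text \<open>Each \<open>f j\<close> preserves the neutral element, so all factors but the one at
  \<open>i\<close> are trivial, and \<open>gfinprod\<close> over a possibly infinite index set
  ignores trivial factors.\<close>

lemma sum_lift_in:
  assumes K: "comm_group K" and f: "\<And>i. i \<in> I \<Longrightarrow> f i \<in> hom (G i) K"
    and i: "i \<in> I" and x: "x \<in> carrier (G i)"
  shows "gfinprod K (\<lambda>j. f j (sum_in I G i x j)) I = f i x"
proof -
  interpret K: comm_group K by fact
  have one: "f j \<one>\<^bsub>G j\<^esub> = \<one>\<^bsub>K\<^esub>" if "j \<in> I" for j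
    using hom_one[OF f[OF that]] G[OF that] by simp
  have fx: "f i x \<in> carrier K" using hom_carrier[OF f[OF i]] x by blast
  have "gfinprod K (\<lambda>j. f j (sum_in I G i x j)) I = gfinprod K (\<lambda>j. f i x) {i}"
    by (rule K.gfinprod_mono_neutral_cong_right)
       (use i x fx one in \<open>auto simp: sum_in_def\<close>)
  also have "\<dots> = f i x" using fx by (simp add: K.finprod_const)
  finally show ?thesis .
qed

end


section \<open>Tensor products of abelian groups, of graded groups and of complexes\<close>

section \<open>Tensor products\<close>

lemma hom_id: "(\<lambda>x. x) \<in> hom G G"
  by (simp add: hom_def)
text \<open>For each fixed s in \<open>S\<close> the second argument is expanded in the generators
  \<open>T\<close>; then the first argument is expanded in \<open>S\<close>. This is why products of
  generators suffice to generate a tensor product or a Day convolution.\<close>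

lemma bihom_in_generate:
  assumes "group G" "group H" "group K" "bihom G H K f" "spans G S" "spans H T"
    and "a \<in> carrier G" "b \<in> carrier H"
  shows "f a b \<in> generate K {f s t |s t. s \<in> S \<and> t \<in> T}"
proof -
  let ?X = "{f s t |s t. s \<in> S \<and> t \<in> T}"
  have S: "S \<subseteq> carrier G" and T: "T \<subseteq> carrier H"
    using spans_closed[OF assms(5)] spans_closed[OF assms(6)] by auto
  have X: "?X \<subseteq> carrier K"
    using bihom_closed[OF assms(4)] S T by blast
  have sb: "f s b \<in> generate K ?X" if s: "s \<in> S" for s
  proof -
    have "f s b \<in> generate K (f s ` T)"
      by (rule hom_in_generate[OF assms(2,3) bihom_hom2[OF assms(4)] T])
         (use assms s S in \<open>auto simp: spans_def\<close>)
    moreover have "f s ` T \<subseteq> ?X" using s by blast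
    ultimately show ?thesis using group.mono_generate[OF assms(3)] by blast
  qed
  have "f a b \<in> generate K ((\<lambda>s. f s b) ` S)"
    by (rule hom_in_generate[OF assms(1,3) bihom_hom1[OF assms(4,8)] S])
       (use assms in \<open>auto simp: spans_def\<close>)
  moreover have "generate K ((\<lambda>s. f s b) ` S) \<subseteq> generate K ?X"
    by (rule group.generate_subgroup_incl[OF assms(3) _ group.generate_is_subgroup[OF assms(3) X]])
       (use sb in blast)
  ultimately show ?thesis by blast
qed

lemma keys_rel2: "x \<in> S \<Longrightarrow> y \<in> S \<Longrightarrow> z \<in> S \<Longrightarrow>
    Poly_Mapping.keys (frag_of x - (frag_of y + frag_of z)) \<subseteq> S"
  by (rule order_trans[OF keys_diff Un_least[OF _ order_trans[OF keys_add Un_least]]]) auto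

subsection \<open>Abelian groups\<close>

context
  fixes G :: "('a, 'm) monoid_scheme" and H :: "('b, 'n) monoid_scheme"
  assumes G: "comm_group G" and H: "comm_group H"
begin

interpretation G: comm_group G by (rule G)
interpretation H: comm_group H by (rule H)

lemma tensor_rels_subset: "tensor_rels G H \<subseteq> carrier (free_Abelian_group (carrier G \<times> carrier H))"
  unfolding tensor_rels_def Un_subset_iff
  by (intro conjI subsetI; clarify; unfold carrier_free_Abelian_group_iff; rule keys_rel2) auto

lemma comm_group_tensor: "comm_group (tensor_group G H)"
  unfolding tensor_group_def by (rule comm_group_presented[OF tensor_rels_subset])

lemma tensor_elt_bihom: "bihom G H (tensor_group G H) (tensor_elt G H)"
  unfolding tensor_elt_def tensor_group_def
proof (rule bihomI)
  note R = tensor_rels_subset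
  fix a a' b assume 1: "a \<in> carrier G" "a' \<in> carrier G" "b \<in> carrier H"
  show "presented_gen (carrier G \<times> carrier H) (tensor_rels G H) (a \<otimes>\<^bsub>G\<^esub> a', b) =
    presented_gen (carrier G \<times> carrier H) (tensor_rels G H) (a, b)
    \<otimes>\<^bsub>presented_group (carrier G \<times> carrier H) (tensor_rels G H)\<^esub>
    presented_gen (carrier G \<times> carrier H) (tensor_rels G H) (a', b)"
    by (rule presented_rel2[OF R]) (use 1 in \<open>auto simp: tensor_rels_def\<close>)
next
  note R = tensor_rels_subset
  fix a b b' assume 1: "a \<in> carrier G" "b' \<in> carrier H" "b \<in> carrier H"
  show "presented_gen (carrier G \<times> carrier H) (tensor_rels G H) (a, b \<otimes>\<^bsub>H\<^esub> b') =
    presented_gen (carrier G \<times> carrier H) (tensor_rels G H) (a, b)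
    \<otimes>\<^bsub>presented_group (carrier G \<times> carrier H) (tensor_rels G H)\<^esub>
    presented_gen (carrier G \<times> carrier H) (tensor_rels G H) (a, b')"
    by (rule presented_rel2[OF R]) (use 1 in \<open>auto simp: tensor_rels_def\<close>)
qed (auto intro: presented_gen_closed[OF tensor_rels_subset])

lemma spans_tensor:
  assumes "spans G S" "spans H T"
  shows "spans (tensor_group G H) {tensor_elt G H s t |s t. s \<in> S \<and> t \<in> T}"
proof (rule spans_trans)
  show "group (tensor_group G H)" using comm_group_tensor by simp
  show "spans (tensor_group G H) {tensor_elt G H a b |a b. a \<in> carrier G \<and> b \<in> carrier H}"
  proof -
    have "presented_gen (carrier G \<times> carrier H) (tensor_rels G H) ` (carrier G \<times> carrier H)
        = {tensor_elt G H a b |a b. a \<in> carrier G \<and> b \<in> carrier H}"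
      by (auto simp: tensor_elt_def)
    then show ?thesis
      using spans_presented[OF tensor_rels_subset] unfolding tensor_group_def by simp
  qed
  show "{tensor_elt G H a b |a b. a \<in> carrier G \<and> b \<in> carrier H} \<subseteq>
    generate (tensor_group G H) {tensor_elt G H s t |s t. s \<in> S \<and> t \<in> T}"
    using bihom_in_generate[OF _ _ _ tensor_elt_bihom assms] comm_group_tensor by auto
  show "{tensor_elt G H s t |s t. s \<in> S \<and> t \<in> T} \<subseteq> carrier (tensor_group G H)"
    using bihom_closed[OF tensor_elt_bihom] spans_closed[OF assms(1)] spans_closed[OF assms(2)] by auto
qed

context
  fixes K :: "('k, 'l) monoid_scheme" and f :: "'a \<Rightarrow> 'b \<Rightarrow> 'k"
  assumes K: "comm_group K" and f: "bihom G H K f"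
begin

lemma tensor_free_lift:
  assumes "r \<in> tensor_rels G H"
  shows "free_lift K (\<lambda>(a, b). f a b) r = \<one>\<^bsub>K\<^esub>"
proof -
  have f': "(\<lambda>(a, b). f a b) \<in> carrier G \<times> carrier H \<rightarrow> carrier K"
    using bihom_closed[OF f] by auto
  show ?thesis
    using assms unfolding tensor_rels_def
    by (auto intro!: free_lift_rel2[OF K f']
      simp: hom_mult[OF bihom_hom1[OF f]] hom_mult[OF bihom_hom2[OF f]])
qed

lemma tensor_lift_hom: "presented_lift K (\<lambda>(a, b). f a b) \<in> hom (tensor_group G H) K"
  unfolding tensor_group_def
  by (rule presented_lift_hom[OF tensor_rels_subset K _ tensor_free_lift])
     (use bihom_closed[OF f] in auto)

lemma tensor_lift_elt:
  "a \<in> carrier G \<Longrightarrow> b \<in> carrier H \<Longrightarrow>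
    presented_lift K (\<lambda>(a, b). f a b) (tensor_elt G H a b) = f a b"
  unfolding tensor_elt_def
  by (subst presented_lift_gen[OF tensor_rels_subset K _ tensor_free_lift])
     (use bihom_closed[OF f] in auto)

end

end

subsection \<open>Graded groups\<close>

definition graded :: "'a chcx \<Rightarrow> bool" where
  "graded C \<longleftrightarrow> (\<forall>k. comm_group (grp C k))"

text \<open>Groups with additive boundary maps are the data that tensor products and colimits pass
  on. The equation d^2 = 0 for \<open>D A\<close> is the separate lemma
  \<open>chain_complex_D\<close>.\<close>

definition precomplex :: "'a chcx \<Rightarrow> bool" where
  "precomplex C \<longleftrightarrow> graded C \<and> (\<forall>k. bd C k \<in> hom (grp C k) (grp C (k - 1)))"

lemma gradedD [simp]: "graded C \<Longrightarrow> comm_group (grp C k)"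
  by (simp add: graded_def)

lemma precomplex_graded [simp]: "precomplex C \<Longrightarrow> graded C"
  by (simp add: precomplex_def)

lemma precomplex_bd: "precomplex C \<Longrightarrow> l = k - 1 \<Longrightarrow> bd C k \<in> hom (grp C k) (grp C l)"
  by (simp add: precomplex_def)

lemma chain_complex_precomplex: "chain_complex C \<Longrightarrow> precomplex C"
  by (simp add: chain_complex_def precomplex_def graded_def)

lemma grp_ctensor [simp]: "grp (ctensor A B) = ctensor_grp A B"
  by (simp add: ctensor_def)

text \<open>Exhibits a homogeneous tensor as the image of an elementary tensor under the inclusion
  of the summand of bidegree (i, j), so that the results on direct sums apply.\<close>

lemma ctens_sum_in:
  "i + j = n \<Longrightarrow> ctens A B i j a b =
     sum_in {(i, j). i + j = n} (\<lambda>(i, j). tensor_group (grp A i) (grp B j)) (i, j)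
       (tensor_elt (grp A i) (grp B j) a b)"
  unfolding ctens_def sum_in_def restrict_def by (auto simp: fun_eq_iff)

context
  fixes A :: "'a chcx" and B :: "'b chcx"
  assumes A: "graded A" and B: "graded B"
begin

lemma comm_group_tensor_family:
  "ij \<in> {(i, j). i + j = n} \<Longrightarrow>
    comm_group ((\<lambda>(i, j). tensor_group (grp A i) (grp B j)) ij)"
  using A B by (auto intro!: comm_group_tensor)

lemma comm_group_ctensor [simp]: "comm_group (ctensor_grp A B n)"
  unfolding ctensor_grp_def by (rule comm_group_sum_group) (rule comm_group_tensor_family)

lemma graded_ctensor [simp]: "graded (ctensor A B)"
  by (simp add: graded_def)

lemma ctens_bihom:
  assumes "i + j = n"
  shows "bihom (grp A i) (grp B j) (ctensor_grp A B n) (ctens A B i j)"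
proof -
  have "sum_in {(i, j). i + j = n} (\<lambda>(i, j). tensor_group (grp A i) (grp B j)) (i, j)
      \<in> hom (tensor_group (grp A i) (grp B j)) (ctensor_grp A B n)"
    using sum_in_hom[where I="{(i, j). i + j = n}" and G="\<lambda>(i, j). tensor_group (grp A i) (grp B j)"
        and i="(i, j)", OF comm_group_tensor_family] assms
    by (simp add: ctensor_grp_def)
  note h = this
  have "ctens A B i j = (\<lambda>a b. sum_in {(i, j). i + j = n} (\<lambda>(i, j). tensor_group (grp A i) (grp B j)) (i, j)
       (tensor_elt (grp A i) (grp B j) a b))"
    by (intro ext ctens_sum_in[OF assms])
  moreover have "bihom (grp A i) (grp B j) (ctensor_grp A B n) \<dots>"
    by (rule bihom_compose[where u="\<lambda>x. x" and v="\<lambda>x. x", OF tensor_elt_bihom _ _ h])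
       (use A B in \<open>auto simp: hom_id\<close>)
  ultimately show ?thesis by simp
qed

lemma ctens_closed:
  "a \<in> elts A i \<Longrightarrow> b \<in> elts B j \<Longrightarrow> i + j = n \<Longrightarrow> ctens A B i j a b \<in> carrier (ctensor_grp A B n)"
  using bihom_closed[OF ctens_bihom] .

lemma spans_ctensor:
  assumes "\<And>i. spans (grp A i) (S i)" "\<And>j. spans (grp B j) (T j)"
  shows "spans (ctensor_grp A B n) {ctens A B i j s t |i j s t. i + j = n \<and> s \<in> S i \<and> t \<in> T j}"
proof -
  let ?I = "{(i, j). i + j = n}" and ?G = "\<lambda>(i, j). tensor_group (grp A i) (grp B j)"
  let ?X = "\<lambda>(i, j). {tensor_elt (grp A i) (grp B j) s t |s t. s \<in> S i \<and> t \<in> T j}"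
  have "spans (sum_group ?I ?G) (\<Union>ij\<in>?I. sum_in ?I ?G ij ` ?X ij)"
    by (rule spans_sum_group[OF comm_group_tensor_family])
       (use spans_tensor[OF _ _ assms] A B in auto)
  moreover have "(\<Union>ij\<in>?I. sum_in ?I ?G ij ` ?X ij)
      = {ctens A B i j s t |i j s t. i + j = n \<and> s \<in> S i \<and> t \<in> T j}"
    by (auto simp: ctens_sum_in image_iff)
  ultimately show ?thesis by (simp add: ctensor_grp_def)
qed

context
  fixes K :: "('k, 'l) monoid_scheme" and f :: "int \<Rightarrow> int \<Rightarrow> 'a \<Rightarrow> 'b \<Rightarrow> 'k" and n :: int
  assumes K: "comm_group K" and f: "\<And>i j. i + j = n \<Longrightarrow> bihom (grp A i) (grp B j) K (f i j)"
begin

lemma ctensor_lift_family_hom: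
  "ij \<in> {(i, j). i + j = n} \<Longrightarrow>
    (\<lambda>(i, j). presented_lift K (\<lambda>(a, b). f i j a b)) ij
      \<in> hom ((\<lambda>(i, j). tensor_group (grp A i) (grp B j)) ij) K"
  using A B K f by (auto intro!: tensor_lift_hom)

lemma ctensor_lift_alt:
  "ctensor_lift K n f = (\<lambda>x. gfinprod K
     (\<lambda>ij. (\<lambda>(i, j). presented_lift K (\<lambda>(a, b). f i j a b)) ij (x ij)) {(i, j). i + j = n})"
  unfolding ctensor_lift_def by (simp add: case_prod_unfold)

lemma ctensor_lift_hom: "ctensor_lift K n f \<in> hom (ctensor_grp A B n) K"
  unfolding ctensor_lift_alt ctensor_grp_def
  by (rule comm_group.hom_group_sum[OF K ctensor_lift_family_hom])
     (use comm_group_tensor_family in \<open>auto intro: comm_group_imp_group\<close>)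

lemma ctensor_lift_ctens:
  assumes "i + j = n" "a \<in> elts A i" "b \<in> elts B j"
  shows "ctensor_lift K n f (ctens A B i j a b) = f i j a b"
proof -
  have "tensor_elt (grp A i) (grp B j) a b \<in> carrier (tensor_group (grp A i) (grp B j))"
    using bihom_closed[OF tensor_elt_bihom[OF gradedD[OF A] gradedD[OF B]]] assms by auto
  then show ?thesis
    unfolding ctensor_lift_alt ctens_sum_in[OF assms(1)]
    using sum_lift_in[where I="{(i, j). i + j = n}" and G="\<lambda>(i, j). tensor_group (grp A i) (grp B j)"
        and i="(i, j)", OF comm_group_tensor_family K ctensor_lift_family_hom]
      tensor_lift_elt[OF _ _ K f] A B assms by simp
qed

end

lemma ctensor_hom_eq:
  assumes "group K" "f \<in> hom (ctensor_grp A B n) K" "g \<in> hom (ctensor_grp A B n) K"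
    and "\<And>i. spans (grp A i) (S i)" "\<And>j. spans (grp B j) (T j)"
    and "\<And>i j s t. i + j = n \<Longrightarrow> s \<in> S i \<Longrightarrow> t \<in> T j \<Longrightarrow> f (ctens A B i j s t) = g (ctens A B i j s t)"
    and "x \<in> carrier (ctensor_grp A B n)"
  shows "f x = g x"
  by (rule hom_eq_on_span[OF _ assms(1) spans_ctensor[OF assms(4,5)] assms(2,3) _ assms(7)])
     (use assms(6) in auto)

end

subsection \<open>Complexes\<close>

context
  fixes A :: "'a chcx" and B :: "'b chcx"
  assumes A: "precomplex A" and B: "precomplex B"
begin

lemma ctensor_bd_bihom:
  assumes "i + j = n"
  shows "bihom (grp A i) (grp B j) (ctensor_grp A B (n - 1))
     (\<lambda>a b. ctens A B (i - 1) j (bd A i a) b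
           \<otimes>\<^bsub>ctensor_grp A B (n - 1)\<^esub>
           ctens A B i (j - 1) a (bd B j b) [^]\<^bsub>ctensor_grp A B (n - 1)\<^esub> ksign i)"
proof -
  show ?thesis
    using assms A B
    by (intro bihom_mult bihom_pow)
       (auto intro!: bihom_compose[where w="\<lambda>x. x" and K="ctensor_grp A B (n - 1)", OF ctens_bihom]
          hom_id precomplex_bd)
qed

lemma ctensor_bd_hom: "bd (ctensor A B) n \<in> hom (ctensor_grp A B n) (ctensor_grp A B (n - 1))"
  unfolding ctensor_def
  using A B by (auto intro!: ctensor_lift_hom ctensor_bd_bihom)

lemma ctensor_bd:
  "i + j = n \<Longrightarrow> a \<in> elts A i \<Longrightarrow> b \<in> elts B j \<Longrightarrow>
    bd (ctensor A B) n (ctens A B i j a b) =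
      ctens A B (i - 1) j (bd A i a) b
           \<otimes>\<^bsub>ctensor_grp A B (n - 1)\<^esub>
           ctens A B i (j - 1) a (bd B j b) [^]\<^bsub>ctensor_grp A B (n - 1)\<^esub> ksign i"
  unfolding ctensor_def
  by (simp, subst ctensor_lift_ctens[of A B]) (use A B in \<open>auto intro!: ctensor_bd_bihom\<close>)

lemma precomplex_ctensor [simp]: "precomplex (ctensor A B)"
  using A B ctensor_bd_hom by (simp add: precomplex_def)

end

context
  fixes A :: "'a chcx" and B :: "'b chcx" and A' :: "'c chcx" and B' :: "'d chcx" and f g and n :: int
  assumes gr: "graded A" "graded B" "graded A'" "graded B'"
    and f: "\<And>i. f i \<in> hom (grp A i) (grp A' i)" and g: "\<And>i. g i \<in> hom (grp B i) (grp B' i)"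
begin

lemma ctensor_map_bihom:
  "i + j = n \<Longrightarrow> bihom (grp A i) (grp B j) (ctensor_grp A' B' n) (\<lambda>a b. ctens A' B' i j (f i a) (g j b))"
  by (rule bihom_compose[where w="\<lambda>x. x", OF ctens_bihom f g]) (use gr in \<open>auto simp: hom_id\<close>)

lemma ctensor_map_hom: "ctensor_map A' B' f g n \<in> hom (ctensor_grp A B n) (ctensor_grp A' B' n)"
  unfolding ctensor_map_def using gr by (intro ctensor_lift_hom ctensor_map_bihom) auto

lemma ctensor_map_ctens:
  "i + j = n \<Longrightarrow> a \<in> elts A i \<Longrightarrow> b \<in> elts B j \<Longrightarrow>
    ctensor_map A' B' f g n (ctens A B i j a b) = ctens A' B' i j (f i a) (g j b)"
  unfolding ctensor_map_def
  using gr ctensor_lift_ctens[OF gr(1,2) comm_group_ctensor[OF gr(3,4)] ctensor_map_bihom] by simp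

end

subsection \<open>The complexes \<open>\<int>[r]\<close>\<close>

lemma comm_group_Zc [simp]: "comm_group (grp (Zc r) k)"
  by (simp add: Zc_def abelian_integer_group)

lemma graded_Zc [simp]: "graded (Zc r)" by (simp add: graded_def)

lemma elts_Zc: "elts (Zc r) k = (if k = r then UNIV else {0})"
  by (simp add: Zc_def)

lemma zero_Zc [simp]: "0 \<in> elts (Zc r) k" by (simp add: elts_Zc)
lemma one_in_Zc [simp]: "1 \<in> elts (Zc r) r" by (simp add: elts_Zc)
lemma one_Zc [simp]: "\<one>\<^bsub>grp (Zc r) k\<^esub> = 0" by (simp add: Zc_def singleton_group_def)
lemma mult_Zc: "x \<in> elts (Zc r) k \<Longrightarrow> y \<in> elts (Zc r) k \<Longrightarrow> x \<otimes>\<^bsub>grp (Zc r) k\<^esub> y = x + y"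
  by (auto simp: Zc_def singleton_group_def split: if_splits)
lemma bd_Zc [simp]: "bd (Zc r) k x = 0" by (simp add: Zc_def)

lemma pow_Zc: "x \<in> elts (Zc r) k \<Longrightarrow> x [^]\<^bsub>grp (Zc r) k\<^esub> (c::int) = c * x"
proof (cases "k = r")
  case True then show ?thesis by (simp add: Zc_def mult.commute)
next
  case False
  assume "x \<in> elts (Zc r) k"
  then show ?thesis using False group.int_pow_one[OF singleton_group[of "0::int"], of c]
    by (simp add: Zc_def singleton_group_def)
qed

lemma precomplex_Zc [simp]: "precomplex (Zc r)"
proof -
  have "bd (Zc r) k = (\<lambda>x. \<one>\<^bsub>grp (Zc r) (k - 1)\<^esub>)" for k by auto
  then show ?thesis unfolding precomplex_def by (metis comm_group_Zc comm_group_imp_group graded_Zc hom_trivial)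
qed

text \<open>The empty generating set outside degree r is what collapses the sum over all bidegrees
  of \<open>ctensor (Zc r) C\<close> to the tensors e_r \<otimes> a in
  \<open>spans_Zc_ctensor\<close>.\<close>

lemma spans_Zc: "spans (grp (Zc r) k) (if k = r then {1} else {})"
proof (cases "k = r")
  case True
  have "c \<in> generate integer_group {1}" for c :: int
  proof -
    have "(1::int) \<in> generate integer_group {1}" by (simp add: generate.incl)
    then have "1 [^]\<^bsub>integer_group\<^esub> c \<in> generate integer_group {1}"
      using group.subgroup_int_pow_closed[OF group_integer_group
        group.generate_is_subgroup[OF group_integer_group]] by (metis carrier_integer_group subset_UNIV)
    then show ?thesis by simp
  qed
  then show ?thesis using True by (auto simp: spans_def Zc_def)
next
  case False
  then show ?thesis
    using group.generate_empty[OF singleton_group[of "0::int"]]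
    by (simp add: spans_def Zc_def singleton_group_def)
qed

text \<open>Where i differs from r the only coefficient is the integer 0, and a zeroth power is
  neutral whatever the value of \<open>h\<close>. So the condition on \<open>h\<close> concerns the
  single bidegree with i = r.\<close>

lemma Zc_ctens_bihom:
  assumes K: "comm_group K" and h: "\<And>j. r + j = n \<Longrightarrow> h j \<in> hom (grp C j) K" and "i + j = n"
  shows "bihom (grp (Zc r) i) (grp C j) K (\<lambda>c a. h j a [^]\<^bsub>K\<^esub> (c::int))"
proof (cases "i = r")
  case True
  interpret K: comm_group K by fact
  have h: "h j \<in> hom (grp C j) K" using h assms True by auto
  then show ?thesis
    using hom_carrier[OF h]
    by (intro bihomI) (auto simp: True Zc_def K.int_pow_mult K.int_pow_distrib hom_mult[OF h] image_subset_iff)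
next
  case False
  interpret K: comm_group K by fact
  show ?thesis by (intro bihomI) (use False in \<open>auto simp: Zc_def singleton_group_def\<close>)
qed

context
  fixes C :: "'a chcx" and K :: "('k, 'l) monoid_scheme" and h and r n :: int
  assumes C: "graded C" and K: "comm_group K" and h: "\<And>j. r + j = n \<Longrightarrow> h j \<in> hom (grp C j) K"
begin

lemma Zc_lift_hom: "Zc_lift K n h \<in> hom (ctensor_grp (Zc r) C n) K"
  unfolding Zc_lift_def using C K h by (auto intro!: ctensor_lift_hom Zc_ctens_bihom)

lemma Zc_lift_ctens:
  "i + j = n \<Longrightarrow> c \<in> elts (Zc r) i \<Longrightarrow> a \<in> elts C j \<Longrightarrow>
     Zc_lift K n h (ctens (Zc r) C i j c a) = h j a [^]\<^bsub>K\<^esub> c"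
  unfolding Zc_lift_def
  by (subst ctensor_lift_ctens[of "Zc r" C]) (use C K h in \<open>auto intro!: Zc_ctens_bihom\<close>)

lemma Zc_lift_unit:
  assumes "r + j = n" "a \<in> elts C j"
  shows "Zc_lift K n h (ctens (Zc r) C r j 1 a) = h j a"
proof -
  have "h j a \<in> carrier K" using h[OF assms(1)] assms(2) by (auto simp: hom_def)
  then show ?thesis using assms K by (simp add: Zc_lift_ctens group.int_pow_1)
qed

end

lemma spans_Zc_ctensor:
  assumes "graded C" "\<And>j. spans (grp C j) (S j)"
  shows "spans (ctensor_grp (Zc r) C n) {ctens (Zc r) C r j 1 a |j a. r + j = n \<and> a \<in> S j}"
proof -
  have "{ctens (Zc r) C i j s t |i j s t. i + j = n \<and> s \<in> (if i = r then {1} else {}) \<and> t \<in> S j}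
     = {ctens (Zc r) C r j 1 a |j a. r + j = n \<and> a \<in> S j}"
    by (auto split: if_splits)
  then show ?thesis using spans_ctensor[OF graded_Zc assms(1) spans_Zc assms(2), of r n] by simp
qed

lemma ctens_Zc_hom:
  "graded C \<Longrightarrow> r + j = n \<Longrightarrow> ctens (Zc r) C r j 1 \<in> hom (grp C j) (ctensor_grp (Zc r) C n)"
  by (rule bihom_hom2[OF ctens_bihom]) auto

lemma ctens_Zc_pow:
  assumes "graded C" "r + j = n" "a \<in> elts C j"
  shows "ctens (Zc r) C r j c a = ctens (Zc r) C r j 1 a [^]\<^bsub>ctensor_grp (Zc r) C n\<^esub> c"
proof -
  have "(\<lambda>c. ctens (Zc r) C r j c a) \<in> hom (grp (Zc r) r) (ctensor_grp (Zc r) C n)"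
    by (rule bihom_hom1[OF ctens_bihom]) (use assms in auto)
  from hom_int_pow[OF this, of 1 c] assms show ?thesis
    by (simp add: pow_Zc)
qed

text \<open>The first Leibniz term contains d(e_r) = 0; the second keeps the Koszul sign (-1)^r of
  moving d past e_r.\<close>

lemma bd_Zc_ctens:
  assumes "precomplex C" "r + j = n" "a \<in> elts C j"
  shows "bd (ctensor (Zc r) C) n (ctens (Zc r) C r j 1 a) =
    ctens (Zc r) C r (j - 1) 1 (bd C j a) [^]\<^bsub>ctensor_grp (Zc r) C (n - 1)\<^esub> ksign r"
proof -
  interpret K: comm_group "ctensor_grp (Zc r) C (n - 1)" using assms by simp
  have b: "bihom (grp (Zc r) (r - 1)) (grp C j) (ctensor_grp (Zc r) C (n - 1)) (ctens (Zc r) C (r - 1) j)"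
    using assms by (auto intro!: ctens_bihom)
  have "ctens (Zc r) C (r - 1) j 0 a = \<one>\<^bsub>ctensor_grp (Zc r) C (n - 1)\<^esub>"
    using hom_one[OF bihom_hom1[OF b assms(3)]] assms(1) by simp
  moreover have "ctens (Zc r) C r (j - 1) 1 (bd C j a) \<in> carrier (ctensor_grp (Zc r) C (n - 1))"
    using assms hom_carrier[OF precomplex_bd[OF assms(1), of "j - 1" j]] by (auto intro!: ctens_closed)
  ultimately show ?thesis
    by (subst ctensor_bd) (use assms in auto)
qed


section \<open>Colimits of complexes over the category of injections\<close>

section \<open>Colimits over injections\<close>

lemma sum_map_hom:
  assumes G: "\<And>i. i \<in> I \<Longrightarrow> group (G i)" and H: "\<And>i. i \<in> I \<Longrightarrow> group (H i)"
    and f: "\<And>i. i \<in> I \<Longrightarrow> f i \<in> hom (G i) (H i)"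
  shows "(\<lambda>x. \<lambda>i\<in>I. f i (x i)) \<in> hom (sum_group I G) (sum_group I H)"
proof (rule homI)
  have one: "f i \<one>\<^bsub>G i\<^esub> = \<one>\<^bsub>H i\<^esub>" if "i \<in> I" for i using hom_one[OF f G H] that by blast
  fix x assume x: "x \<in> carrier (sum_group I G)"
  have "{i \<in> I. f i (x i) \<noteq> \<one>\<^bsub>H i\<^esub>} \<subseteq> {i \<in> I. x i \<noteq> \<one>\<^bsub>G i\<^esub>}" using one by auto
  then have "finite {i \<in> I. f i (x i) \<noteq> \<one>\<^bsub>H i\<^esub>}"
    using x G by (auto simp: carrier_sum_group intro: finite_subset)
  then show "(\<lambda>i\<in>I. f i (x i)) \<in> carrier (sum_group I H)"
    using x f G H by (auto simp: carrier_sum_group hom_def Pi_iff PiE_iff cong: conj_cong)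
  fix y assume y: "y \<in> carrier (sum_group I G)"
  show "(\<lambda>i\<in>I. f i ((x \<otimes>\<^bsub>sum_group I G\<^esub> y) i)) =
      (\<lambda>i\<in>I. f i (x i)) \<otimes>\<^bsub>sum_group I H\<^esub> (\<lambda>i\<in>I. f i (y i))"
    using x y f G by (auto simp: carrier_sum_group PiE_iff hom_mult intro!: restrict_ext)
qed

lemma grp_colim [simp]:
  "grp (colim F) k = jsum F k Mod generate (jsum F k) (colim_rels F k)"
  by (simp add: colim_def)

lemma jsum_in_eq_sum_in: "jsum_in F k = sum_in UNIV (\<lambda>n. grp (jobj F n) k)"
  by (simp add: jsum_in_def sum_in_def restrict_def fun_eq_iff)

text \<open>What the quotient of the direct sum uses of a diagram: each transition map is additive
  and commutes with the differential.\<close>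

locale diagram =
  fixes F :: "'a jdiagram"
  assumes precomplex_jobj: "precomplex (jobj F n)"
    and jmap_hom: "injection n m \<alpha> \<Longrightarrow> jmap F n m \<alpha> k \<in> hom (grp (jobj F n) k) (grp (jobj F m) k)"
    and bd_jmap: "injection n m \<alpha> \<Longrightarrow> x \<in> elts (jobj F n) k \<Longrightarrow>
      bd (jobj F m) k (jmap F n m \<alpha> k x) = jmap F n m \<alpha> (k - 1) (bd (jobj F n) k x)"
begin

lemma jobj_group: "comm_group (grp (jobj F n) k)"
  using precomplex_jobj[of n] by simp

lemma jsum_group: "comm_group (jsum F k)"
  unfolding jsum_def by (rule comm_group_sum_group) (rule jobj_group)

lemma jsum_in_hom: "jsum_in F k n \<in> hom (grp (jobj F n) k) (jsum F k)"
  unfolding jsum_in_eq_sum_in jsum_def by (rule sum_in_hom) (auto intro: jobj_group)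

lemma jsum_in_closed: "x \<in> elts (jobj F n) k \<Longrightarrow> jsum_in F k n x \<in> carrier (jsum F k)"
  using jsum_in_hom hom_carrier by blast

lemma jmap_closed: "injection n m \<alpha> \<Longrightarrow> x \<in> elts (jobj F n) k \<Longrightarrow> jmap F n m \<alpha> k x \<in> elts (jobj F m) k"
  using jmap_hom hom_carrier by blast

lemma colim_rels_subset: "colim_rels F k \<subseteq> carrier (jsum F k)"
proof -
  interpret J: comm_group "jsum F k" by (rule jsum_group)
  show ?thesis unfolding colim_rels_def
    by (auto intro!: J.m_closed J.inv_closed jsum_in_closed jmap_closed)
qed

lemma comm_group_colim: "comm_group (grp (colim F) k)"
  using comm_group.comm_group_Mod[OF jsum_group colim_rels_subset] by simp

lemma colim_class_hom: "colim_class F k \<in> hom (jsum F k) (grp (colim F) k)"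
  unfolding colim_class_def[abs_def]
  using comm_group.class_hom[OF jsum_group colim_rels_subset] by simp

lemma colim_in_hom: "colim_in F n k \<in> hom (grp (jobj F n) k) (grp (colim F) k)"
  unfolding colim_in_def[abs_def]
  by (rule hom_compose_fun[OF jsum_in_hom colim_class_hom])

lemma colim_in_jmap:
  assumes "injection n m \<alpha>" "x \<in> elts (jobj F n) k"
  shows "colim_in F m k (jmap F n m \<alpha> k x) = colim_in F n k x"
  unfolding colim_in_def colim_class_def
  by (rule comm_group.class_eqI[OF jsum_group colim_rels_subset, symmetric])
     (use assms in \<open>auto intro!: jsum_in_closed jmap_closed simp: colim_rels_def\<close>)

lemma spans_colim:
  assumes "\<And>n. spans (grp (jobj F n) k) (S n)"
  shows "spans (grp (colim F) k) (\<Union>n. colim_in F n k ` S n)"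
proof -
  have "spans (jsum F k) (\<Union>n. jsum_in F k n ` S n)"
    using spans_sum_group[of UNIV "\<lambda>n. grp (jobj F n) k" S] jobj_group assms
    by (simp add: jsum_def jsum_in_eq_sum_in)
  from comm_group.spans_Mod[OF jsum_group colim_rels_subset this]
  have "spans (grp (colim F) k) (colim_class F k ` (\<Union>n. jsum_in F k n ` S n))"
    by (simp add: colim_class_def[abs_def])
  also have "colim_class F k ` (\<Union>n. jsum_in F k n ` S n) = (\<Union>n. colim_in F n k ` S n)"
    by (auto simp: colim_in_def)
  finally show ?thesis .
qed

text \<open>A homomorphism with equal values at x in level n and at its image in level m sends the
  corresponding relator to the neutral element. Stated for an arbitrary \<open>h\<close> on the
  direct sum, this yields both \<open>colim_lift\<close> and the differential.\<close>

lemma quotient_lift_colim: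
  assumes K: "comm_group K" and h: "h \<in> hom (jsum F k) K"
    and rel: "\<And>n m \<alpha> x. injection n m \<alpha> \<Longrightarrow> x \<in> elts (jobj F n) k \<Longrightarrow>
      h (jsum_in F k m (jmap F n m \<alpha> k x)) = h (jsum_in F k n x)"
  shows "quotient_lift h \<in> hom (grp (colim F) k) K"
    and "x \<in> elts (jobj F n) k \<Longrightarrow> quotient_lift h (colim_in F n k x) = h (jsum_in F k n x)"
proof -
  interpret K: comm_group K by fact
  interpret J: comm_group "jsum F k" by (rule jsum_group)
  have r: "h r = \<one>\<^bsub>K\<^esub>" if "r \<in> colim_rels F k" for r
  proof -
    obtain n m \<alpha> x where x: "injection n m \<alpha>" "x \<in> elts (jobj F n) k"
      and r: "r = jsum_in F k n x \<otimes>\<^bsub>jsum F k\<^esub> inv\<^bsub>jsum F k\<^esub> (jsum_in F k m (jmap F n m \<alpha> k x))"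
      using \<open>r \<in> colim_rels F k\<close> unfolding colim_rels_def by blast
    have c: "jsum_in F k n x \<in> carrier (jsum F k)" "jsum_in F k m (jmap F n m \<alpha> k x) \<in> carrier (jsum F k)"
      using x by (auto intro!: jsum_in_closed jmap_closed)
    have "h (jsum_in F k n x) \<in> carrier K" using h c by (auto simp: hom_def)
    then show ?thesis
      unfolding r using c rel[OF x]
      by (simp add: hom_mult[OF h] hom_inverse[OF _ _ h])
  qed
  show "quotient_lift h \<in> hom (grp (colim F) k) K"
    using J.quotient_lift_hom[OF colim_rels_subset _ h r] K by simp
  show "quotient_lift h (colim_in F n k x) = h (jsum_in F k n x)" if "x \<in> elts (jobj F n) k"
    using J.quotient_lift_class[OF colim_rels_subset _ h r jsum_in_closed[OF that]] K
    by (simp add: colim_in_def colim_class_def)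
qed

context
  fixes K :: "('k, 'l) monoid_scheme" and g :: "nat \<Rightarrow> 'a \<Rightarrow> 'k" and k :: int
  assumes K: "comm_group K" and g: "\<And>n. g n \<in> hom (grp (jobj F n) k) K"
    and rel: "\<And>n m \<alpha> x. injection n m \<alpha> \<Longrightarrow> x \<in> elts (jobj F n) k \<Longrightarrow>
      g m (jmap F n m \<alpha> k x) = g n x"
begin

lemma jsum_lift_hom: "(\<lambda>x. gfinprod K (\<lambda>n. g n (x n)) UNIV) \<in> hom (jsum F k) K"
  unfolding jsum_def
  by (rule comm_group.hom_group_sum[OF K g]) (use jobj_group in simp)

lemma jsum_lift_in: "x \<in> elts (jobj F n) k \<Longrightarrow> gfinprod K (\<lambda>m. g m (jsum_in F k n x m)) UNIV = g n x"
  unfolding jsum_in_eq_sum_in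
  by (rule sum_lift_in[where G="\<lambda>n. grp (jobj F n) k", OF jobj_group K g]) auto

lemma colim_lift_hom: "colim_lift K g \<in> hom (grp (colim F) k) K"
  unfolding colim_lift_def[abs_def]
  by (rule quotient_lift_colim(1)[OF K jsum_lift_hom])
     (simp add: jsum_lift_in jmap_closed rel)

lemma colim_lift_in: "x \<in> elts (jobj F n) k \<Longrightarrow> colim_lift K g (colim_in F n k x) = g n x"
  unfolding colim_lift_def[abs_def]
  by (subst quotient_lift_colim(2)[OF K jsum_lift_hom])
     (simp_all add: jsum_lift_in jmap_closed rel)

end

lemma bd_closed: "x \<in> elts (jobj F n) k \<Longrightarrow> bd (jobj F n) k x \<in> elts (jobj F n) (k - 1)"
  using hom_carrier[OF precomplex_bd[OF precomplex_jobj refl]] by blast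

lemma bd_jsum_hom: "(\<lambda>x n. bd (jobj F n) k (x n)) \<in> hom (jsum F k) (jsum F (k - 1))"
  using sum_map_hom[of UNIV "\<lambda>n. grp (jobj F n) k" "\<lambda>n. grp (jobj F n) (k - 1)" "\<lambda>n. bd (jobj F n) k"]
    jobj_group precomplex_bd[OF precomplex_jobj refl]
  by (simp add: jsum_def restrict_def)

text \<open>The differential acts componentwise and preserves neutral elements, so an element
  concentrated in level n stays concentrated there.\<close>

lemma bd_jsum_in:
  assumes "x \<in> elts (jobj F n) k"
  shows "(\<lambda>n'. bd (jobj F n') k (jsum_in F k n x n')) = jsum_in F (k - 1) n (bd (jobj F n) k x)"
  using hom_one[OF precomplex_bd[OF precomplex_jobj refl]] jobj_group
  by (auto simp: jsum_in_def fun_eq_iff)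

lemma bd_colim_hom: "bd (colim F) k \<in> hom (grp (colim F) k) (grp (colim F) (k - 1))"
  and bd_colim_in: "x \<in> elts (jobj F n) k \<Longrightarrow>
    bd (colim F) k (colim_in F n k x) = colim_in F n (k - 1) (bd (jobj F n) k x)"
proof -
  \<comment> \<open>A transition map commutes with d, and \<open>colim_in\<close> does not see
    transition maps; hence the class of the boundary is constant along the colimit
    relations.\<close>
  have rel: "colim_class F (k - 1) (\<lambda>n'. bd (jobj F n') k (jsum_in F k m (jmap F n m \<alpha> k x) n'))
      = colim_class F (k - 1) (\<lambda>n'. bd (jobj F n') k (jsum_in F k n x n'))"
    if "injection n m \<alpha>" "x \<in> elts (jobj F n) k" for n m \<alpha> x
    using colim_in_jmap[OF that(1) bd_closed[OF that(2)]] that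
    by (simp add: bd_jsum_in jmap_closed bd_jmap colim_in_def)
  note q = quotient_lift_colim[OF comm_group_colim hom_compose_fun[OF bd_jsum_hom colim_class_hom] rel]
  show "bd (colim F) k \<in> hom (grp (colim F) k) (grp (colim F) (k - 1))"
    using q(1) by (simp add: colim_def)
  show "bd (colim F) k (colim_in F n k x) = colim_in F n (k - 1) (bd (jobj F n) k x)"
    if "x \<in> elts (jobj F n) k"
    using q(2)[OF _ _ that] that by (simp add: colim_def bd_jsum_in) (simp add: colim_in_def)
qed

lemma precomplex_colim: "precomplex (colim F)"
  using comm_group_colim bd_colim_hom by (simp add: precomplex_def graded_def)

end

section \<open>Spectra described through the operations \<sigma>(e_k \<otimes> a)\<close>

section \<open>Spectra\<close>

text \<open>
  A symmetric spectrum without the conditions \<open>d\<^sup>2 = 0\<close> and \<open>A\<^bsub>n,k\<^esub> = 0\<close> for \<open>k < 0\<close>. The map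
  \<open>\<phi>\<close> is an isomorphism in this generality, and less has to be checked of a tensor product.
\<close>

locale prespectrum =
  fixes A :: "'a symspec"
  assumes precomplex_lev [simp]: "precomplex (lev A n)"
    and pact_hom: "\<alpha> permutes {..<n} \<Longrightarrow> pact A n \<alpha> i \<in> hom (grp (lev A n) i) (grp (lev A n) i)"
    and bd_pact: "\<alpha> permutes {..<n} \<Longrightarrow> a \<in> elts (lev A n) i \<Longrightarrow>
      bd (lev A n) i (pact A n \<alpha> i a) = pact A n \<alpha> (i - 1) (bd (lev A n) i a)"
    and pact_id: "a \<in> elts (lev A n) i \<Longrightarrow> pact A n id i a = a"
    and pact_comp: "\<alpha> permutes {..<n} \<Longrightarrow> \<beta> permutes {..<n} \<Longrightarrow> a \<in> elts (lev A n) i \<Longrightarrow>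
      pact A n (\<alpha> \<circ> \<beta>) i a = pact A n \<alpha> i (pact A n \<beta> i a)"
    and sig_hom': "sig A k n i \<in> hom (grp (lev A n) i) (grp (lev A (k + n)) (int k + i))"
    and bd_sig: "a \<in> elts (lev A n) i \<Longrightarrow> bd (lev A (k + n)) (int k + i) (sig A k n i a) =
      sig A k n (i - 1) (bd (lev A n) i a) [^]\<^bsub>grp (lev A (k + n)) (int k + i - 1)\<^esub> ksign (int k)"
    and sig_box: "a \<in> elts (lev A n) i \<Longrightarrow> \<alpha> permutes {..<k} \<Longrightarrow> \<beta> permutes {..<n} \<Longrightarrow>
      pact A (k + n) (box k n \<alpha> \<beta>) (int k + i) (sig A k n i a) =
        sig A k n i (pact A n \<beta> i a) [^]\<^bsub>grp (lev A (k + n)) (int k + i)\<^esub> sign \<alpha>"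
    and sig_0: "a \<in> elts (lev A n) i \<Longrightarrow> sig A 0 n i a = a"
    and sig_sig: "a \<in> elts (lev A n) i \<Longrightarrow>
      sig A k (l + n) (int l + i) (sig A l n i a) = sig A (k + l) n i a"
begin

lemma lev_group [simp]: "comm_group (grp (lev A n) i)"
  using precomplex_lev[of n] by simp

lemma lev_mult_closed:
  "a \<in> elts (lev A n) i \<Longrightarrow> a' \<in> elts (lev A n) i \<Longrightarrow> a \<otimes>\<^bsub>grp (lev A n) i\<^esub> a' \<in> elts (lev A n) i"
  using lev_group[of n i] by (simp add: comm_group_def group.is_monoid monoid.m_closed)

lemma sig_hom: "m = k + n \<Longrightarrow> j = int k + i \<Longrightarrow> sig A k n i \<in> hom (grp (lev A n) i) (grp (lev A m) j)"
  using sig_hom' by simp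

lemma sig_closed: "a \<in> elts (lev A n) i \<Longrightarrow> m = k + n \<Longrightarrow> j = int k + i \<Longrightarrow> sig A k n i a \<in> elts (lev A m) j"
  using sig_hom hom_carrier by blast

lemma pact_closed: "\<alpha> permutes {..<n} \<Longrightarrow> a \<in> elts (lev A n) i \<Longrightarrow> pact A n \<alpha> i a \<in> elts (lev A n) i"
  using pact_hom hom_carrier by blast

lemma bd_hom: "j = i - 1 \<Longrightarrow> bd (lev A n) i \<in> hom (grp (lev A n) i) (grp (lev A n) j)"
  by (rule precomplex_bd) auto

lemma bd_closed: "a \<in> elts (lev A n) i \<Longrightarrow> j = i - 1 \<Longrightarrow> bd (lev A n) i a \<in> elts (lev A n) j"
  using bd_hom hom_carrier by blast

end

text \<open>The translation that is more than unfolding concerns \<open>bd_sig\<close>: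
  \<open>sact\<close> is a chain map, and d(e_k \<otimes> a) = (-1)^k e_k \<otimes> da gives the
  rule its sign.\<close>

lemma symmetric_spectrum_prespectrum:
  assumes "symmetric_spectrum A" shows "prespectrum A"
proof -
  have S: "symmetric_sequence A" using assms by (simp add: symmetric_spectrum_def)
  then have lev: "precomplex (lev A n)" for n
    by (simp add: symmetric_sequence_def nonneg_complex_def chain_complex_precomplex)
  have act: "sact A k n t \<in> hom (ctensor_grp (Zc (int k)) (lev A n) t) (grp (lev A (k + n)) t)"
    "x \<in> carrier (ctensor_grp (Zc (int k)) (lev A n) t) \<Longrightarrow>
      sact A k n (t - 1) (bd (ctensor (Zc (int k)) (lev A n)) t x) = bd (lev A (k + n)) t (sact A k n t x)"
    for k n t x
    using assms by (simp_all add: symmetric_spectrum_def chain_map_def)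
  have c: "ctens (Zc (int k)) (lev A n) (int k) i 1 \<in> hom (grp (lev A n) i) (ctensor_grp (Zc (int k)) (lev A n) (int k + i))" for k n i
    using lev[of n] by (intro ctens_Zc_hom) auto
  show ?thesis
  proof
    show "precomplex (lev A n)" for n by (rule lev)
    show "sig A k n i \<in> hom (grp (lev A n) i) (grp (lev A (k + n)) (int k + i))" for k n i
      unfolding sig_def[abs_def] by (rule hom_compose_fun[OF c act(1)])
    fix a n i k assume a: "a \<in> elts (lev A n) i"
    have "bd (lev A n) i a \<in> elts (lev A n) (i - 1)"
      using hom_carrier[OF precomplex_bd[OF lev[of n], of "i - 1" i]] a by auto
    then have d: "ctens (Zc (int k)) (lev A n) (int k) (i - 1) 1 (bd (lev A n) i a)
       \<in> carrier (ctensor_grp (Zc (int k)) (lev A n) (int k + i - 1))"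
      using lev[of n] by (intro ctens_closed) auto
    have "bd (lev A (k + n)) (int k + i) (sig A k n i a) =
       sact A k n (int k + i - 1) (bd (ctensor (Zc (int k)) (lev A n)) (int k + i) (ctens (Zc (int k)) (lev A n) (int k) i 1 a))"
      unfolding sig_def using hom_carrier[OF c] a by (subst act(2)) blast+
    also have "\<dots> = sig A k n (i - 1) (bd (lev A n) i a) [^]\<^bsub>grp (lev A (k + n)) (int k + i - 1)\<^esub> ksign (int k)"
      using hom_int_pow[OF act(1) d, of "ksign (int k)"] lev a
      by (subst bd_Zc_ctens) (auto simp: sig_def add_diff_eq)
    finally show "bd (lev A (k + n)) (int k + i) (sig A k n i a) = \<dots>" .
  qed (use S assms in \<open>simp_all add: symmetric_spectrum_def symmetric_sequence_def chain_map_def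
        chain_map_eq_def chain_comp_def chain_id_def\<close>)
qed


section \<open>Generators, relations and the universal property of D(A)\<close>

section \<open>The functor \<open>D\<close>\<close>

lemma ksign_minus [simp]: "ksign (- k) = ksign k"
  by (simp add: ksign_def)

lemma ksign_add: "ksign (k + l) = ksign k * ksign l"
  by (simp add: ksign_def)

lemma ksign_diff: "ksign (k - l) = ksign k * ksign l"
  by (simp add: ksign_def)

lemma ksign_square [simp]: "ksign k * ksign k = 1"
  by (simp add: ksign_def)

lemma ksign_0 [simp]: "ksign 0 = 1"
  by (simp add: ksign_def)

text \<open>The choice in \<open>perm_ext\<close> is justified by a witness: the first m - n points
  go to the complement of the image of \<alpha> by any bijection, which exists by counting, and the
  last n points follow \<alpha>.\<close>

lemma perm_ext_props:
  assumes "injection n m \<alpha>"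
  shows "n \<le> m" and "perm_ext n m \<alpha> permutes {..<m}"
    and "i < n \<Longrightarrow> perm_ext n m \<alpha> (m - n + i) = \<alpha> i"
proof -
  have inj: "inj_on \<alpha> {..<n}" and im: "\<alpha> ` {..<n} \<subseteq> {..<m}"
    using assms by (auto simp: injection_def)
  show nm: "n \<le> m" using card_inj_on_le[OF inj im] by simp
  have "card ({..<m} - \<alpha> ` {..<n}) = m - n"
    using inj im by (simp add: card_Diff_subset card_image)
  then obtain h where h: "bij_betw h {..<m - n} ({..<m} - \<alpha> ` {..<n})"
    using finite_same_card_bij[of "{..<m - n}" "{..<m} - \<alpha> ` {..<n}"] by auto
  define \<beta> where "\<beta> i = (if i < m - n then h i else if i < m then \<alpha> (i - (m - n)) else i)" for i
  have "bij_betw \<beta> ({..<m - n} \<union> {m - n..<m}) (({..<m} - \<alpha> ` {..<n}) \<union> \<alpha> ` {..<n})"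
  proof (rule bij_betw_combine)
    show "bij_betw \<beta> {..<m - n} ({..<m} - \<alpha> ` {..<n})"
      by (rule iffD1[OF bij_betw_cong h]) (auto simp: \<beta>_def)
    have "bij_betw (\<lambda>i. i - (m - n)) {m - n..<m} {..<n}"
      by (rule bij_betw_byWitness[where f'="\<lambda>i. i + (m - n)"]) (use nm in auto)
    from bij_betw_trans[OF this inj_on_imp_bij_betw[OF inj]]
    show "bij_betw \<beta> {m - n..<m} (\<alpha> ` {..<n})"
      by (rule iffD1[OF bij_betw_cong, rotated]) (auto simp: \<beta>_def)
  qed auto
  moreover have "{..<m - n} \<union> {m - n..<m} = {..<m}" "({..<m} - \<alpha> ` {..<n}) \<union> \<alpha> ` {..<n} = {..<m}"
    using im by auto
  ultimately have "\<beta> permutes {..<m}"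
    by (intro bij_imp_permutes) (auto simp: \<beta>_def)
  then have "\<exists>\<beta>. \<beta> permutes {..<m} \<and> (\<forall>i < n. \<beta> ((m - n) + i) = \<alpha> i)"
    using nm by (intro exI[of _ \<beta>]) (auto simp: \<beta>_def)
  from someI_ex[OF this] show "perm_ext n m \<alpha> permutes {..<m}"
    and "i < n \<Longrightarrow> perm_ext n m \<alpha> (m - n + i) = \<alpha> i"
    by (auto simp: perm_ext_def)
qed

text \<open>When m = n the shift vanishes and the extension is prescribed everywhere, so the
  arbitrary choice disappears. This makes the effect of a permutation on the diagram
  computable.\<close>

lemma perm_ext_permutation:
  assumes "\<alpha> permutes {..<n}"
  shows "perm_ext n n \<alpha> = \<alpha>"
proof
  have "injection n n \<alpha>"
    using assms permutes_image[OF assms] permutes_inj_on[OF assms] by (simp add: injection_def)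
  note p = perm_ext_props[OF this]
  show "perm_ext n n \<alpha> i = \<alpha> i" for i
    using p(2,3) assms by (cases "i < n") (auto simp: permutes_def)
qed

text \<open>\<open>e\<^bsub>-n\<^esub> \<otimes> a\<close> as an element of \<open>\<int>[-n] \<otimes> A\<^sub>n\<close>.\<close>

definition desusp :: "'a symspec \<Rightarrow> nat \<Rightarrow> int \<Rightarrow> 'a \<Rightarrow> (int, 'a) ctensor" where
  "desusp A n j = ctens (Zc (- int n)) (lev A n) (- int n) j 1"

text \<open>The two relations among the generators \<xi>(a): a permutation acts by its sign, and
  suspension acts trivially. An injection is a standard inclusion followed by a permutation, so
  these two cover all relations of the colimit; see \<open>compatible_jmap\<close>. Only levels and
  degrees with i - n = k contribute to degree k.\<close>

definition compatible ::
    "'a symspec \<Rightarrow> ('k, 'm) monoid_scheme \<Rightarrow> int \<Rightarrow> (nat \<Rightarrow> int \<Rightarrow> 'a \<Rightarrow> 'k) \<Rightarrow> bool" where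
  "compatible A K k f \<longleftrightarrow>
     (\<forall>n i. i - int n = k \<longrightarrow>
        f n i \<in> hom (grp (lev A n) i) K \<and>
        (\<forall>a \<in> elts (lev A n) i.
           (\<forall>\<alpha>. \<alpha> permutes {..<n} \<longrightarrow> f n i (pact A n \<alpha> i a) = f n i a [^]\<^bsub>K\<^esub> sign \<alpha>) \<and>
           (\<forall>l. f (l + n) (int l + i) (sig A l n i a) = f n i a)))"

text \<open>The part of \<open>spectrum_map\<close> that governs the values of \<open>D_map\<close>
  on the generators \<open>xi\<close>; the differential is treated apart in
  \<open>chain_map_D_map\<close>.\<close>

definition premorphism ::
    "'a symspec \<Rightarrow> 'b symspec \<Rightarrow> (nat \<Rightarrow> int \<Rightarrow> 'a \<Rightarrow> 'b) \<Rightarrow> bool" where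
  "premorphism A B f \<longleftrightarrow>
     (\<forall>n i. f n i \<in> hom (grp (lev A n) i) (grp (lev B n) i)) \<and>
     (\<forall>n i \<alpha>. \<forall>a \<in> elts (lev A n) i. \<alpha> permutes {..<n} \<longrightarrow>
        f n i (pact A n \<alpha> i a) = pact B n \<alpha> i (f n i a)) \<and>
     (\<forall>k n i. \<forall>a \<in> elts (lev A n) i.
        f (k + n) (int k + i) (sig A k n i a) = sig B k n i (f n i a))"

lemma spectrum_map_premorphism: "spectrum_map A B f \<Longrightarrow> premorphism A B f"
  by (simp add: spectrum_map_def premorphism_def chain_map_def chain_map_eq_def chain_comp_def)

lemma jobj_D_diagram [simp]: "jobj (D_diagram A) n = ctensor (Zc (- int n)) (lev A n)"
  by (simp add: D_diagram_def)

lemma xi_desusp: "i - int n = k \<Longrightarrow> xi A n i a = colim_in (D_diagram A) n k (desusp A n i a)"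
  by (auto simp: xi_def desusp_def)

lemma pow_sign_sign:
  "group K \<Longrightarrow> x \<in> carrier K \<Longrightarrow> (x [^]\<^bsub>K\<^esub> sign p) [^]\<^bsub>K\<^esub> sign p = x"
  by (simp add: group.int_pow_pow sign_def group.int_pow_1)

lemma pow_ksign_ksign:
  "group K \<Longrightarrow> x \<in> carrier K \<Longrightarrow> (x [^]\<^bsub>K\<^esub> ksign p) [^]\<^bsub>K\<^esub> ksign p = x"
  by (simp add: group.int_pow_pow group.int_pow_1)

context prespectrum
begin

lemma desusp_hom:
  "j - int n = k \<Longrightarrow> desusp A n j \<in> hom (grp (lev A n) j) (ctensor_grp (Zc (- int n)) (lev A n) k)"
  unfolding desusp_def by (rule ctens_Zc_hom) auto

lemma desusp_closed:
  "a \<in> elts (lev A n) j \<Longrightarrow> j - int n = k \<Longrightarrow>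
    desusp A n j a \<in> carrier (ctensor_grp (Zc (- int n)) (lev A n) k)"
  using desusp_hom hom_carrier by blast

lemma spans_desusp:
  assumes "\<And>j. spans (grp (lev A n) j) (S j)"
  shows "spans (ctensor_grp (Zc (- int n)) (lev A n) k) {desusp A n j a |j a. j - int n = k \<and> a \<in> S j}"
proof -
  have "{desusp A n j a |j a. j - int n = k \<and> a \<in> S j}
     = {ctens (Zc (- int n)) (lev A n) (- int n) j 1 a |j a. - int n + j = k \<and> a \<in> S j}"
    by (auto simp: desusp_def)
  then show ?thesis using spans_Zc_ctensor[of "lev A n" S "- int n" k] assms by simp
qed

lemma bd_desusp:
  assumes "a \<in> elts (lev A n) j" "j - int n = k" "k' = k - 1"
  shows "bd (ctensor (Zc (- int n)) (lev A n)) k (desusp A n j a) =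
    desusp A n (j - 1) (bd (lev A n) j a) [^]\<^bsub>ctensor_grp (Zc (- int n)) (lev A n) k'\<^esub> ksign (int n)"
  using bd_Zc_ctens[OF precomplex_lev[of n], of "- int n" j k a] assms by (simp add: desusp_def)

context
  fixes n m \<alpha> \<alpha>' assumes inj: "injection n m \<alpha>" and \<alpha>': "\<alpha>' = perm_ext n m \<alpha>"
begin

lemma jmap_summand_hom:
  assumes "- int n + j = k"
  shows "(\<lambda>a. desusp A m (int (m - n) + j) (pact A m \<alpha>' (int (m - n) + j) (sig A (m - n) n j a))
       [^]\<^bsub>ctensor_grp (Zc (- int m)) (lev A m) k\<^esub> sign \<alpha>')
     \<in> hom (grp (lev A n) j) (ctensor_grp (Zc (- int m)) (lev A m) k)"
proof -
  have e: "int (m - n) + j - int m = k" "m = m - n + n"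
    using perm_ext_props(1)[OF inj] assms by auto
  have "(\<lambda>a. desusp A m (int (m - n) + j) (pact A m \<alpha>' (int (m - n) + j) (sig A (m - n) n j a)))
     \<in> hom (grp (lev A n) j) (ctensor_grp (Zc (- int m)) (lev A m) k)"
    using perm_ext_props(2)[OF inj] \<alpha>'
    by (intro hom_compose_fun[OF hom_compose_fun[OF sig_hom pact_hom] desusp_hom[OF e(1)]] e(2)) auto
  then show ?thesis by (rule hom_pow[rotated]) simp
qed

lemma jmap_D_hom:
  "jmap (D_diagram A) n m \<alpha> k \<in>
     hom (ctensor_grp (Zc (- int n)) (lev A n) k) (ctensor_grp (Zc (- int m)) (lev A m) k)"
  unfolding D_diagram_def Let_def jdiagram.simps
  using jmap_summand_hom \<alpha>' by (intro Zc_lift_hom) (auto simp: desusp_def)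

lemma jmap_desusp:
  assumes "a \<in> elts (lev A n) j" "j - int n = k"
  shows "jmap (D_diagram A) n m \<alpha> k (desusp A n j a) =
     desusp A m (int (m - n) + j) (pact A m \<alpha>' (int (m - n) + j) (sig A (m - n) n j a))
       [^]\<^bsub>ctensor_grp (Zc (- int m)) (lev A m) k\<^esub> sign \<alpha>'"
proof -
  have "jmap (D_diagram A) n m \<alpha> k (desusp A n j a) =
    Zc_lift (ctensor_grp (Zc (- int m)) (lev A m) k) k (\<lambda>j a. 
      desusp A m (int (m - n) + j) (pact A m \<alpha>' (int (m - n) + j) (sig A (m - n) n j a))
       [^]\<^bsub>ctensor_grp (Zc (- int m)) (lev A m) k\<^esub> sign \<alpha>')
    (ctens (Zc (- int n)) (lev A n) (- int n) j 1 a)"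
    by (simp add: D_diagram_def Let_def desusp_def \<alpha>')
  also have "\<dots> = desusp A m (int (m - n) + j) (pact A m \<alpha>' (int (m - n) + j) (sig A (m - n) n j a))
       [^]\<^bsub>ctensor_grp (Zc (- int m)) (lev A m) k\<^esub> sign \<alpha>'"
    using assms jmap_summand_hom by (subst Zc_lift_unit) auto
  finally show ?thesis .
qed

text \<open>Both sides are a power of the same element \<open>x\<close>. On the left,
  differentiating \<sigma>(e_{m-n} \<otimes> a) gives (-1)^{m-n} and passing e_{-m} gives (-1)^m;
  their product is (-1)^n, which is the sign of passing e_{-n} on the right.\<close>

lemma bd_jmap_desusp:
  assumes a: "a \<in> elts (lev A n) j" and k: "j - int n = k"
  shows "bd (ctensor (Zc (- int m)) (lev A m)) k (jmap (D_diagram A) n m \<alpha> k (desusp A n j a)) =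
    jmap (D_diagram A) n m \<alpha> (k - 1) (bd (ctensor (Zc (- int n)) (lev A n)) k (desusp A n j a))"
proof -
  have nm: "n \<le> m" and p: "\<alpha>' permutes {..<m}" using perm_ext_props[OF inj] \<alpha>' by auto
  define J where "J = int (m - n) + j"
  define J' where "J' = int (m - n) + (j - 1)"
  have J: "J - int m = k" "J' - int m = k - 1" "J - 1 = J'" using nm k by (auto simp: J_def J'_def)
  let ?K = "ctensor_grp (Zc (- int m)) (lev A m) k" and ?K' = "ctensor_grp (Zc (- int m)) (lev A m) (k - 1)"
  let ?a = "bd (lev A n) j a"
  define x where "x = desusp A m J' (pact A m \<alpha>' J' (sig A (m - n) n (j - 1) ?a))"
  have sa: "sig A (m - n) n j a \<in> elts (lev A m) J"
    by (rule sig_closed[OF a]) (use nm in \<open>auto simp: J_def\<close>)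
  have da: "?a \<in> elts (lev A n) (j - 1)" using bd_closed[OF a] by simp
  have sda: "sig A (m - n) n (j - 1) ?a \<in> elts (lev A m) J'"
    by (rule sig_closed[OF da]) (use nm in \<open>auto simp: J'_def\<close>)
  have x: "x \<in> carrier ?K'" unfolding x_def using pact_closed[OF p sda] J by (intro desusp_closed) auto
  have bds: "bd (lev A m) J (sig A (m - n) n j a) =
      sig A (m - n) n (j - 1) ?a [^]\<^bsub>grp (lev A m) J'\<^esub> ksign (int (m - n))"
    using bd_sig[OF a, of "m - n"] nm by (simp add: J_def J'_def add_diff_eq)
  have g': "group ?K'" by simp
  have "bd (ctensor (Zc (- int m)) (lev A m)) k (jmap (D_diagram A) n m \<alpha> k (desusp A n j a)) =
    bd (ctensor (Zc (- int m)) (lev A m)) k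
      (desusp A m J (pact A m \<alpha>' J (sig A (m - n) n j a)) [^]\<^bsub>?K\<^esub> sign \<alpha>')"
    using jmap_desusp[OF a k] by (simp add: J_def)
  also have "\<dots> = (bd (ctensor (Zc (- int m)) (lev A m)) k
      (desusp A m J (pact A m \<alpha>' J (sig A (m - n) n j a)))) [^]\<^bsub>?K'\<^esub> sign \<alpha>'"
    by (rule hom_int_pow[OF ctensor_bd_hom desusp_closed[OF pact_closed[OF p sa] J(1)]]) auto
  also have "\<dots> = (desusp A m J' (bd (lev A m) J (pact A m \<alpha>' J (sig A (m - n) n j a)))
      [^]\<^bsub>?K'\<^esub> ksign (int m)) [^]\<^bsub>?K'\<^esub> sign \<alpha>'"
    by (subst bd_desusp[OF pact_closed[OF p sa] J(1) refl]) (simp add: J)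
  also have "bd (lev A m) J (pact A m \<alpha>' J (sig A (m - n) n j a)) =
      pact A m \<alpha>' J' (sig A (m - n) n (j - 1) ?a) [^]\<^bsub>grp (lev A m) J'\<^esub> ksign (int (m - n))"
    using hom_int_pow[OF pact_hom[OF p] sda] by (simp add: bd_pact[OF p sa] bds J)
  also have "desusp A m J' \<dots> = x [^]\<^bsub>?K'\<^esub> ksign (int (m - n))"
    unfolding x_def by (rule hom_int_pow[OF desusp_hom[OF J(2)] pact_closed[OF p sda]]) auto
  also have "((x [^]\<^bsub>?K'\<^esub> ksign (int (m - n))) [^]\<^bsub>?K'\<^esub> ksign (int m)) [^]\<^bsub>?K'\<^esub> sign \<alpha>' =
     (x [^]\<^bsub>?K'\<^esub> sign \<alpha>') [^]\<^bsub>?K'\<^esub> ksign (int n)"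
    using x nm by (simp add: group.int_pow_pow[OF g'] of_nat_diff ksign_diff mult.commute)
       (simp add: ksign_def)
  also have "x [^]\<^bsub>?K'\<^esub> sign \<alpha>' = jmap (D_diagram A) n m \<alpha> (k - 1) (desusp A n (j - 1) ?a)"
    using k by (subst jmap_desusp[OF da]) (auto simp: x_def J'_def)
  also have "\<dots> [^]\<^bsub>?K'\<^esub> ksign (int n) =
     jmap (D_diagram A) n m \<alpha> (k - 1) (desusp A n (j - 1) ?a
       [^]\<^bsub>ctensor_grp (Zc (- int n)) (lev A n) (k - 1)\<^esub> ksign (int n))"
    by (rule hom_int_pow[OF jmap_D_hom, symmetric], rule desusp_closed[OF da]) (use k in auto)
  also have "\<dots> = jmap (D_diagram A) n m \<alpha> (k - 1) (bd (ctensor (Zc (- int n)) (lev A n)) k (desusp A n j a))"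
    by (subst bd_desusp[OF a k refl]) simp
  finally show ?thesis .
qed

end

sublocale DD: diagram "D_diagram A"
proof
  show "precomplex (jobj (D_diagram A) n)" for n by simp
  fix n m \<alpha> k assume inj: "injection n m \<alpha>"
  show "jmap (D_diagram A) n m \<alpha> k \<in> hom (grp (jobj (D_diagram A) n) k) (grp (jobj (D_diagram A) m) k)"
    using jmap_D_hom[OF inj refl] by simp
  fix x assume x: "x \<in> elts (jobj (D_diagram A) n) k"
  let ?Z = "\<lambda>n. ctensor (Zc (- int n)) (lev A n)"
  have "bd (?Z m) k (jmap (D_diagram A) n m \<alpha> k x) = jmap (D_diagram A) n m \<alpha> (k - 1) (bd (?Z n) k x)"
    by (rule hom_eq_on_span[OF _ _ spans_desusp[OF spans_carrier]
          hom_compose_fun[OF jmap_D_hom[OF inj refl] ctensor_bd_hom]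
          hom_compose_fun[OF ctensor_bd_hom jmap_D_hom[OF inj refl]]])
       (use x bd_jmap_desusp[OF inj refl] in auto)
  then show "bd (jobj (D_diagram A) m) k (jmap (D_diagram A) n m \<alpha> k x) =
      jmap (D_diagram A) n m \<alpha> (k - 1) (bd (jobj (D_diagram A) n) k x)" by simp
qed

lemma precomplex_D [simp]: "precomplex (D A)"
  unfolding D_def by (rule DD.precomplex_colim)

lemma D_group [simp]: "comm_group (grp (D A) k)"
  by simp

lemma xi_hom: "i - int n = k \<Longrightarrow> xi A n i \<in> hom (grp (lev A n) i) (grp (D A) k)"
  using hom_compose_fun[OF desusp_hom DD.colim_in_hom[unfolded jobj_D_diagram grp_ctensor], of i n k]
  by (auto simp: xi_def[abs_def] desusp_def D_def)

lemma xi_closed: "a \<in> elts (lev A n) i \<Longrightarrow> i - int n = k \<Longrightarrow> xi A n i a \<in> elts (D A) k"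
  using xi_hom hom_carrier by blast

lemma xi_jmap:
  assumes inj: "injection n m \<alpha>" and a: "a \<in> elts (lev A n) i" and k: "i - int n = k"
  shows "xi A m (int (m - n) + i) (pact A m (perm_ext n m \<alpha>) (int (m - n) + i) (sig A (m - n) n i a))
      [^]\<^bsub>grp (D A) k\<^esub> sign (perm_ext n m \<alpha>) = xi A n i a"
proof -
  let ?b = "pact A m (perm_ext n m \<alpha>) (int (m - n) + i) (sig A (m - n) n i a)"
  have m: "int (m - n) + i - int m = k" using perm_ext_props(1)[OF inj] k by auto
  have b: "?b \<in> elts (lev A m) (int (m - n) + i)"
    by (intro pact_closed sig_closed perm_ext_props[OF inj] a) (use perm_ext_props(1)[OF inj] in auto)
  have "xi A n i a = colim_in (D_diagram A) m k (jmap (D_diagram A) n m \<alpha> k (desusp A n i a))"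
    using DD.colim_in_jmap[OF inj, of _ k] desusp_closed[OF a k] by (simp add: xi_desusp[OF k])
  also have "\<dots> = xi A m (int (m - n) + i) ?b [^]\<^bsub>grp (D A) k\<^esub> sign (perm_ext n m \<alpha>)"
    unfolding jmap_desusp[OF inj refl a k] D_def xi_desusp[OF m]
    by (rule hom_int_pow[OF DD.colim_in_hom[unfolded jobj_D_diagram grp_ctensor] desusp_closed[OF b m]])
       (use DD.comm_group_colim in auto)
  finally show ?thesis by simp
qed

text \<open>The colimit relation for an endomorphism of n, where no suspension occurs and the chosen
  extension is \<alpha> itself. The sign changes sides because its square is 1.\<close>

lemma xi_pact:
  assumes "\<alpha> permutes {..<n}" "a \<in> elts (lev A n) i" "i - int n = k"
  shows "xi A n i (pact A n \<alpha> i a) = xi A n i a [^]\<^bsub>grp (D A) k\<^esub> sign \<alpha>"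
proof -
  have "injection n n \<alpha>"
    using permutes_image[OF assms(1)] permutes_inj_on[OF assms(1)] by (simp add: injection_def)
  from xi_jmap[OF this assms(2,3)]
  have "xi A n i (pact A n \<alpha> i a) [^]\<^bsub>grp (D A) k\<^esub> sign \<alpha> = xi A n i a"
    by (simp add: perm_ext_permutation[OF assms(1)] sig_0[OF assms(2)])
  from this[symmetric] show ?thesis
    using assms by (simp add: pow_sign_sign xi_closed pact_closed)
qed

text \<open>The colimit relation for the inclusion of n as the last n of l + n points. The chosen
  extension may still permute the first l points; equivariance of \<sigma> then contributes its
  sign, which cancels the sign built into the diagram.\<close>

lemma xi_sig:
  assumes "a \<in> elts (lev A n) i"
  shows "xi A (l + n) (int l + i) (sig A l n i a) = xi A n i a"
proof -
  define \<alpha> where "\<alpha> = perm_ext n (l + n) (\<lambda>i. l + i)"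
  define k where "k = i - int n"
  have inj: "injection n (l + n) (\<lambda>i. l + i)" by (auto simp: injection_def inj_on_def)
  note p = perm_ext_props[OF inj]
  \<comment> \<open>On the block starting at l the extension is prescribed to be the identity, so it
    has the form \<alpha> \<box> 1 with \<alpha> a permutation of the first l points.\<close>
  have fix_\<alpha>: "\<alpha> x = x" if "l \<le> x" for x
    using p(3)[of "x - l"] p(2) that unfolding \<alpha>_def by (cases "x < l + n") (auto simp: permutes_def)
  have \<alpha>: "\<alpha> permutes {..<l}"
    by (rule permutes_superset[of _ "{..<l + n}"]) (use p(2) fix_\<alpha> in \<open>auto simp: \<alpha>_def\<close>)
  have "box l n \<alpha> id = \<alpha>"
    by (auto simp: box_def fun_eq_iff fix_\<alpha>)
  with sig_box[OF assms \<alpha> permutes_id]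
  have e: "pact A (l + n) \<alpha> (int l + i) (sig A l n i a) =
      sig A l n i a [^]\<^bsub>grp (lev A (l + n)) (int l + i)\<^esub> sign \<alpha>"
    by (simp add: pact_id assms)
  have k': "int l + i - int (l + n) = k" by (simp add: k_def)
  have sc: "sig A l n i a \<in> elts (lev A (l + n)) (int l + i)" using sig_closed[OF assms] by simp
  have "xi A n i a = xi A (l + n) (int l + i) (pact A (l + n) \<alpha> (int l + i) (sig A l n i a))
      [^]\<^bsub>grp (D A) k\<^esub> sign \<alpha>"
    using xi_jmap[OF inj assms refl] by (simp add: \<alpha>_def k_def)
  also have "\<dots> = xi A (l + n) (int l + i) (sig A l n i a)"
    unfolding e hom_int_pow[OF xi_hom[OF k'] sc comm_group_imp_group[OF lev_group] comm_group_imp_group[OF D_group]]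
    using xi_closed[OF sc k'] by (simp add: pow_sign_sign)
  finally show ?thesis by simp
qed

lemma spans_D:
  assumes "\<And>n i. spans (grp (lev A n) i) (S n i)"
  shows "spans (grp (D A) k) {xi A n i a |n i a. i - int n = k \<and> a \<in> S n i}"
proof -
  have "spans (grp (jobj (D_diagram A) n) k) {desusp A n j a |j a. j - int n = k \<and> a \<in> S n j}" for n
    using spans_desusp[OF assms] by simp
  from DD.spans_colim[OF this]
  have "spans (grp (D A) k) (\<Union>n. colim_in (D_diagram A) n k ` {desusp A n j a |j a. j - int n = k \<and> a \<in> S n j})"
    by (simp add: D_def)
  also have "(\<Union>n. colim_in (D_diagram A) n k ` {desusp A n j a |j a. j - int n = k \<and> a \<in> S n j})
      = {xi A n i a |n i a. i - int n = k \<and> a \<in> S n i}"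
    by (auto simp: xi_desusp)
  finally show ?thesis .
qed

lemmas spans_xi = spans_D[OF spans_carrier[OF comm_group_imp_group[OF lev_group]]]

lemma D_hom_eq:
  assumes "group K" "f \<in> hom (grp (D A) k) K" "g \<in> hom (grp (D A) k) K"
    and "\<And>n i a. i - int n = k \<Longrightarrow> a \<in> elts (lev A n) i \<Longrightarrow> f (xi A n i a) = g (xi A n i a)"
    and "x \<in> elts (D A) k"
  shows "f x = g x"
  by (rule hom_eq_on_span[OF _ assms(1) spans_xi assms(2,3) _ assms(5)]) (use assms(4) in auto)

lemma bd_xi:
  assumes a: "a \<in> elts (lev A n) i" and "i - int n = k"
  shows "bd (D A) k (xi A n i a) = xi A n (i - 1) (bd (lev A n) i a) [^]\<^bsub>grp (D A) (k - 1)\<^esub> ksign (int n)"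
proof -
  have k: "i - 1 - int n = k - 1" using assms by simp
  have "bd (D A) k (xi A n i a) = colim_in (D_diagram A) n (k - 1)
     (desusp A n (i - 1) (bd (lev A n) i a) [^]\<^bsub>ctensor_grp (Zc (- int n)) (lev A n) (k - 1)\<^esub> ksign (int n))"
    using DD.bd_colim_in[of _ n k] desusp_closed[OF a assms(2)] bd_desusp[OF a assms(2) refl]
    by (simp add: D_def xi_desusp[OF assms(2)])
  also have "\<dots> = xi A n (i - 1) (bd (lev A n) i a) [^]\<^bsub>grp (D A) (k - 1)\<^esub> ksign (int n)"
    unfolding D_def xi_desusp[OF k]
    by (rule hom_int_pow[OF DD.colim_in_hom[unfolded jobj_D_diagram grp_ctensor] desusp_closed[OF bd_closed[OF a refl] k]])
       (use DD.comm_group_colim in auto)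
  finally show ?thesis .
qed

context
  fixes K :: "('k, 'l) monoid_scheme" and f :: "nat \<Rightarrow> int \<Rightarrow> 'a \<Rightarrow> 'k" and k :: int
  assumes K: "comm_group K" and f: "compatible A K k f"
begin

context
  fixes g
  assumes g: "\<And>n. g n \<in> hom (ctensor_grp (Zc (- int n)) (lev A n) k) K"
    and gf: "\<And>n i a. i - int n = k \<Longrightarrow> a \<in> elts (lev A n) i \<Longrightarrow> g n (desusp A n i a) = f n i a"
begin

text \<open>On e_{-n} \<otimes> a the transition map contributes the sign of the extension, the
  permutation rule for \<open>f\<close> contributes it once more, and the suspension rule removes
  the shift. Here \<open>g\<close> is any family with the values \<open>f\<close> on these tensors,
  so the result serves both \<open>D_lift\<close>, built from \<open>Zc_lift\<close>, and
  \<open>D_map\<close>, built from \<open>ctensor_map\<close>.\<close>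

lemma compatible_jmap:
  assumes inj: "injection n m \<alpha>" and x: "x \<in> carrier (ctensor_grp (Zc (- int n)) (lev A n) k)"
  shows "g m (jmap (D_diagram A) n m \<alpha> k x) = g n x"
proof (rule hom_eq_on_span[OF _ _ spans_desusp[OF spans_carrier] hom_compose_fun[OF jmap_D_hom[OF inj refl] g] g _ x])
  fix s assume "s \<in> {desusp A n j a |j a. j - int n = k \<and> a \<in> elts (lev A n) j}"
  then obtain j a where s: "s = desusp A n j a" and k: "j - int n = k" and a: "a \<in> elts (lev A n) j"
    by auto
  obtain l where m: "m = l + n" using perm_ext_props(1)[OF inj] le_iff_add by (metis add.commute)
  define \<alpha>' where "\<alpha>' = perm_ext n m \<alpha>"
  have p: "\<alpha>' permutes {..<m}" using perm_ext_props(2)[OF inj] by (simp add: \<alpha>'_def)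
  have sa: "sig A l n j a \<in> elts (lev A m) (int l + j)" using sig_closed[OF a] m by simp
  have k': "int l + j - int m = k" using k m by simp
  have "g m (jmap (D_diagram A) n m \<alpha> k s) =
     g m (desusp A m (int l + j) (pact A m \<alpha>' (int l + j) (sig A l n j a))
       [^]\<^bsub>ctensor_grp (Zc (- int m)) (lev A m) k\<^esub> sign \<alpha>')"
    using jmap_desusp[OF inj \<alpha>'_def a k] s m by simp
  also have "\<dots> = f m (int l + j) (pact A m \<alpha>' (int l + j) (sig A l n j a)) [^]\<^bsub>K\<^esub> sign \<alpha>'"
    using hom_int_pow[OF g desusp_closed[OF pact_closed[OF p sa] k']] K
      gf[OF k' pact_closed[OF p sa]] by simp
  also have "\<dots> = f m (int l + j) (sig A l n j a)"
  proof -
    have "f m (int l + j) \<in> hom (grp (lev A m) (int l + j)) K"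
      using f k' by (simp add: compatible_def)
    then have "f m (int l + j) (sig A l n j a) \<in> carrier K" using sa hom_carrier by blast
    then show ?thesis using f k' sa p K by (simp add: compatible_def pow_sign_sign)
  qed
  also have "\<dots> = g n s" using f k a m gf[OF k a] by (simp add: compatible_def s)
  finally show "g m (jmap (D_diagram A) n m \<alpha> k s) = g n s" .
qed (use K in auto)

lemma D_colim_lift_hom: "colim_lift K g \<in> hom (grp (D A) k) K"
  unfolding D_def by (rule DD.colim_lift_hom[OF K]) (simp_all add: g compatible_jmap)

lemma D_colim_lift_xi:
  assumes "i - int n = k" "a \<in> elts (lev A n) i"
  shows "colim_lift K g (xi A n i a) = f n i a"
  unfolding xi_desusp[OF assms(1)]
  by (subst DD.colim_lift_in[OF K])
     (use assms in \<open>simp_all add: g compatible_jmap desusp_closed gf\<close>)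

end

lemma Zc_lift_desusp:
  "Zc_lift K k (f n) \<in> hom (ctensor_grp (Zc (- int n)) (lev A n) k) K"
  "i - int n = k \<Longrightarrow> a \<in> elts (lev A n) i \<Longrightarrow> Zc_lift K k (f n) (desusp A n i a) = f n i a"
proof -
  have h: "f n j \<in> hom (grp (lev A n) j) K" if "- int n + j = k" for j
    using f that by (simp add: compatible_def)
  show "Zc_lift K k (f n) \<in> hom (ctensor_grp (Zc (- int n)) (lev A n) k) K"
    by (rule Zc_lift_hom[OF _ K h]) auto
  show "Zc_lift K k (f n) (desusp A n i a) = f n i a" if "i - int n = k" "a \<in> elts (lev A n) i"
    unfolding desusp_def by (rule Zc_lift_unit[OF _ K h]) (use that in auto)
qed

lemma D_lift_hom: "D_lift K k f \<in> hom (grp (D A) k) K"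
  unfolding D_lift_def by (rule D_colim_lift_hom) (auto simp: Zc_lift_desusp)

lemma D_lift_xi: "i - int n = k \<Longrightarrow> a \<in> elts (lev A n) i \<Longrightarrow> D_lift K k f (xi A n i a) = f n i a"
  unfolding D_lift_def by (rule D_colim_lift_xi) (auto simp: Zc_lift_desusp)

end

end

locale prespectrum_map = A: prespectrum A + B: prespectrum B for A :: "'a symspec" and B :: "'b symspec" +
  fixes f :: "nat \<Rightarrow> int \<Rightarrow> 'a \<Rightarrow> 'b"
  assumes premorphism: "premorphism A B f"
begin

lemma f_hom: "f n i \<in> hom (grp (lev A n) i) (grp (lev B n) i)"
  using premorphism by (simp add: premorphism_def)

lemma f_closed: "a \<in> elts (lev A n) i \<Longrightarrow> f n i a \<in> elts (lev B n) i"
  using f_hom hom_carrier by blast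

lemma f_pact: "a \<in> elts (lev A n) i \<Longrightarrow> \<alpha> permutes {..<n} \<Longrightarrow> f n i (pact A n \<alpha> i a) = pact B n \<alpha> i (f n i a)"
  and f_sig: "a \<in> elts (lev A n) i \<Longrightarrow> f (k + n) (int k + i) (sig A k n i a) = sig B k n i (f n i a)"
  using premorphism by (simp_all add: premorphism_def)

lemma compatible_xi: "compatible A (grp (D B) k) k (\<lambda>n i a. xi B n i (f n i a))"
  using premorphism f_closed
  by (auto simp: compatible_def premorphism_def B.xi_pact B.xi_sig intro: hom_compose_fun[OF _ B.xi_hom])

text \<open>\<open>D_map\<close> is defined levelwise through \<open>ctensor_map\<close>; this
  supplies the two facts by which its values on \<xi>(a) can be read off from
  \<open>D_colim_lift_xi\<close>.\<close>

lemma D_map_summand: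
  "(\<lambda>x. colim_in (D_diagram B) n k (ctensor_map (Zc (- int n)) (lev B n) chain_id (f n) k x))
    \<in> hom (ctensor_grp (Zc (- int n)) (lev A n) k) (grp (D B) k)"
  "i - int n = k \<Longrightarrow> a \<in> elts (lev A n) i \<Longrightarrow>
    colim_in (D_diagram B) n k (ctensor_map (Zc (- int n)) (lev B n) chain_id (f n) k (desusp A n i a))
      = xi B n i (f n i a)"
proof -
  have id: "chain_id i \<in> hom G G" for i G by (simp add: hom_def chain_id_def)
  show "(\<lambda>x. colim_in (D_diagram B) n k (ctensor_map (Zc (- int n)) (lev B n) chain_id (f n) k x))
    \<in> hom (ctensor_grp (Zc (- int n)) (lev A n) k) (grp (D B) k)"
    unfolding D_def
    by (rule hom_compose_fun[OF ctensor_map_hom B.DD.colim_in_hom[unfolded jobj_D_diagram grp_ctensor]])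
       (auto simp: id f_hom)
  show "colim_in (D_diagram B) n k (ctensor_map (Zc (- int n)) (lev B n) chain_id (f n) k (desusp A n i a))
      = xi B n i (f n i a)" if "i - int n = k" "a \<in> elts (lev A n) i"
    using that unfolding desusp_def
    by (subst ctensor_map_ctens[of "Zc (- int n)" "lev A n"])
       (auto simp: id f_hom xi_desusp desusp_def chain_id_def[of _ 1])
qed

lemma D_map_hom: "D_map B f k \<in> hom (grp (D A) k) (grp (D B) k)"
  unfolding D_map_def
  by (rule A.D_colim_lift_hom[OF B.D_group compatible_xi D_map_summand])

lemma D_map_xi:
  "i - int n = k \<Longrightarrow> a \<in> elts (lev A n) i \<Longrightarrow> D_map B f k (xi A n i a) = xi B n i (f n i a)"
  unfolding D_map_def
  by (rule A.D_colim_lift_xi[OF B.D_group compatible_xi D_map_summand])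

end


section \<open>Block permutations and their signs\<close>

section \<open>Block permutations\<close>

lemma permutes_lessThan:
  assumes "p permutes {..<n::nat}"
  shows "p x < n \<longleftrightarrow> x < n" and "n \<le> x \<Longrightarrow> p x = x" and "\<not> x < n \<Longrightarrow> p x = x"
  using permutes_in_image[OF assms, of x] assms by (auto simp: permutes_def)

lemma permutes_lessThanI:
  fixes p q :: "nat \<Rightarrow> nat"
  assumes "\<And>x. x < n \<Longrightarrow> p x < n \<and> q x < n \<and> p (q x) = x \<and> q (p x) = x"
    and "\<And>x. n \<le> x \<Longrightarrow> p x = x"
  shows "p permutes {..<n}"
  by (rule bij_imp_permutes[OF bij_betw_byWitness[where f'=q]]) (use assms in auto)

text \<open>The inverse of a block permutation is the block permutation of the inverses.\<close>

lemma box_permutes: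
  assumes \<alpha>: "\<alpha> permutes {..<n}" and \<beta>: "\<beta> permutes {..<m}" and "q = n + m"
  shows "box n m \<alpha> \<beta> permutes {..<q}"
proof (rule permutes_lessThanI[where q="box n m (inv_into UNIV \<alpha>) (inv_into UNIV \<beta>)"])
  note p = permutes_lessThan[OF \<alpha>] permutes_lessThan[OF \<beta>]
    permutes_lessThan[OF permutes_inv[OF \<alpha>]] permutes_lessThan[OF permutes_inv[OF \<beta>]]
    permutes_inverses[OF \<alpha>] permutes_inverses[OF \<beta>]
  have \<beta>1: "\<beta> (x - n) < m" "inv_into UNIV \<beta> (x - n) < m" if "x < q" "\<not> x < n" for x
    using that p \<open>q = n + m\<close> by auto
  show "box n m \<alpha> \<beta> x < q \<and> box n m (inv_into UNIV \<alpha>) (inv_into UNIV \<beta>) x < q \<and>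
      box n m \<alpha> \<beta> (box n m (inv_into UNIV \<alpha>) (inv_into UNIV \<beta>) x) = x \<and>
      box n m (inv_into UNIV \<alpha>) (inv_into UNIV \<beta>) (box n m \<alpha> \<beta> x) = x" if "x < q" for x
    using that \<beta>1[of x] p \<open>q = n + m\<close>
    by (cases "x < n") (auto simp: box_def trans_less_add1)
qed (use \<open>q = n + m\<close> in \<open>auto simp: box_def\<close>)

lemma twist_permutes: "q = m + n \<Longrightarrow> twist m n permutes {..<q}"
  by (rule permutes_lessThanI[where q="twist n m"]) (auto simp: twist_def)

lemma permutes_permutation: "p permutes {..<n::nat} \<Longrightarrow> permutation p"
  using permutation_permutes by blast

lemma box_id_right: "\<alpha> permutes {..<n} \<Longrightarrow> box n m \<alpha> id = \<alpha>"
  by (auto simp: box_def fun_eq_iff permutes_lessThan)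

text \<open>Naturality of the block twist for a permutation of one block. It exhibits 1 \<box>
  \<beta> as a conjugate of \<beta>.\<close>

lemma box_id_left: "box n m id \<beta> \<circ> twist m n = twist m n \<circ> \<beta>" if "\<beta> permutes {..<m}"
proof
  fix x
  consider "x < m" | "m \<le> x" "x < m + n" | "m + n \<le> x" by linarith
  then show "(box n m id \<beta> \<circ> twist m n) x = (twist m n \<circ> \<beta>) x"
    using permutes_lessThan[OF that, of x]
    by cases (auto simp: box_def twist_def)
qed

text \<open>Factor the permutation as \<alpha> \<box> 1 after 1 \<box> \<beta>. As a function on all
  natural numbers the first factor is \<alpha> itself; the second is conjugate to \<beta> under the
  block twist and so has its sign.\<close>

lemma sign_box:
  assumes \<alpha>: "\<alpha> permutes {..<n}" and \<beta>: "\<beta> permutes {..<m}"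
  shows "sign (box n m \<alpha> \<beta>) = sign \<alpha> * sign \<beta>"
proof -
  have id: "(id :: nat \<Rightarrow> nat) permutes S" for S by (rule permutes_id)
  note P = permutes_permutation[OF box_permutes[OF \<alpha> id refl]] permutes_permutation[OF box_permutes[OF id \<beta> refl]]
    permutes_permutation[OF twist_permutes[OF refl]] permutes_permutation[OF \<beta>]
  have "sign (box n m id \<beta>) * sign (twist m n) = sign (twist m n) * sign \<beta>"
    using arg_cong[OF box_id_left[OF \<beta>, of n], of sign] P by (simp add: sign_compose)
  then have "sign (box n m id \<beta>) = sign \<beta>"
    by (metis mult.commute mult_cancel_left sign_nz)
  moreover have "box n m \<alpha> \<beta> = box n m \<alpha> id \<circ> box n m id \<beta>"
    using permutes_lessThan[OF \<alpha>] permutes_lessThan[OF \<beta>]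
    by (auto simp: box_def fun_eq_iff)
  ultimately show ?thesis using P by (simp add: sign_compose box_id_right[OF \<alpha>])
qed

text \<open>Moving one point past n + 1 others is moving it past n of them, followed by one adjacent
  transposition.\<close>

lemma sign_twist_1: "sign (twist 1 n) = ksign (int n)"
proof (induction n)
  case 0
  have "twist 1 0 = id" by (auto simp: twist_def fun_eq_iff)
  then show ?case by simp
next
  case (Suc n)
  have "twist 1 (Suc n) = transpose n (Suc n) \<circ> twist 1 n"
    by (auto simp: twist_def fun_eq_iff transpose_def)
  then have "sign (twist 1 (Suc n)) = - sign (twist 1 n)"
    using permutes_permutation[OF twist_permutes[OF refl, of 1 n]]
    by (simp add: sign_compose permutation_swap_id sign_swap_id)
  then show ?case using Suc by (simp add: ksign_def)
qed

text \<open>To move m + 1 points past n others, move the last of them and then the remaining m; each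
  stage with a single point costs (-1)^n.\<close>

lemma sign_twist: "sign (twist m n) = ksign (int m * int n)"
proof (induction m)
  case 0
  have "twist 0 n = id" by (auto simp: twist_def fun_eq_iff)
  then show ?case by simp
next
  case (Suc m)
  have "twist (Suc m) n = twist m n \<circ> box m (1 + n) id (twist 1 n)"
    by (auto simp: twist_def box_def fun_eq_iff)
  then have "sign (twist (Suc m) n) = sign (twist m n) * sign (box m (1 + n) id (twist 1 n))"
    using permutes_permutation[OF twist_permutes[OF refl, of m n]]
      permutes_permutation[OF box_permutes[OF permutes_id twist_permutes[OF refl] refl, of m 1 n]]
    by (simp add: sign_compose)
  also have "\<dots> = ksign (int m * int n) * ksign (int n)"
    using Suc sign_box[OF permutes_id twist_permutes[OF refl], of m 1 n] sign_twist_1[of n] by simp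
  finally show ?case by (simp add: ksign_add[symmetric] algebra_simps)
qed

section \<open>The Day convolution and maps out of it\<close>

section \<open>The Day convolution\<close>

text \<open>The conditions under which values on the generators extend to a homomorphism on the Day
  convolution: biadditivity accounts for the first two families in \<open>day_rels\<close>, the
  equation for the third.\<close>

definition day_balanced ::
    "'a symspec \<Rightarrow> 'b symspec \<Rightarrow> ('k, 'm) monoid_scheme \<Rightarrow> nat \<Rightarrow> int \<Rightarrow>
     (('a, 'b) day_gen \<Rightarrow> 'k) \<Rightarrow> bool" where
  "day_balanced A B K p k F \<longleftrightarrow>
     (\<forall>n m i j \<theta>. n + m = p \<longrightarrow> i + j = k \<longrightarrow> \<theta> permutes {..<p} \<longrightarrow>
        bihom (grp (lev A n) i) (grp (lev B m) j) K (\<lambda>a b. F (Day_Gen n i a m j b \<theta>)) \<and>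
        (\<forall>a \<in> elts (lev A n) i. \<forall>b \<in> elts (lev B m) j.
           \<forall>\<alpha> \<beta>. \<alpha> permutes {..<n} \<longrightarrow> \<beta> permutes {..<m} \<longrightarrow>
             F (Day_Gen n i a m j b (\<theta> \<circ> box n m \<alpha> \<beta>)) =
             F (Day_Gen n i (pact A n \<alpha> i a) m j (pact B m \<beta> j b) \<theta>)))"

text \<open>Adds the coequaliser relation over Z[*], so that the extension descends to the tensor
  product of spectra.\<close>

definition smash_balanced ::
    "'a symspec \<Rightarrow> 'b symspec \<Rightarrow> ('k, 'm) monoid_scheme \<Rightarrow> nat \<Rightarrow> int \<Rightarrow>
     (('a, 'b) day_gen \<Rightarrow> 'k) \<Rightarrow> bool" where
  "smash_balanced A B K q t F \<longleftrightarrow>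
     day_balanced A B K q t F \<and>
     (\<forall>n i m p k \<phi>. n + m + p = q \<longrightarrow> i + int m + k = t \<longrightarrow> \<phi> permutes {..<q} \<longrightarrow>
        (\<forall>a \<in> elts (lev A n) i. \<forall>b \<in> elts (lev B p) k.
           F (Day_Gen n i a (m + p) (int m + k) (sig B m p k b) \<phi>) =
           F (Day_Gen (m + n) (int m + i) (sig A m n i a) p k b
               (\<phi> \<circ> box (m + n) p (twist m n) id)) [^]\<^bsub>K\<^esub> ksign (i * int m)))"

lemma day_gens_iff [simp]:
  "Day_Gen n i a m j b \<theta> \<in> day_gens A B p k \<longleftrightarrow>
     n + m = p \<and> i + j = k \<and> a \<in> elts (lev A n) i \<and> b \<in> elts (lev B m) j \<and> \<theta> permutes {..<p}"
  by (auto simp: day_gens_def)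

lemma perm_comp_box:
  "\<theta> permutes {..<n + m} \<Longrightarrow> \<alpha> permutes {..<n} \<Longrightarrow> \<beta> permutes {..<m} \<Longrightarrow>
    \<theta> \<circ> box n m \<alpha> \<beta> permutes {..<n + m}"
  by (rule permutes_compose[OF box_permutes]) auto

lemma perm_comp_twist:
  "\<phi> permutes {..<q} \<Longrightarrow> n + m + p = q \<Longrightarrow> \<phi> \<circ> box (m + n) p (twist m n) id permutes {..<q}"
  by (rule permutes_compose[OF box_permutes[OF twist_permutes[OF refl] permutes_id]]) auto

locale prespectrum_pair = A: prespectrum A + B: prespectrum B
  for A :: "'a symspec" and B :: "'b symspec"
begin

lemma day_rels_subset: "day_rels A B p k \<subseteq> carrier (free_Abelian_group (day_gens A B p k))"
proof -
  have keys_rel1: "x \<in> S \<Longrightarrow> y \<in> S \<Longrightarrow> Poly_Mapping.keys (frag_of x - frag_of y) \<subseteq> S" for x y and S :: "'z set"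
    by (rule order_trans[OF keys_diff]) auto
  note m = A.lev_mult_closed B.lev_mult_closed
  show ?thesis
    unfolding day_rels_def Un_subset_iff
    by (intro conjI subsetI; clarify; unfold carrier_free_Abelian_group_iff;
        (rule keys_rel1 | rule keys_rel2))
       (auto simp: m intro!: A.pact_closed B.pact_closed perm_comp_box)
qed

lemma day_group [simp]: "comm_group (day_grp A B p k)"
  unfolding day_grp_def by (rule comm_group_presented[OF day_rels_subset])

lemma day_elt_bihom:
  assumes "\<theta> permutes {..<p}" "n + m = p" "i + j = k"
  shows "bihom (grp (lev A n) i) (grp (lev B m) j) (day_grp A B p k) (\<lambda>a b. day_elt A B \<theta> n i a m j b)"
proof -
  note m = A.lev_mult_closed B.lev_mult_closed
  show ?thesis
    unfolding day_elt_def day_grp_def assms(2,3)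
  proof (rule bihomI)
    show "presented_gen (day_gens A B p k) (day_rels A B p k) (Day_Gen n i a m j b \<theta>)
        \<in> carrier (presented_group (day_gens A B p k) (day_rels A B p k))"
      if "a \<in> elts (lev A n) i" "b \<in> elts (lev B m) j" for a b
      using that assms by (intro presented_gen_closed[OF day_rels_subset]) auto
    show "presented_gen (day_gens A B p k) (day_rels A B p k) (Day_Gen n i (a \<otimes>\<^bsub>grp (lev A n) i\<^esub> a') m j b \<theta>) =
       presented_gen (day_gens A B p k) (day_rels A B p k) (Day_Gen n i a m j b \<theta>)
       \<otimes>\<^bsub>presented_group (day_gens A B p k) (day_rels A B p k)\<^esub>
       presented_gen (day_gens A B p k) (day_rels A B p k) (Day_Gen n i a' m j b \<theta>)"
      if "a \<in> elts (lev A n) i" "a' \<in> elts (lev A n) i" "b \<in> elts (lev B m) j" for a a' b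
    proof (rule presented_rel2[OF day_rels_subset])
      show "frag_of (Day_Gen n i (a \<otimes>\<^bsub>grp (lev A n) i\<^esub> a') m j b \<theta>) -
        (frag_of (Day_Gen n i a m j b \<theta>) + frag_of (Day_Gen n i a' m j b \<theta>)) \<in> day_rels A B p k"
        unfolding day_rels_def using that assms by (intro UnI1) blast
    qed (use that assms m in auto)
    show "presented_gen (day_gens A B p k) (day_rels A B p k) (Day_Gen n i a m j (b \<otimes>\<^bsub>grp (lev B m) j\<^esub> b') \<theta>) =
       presented_gen (day_gens A B p k) (day_rels A B p k) (Day_Gen n i a m j b \<theta>)
       \<otimes>\<^bsub>presented_group (day_gens A B p k) (day_rels A B p k)\<^esub>
       presented_gen (day_gens A B p k) (day_rels A B p k) (Day_Gen n i a m j b' \<theta>)"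
      if "a \<in> elts (lev A n) i" "b \<in> elts (lev B m) j" "b' \<in> elts (lev B m) j" for a b b'
    proof (rule presented_rel2[OF day_rels_subset])
      show "frag_of (Day_Gen n i a m j (b \<otimes>\<^bsub>grp (lev B m) j\<^esub> b') \<theta>) -
        (frag_of (Day_Gen n i a m j b \<theta>) + frag_of (Day_Gen n i a m j b' \<theta>)) \<in> day_rels A B p k"
        unfolding day_rels_def using that assms by (intro UnI1 UnI2) blast
    qed (use that assms m in auto)
  qed
qed

lemma day_elt_closed:
  "\<theta> permutes {..<p} \<Longrightarrow> n + m = p \<Longrightarrow> i + j = k \<Longrightarrow> a \<in> elts (lev A n) i \<Longrightarrow> b \<in> elts (lev B m) j \<Longrightarrow>
    day_elt A B \<theta> n i a m j b \<in> carrier (day_grp A B p k)"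
  using bihom_closed[OF day_elt_bihom] by blast

lemma day_elt_box:
  assumes "\<theta> permutes {..<n + m}" "a \<in> elts (lev A n) i" "b \<in> elts (lev B m) j"
    and "\<alpha> permutes {..<n}" "\<beta> permutes {..<m}"
  shows "day_elt A B (\<theta> \<circ> box n m \<alpha> \<beta>) n i a m j b =
    day_elt A B \<theta> n i (pact A n \<alpha> i a) m j (pact B m \<beta> j b)"
  unfolding day_elt_def
proof (rule presented_rel1[OF day_rels_subset])
  show "frag_of (Day_Gen n i a m j b (\<theta> \<circ> box n m \<alpha> \<beta>))
      - frag_of (Day_Gen n i (pact A n \<alpha> i a) m j (pact B m \<beta> j b) \<theta>) \<in> day_rels A B (n + m) (i + j)"
    unfolding day_rels_def using assms by blast
qed (use assms in \<open>auto intro!: perm_comp_box A.pact_closed B.pact_closed\<close>)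

lemma spans_day_elt:
  "spans (day_grp A B p k) {day_elt A B \<theta> n i a m j b |\<theta> n i a m j b.
     n + m = p \<and> i + j = k \<and> a \<in> elts (lev A n) i \<and> b \<in> elts (lev B m) j \<and> \<theta> permutes {..<p}}"
proof -
  have "{day_elt A B \<theta> n i a m j b |\<theta> n i a m j b.
     n + m = p \<and> i + j = k \<and> a \<in> elts (lev A n) i \<and> b \<in> elts (lev B m) j \<and> \<theta> permutes {..<p}}
     = presented_gen (day_gens A B p k) (day_rels A B p k) ` day_gens A B p k"
    by (fastforce simp: day_gens_def day_elt_def)
  then show ?thesis using spans_presented[OF day_rels_subset] by (simp add: day_grp_def)
qed

lemma spans_day:
  assumes S: "\<And>n i. spans (grp (lev A n) i) (S n i)" and T: "\<And>n i. spans (grp (lev B n) i) (T n i)"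
  shows "spans (day_grp A B p k) {day_elt A B \<theta> n i a m j b |\<theta> n i a m j b.
     n + m = p \<and> i + j = k \<and> a \<in> S n i \<and> b \<in> T m j \<and> \<theta> permutes {..<p}}" (is "spans _ ?X")
proof (rule spans_trans[OF _ spans_day_elt])
  have X: "?X \<subseteq> carrier (day_grp A B p k)"
    using day_elt_closed spans_closed[OF S] spans_closed[OF T] by auto
  then show "?X \<subseteq> carrier (day_grp A B p k)" .
  show g: "group (day_grp A B p k)" by simp
  show "{day_elt A B \<theta> n i a m j b |\<theta> n i a m j b.
     n + m = p \<and> i + j = k \<and> a \<in> elts (lev A n) i \<and> b \<in> elts (lev B m) j \<and> \<theta> permutes {..<p}}
     \<subseteq> generate (day_grp A B p k) ?X"
  proof clarify
    fix \<theta> n i a m j b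
    assume *: "a \<in> elts (lev A n) i" "b \<in> elts (lev B m) j" "\<theta> permutes {..<n + m}" "p = n + m" "k = i + j"
    let ?Y = "{day_elt A B \<theta> n i s m j t |s t. s \<in> S n i \<and> t \<in> T m j}"
    have "day_elt A B \<theta> n i a m j b \<in> generate (day_grp A B (n + m) (i + j)) ?Y"
      by (rule bihom_in_generate[OF _ _ _ day_elt_bihom S T]) (use * in auto)
    moreover have "?Y \<subseteq> ?X" using * by blast
    ultimately show "day_elt A B \<theta> n i a m j b \<in> generate (day_grp A B (n + m) (i + j))
      {day_elt A B \<theta> na ia a ma ja b |\<theta> na ia a ma ja b. na + ma = n + m \<and> ia + ja = i + j \<and>
        a \<in> S na ia \<and> b \<in> T ma ja \<and> \<theta> permutes {..<n + m}}"
      using group.mono_generate[OF g, of ?Y ?X] * by blast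
  qed
qed

context
  fixes K :: "('k, 'l) monoid_scheme" and F p k
  assumes K: "comm_group K" and F: "day_balanced A B K p k F"
begin

lemma day_balanced_bihom:
  "n + m = p \<Longrightarrow> i + j = k \<Longrightarrow> \<theta> permutes {..<p} \<Longrightarrow>
    bihom (grp (lev A n) i) (grp (lev B m) j) K (\<lambda>a b. F (Day_Gen n i a m j b \<theta>))"
  using F by (simp add: day_balanced_def)

lemma day_balanced_closed: "F \<in> day_gens A B p k \<rightarrow> carrier K"
  using bihom_closed[OF day_balanced_bihom] by (fastforce simp: day_gens_def)

lemma day_free_lift:
  assumes "r \<in> day_rels A B p k" shows "free_lift K F r = \<one>\<^bsub>K\<^esub>"
proof -
  note m = A.lev_mult_closed B.lev_mult_closed
  note b1 = hom_mult[OF bihom_hom1[OF day_balanced_bihom]] and b2 = hom_mult[OF bihom_hom2[OF day_balanced_bihom]]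
  show ?thesis
    using assms unfolding day_rels_def
  proof (elim UnE; clarify)
    fix n i a a' m j b \<theta>
    assume *: "a \<in> elts (lev A n) i" "a' \<in> elts (lev A n) i" "b \<in> elts (lev B m) j" "\<theta> permutes {..<n + m}"
      "p = n + m" "k = i + j"
    show "free_lift K F (frag_of (Day_Gen n i (a \<otimes>\<^bsub>grp (lev A n) i\<^esub> a') m j b \<theta>) -
       (frag_of (Day_Gen n i a m j b \<theta>) + frag_of (Day_Gen n i a' m j b \<theta>))) = \<one>\<^bsub>K\<^esub>"
      by (rule free_lift_rel2[OF K day_balanced_closed]) (use * m b1 in auto)
  next
    fix n i a m j b b' \<theta>
    assume *: "a \<in> elts (lev A n) i" "b \<in> elts (lev B m) j" "b' \<in> elts (lev B m) j" "\<theta> permutes {..<n + m}"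
      "p = n + m" "k = i + j"
    show "free_lift K F (frag_of (Day_Gen n i a m j (b \<otimes>\<^bsub>grp (lev B m) j\<^esub> b') \<theta>) -
       (frag_of (Day_Gen n i a m j b \<theta>) + frag_of (Day_Gen n i a m j b' \<theta>))) = \<one>\<^bsub>K\<^esub>"
      by (rule free_lift_rel2[OF K day_balanced_closed]) (use * m b2 in auto)
  next
    fix n i a m j b \<theta> \<alpha> \<beta>
    assume *: "a \<in> elts (lev A n) i" "b \<in> elts (lev B m) j" "\<theta> permutes {..<n + m}"
      "\<alpha> permutes {..<n}" "\<beta> permutes {..<m}" "p = n + m" "k = i + j"
    show "free_lift K F (frag_of (Day_Gen n i a m j b (\<theta> \<circ> box n m \<alpha> \<beta>)) -
       frag_of (Day_Gen n i (pact A n \<alpha> i a) m j (pact B m \<beta> j b) \<theta>)) = \<one>\<^bsub>K\<^esub>"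
      by (rule free_lift_rel1[OF K day_balanced_closed])
         (use * F in \<open>auto simp: day_balanced_def intro!: perm_comp_box A.pact_closed B.pact_closed\<close>)
  qed
qed

lemma day_lift_hom: "presented_lift K F \<in> hom (day_grp A B p k) K"
  unfolding day_grp_def
  by (rule presented_lift_hom[OF day_rels_subset K day_balanced_closed day_free_lift])

lemma day_lift_elt:
  "n + m = p \<Longrightarrow> i + j = k \<Longrightarrow> \<theta> permutes {..<p} \<Longrightarrow> a \<in> elts (lev A n) i \<Longrightarrow> b \<in> elts (lev B m) j \<Longrightarrow>
    presented_lift K F (day_elt A B \<theta> n i a m j b) = F (Day_Gen n i a m j b \<theta>)"
  unfolding day_elt_def
  using presented_lift_gen[OF day_rels_subset K day_balanced_closed day_free_lift] by auto

end

end


section \<open>The tensor product over Z[*] as a spectrum\<close>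

section \<open>The tensor product of spectra\<close>

lemma grp_smash [simp]: "grp (lev (smash A B) q) t = smash_grp A B q t"
  by (simp add: smash_def)

lemma smash_elt_eq:
  "n + m = q \<Longrightarrow> i + j = t \<Longrightarrow> smash_elt A B \<theta> n i a m j b = smash_class A B q t (day_elt A B \<theta> n i a m j b)"
  by (auto simp: smash_elt_def)

context prespectrum_pair
begin

lemma smash_rels_subset: "smash_rels A B q t \<subseteq> carrier (day_grp A B q t)"
proof
  interpret G: comm_group "day_grp A B q t" by simp
  fix r assume "r \<in> smash_rels A B q t"
  then obtain n i a m p k b \<phi> where r: "r = day_elt A B \<phi> n i a (m + p) (int m + k) (sig B m p k b)
        \<otimes>\<^bsub>day_grp A B q t\<^esub> inv\<^bsub>day_grp A B q t\<^esub>
          (day_elt A B (\<phi> \<circ> box (m + n) p (twist m n) id) (m + n) (int m + i) (sig A m n i a) p k b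
             [^]\<^bsub>day_grp A B q t\<^esub> ksign (i * int m))"
    and *: "n + m + p = q" "i + int m + k = t" "a \<in> elts (lev A n) i" "b \<in> elts (lev B p) k"
        "\<phi> permutes {..<q}"
    unfolding smash_rels_def by blast
  show "r \<in> carrier (day_grp A B q t)" unfolding r
    using * by (intro G.m_closed G.inv_closed G.int_pow_closed day_elt_closed perm_comp_twist
        A.sig_closed B.sig_closed) auto
qed

lemma smash_group [simp]: "comm_group (smash_grp A B q t)"
  unfolding smash_grp_def by (rule comm_group.comm_group_Mod[OF day_group smash_rels_subset])

lemma smash_class_hom: "smash_class A B q t \<in> hom (day_grp A B q t) (smash_grp A B q t)"
  unfolding smash_class_def[abs_def] smash_grp_def
  by (rule comm_group.class_hom[OF day_group smash_rels_subset])

lemma smash_elt_bihom: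
  assumes "\<theta> permutes {..<q}" "n + m = q" "i + j = t"
  shows "bihom (grp (lev A n) i) (grp (lev B m) j) (smash_grp A B q t) (\<lambda>a b. smash_elt A B \<theta> n i a m j b)"
  unfolding smash_elt_eq[OF assms(2,3)]
  by (rule bihom_compose[OF day_elt_bihom[OF assms] hom_id hom_id smash_class_hom])

lemma smash_elt_closed:
  "\<theta> permutes {..<q} \<Longrightarrow> n + m = q \<Longrightarrow> i + j = t \<Longrightarrow> a \<in> elts (lev A n) i \<Longrightarrow> b \<in> elts (lev B m) j \<Longrightarrow>
    smash_elt A B \<theta> n i a m j b \<in> carrier (smash_grp A B q t)"
  using bihom_closed[OF smash_elt_bihom] by blast

lemma smash_elt_pow1:
  "\<theta> permutes {..<q} \<Longrightarrow> n + m = q \<Longrightarrow> i + j = t \<Longrightarrow> a \<in> elts (lev A n) i \<Longrightarrow> b \<in> elts (lev B m) j \<Longrightarrow>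
    smash_elt A B \<theta> n i (a [^]\<^bsub>grp (lev A n) i\<^esub> (c::int)) m j b
      = smash_elt A B \<theta> n i a m j b [^]\<^bsub>smash_grp A B q t\<^esub> c"
  using hom_int_pow[OF bihom_hom1[OF smash_elt_bihom]] by simp

lemma smash_elt_pow2:
  "\<theta> permutes {..<q} \<Longrightarrow> n + m = q \<Longrightarrow> i + j = t \<Longrightarrow> a \<in> elts (lev A n) i \<Longrightarrow> b \<in> elts (lev B m) j \<Longrightarrow>
    smash_elt A B \<theta> n i a m j (b [^]\<^bsub>grp (lev B m) j\<^esub> (c::int))
      = smash_elt A B \<theta> n i a m j b [^]\<^bsub>smash_grp A B q t\<^esub> c"
  using hom_int_pow[OF bihom_hom2[OF smash_elt_bihom]] by simp

lemma smash_elt_box: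
  assumes "\<theta> permutes {..<n + m}" "a \<in> elts (lev A n) i" "b \<in> elts (lev B m) j"
    and "\<alpha> permutes {..<n}" "\<beta> permutes {..<m}"
  shows "smash_elt A B (\<theta> \<circ> box n m \<alpha> \<beta>) n i a m j b =
    smash_elt A B \<theta> n i (pact A n \<alpha> i a) m j (pact B m \<beta> j b)"
  by (simp add: smash_elt_def day_elt_box[OF assms])

text \<open>This is the rule for carrying a suspension from the right factor to the left one; the
  Koszul signs and block twists in the later arguments originate here.\<close>

lemma smash_elt_sig:
  assumes "n + m + p = q" "i + int m + k = t" "\<phi> permutes {..<q}"
    and "a \<in> elts (lev A n) i" "b \<in> elts (lev B p) k"
  shows "smash_elt A B \<phi> n i a (m + p) (int m + k) (sig B m p k b) =
    smash_elt A B (\<phi> \<circ> box (m + n) p (twist m n) id) (m + n) (int m + i) (sig A m n i a) p k b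
      [^]\<^bsub>smash_grp A B q t\<^esub> ksign (i * int m)"
proof -
  interpret G: comm_group "day_grp A B q t" by simp
  let ?x = "day_elt A B \<phi> n i a (m + p) (int m + k) (sig B m p k b)"
  let ?y = "day_elt A B (\<phi> \<circ> box (m + n) p (twist m n) id) (m + n) (int m + i) (sig A m n i a) p k b"
  have x: "?x \<in> carrier (day_grp A B q t)" and y: "?y \<in> carrier (day_grp A B q t)"
    using assms by (auto intro!: day_elt_closed perm_comp_twist A.sig_closed B.sig_closed)
  have "smash_class A B q t ?x = smash_class A B q t (?y [^]\<^bsub>day_grp A B q t\<^esub> ksign (i * int m))"
    unfolding smash_class_def
  proof (rule G.class_eqI[OF smash_rels_subset x])
    show "?x \<otimes>\<^bsub>day_grp A B q t\<^esub> inv\<^bsub>day_grp A B q t\<^esub> (?y [^]\<^bsub>day_grp A B q t\<^esub> ksign (i * int m)) \<in> smash_rels A B q t"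
      unfolding smash_rels_def using assms by blast
  qed (use y in auto)
  also have "\<dots> = smash_class A B q t ?y [^]\<^bsub>smash_grp A B q t\<^esub> ksign (i * int m)"
    by (rule hom_int_pow[OF smash_class_hom y]) auto
  finally show ?thesis
    using assms by (simp add: smash_elt_eq[of _ _ q _ _ t])
qed

lemma spans_smash:
  assumes S: "\<And>n i. spans (grp (lev A n) i) (S n i)" and T: "\<And>n i. spans (grp (lev B n) i) (T n i)"
  shows "spans (smash_grp A B q t) {smash_elt A B \<theta> n i a m j b |\<theta> n i a m j b.
     n + m = q \<and> i + j = t \<and> a \<in> S n i \<and> b \<in> T m j \<and> \<theta> permutes {..<q}}"
proof -
  have "smash_class A B q t ` {day_elt A B \<theta> n i a m j b |\<theta> n i a m j b.
     n + m = q \<and> i + j = t \<and> a \<in> S n i \<and> b \<in> T m j \<and> \<theta> permutes {..<q}}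
     = {smash_elt A B \<theta> n i a m j b |\<theta> n i a m j b.
     n + m = q \<and> i + j = t \<and> a \<in> S n i \<and> b \<in> T m j \<and> \<theta> permutes {..<q}}"
    by (fastforce simp: smash_elt_def)
  moreover have "spans (smash_grp A B q t) (smash_class A B q t ` {day_elt A B \<theta> n i a m j b |\<theta> n i a m j b.
     n + m = q \<and> i + j = t \<and> a \<in> S n i \<and> b \<in> T m j \<and> \<theta> permutes {..<q}})"
    unfolding smash_class_def[abs_def] smash_grp_def
    by (rule comm_group.spans_Mod[OF day_group smash_rels_subset spans_day[OF S T]])
  ultimately show ?thesis by simp
qed

lemmas spans_smash_elt =
  spans_smash[OF spans_carrier[OF comm_group_imp_group[OF A.lev_group]]
    spans_carrier[OF comm_group_imp_group[OF B.lev_group]]]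

lemma smash_hom_eq:
  assumes "group K" "f \<in> hom (smash_grp A B q t) K" "g \<in> hom (smash_grp A B q t) K"
    and "\<And>\<theta> n i a m j b. n + m = q \<Longrightarrow> i + j = t \<Longrightarrow> \<theta> permutes {..<q} \<Longrightarrow>
      a \<in> elts (lev A n) i \<Longrightarrow> b \<in> elts (lev B m) j \<Longrightarrow>
      f (smash_elt A B \<theta> n i a m j b) = g (smash_elt A B \<theta> n i a m j b)"
    and "x \<in> carrier (smash_grp A B q t)"
  shows "f x = g x"
  by (rule hom_eq_on_span[OF _ assms(1) spans_smash_elt assms(2,3) _ assms(5)]) (use assms(4) in auto)

context
  fixes K :: "('k, 'l) monoid_scheme" and h q t
  assumes K: "comm_group K" and h: "h \<in> hom (day_grp A B q t) K"
    and rel: "\<And>n i a m p k b \<phi>. n + m + p = q \<Longrightarrow> i + int m + k = t \<Longrightarrow> a \<in> elts (lev A n) i \<Longrightarrow>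
      b \<in> elts (lev B p) k \<Longrightarrow> \<phi> permutes {..<q} \<Longrightarrow>
      h (day_elt A B \<phi> n i a (m + p) (int m + k) (sig B m p k b)) =
      h (day_elt A B (\<phi> \<circ> box (m + n) p (twist m n) id) (m + n) (int m + i) (sig A m n i a) p k b)
        [^]\<^bsub>K\<^esub> ksign (i * int m)"
begin

text \<open>The surrounding context takes an arbitrary homomorphism on the Day convolution, because
  the differential and the permutation action are induced from such maps directly, whereas
  \<open>smash_lift\<close> starts from values on generators.\<close>

lemma smash_relator:
  assumes "r \<in> smash_rels A B q t" shows "h r = \<one>\<^bsub>K\<^esub>"
proof -
  interpret G: comm_group "day_grp A B q t" by simp
  interpret K: comm_group K by (rule K)
  obtain n i a m p k b \<phi> where r: "r = day_elt A B \<phi> n i a (m + p) (int m + k) (sig B m p k b)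
        \<otimes>\<^bsub>day_grp A B q t\<^esub> inv\<^bsub>day_grp A B q t\<^esub>
          (day_elt A B (\<phi> \<circ> box (m + n) p (twist m n) id) (m + n) (int m + i) (sig A m n i a) p k b
             [^]\<^bsub>day_grp A B q t\<^esub> ksign (i * int m))"
    and *: "n + m + p = q" "i + int m + k = t" "a \<in> elts (lev A n) i" "b \<in> elts (lev B p) k"
        "\<phi> permutes {..<q}"
    using assms unfolding smash_rels_def by blast
  let ?x = "day_elt A B \<phi> n i a (m + p) (int m + k) (sig B m p k b)"
  let ?y = "day_elt A B (\<phi> \<circ> box (m + n) p (twist m n) id) (m + n) (int m + i) (sig A m n i a) p k b"
  have x: "?x \<in> carrier (day_grp A B q t)" and y: "?y \<in> carrier (day_grp A B q t)"
    using * by (auto intro!: day_elt_closed perm_comp_twist A.sig_closed B.sig_closed)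
  have hx: "h ?x \<in> carrier K" using hom_carrier[OF h] x by blast
  have "h r = h ?x \<otimes>\<^bsub>K\<^esub> inv\<^bsub>K\<^esub> (h ?y [^]\<^bsub>K\<^esub> ksign (i * int m))"
    unfolding r using x y
    by (simp add: hom_mult[OF h] hom_inverse[OF _ _ h] hom_int_pow[OF h] G.int_pow_closed)
  then show ?thesis using rel[OF *] hx by simp
qed

lemma smash_quotient_hom: "quotient_lift h \<in> hom (smash_grp A B q t) K"
  unfolding smash_grp_def
  by (rule comm_group.quotient_lift_hom[OF day_group smash_rels_subset _ h smash_relator])
     (use K in simp)

lemma smash_quotient_elt:
  assumes "n + m = q" "i + j = t" "\<theta> permutes {..<q}" "a \<in> elts (lev A n) i" "b \<in> elts (lev B m) j"
  shows "quotient_lift h (smash_elt A B \<theta> n i a m j b) = h (day_elt A B \<theta> n i a m j b)"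
  unfolding smash_elt_eq[OF assms(1,2)] smash_class_def
  by (rule comm_group.quotient_lift_class[OF day_group smash_rels_subset _ h smash_relator])
     (use K assms in \<open>auto intro!: day_elt_closed\<close>)

end

context
  fixes K :: "('k, 'l) monoid_scheme" and F q t
  assumes K: "comm_group K" and F: "smash_balanced A B K q t F"
begin

lemma smash_balanced_day: "day_balanced A B K q t F"
  using F by (simp add: smash_balanced_def)

lemma smash_balanced_rel:
  "n + m + p = q \<Longrightarrow> i + int m + k = t \<Longrightarrow> a \<in> elts (lev A n) i \<Longrightarrow>
      b \<in> elts (lev B p) k \<Longrightarrow> \<phi> permutes {..<q} \<Longrightarrow>
      presented_lift K F (day_elt A B \<phi> n i a (m + p) (int m + k) (sig B m p k b)) =
      presented_lift K F (day_elt A B (\<phi> \<circ> box (m + n) p (twist m n) id) (m + n) (int m + i) (sig A m n i a) p k b)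
        [^]\<^bsub>K\<^esub> ksign (i * int m)"
  using F
  by (subst (1 2) day_lift_elt[OF K smash_balanced_day])
     (auto simp: smash_balanced_def intro!: perm_comp_twist A.sig_closed B.sig_closed)

lemma smash_lift_hom: "smash_lift K F \<in> hom (smash_grp A B q t) K"
  unfolding smash_lift_def
  by (rule smash_quotient_hom[OF K day_lift_hom[OF K smash_balanced_day] smash_balanced_rel])

lemma smash_lift_elt:
  assumes "n + m = q" "i + j = t" "\<theta> permutes {..<q}" "a \<in> elts (lev A n) i" "b \<in> elts (lev B m) j"
  shows "smash_lift K F (smash_elt A B \<theta> n i a m j b) = F (Day_Gen n i a m j b \<theta>)"
proof -
  have "smash_lift K F (smash_elt A B \<theta> n i a m j b) = presented_lift K F (day_elt A B \<theta> n i a m j b)"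
    unfolding smash_lift_def
    by (rule smash_quotient_elt[OF K day_lift_hom[OF K smash_balanced_day] smash_balanced_rel])
       (use assms in auto)
  then show ?thesis using day_lift_elt[OF K smash_balanced_day assms] by simp
qed

end

subsection \<open>The differential\<close>

lemma day_bd_balanced:
  "day_balanced A B (day_grp A B p (k - 1)) p k
     (\<lambda>Day_Gen n i a m j b \<theta> \<Rightarrow>
        day_elt A B \<theta> n (i - 1) (bd (lev A n) i a) m j b
        \<otimes>\<^bsub>day_grp A B p (k - 1)\<^esub>
        day_elt A B \<theta> n i a m (j - 1) (bd (lev B m) j b) [^]\<^bsub>day_grp A B p (k - 1)\<^esub> ksign i)"
  unfolding day_balanced_def day_gen.case
proof (intro allI impI conjI ballI)
  fix n m i j \<theta> assume *: "n + m = p" "i + j = k" "\<theta> permutes {..<p}"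
  show "bihom (grp (lev A n) i) (grp (lev B m) j) (day_grp A B p (k - 1)) (\<lambda>a b. 
       day_elt A B \<theta> n (i - 1) (bd (lev A n) i a) m j b \<otimes>\<^bsub>day_grp A B p (k - 1)\<^esub>
       day_elt A B \<theta> n i a m (j - 1) (bd (lev B m) j b) [^]\<^bsub>day_grp A B p (k - 1)\<^esub> ksign i)"
    by (intro bihom_mult bihom_pow
        bihom_compose[where w="\<lambda>x. x" and v="\<lambda>x. x", OF day_elt_bihom A.bd_hom[OF refl] hom_id hom_id]
        bihom_compose[where w="\<lambda>x. x" and u="\<lambda>x. x", OF day_elt_bihom hom_id B.bd_hom[OF refl] hom_id])
       (use * in auto)
  fix a b \<alpha> \<beta> assume "a \<in> elts (lev A n) i" "b \<in> elts (lev B m) j" "\<alpha> permutes {..<n}" "\<beta> permutes {..<m}"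
  with * show "day_elt A B (\<theta> \<circ> box n m \<alpha> \<beta>) n (i - 1) (bd (lev A n) i a) m j b \<otimes>\<^bsub>day_grp A B p (k - 1)\<^esub>
       day_elt A B (\<theta> \<circ> box n m \<alpha> \<beta>) n i a m (j - 1) (bd (lev B m) j b) [^]\<^bsub>day_grp A B p (k - 1)\<^esub> ksign i
     = day_elt A B \<theta> n (i - 1) (bd (lev A n) i (pact A n \<alpha> i a)) m j (pact B m \<beta> j b) \<otimes>\<^bsub>day_grp A B p (k - 1)\<^esub>
       day_elt A B \<theta> n i (pact A n \<alpha> i a) m (j - 1) (bd (lev B m) j (pact B m \<beta> j b)) [^]\<^bsub>day_grp A B p (k - 1)\<^esub> ksign i"
    by (simp add: day_elt_box A.bd_pact B.bd_pact A.bd_closed B.bd_closed)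
qed

lemma day_bd_hom: "bd (lev (day_conv A B) p) k \<in> hom (day_grp A B p k) (day_grp A B p (k - 1))"
  using day_lift_hom[OF day_group day_bd_balanced] by (simp add: day_conv_def)

lemma day_bd_elt:
  assumes "n + m = p" "i + j = k" "\<theta> permutes {..<p}" "a \<in> elts (lev A n) i" "b \<in> elts (lev B m) j"
  shows "bd (lev (day_conv A B) p) k (day_elt A B \<theta> n i a m j b) =
        day_elt A B \<theta> n (i - 1) (bd (lev A n) i a) m j b
        \<otimes>\<^bsub>day_grp A B p (k - 1)\<^esub>
        day_elt A B \<theta> n i a m (j - 1) (bd (lev B m) j b) [^]\<^bsub>day_grp A B p (k - 1)\<^esub> ksign i"
  using day_lift_elt[OF day_group day_bd_balanced assms] by (simp add: day_conv_def)

lemma class_day_bd_hom: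
  "(\<lambda>x. smash_class A B q (t - 1) (bd (lev (day_conv A B) q) t x)) \<in> hom (day_grp A B q t) (smash_grp A B q (t - 1))"
  by (rule hom_compose_fun[OF day_bd_hom smash_class_hom])

lemma class_day_bd_elt:
  assumes "n + m = q" "i + j = t" "\<theta> permutes {..<q}" "a \<in> elts (lev A n) i" "b \<in> elts (lev B m) j"
  shows "smash_class A B q (t - 1) (bd (lev (day_conv A B) q) t (day_elt A B \<theta> n i a m j b)) =
        smash_elt A B \<theta> n (i - 1) (bd (lev A n) i a) m j b
        \<otimes>\<^bsub>smash_grp A B q (t - 1)\<^esub>
        smash_elt A B \<theta> n i a m (j - 1) (bd (lev B m) j b) [^]\<^bsub>smash_grp A B q (t - 1)\<^esub> ksign i"
proof -
  have c: "day_elt A B \<theta> n (i - 1) (bd (lev A n) i a) m j b \<in> carrier (day_grp A B q (t - 1))"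
    "day_elt A B \<theta> n i a m (j - 1) (bd (lev B m) j b) \<in> carrier (day_grp A B q (t - 1))"
    using assms by (auto intro!: day_elt_closed A.bd_closed B.bd_closed)
  have d: "i - 1 + j = t - 1" "i + (j - 1) = t - 1" using assms by auto
  show ?thesis unfolding day_bd_elt[OF assms] smash_elt_eq[OF assms(1) d(1)] smash_elt_eq[OF assms(1) d(2)]
    using c hom_int_pow[OF smash_class_hom c(2)]
    by (simp add: hom_mult[OF smash_class_hom] group.int_pow_closed)
qed

text \<open>The Leibniz rule reduces both sides to the same two classes, \<open>X\<close> containing
  da and \<open>Y\<close> containing db. For \<open>X\<close> the left sign is (-1)^{(i-1)m},
  because da has degree i - 1, and the right one is (-1)^m from d\<sigma> times (-1)^{im}. For
  \<open>Y\<close> both are (-1)^{im+m+i}, as the left factor has degree i on one side and m + i on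
  the other.\<close>

lemma class_day_bd_rel:
  assumes "n + m + p = q" "i + int m + k = t" and a: "a \<in> elts (lev A n) i"
      and b: "b \<in> elts (lev B p) k" and \<phi>: "\<phi> permutes {..<q}"
  shows "smash_class A B q (t - 1) (bd (lev (day_conv A B) q) t
      (day_elt A B \<phi> n i a (m + p) (int m + k) (sig B m p k b))) =
     smash_class A B q (t - 1) (bd (lev (day_conv A B) q) t
       (day_elt A B (\<phi> \<circ> box (m + n) p (twist m n) id) (m + n) (int m + i) (sig A m n i a) p k b))
        [^]\<^bsub>smash_grp A B q (t - 1)\<^esub> ksign (i * int m)" (is "?L = ?R")
proof -
  let ?G = "smash_grp A B q (t - 1)"
  interpret G: comm_group ?G by simp
  define \<psi> where "\<psi> = \<phi> \<circ> box (m + n) p (twist m n) id"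
  have \<psi>: "\<psi> permutes {..<q}" unfolding \<psi>_def by (rule perm_comp_twist[OF \<phi> assms(1)])
  define X where "X = smash_elt A B \<psi> (m + n) (int m + (i - 1)) (sig A m n (i - 1) (bd (lev A n) i a)) p k b"
  define Y where "Y = smash_elt A B \<psi> (m + n) (int m + i) (sig A m n i a) p (k - 1) (bd (lev B p) k b)"
  have da: "bd (lev A n) i a \<in> elts (lev A n) (i - 1)" and db: "bd (lev B p) k b \<in> elts (lev B p) (k - 1)"
    using A.bd_closed[OF a] B.bd_closed[OF b] by auto
  have sda: "sig A m n (i - 1) (bd (lev A n) i a) \<in> elts (lev A (m + n)) (int m + (i - 1))"
    and sdb: "sig B m p (k - 1) (bd (lev B p) k b) \<in> elts (lev B (m + p)) (int m + (k - 1))"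
    and sa: "sig A m n i a \<in> elts (lev A (m + n)) (int m + i)"
    and sb: "sig B m p k b \<in> elts (lev B (m + p)) (int m + k)"
    using A.sig_closed[OF da] B.sig_closed[OF db] A.sig_closed[OF a] B.sig_closed[OF b] by auto
  have XY: "X \<in> carrier ?G" "Y \<in> carrier ?G" unfolding X_def Y_def
    using \<psi> sda b sa db assms by (auto intro!: smash_elt_closed)
  have e: "int m + i - 1 = int m + (i - 1)" "int m + k - 1 = int m + (k - 1)" by auto
  have 1: "smash_elt A B \<phi> n (i - 1) (bd (lev A n) i a) (m + p) (int m + k) (sig B m p k b) = X [^]\<^bsub>?G\<^esub> ksign ((i - 1) * int m)"
    unfolding X_def \<psi>_def using assms da by (intro smash_elt_sig) auto
  have 2: "smash_elt A B \<phi> n i a (m + p) (int m + (k - 1)) (sig B m p (k - 1) (bd (lev B p) k b)) = Y [^]\<^bsub>?G\<^esub> ksign (i * int m)"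
    unfolding Y_def \<psi>_def using assms db by (intro smash_elt_sig) auto
  have 3: "smash_elt A B \<phi> n i a (m + p) (int m + k - 1) (bd (lev B (m + p)) (int m + k) (sig B m p k b))
      = (Y [^]\<^bsub>?G\<^esub> ksign (i * int m)) [^]\<^bsub>?G\<^esub> ksign (int m)"
    unfolding B.bd_sig[OF b] e 2[symmetric] by (rule smash_elt_pow2) (use assms sdb in auto)
  have 4: "smash_elt A B \<psi> (m + n) (int m + i - 1) (bd (lev A (m + n)) (int m + i) (sig A m n i a)) p k b
      = X [^]\<^bsub>?G\<^esub> ksign (int m)"
    unfolding A.bd_sig[OF a] e X_def by (rule smash_elt_pow1) (use assms \<psi> sda in auto)
  have "?L = X [^]\<^bsub>?G\<^esub> ksign ((i - 1) * int m) \<otimes>\<^bsub>?G\<^esub>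
      ((Y [^]\<^bsub>?G\<^esub> ksign (i * int m)) [^]\<^bsub>?G\<^esub> ksign (int m)) [^]\<^bsub>?G\<^esub> ksign i"
    unfolding 1[symmetric] 3[symmetric] by (rule class_day_bd_elt) (use assms sb in auto)
  moreover have "smash_class A B q (t - 1) (bd (lev (day_conv A B) q) t
       (day_elt A B \<psi> (m + n) (int m + i) (sig A m n i a) p k b))
      = X [^]\<^bsub>?G\<^esub> ksign (int m) \<otimes>\<^bsub>?G\<^esub> Y [^]\<^bsub>?G\<^esub> ksign (int m + i)"
    unfolding 4[symmetric] Y_def by (rule class_day_bd_elt) (use assms sa \<psi> in auto)
  moreover have "ksign ((i - 1) * int m) = ksign (int m) * ksign (i * int m)"
    "ksign (i * int m) * ksign (int m) * ksign i = ksign (int m + i) * ksign (i * int m)"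
    by (auto simp: ksign_def)
  ultimately show ?thesis unfolding \<psi>_def[symmetric]
    using XY by (simp add: G.int_pow_pow G.int_pow_distrib)
qed

lemma smash_bd_hom: "bd (lev (smash A B) q) t \<in> hom (smash_grp A B q t) (smash_grp A B q (t - 1))"
  unfolding smash_def symspec.simps symseq.simps chcx.simps
  by (rule smash_quotient_hom[OF smash_group class_day_bd_hom class_day_bd_rel])

lemma smash_bd_elt:
  assumes "n + m = q" "i + j = t" "\<theta> permutes {..<q}" "a \<in> elts (lev A n) i" "b \<in> elts (lev B m) j"
  shows "bd (lev (smash A B) q) t (smash_elt A B \<theta> n i a m j b) =
        smash_elt A B \<theta> n (i - 1) (bd (lev A n) i a) m j b
        \<otimes>\<^bsub>smash_grp A B q (t - 1)\<^esub>
        smash_elt A B \<theta> n i a m (j - 1) (bd (lev B m) j b) [^]\<^bsub>smash_grp A B q (t - 1)\<^esub> ksign i"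
proof -
  have "bd (lev (smash A B) q) t (smash_elt A B \<theta> n i a m j b) =
      smash_class A B q (t - 1) (bd (lev (day_conv A B) q) t (day_elt A B \<theta> n i a m j b))"
    unfolding smash_def symspec.simps symseq.simps chcx.simps
    by (rule smash_quotient_elt[OF smash_group class_day_bd_hom class_day_bd_rel]) (use assms in auto)
  then show ?thesis using class_day_bd_elt[OF assms] by simp
qed

subsection \<open>The action of permutations\<close>

lemma day_pact_balanced:
  assumes "\<gamma> permutes {..<p}"
  shows "day_balanced A B (day_grp A B p k) p k
     (\<lambda>Day_Gen n i a m j b \<theta> \<Rightarrow> day_elt A B (\<gamma> \<circ> \<theta>) n i a m j b)"
  unfolding day_balanced_def day_gen.case
proof (intro allI impI conjI ballI)
  fix n m i j \<theta> assume *: "n + m = p" "i + j = k" "\<theta> permutes {..<p}"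
  have \<gamma>\<theta>: "\<gamma> \<circ> \<theta> permutes {..<p}" by (rule permutes_compose[OF *(3) assms])
  show "bihom (grp (lev A n) i) (grp (lev B m) j) (day_grp A B p k)
      (\<lambda>a b. day_elt A B (\<gamma> \<circ> \<theta>) n i a m j b)"
    by (rule day_elt_bihom[OF \<gamma>\<theta> *(1,2)])
  fix a b \<alpha> \<beta> assume "a \<in> elts (lev A n) i" "b \<in> elts (lev B m) j" "\<alpha> permutes {..<n}" "\<beta> permutes {..<m}"
  then show "day_elt A B (\<gamma> \<circ> (\<theta> \<circ> box n m \<alpha> \<beta>)) n i a m j b =
      day_elt A B (\<gamma> \<circ> \<theta>) n i (pact A n \<alpha> i a) m j (pact B m \<beta> j b)"
    using day_elt_box[of "\<gamma> \<circ> \<theta>" n m a i b j \<alpha> \<beta>] \<gamma>\<theta> * by (simp add: comp_assoc)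
qed

lemma class_day_pact:
  assumes \<gamma>: "\<gamma> permutes {..<q}"
  shows "(\<lambda>x. smash_class A B q t (pact (day_conv A B) q \<gamma> t x)) \<in> hom (day_grp A B q t) (smash_grp A B q t)"
    and "\<And>n i a m j b \<theta>. n + m = q \<Longrightarrow> i + j = t \<Longrightarrow> \<theta> permutes {..<q} \<Longrightarrow> a \<in> elts (lev A n) i \<Longrightarrow>
      b \<in> elts (lev B m) j \<Longrightarrow>
      smash_class A B q t (pact (day_conv A B) q \<gamma> t (day_elt A B \<theta> n i a m j b)) = smash_elt A B (\<gamma> \<circ> \<theta>) n i a m j b"
  using hom_compose_fun[OF day_lift_hom[OF day_group day_pact_balanced[OF \<gamma>]] smash_class_hom]
    day_lift_elt[OF day_group day_pact_balanced[OF \<gamma>]]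
  by (simp_all add: day_conv_def smash_elt_eq[of _ _ q _ _ t])

lemma class_day_pact_rel:
  assumes \<gamma>: "\<gamma> permutes {..<q}"
    and *: "n + m + p = q" "i + int m + k = t" "a \<in> elts (lev A n) i" "b \<in> elts (lev B p) k" "\<phi> permutes {..<q}"
  shows "smash_class A B q t (pact (day_conv A B) q \<gamma> t
      (day_elt A B \<phi> n i a (m + p) (int m + k) (sig B m p k b))) =
     smash_class A B q t (pact (day_conv A B) q \<gamma> t
       (day_elt A B (\<phi> \<circ> box (m + n) p (twist m n) id) (m + n) (int m + i) (sig A m n i a) p k b))
        [^]\<^bsub>smash_grp A B q t\<^esub> ksign (i * int m)"
proof -
  have "smash_elt A B (\<gamma> \<circ> \<phi>) n i a (m + p) (int m + k) (sig B m p k b) =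
    smash_elt A B (\<gamma> \<circ> (\<phi> \<circ> box (m + n) p (twist m n) id)) (m + n) (int m + i) (sig A m n i a) p k b
      [^]\<^bsub>smash_grp A B q t\<^esub> ksign (i * int m)"
    using smash_elt_sig[OF *(1,2) permutes_compose[OF *(5) \<gamma>] *(3,4)] by (simp add: comp_assoc)
  then show ?thesis
    using * by (subst (1 2) class_day_pact(2)[OF \<gamma>]) (auto intro!: perm_comp_twist A.sig_closed B.sig_closed)
qed

lemma smash_pact_hom: "\<gamma> permutes {..<q} \<Longrightarrow> pact (smash A B) q \<gamma> t \<in> hom (smash_grp A B q t) (smash_grp A B q t)"
  unfolding smash_def symspec.simps symseq.simps
  by (rule smash_quotient_hom[OF smash_group class_day_pact(1) class_day_pact_rel])

lemma smash_pact_elt: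
  assumes \<gamma>: "\<gamma> permutes {..<q}"
    and *: "n + m = q" "i + j = t" "\<theta> permutes {..<q}" "a \<in> elts (lev A n) i" "b \<in> elts (lev B m) j"
  shows "pact (smash A B) q \<gamma> t (smash_elt A B \<theta> n i a m j b) = smash_elt A B (\<gamma> \<circ> \<theta>) n i a m j b"
proof -
  have "pact (smash A B) q \<gamma> t (smash_elt A B \<theta> n i a m j b) =
      smash_class A B q t (pact (day_conv A B) q \<gamma> t (day_elt A B \<theta> n i a m j b))"
    unfolding smash_def symspec.simps symseq.simps
    by (rule smash_quotient_elt[OF smash_group class_day_pact(1) class_day_pact_rel]) (use assms in auto)
  then show ?thesis using class_day_pact(2)[OF \<gamma> *] by simp
qed

end


subsection \<open>The structure maps\<close>

text \<open>Functoriality of \<box> in its second argument together with its strict associativity,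
  by which 1 \<box> (\<alpha> \<box> \<beta>) is (1 \<box> \<alpha>) \<box> \<beta>.\<close>

lemma box_shift_box:
  "box r (n + m) id (\<theta> \<circ> box n m \<alpha> \<beta>) = box r (n + m) id \<theta> \<circ> box (r + n) m (box r n id \<alpha>) \<beta>"
  if "\<alpha> permutes {..<n}" "\<beta> permutes {..<m}"
proof
  fix x
  consider "x < r" | "r \<le> x" "x < r + n" | "r + n \<le> x" "x < r + n + m" | "r + n + m \<le> x" by linarith
  then show "box r (n + m) id (\<theta> \<circ> box n m \<alpha> \<beta>) x
      = (box r (n + m) id \<theta> \<circ> box (r + n) m (box r n id \<alpha>) \<beta>) x"
  proof cases
    case 2
    then have "\<alpha> (x - r) < n" using permutes_lessThan(1)[OF that(1), of "x - r"] by auto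
    then show ?thesis using 2 by (auto simp: box_def)
  next
    case 3
    then have "\<beta> (x - (r + n)) < m" using permutes_lessThan(1)[OF that(2), of "x - (r + n)"] by auto
    moreover have "x - r - n = x - (r + n)" by simp
    ultimately show ?thesis using 3 by (auto simp: box_def add.assoc add.commute)
  qed (auto simp: box_def)
qed

text \<open>Both sides bring blocks m, r, n, p into the order r, n, m, p before \<phi> acts: the
  left moves m past r + n at once, the right moves it past r and then past n.\<close>

lemma box_shift_twist:
  "box r (n + m + p) id \<phi> \<circ> box (m + (r + n)) p (twist m (r + n)) id =
   box r (n + m + p) id (\<phi> \<circ> box (m + n) p (twist m n) id)
     \<circ> box (m + r + n) p (box (m + r) n (twist m r) id) id"
proof
  fix x
  consider "x < m" | "m \<le> x" "x < m + r" | "m + r \<le> x" "x < m + r + n"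
    | "m + r + n \<le> x" "x < m + r + n + p" | "m + r + n + p \<le> x" by linarith
  then show "(box r (n + m + p) id \<phi> \<circ> box (m + (r + n)) p (twist m (r + n)) id) x =
   (box r (n + m + p) id (\<phi> \<circ> box (m + n) p (twist m n) id)
     \<circ> box (m + r + n) p (box (m + r) n (twist m r) id) id) x"
    by cases (auto simp: box_def twist_def add.commute[of r m])
qed

text \<open>The interchange law for \<box>, with the block of q points regrouped as n + m so that
  \<alpha> \<box> 1 acts on the left factor of a tensor alone.\<close>

lemma box_shift_comp: "box k q \<alpha> \<beta> \<circ> box k q id \<theta> = box k q id (\<beta> \<circ> \<theta>) \<circ> box (k + n) m (box k n \<alpha> id) id"
  if "\<alpha> permutes {..<k}" "\<theta> permutes {..<q}" "q = n + m"
proof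
  fix x
  consider "x < k" | "k \<le> x" "x < k + n" | "k + n \<le> x" "x < k + q" | "k + q \<le> x" by linarith
  then show "(box k q \<alpha> \<beta> \<circ> box k q id \<theta>) x = (box k q id (\<beta> \<circ> \<theta>) \<circ> box (k + n) m (box k n \<alpha> id) id) x"
    using permutes_lessThan(1)[OF that(1), of x] permutes_lessThan(1)[OF that(2), of "x - k"] that(3)
    by cases (auto simp: box_def)
qed

lemma box_0_left: "\<theta> permutes {..<q} \<Longrightarrow> box 0 q id \<theta> = \<theta>"
  by (auto simp: box_def fun_eq_iff permutes_lessThan)

lemma box_box_left: "\<theta> permutes {..<q} \<Longrightarrow> box k (l + q) id (box l q id \<theta>) = box (k + l) q id \<theta>"
  by (auto simp: box_def fun_eq_iff permutes_lessThan)

context prespectrum_pair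
begin

text \<open>For the coequaliser relation, carrying e_m past \<sigma>(e_r \<otimes> a) costs
  (-1)^{(r+i)m}, since that element has degree r + i. Exchanging e_m with e_r is a block twist
  acting on a suspension, which by equivariance costs (-1)^{mr}. The product is the required
  (-1)^{im}.\<close>

lemma smash_sig_balanced:
  "smash_balanced A B (smash_grp A B (r + q) (int r + t)) q t
     (\<lambda>Day_Gen n i a m j b \<theta> \<Rightarrow>
        smash_elt A B (box r q id \<theta>) (r + n) (int r + i) (sig A r n i a) m j b)"
  unfolding smash_balanced_def day_balanced_def day_gen.case
proof (intro allI impI conjI ballI)
  fix n m i j \<theta> assume *: "n + m = q" "i + j = t" "\<theta> permutes {..<q}"
  have r\<theta>: "box r q id \<theta> permutes {..<r + q}" by (rule box_permutes[OF permutes_id *(3) refl])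
  show "bihom (grp (lev A n) i) (grp (lev B m) j) (smash_grp A B (r + q) (int r + t))
     (\<lambda>a b. smash_elt A B (box r q id \<theta>) (r + n) (int r + i) (sig A r n i a) m j b)"
    by (rule bihom_compose[where w="\<lambda>x. x" and v="\<lambda>x. x", OF smash_elt_bihom[OF r\<theta>] A.sig_hom[OF refl refl] hom_id hom_id])
       (use * in auto)
  fix a b \<alpha> \<beta> assume ab: "a \<in> elts (lev A n) i" "b \<in> elts (lev B m) j"
    and \<alpha>: "\<alpha> permutes {..<n}" and \<beta>: "\<beta> permutes {..<m}"
  have sa: "sig A r n i a \<in> elts (lev A (r + n)) (int r + i)" using A.sig_closed[OF ab(1)] by auto
  have "pact A (r + n) (box r n id \<alpha>) (int r + i) (sig A r n i a) = sig A r n i (pact A n \<alpha> i a)"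
    using A.sig_box[OF ab(1) permutes_id \<alpha>] A.sig_closed[OF A.pact_closed[OF \<alpha> ab(1)]]
    by (simp add: group.int_pow_1)
  then show "smash_elt A B (box r q id (\<theta> \<circ> box n m \<alpha> \<beta>)) (r + n) (int r + i) (sig A r n i a) m j b =
      smash_elt A B (box r q id \<theta>) (r + n) (int r + i) (sig A r n i (pact A n \<alpha> i a)) m j (pact B m \<beta> j b)"
    using smash_elt_box[of "box r q id \<theta>" "r + n" m, OF _ sa ab(2) box_permutes[OF permutes_id \<alpha> refl] \<beta>] r\<theta> *
      box_shift_box[OF \<alpha> \<beta>, of r \<theta>] by (simp add: add.assoc)
next
  fix n i m p k \<phi> a b
  assume *: "n + m + p = q" "i + int m + k = t" "\<phi> permutes {..<q}"
    and a: "a \<in> elts (lev A n) i" and b: "b \<in> elts (lev B p) k"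
  let ?G = "smash_grp A B (r + q) (int r + t)"
  interpret G: comm_group ?G by simp
  \<comment> \<open>Levels and degrees are named because the two sides reach them with different
    bracketings, and \<open>smash_elt\<close> carries them as arguments.\<close>
  define N where "N = m + r + n"
  define I where "I = int (m + r) + i"
  define \<phi>' where "\<phi>' = box r q id (\<phi> \<circ> box (m + n) p (twist m n) id)"
  define \<delta> where "\<delta> = box (m + r) n (twist m r) id"
  have N: "m + (r + n) = N" "r + (m + n) = N" "int m + (int r + i) = I" "int r + (int m + i) = I" "r + m = m + r"
    by (simp_all add: N_def I_def)
  have Np: "N + p = r + q" "I + k = int r + t" "(r + n) + m + p = r + q" "(int r + i) + int m + k = int r + t"
    using * by (auto simp: N_def I_def)
  have \<phi>': "\<phi>' permutes {..<r + q}" unfolding \<phi>'_def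
    by (rule box_permutes[OF permutes_id perm_comp_twist[OF *(3,1)] refl])
  have \<delta>: "\<delta> permutes {..<N}" unfolding \<delta>_def N_def
    by (intro box_permutes twist_permutes permutes_id refl)
  have r\<phi>: "box r q id \<phi> permutes {..<r + q}" by (rule box_permutes[OF permutes_id *(3) refl])
  have sa: "sig A r n i a \<in> elts (lev A (r + n)) (int r + i)" using A.sig_closed[OF a] by auto
  define x where "x = sig A (m + r) n i a"
  have x: "x \<in> elts (lev A N) I" unfolding x_def by (rule A.sig_closed[OF a]) (auto simp: N_def I_def)
  have xx: "sig A m (r + n) (int r + i) (sig A r n i a) = x" "sig A r (m + n) (int m + i) (sig A m n i a) = x"
    unfolding x_def using A.sig_sig[OF a, of m r] A.sig_sig[OF a, of r m] by (simp_all add: add.commute[of r m])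
  define X where "X = smash_elt A B \<phi>' N I x p k b"
  have X: "X \<in> carrier ?G" unfolding X_def
    by (rule smash_elt_closed[OF \<phi>' Np(1,2) x b])
  have "pact A N \<delta> I x = x [^]\<^bsub>grp (lev A N) I\<^esub> sign (twist m r)"
    unfolding x_def N_def I_def \<delta>_def
    using A.sig_box[OF a twist_permutes[OF refl] permutes_id] by (simp add: A.pact_id[OF a])
  then have d: "smash_elt A B (\<phi>' \<circ> box N p \<delta> id) N I x p k b = X [^]\<^bsub>?G\<^esub> ksign (int m * int r)"
    using smash_elt_box[of \<phi>' N p, OF _ x b \<delta> permutes_id] smash_elt_pow1[OF \<phi>' Np(1,2) x b] \<phi>'
    by (simp add: X_def Np(1) sign_twist B.pact_id[OF b])
  have "smash_elt A B (box r q id \<phi>) (r + n) (int r + i) (sig A r n i a) (m + p) (int m + k) (sig B m p k b)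
    = smash_elt A B (box r q id \<phi> \<circ> box N p (twist m (r + n)) id) N I x p k b
      [^]\<^bsub>?G\<^esub> ksign ((int r + i) * int m)"
    using smash_elt_sig[OF Np(3,4) r\<phi> sa b] unfolding N xx .
  also have "box r q id \<phi> \<circ> box N p (twist m (r + n)) id = \<phi>' \<circ> box N p \<delta> id"
    using box_shift_twist[of r n m p \<phi>] unfolding N by (simp add: * N_def \<delta>_def \<phi>'_def)
  also have "smash_elt A B \<dots> N I x p k b [^]\<^bsub>?G\<^esub> ksign ((int r + i) * int m) = X [^]\<^bsub>?G\<^esub> ksign (i * int m)"
  proof -
    have "ksign (int m * int r) * ksign ((int r + i) * int m) = ksign (i * int m)"
      by (auto simp: ksign_def)
    then show ?thesis unfolding d using X by (simp add: G.int_pow_pow)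
  qed
  finally show "smash_elt A B (box r q id \<phi>) (r + n) (int r + i) (sig A r n i a) (m + p) (int m + k) (sig B m p k b)
    = smash_elt A B (box r q id (\<phi> \<circ> box (m + n) p (twist m n) id)) (r + (m + n)) (int r + (int m + i))
      (sig A r (m + n) (int m + i) (sig A m n i a)) p k b [^]\<^bsub>?G\<^esub> ksign (i * int m)"
    unfolding xx N X_def \<phi>'_def .
qed

lemma graded_smash_lev [simp]: "graded (lev (smash A B) q)"
  by (simp add: graded_def)

text \<open>\<open>sact\<close> is defined on all of Z[r] \<otimes> (A \<otimes> B); evaluating it
  at e_r leaves the lift itself, which is additive and known on generators.\<close>

lemma smash_sig_eq:
  assumes "x \<in> carrier (smash_grp A B q t)"
  shows "sig (smash A B) r q t x = smash_lift (smash_grp A B (r + q) (int r + t))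
     (\<lambda>Day_Gen n i a m j b \<theta> \<Rightarrow>
        smash_elt A B (box r q id \<theta>) (r + n) (int r + i) (sig A r n i a) m j b) x"
proof -
  have "sact (smash A B) r q (int r + t) = Zc_lift (smash_grp A B (r + q) (int r + t)) (int r + t)
    (\<lambda>_. smash_lift (smash_grp A B (r + q) (int r + t))
     (\<lambda>Day_Gen n i a m j b \<theta> \<Rightarrow>
        smash_elt A B (box r q id \<theta>) (r + n) (int r + i) (sig A r n i a) m j b))"
    by (simp add: smash_def)
  then show ?thesis unfolding sig_def[of "smash A B"]
    by (simp only:) (rule Zc_lift_unit; use assms smash_lift_hom[OF smash_group smash_sig_balanced] in auto)
qed

lemma smash_sig_hom:
  "sig (smash A B) r q t \<in> hom (smash_grp A B q t) (smash_grp A B (r + q) (int r + t))"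
proof -
  interpret G: comm_group "smash_grp A B q t" by simp
  note h = smash_lift_hom[OF smash_group smash_sig_balanced[of r q t]]
  show ?thesis
    using hom_carrier[OF h] by (intro homI) (auto simp: smash_sig_eq hom_mult[OF h])
qed

lemma smash_sig_elt:
  assumes "n + m = q" "i + j = t" "\<theta> permutes {..<q}" "a \<in> elts (lev A n) i" "b \<in> elts (lev B m) j"
  shows "sig (smash A B) r q t (smash_elt A B \<theta> n i a m j b) =
    smash_elt A B (box r q id \<theta>) (r + n) (int r + i) (sig A r n i a) m j b"
  using smash_elt_closed[OF assms(3,1,2,4,5)] smash_lift_elt[OF smash_group smash_sig_balanced assms, of r]
  by (simp add: smash_sig_eq)

text \<open>Raising a homomorphism to a fixed power keeps it a homomorphism, so the axioms that
  carry a sign can be tested on the classes \<theta>_*(a \<otimes> b) as well. There the axioms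
  about suspension reduce to those of A, because suspension acts through the left factor.\<close>

lemma prespectrum_smash: "prespectrum (smash A B)"
proof
  note pact = smash_pact_hom and bd = smash_bd_hom and sig = smash_sig_hom
  show "precomplex (lev (smash A B) q)" for q
    using smash_bd_hom by (simp add: precomplex_def)
  show "sig (smash A B) k q t \<in> hom (grp (lev (smash A B) q) t) (grp (lev (smash A B) (k + q)) (int k + t))" for k q t
    using smash_sig_hom by simp
  fix q t
  show "pact (smash A B) q \<alpha> t \<in> hom (grp (lev (smash A B) q) t) (grp (lev (smash A B) q) t)"
    if "\<alpha> permutes {..<q}" for \<alpha>
    using smash_pact_hom[OF that] by simp
  fix x assume "x \<in> elts (lev (smash A B) q) t"
  then have x: "x \<in> carrier (smash_grp A B q t)" by simp
  show "bd (lev (smash A B) q) t (pact (smash A B) q \<alpha> t x) =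
      pact (smash A B) q \<alpha> (t - 1) (bd (lev (smash A B) q) t x)" if \<alpha>: "\<alpha> permutes {..<q}" for \<alpha>
  proof (rule smash_hom_eq[OF _ hom_compose_fun[OF pact[OF \<alpha>] bd] hom_compose_fun[OF bd pact[OF \<alpha>]] _ x])
    fix \<theta> n i a m j b assume *: "n + m = q" "i + j = t" "\<theta> permutes {..<q}"
      "a \<in> elts (lev A n) i" "b \<in> elts (lev B m) j"
    have c: "smash_elt A B \<theta> n (i - 1) (bd (lev A n) i a) m j b \<in> carrier (smash_grp A B q (t - 1))"
      "smash_elt A B \<theta> n i a m (j - 1) (bd (lev B m) j b) \<in> carrier (smash_grp A B q (t - 1))"
      using * by (auto intro!: smash_elt_closed A.bd_closed B.bd_closed)
    show "bd (lev (smash A B) q) t (pact (smash A B) q \<alpha> t (smash_elt A B \<theta> n i a m j b)) =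
        pact (smash A B) q \<alpha> (t - 1) (bd (lev (smash A B) q) t (smash_elt A B \<theta> n i a m j b))"
      using * \<alpha> c
      by (simp add: smash_pact_elt smash_bd_elt permutes_compose hom_mult[OF pact] hom_int_pow[OF pact]
          group.int_pow_closed A.bd_closed B.bd_closed)
  qed simp
  show "pact (smash A B) q id t x = x"
    by (rule smash_hom_eq[OF _ pact[OF permutes_id] hom_id _ x])
       (auto simp: smash_pact_elt permutes_id)
  show "pact (smash A B) q (\<alpha> \<circ> \<beta>) t x = pact (smash A B) q \<alpha> t (pact (smash A B) q \<beta> t x)"
    if "\<alpha> permutes {..<q}" "\<beta> permutes {..<q}" for \<alpha> \<beta>
    by (rule smash_hom_eq[OF _ pact[OF permutes_compose[OF that(2,1)]]
          hom_compose_fun[OF pact[OF that(2)] pact[OF that(1)]] _ x])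
       (use that in \<open>auto simp: smash_pact_elt permutes_compose comp_assoc\<close>)
  show "bd (lev (smash A B) (k + q)) (int k + t) (sig (smash A B) k q t x) =
      sig (smash A B) k q (t - 1) (bd (lev (smash A B) q) t x)
        [^]\<^bsub>grp (lev (smash A B) (k + q)) (int k + t - 1)\<^esub> ksign (int k)" for k
  proof -
    let ?G = "smash_grp A B (k + q) (int k + t - 1)"
    interpret G: comm_group ?G by simp
    have sig': "sig (smash A B) k q (t - 1) \<in> hom (smash_grp A B q (t - 1)) ?G"
      using sig[of k q "t - 1"] by (simp add: add_diff_eq)
    have "bd (lev (smash A B) (k + q)) (int k + t) (sig (smash A B) k q t x) =
      sig (smash A B) k q (t - 1) (bd (lev (smash A B) q) t x) [^]\<^bsub>?G\<^esub> ksign (int k)"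
    proof (rule smash_hom_eq[OF _ hom_compose_fun[OF sig bd] hom_pow[OF _ hom_compose_fun[OF bd sig']] _ x])
      fix \<theta> n i a m j b assume *: "n + m = q" "i + j = t" "\<theta> permutes {..<q}"
        and a: "a \<in> elts (lev A n) i" and b: "b \<in> elts (lev B m) j"
      let ?\<theta> = "box k q id \<theta>"
      have \<theta>: "?\<theta> permutes {..<k + q}" by (rule box_permutes[OF permutes_id *(3) refl])
      have da: "bd (lev A n) i a \<in> elts (lev A n) (i - 1)" and db: "bd (lev B m) j b \<in> elts (lev B m) (j - 1)"
        using A.bd_closed[OF a] B.bd_closed[OF b] by auto
      have sa: "sig A k n i a \<in> elts (lev A (k + n)) (int k + i)"
        and sda: "sig A k n (i - 1) (bd (lev A n) i a) \<in> elts (lev A (k + n)) (int k + i - 1)"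
        by (rule A.sig_closed[OF a] A.sig_closed[OF da]; auto)+
      have kn: "k + n + m = k + q" "int k + i - 1 + j = int k + t - 1" "int k + i + j = int k + t"
        using * by auto
      \<comment> \<open>\<open>X\<close> and \<open>Y\<close> are the two Leibniz terms after
        suspension. The first acquires (-1)^k from d\<sigma>, the second because suspension raises
        the degree of the left factor by k; so (-1)^k factors out.\<close>
      define X where "X = smash_elt A B ?\<theta> (k + n) (int k + i - 1) (sig A k n (i - 1) (bd (lev A n) i a)) m j b"
      define Y where "Y = smash_elt A B ?\<theta> (k + n) (int k + i) (sig A k n i a) m (j - 1) (bd (lev B m) j b)"
      have XY: "X \<in> carrier ?G" "Y \<in> carrier ?G" unfolding X_def Y_def
        using \<theta> * sa sda b db by (auto intro!: smash_elt_closed)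
      have c: "smash_elt A B \<theta> n (i - 1) (bd (lev A n) i a) m j b \<in> carrier (smash_grp A B q (t - 1))"
        "smash_elt A B \<theta> n i a m (j - 1) (bd (lev B m) j b) \<in> carrier (smash_grp A B q (t - 1))"
        using * a b da db by (auto intro!: smash_elt_closed)
      have "bd (lev (smash A B) (k + q)) (int k + t) (sig (smash A B) k q t (smash_elt A B \<theta> n i a m j b))
         = X [^]\<^bsub>?G\<^esub> ksign (int k) \<otimes>\<^bsub>?G\<^esub> Y [^]\<^bsub>?G\<^esub> ksign (int k + i)"
        unfolding smash_sig_elt[OF * a b]
        unfolding smash_bd_elt[OF kn(1,3) \<theta> sa b] A.bd_sig[OF a] smash_elt_pow1[OF \<theta> kn(1,2) sda b] X_def Y_def ..
      moreover have "sig (smash A B) k q (t - 1) (bd (lev (smash A B) q) t (smash_elt A B \<theta> n i a m j b))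
         = X \<otimes>\<^bsub>?G\<^esub> Y [^]\<^bsub>?G\<^esub> ksign i"
      proof -
        have "sig (smash A B) k q (t - 1) (smash_elt A B \<theta> n (i - 1) (bd (lev A n) i a) m j b) = X"
          "sig (smash A B) k q (t - 1) (smash_elt A B \<theta> n i a m (j - 1) (bd (lev B m) j b)) = Y"
          using smash_sig_elt[OF *(1) _ *(3) da b, of "t - 1" k] smash_sig_elt[OF *(1) _ *(3) a db, of "t - 1" k] *(2)
          by (simp_all add: X_def Y_def add_diff_eq)
        then show ?thesis
          unfolding smash_bd_elt[OF * a b] using c
          by (simp add: hom_mult[OF sig'] hom_int_pow[OF sig'] group.int_pow_closed)
      qed
      ultimately show "bd (lev (smash A B) (k + q)) (int k + t) (sig (smash A B) k q t (smash_elt A B \<theta> n i a m j b)) =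
        sig (smash A B) k q (t - 1) (bd (lev (smash A B) q) t (smash_elt A B \<theta> n i a m j b)) [^]\<^bsub>?G\<^esub> ksign (int k)"
        using XY by (simp add: G.int_pow_distrib G.int_pow_pow ksign_add mult.commute)
    qed auto
    then show ?thesis by simp
  qed
  show "pact (smash A B) (k + q) (box k q \<alpha> \<beta>) (int k + t) (sig (smash A B) k q t x) =
      sig (smash A B) k q t (pact (smash A B) q \<beta> t x) [^]\<^bsub>grp (lev (smash A B) (k + q)) (int k + t)\<^esub> sign \<alpha>"
    if \<alpha>: "\<alpha> permutes {..<k}" and \<beta>: "\<beta> permutes {..<q}" for k \<alpha> \<beta>
  proof -
    have \<alpha>\<beta>: "box k q \<alpha> \<beta> permutes {..<k + q}" by (rule box_permutes[OF \<alpha> \<beta> refl])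
    let ?G = "smash_grp A B (k + q) (int k + t)"
    have "pact (smash A B) (k + q) (box k q \<alpha> \<beta>) (int k + t) (sig (smash A B) k q t x) =
      sig (smash A B) k q t (pact (smash A B) q \<beta> t x) [^]\<^bsub>?G\<^esub> sign \<alpha>"
    proof (rule smash_hom_eq[OF _ hom_compose_fun[OF sig pact[OF \<alpha>\<beta>]] hom_pow[OF _ hom_compose_fun[OF pact[OF \<beta>] sig]] _ x])
      fix \<theta> n i a m j b assume *: "n + m = q" "i + j = t" "\<theta> permutes {..<q}"
        and a: "a \<in> elts (lev A n) i" and b: "b \<in> elts (lev B m) j"
      have \<beta>\<theta>: "\<beta> \<circ> \<theta> permutes {..<q}" by (rule permutes_compose[OF *(3) \<beta>])
      have k\<theta>: "box k q id \<theta> permutes {..<k + q}" "box k q id (\<beta> \<circ> \<theta>) permutes {..<k + q}"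
        by (rule box_permutes[OF permutes_id _ refl] * \<beta>\<theta>)+
      have sa: "sig A k n i a \<in> elts (lev A (k + n)) (int k + i)" using A.sig_closed[OF a] by auto
      have kn: "k + n + m = k + q" "int k + i + j = int k + t" using * by auto
      have "pact (smash A B) (k + q) (box k q \<alpha> \<beta>) (int k + t) (sig (smash A B) k q t (smash_elt A B \<theta> n i a m j b))
        = smash_elt A B (box k q \<alpha> \<beta> \<circ> box k q id \<theta>) (k + n) (int k + i) (sig A k n i a) m j b"
        unfolding smash_sig_elt[OF * a b] by (rule smash_pact_elt[OF \<alpha>\<beta> kn k\<theta>(1) sa b])
      \<comment> \<open>By the interchange law \<alpha> now acts on \<sigma>(e_k \<otimes> a) alone,
        where equivariance in A turns it into its sign.\<close>
      also have "\<dots> = smash_elt A B (box k q id (\<beta> \<circ> \<theta>)) (k + n) (int k + i)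
          (pact A (k + n) (box k n \<alpha> id) (int k + i) (sig A k n i a)) m j b"
        unfolding box_shift_comp[OF \<alpha> *(3) *(1)[symmetric]]
        using smash_elt_box[of "box k q id (\<beta> \<circ> \<theta>)" "k + n" m, OF _ sa b box_permutes[OF \<alpha> permutes_id refl] permutes_id] k\<theta>(2)
        by (simp add: kn B.pact_id[OF b])
      also have "\<dots> = smash_elt A B (box k q id (\<beta> \<circ> \<theta>)) (k + n) (int k + i) (sig A k n i a) m j b [^]\<^bsub>?G\<^esub> sign \<alpha>"
        unfolding A.sig_box[OF a \<alpha> permutes_id] A.pact_id[OF a]
        by (rule smash_elt_pow1[OF k\<theta>(2) kn sa b])
      also have "smash_elt A B (box k q id (\<beta> \<circ> \<theta>)) (k + n) (int k + i) (sig A k n i a) m j b =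
         sig (smash A B) k q t (pact (smash A B) q \<beta> t (smash_elt A B \<theta> n i a m j b))"
        unfolding smash_pact_elt[OF \<beta> * a b] smash_sig_elt[OF *(1,2) \<beta>\<theta> a b] ..
      finally show "pact (smash A B) (k + q) (box k q \<alpha> \<beta>) (int k + t) (sig (smash A B) k q t (smash_elt A B \<theta> n i a m j b))
        = sig (smash A B) k q t (pact (smash A B) q \<beta> t (smash_elt A B \<theta> n i a m j b)) [^]\<^bsub>?G\<^esub> sign \<alpha>" .
    qed auto
    then show ?thesis by simp
  qed
  show "sig (smash A B) 0 q t x = x"
    by (rule smash_hom_eq[OF _ sig[of 0 q t, simplified] hom_id _ x])
       (auto simp: smash_sig_elt box_0_left A.sig_0)
  show "sig (smash A B) k (l + q) (int l + t) (sig (smash A B) l q t x) = sig (smash A B) (k + l) q t x" for k l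
  proof (rule smash_hom_eq[OF _ hom_compose_fun[OF sig sig] _ _ x])
    show "sig (smash A B) (k + l) q t \<in> hom (smash_grp A B q t) (smash_grp A B (k + (l + q)) (int k + (int l + t)))"
      using sig[of "k + l" q t] by (simp add: add.assoc)
    fix \<theta> n i a m j b assume *: "n + m = q" "i + j = t" "\<theta> permutes {..<q}"
        and a: "a \<in> elts (lev A n) i" and b: "b \<in> elts (lev B m) j"
    have sa: "sig A l n i a \<in> elts (lev A (l + n)) (int l + i)" using A.sig_closed[OF a] by auto
    show "sig (smash A B) k (l + q) (int l + t) (sig (smash A B) l q t (smash_elt A B \<theta> n i a m j b)) =
       sig (smash A B) (k + l) q t (smash_elt A B \<theta> n i a m j b)"
      unfolding smash_sig_elt[OF * a b]
      by (subst smash_sig_elt[OF _ _ box_permutes[OF permutes_id *(3) refl] sa b])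
         (use * in \<open>auto simp: A.sig_sig[OF a] box_box_left add.assoc\<close>)
  qed simp
qed

end

subsection \<open>The unit\<close>

lemma lev_Zstar [simp]: "lev Zstar n = Zc (int n)"
  and pact_Zstar [simp]: "pact Zstar n \<alpha> k c = sign \<alpha> * c"
  by (simp_all add: Zstar_def)

lemma sact_Zstar_bihom:
  "i + j = t \<Longrightarrow> bihom (grp (Zc (int k)) i) (grp (Zc (int n)) j) (grp (Zc (int (k + n))) t) (\<lambda>c c'. c * c')"
  by (rule bihomI) (auto simp: Zc_def singleton_group_def algebra_simps split: if_splits)

lemma sact_Zstar:
  "i + j = t \<Longrightarrow> c \<in> elts (Zc (int k)) i \<Longrightarrow> c' \<in> elts (Zc (int n)) j \<Longrightarrow>
    sact Zstar k n t (ctens (Zc (int k)) (Zc (int n)) i j c c') = c * c'"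
  unfolding Zstar_def symspec.simps
  by (rule ctensor_lift_ctens[OF graded_Zc graded_Zc comm_group_Zc sact_Zstar_bihom])

lemma sig_Zstar: "c \<in> elts (Zc (int n)) i \<Longrightarrow> sig Zstar k n i c = c"
  by (simp add: sig_def sact_Zstar)

text \<open>On underlying integers \<sigma> is the identity, since e_k times e_n is e_{k+n}.
  Equivariance thereby becomes multiplicativity of the sign of a block permutation.\<close>

lemma prespectrum_Zstar: "prespectrum Zstar"
proof
  show "sig Zstar k n i \<in> hom (grp (lev Zstar n) i) (grp (lev Zstar (k + n)) (int k + i))" for k n i
  proof (rule homI)
    fix x assume x: "x \<in> elts (lev Zstar n) i"
    then show "sig Zstar k n i x \<in> elts (lev Zstar (k + n)) (int k + i)"
      by (auto simp: sig_Zstar elts_Zc split: if_splits)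
    fix y assume y: "y \<in> elts (lev Zstar n) i"
    then have "x + y \<in> elts (Zc (int n)) i" using x by (auto simp: elts_Zc split: if_splits)
    moreover have "x \<in> elts (Zc (int (k + n))) (int k + i)" "y \<in> elts (Zc (int (k + n))) (int k + i)"
      using x y by (auto simp: elts_Zc split: if_splits)
    ultimately show "sig Zstar k n i (x \<otimes>\<^bsub>grp (lev Zstar n) i\<^esub> y) =
       sig Zstar k n i x \<otimes>\<^bsub>grp (lev Zstar (k + n)) (int k + i)\<^esub> sig Zstar k n i y"
      using x y by (simp add: mult_Zc sig_Zstar del: of_nat_add)
  qed
  show "pact Zstar n \<alpha> i \<in> hom (grp (lev Zstar n) i) (grp (lev Zstar n) i)" for n i \<alpha>
    by (rule homI) (auto simp: Zc_def singleton_group_def algebra_simps split: if_splits)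
  fix a n i assume a: "a \<in> elts (lev Zstar n) i"
  then have sa: "sign p * a \<in> elts (Zc (int n)) i" "a \<in> elts (Zc (int (k + n))) (int k + i)" for p k
    by (auto simp: elts_Zc split: if_splits)
  show "pact Zstar (k + n) (box k n \<alpha> \<beta>) (int k + i) (sig Zstar k n i a) =
       sig Zstar k n i (pact Zstar n \<beta> i a) [^]\<^bsub>grp (lev Zstar (k + n)) (int k + i)\<^esub> sign \<alpha>"
    if "\<alpha> permutes {..<k}" "\<beta> permutes {..<n}" for k \<alpha> \<beta>
  proof -
    have "sign \<beta> * a \<in> elts (Zc (int (k + n))) (int k + i)"
      using sa(2)[of k] by (auto simp: elts_Zc split: if_splits)
    from pow_Zc[OF this, of "sign \<alpha>"] show ?thesis
      using a sa(1)[of \<beta>] sign_box[OF that] by (simp add: sig_Zstar del: of_nat_add)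
  qed
  show "sig Zstar k (l + n) (int l + i) (sig Zstar l n i a) = sig Zstar (k + l) n i a" for k l
    using a sa(2)[of l] by (simp add: sig_Zstar del: of_nat_add)
  show "bd (lev Zstar (k + n)) (int k + i) (sig Zstar k n i a) =
     sig Zstar k n (i - 1) (bd (lev Zstar n) i a) [^]\<^bsub>grp (lev Zstar (k + n)) (int k + i - 1)\<^esub> ksign (int k)" for k
    using pow_Zc[OF zero_Zc] by (simp add: sig_Zstar)
qed (auto simp: sig_Zstar sign_compose permutes_permutation)


section \<open>The maps \<phi>, their inverses, and compatibility with the differentials\<close>

section \<open>The structure isomorphism\<close>

definition xi_smash ::
    "'a symspec \<Rightarrow> 'b symspec \<Rightarrow> nat \<Rightarrow> int \<Rightarrow> 'a \<Rightarrow> nat \<Rightarrow> int \<Rightarrow> 'b \<Rightarrow> ('a, 'b) day set Dtype" where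
  "xi_smash A B n i a m j b = xi (smash A B) (n + m) (i + j) (smash_elt A B id n i a m j b)"

text \<open>Only the parity of m(i - n) matters, so replacing level n and degree i by l + n and l +
  i changes nothing. This invariance is forced by \<xi>(\<sigma>(e_l \<otimes> a)) =
  \<xi>(a).\<close>

definition phi_sign :: "nat \<Rightarrow> int \<Rightarrow> nat \<Rightarrow> int" where
  "phi_sign n i m = ksign (int m * int n + int m * i)"

lemma phi_sign_square [simp]: "phi_sign n i m * phi_sign n i m = 1"
  by (simp add: phi_sign_def)

lemma box_id_id [simp]: "box l q id id = id"
  by (auto simp: box_def fun_eq_iff)

context prespectrum_pair
begin

sublocale S: prespectrum "smash A B"
  by (rule prespectrum_smash)

text \<open>In D a permutation acts by its sign, so the generators with \<theta> the identity
  already carry all the information.\<close>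

lemma xi_smash_elt:
  assumes "\<theta> permutes {..<q}" "n + m = q" "i + j = t" "t - int q = k" "a \<in> elts (lev A n) i" "b \<in> elts (lev B m) j"
  shows "xi (smash A B) q t (smash_elt A B \<theta> n i a m j b) =
    xi_smash A B n i a m j b [^]\<^bsub>grp (D (smash A B)) k\<^esub> sign \<theta>"
proof -
  have "smash_elt A B \<theta> n i a m j b = pact (smash A B) q \<theta> t (smash_elt A B id n i a m j b)"
    using smash_pact_elt[OF assms(1-3) permutes_id assms(5,6)] by simp
  then show ?thesis
    using S.xi_pact[OF assms(1) _ assms(4), of "smash_elt A B id n i a m j b"]
      smash_elt_closed[OF permutes_id assms(2,3,5,6)] assms(2,3) by (simp add: xi_smash_def)
qed

lemma xi_smash_bihom:
  assumes "i - int n + (j - int m) = k"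
  shows "bihom (grp (lev A n) i) (grp (lev B m) j) (grp (D (smash A B)) k) (\<lambda>a b. xi_smash A B n i a m j b)"
  unfolding xi_smash_def
  by (rule bihom_compose[OF smash_elt_bihom[OF permutes_id refl refl] hom_id hom_id])
     (use S.xi_hom[of "i + j" "n + m" k] assms in simp)

lemma xi_smash_closed:
  "a \<in> elts (lev A n) i \<Longrightarrow> b \<in> elts (lev B m) j \<Longrightarrow> i - int n + (j - int m) = k \<Longrightarrow>
    xi_smash A B n i a m j b \<in> elts (D (smash A B)) k"
  using bihom_closed[OF xi_smash_bihom] .

lemma xi_smash_pact:
  assumes ab: "a \<in> elts (lev A n) i" "b \<in> elts (lev B m) j" and k: "i - int n + (j - int m) = k"
    and \<alpha>: "\<alpha> permutes {..<n}" and \<beta>: "\<beta> permutes {..<m}"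
  shows "xi_smash A B n i (pact A n \<alpha> i a) m j (pact B m \<beta> j b) =
    xi_smash A B n i a m j b [^]\<^bsub>grp (D (smash A B)) k\<^esub> (sign \<alpha> * sign \<beta>)"
  using xi_smash_elt[OF box_permutes[OF \<alpha> \<beta> refl] refl refl _ ab, of k] k
    smash_elt_box[OF permutes_id ab \<alpha> \<beta>] by (simp add: xi_smash_def sign_box[OF \<alpha> \<beta>])

lemma xi_smash_sig1:
  assumes "a \<in> elts (lev A n) i" "b \<in> elts (lev B m) j"
  shows "xi_smash A B (l + n) (int l + i) (sig A l n i a) m j b = xi_smash A B n i a m j b"
  using S.xi_sig[of "smash_elt A B id n i a m j b" "n + m" "i + j" l]
    smash_sig_elt[OF refl refl permutes_id assms, of l] smash_elt_closed[OF permutes_id refl refl assms]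
  by (simp add: xi_smash_def add.assoc)

text \<open>Suspension of the tensor product acts through its left factor, so e_l must first be
  carried from b to a. This costs (-1)^{il} and a block twist, which \<xi> turns into (-1)^{ln};
  then \<open>xi_smash_sig1\<close> removes the suspension.\<close>

lemma xi_smash_sig2:
  assumes a: "a \<in> elts (lev A n) i" and b: "b \<in> elts (lev B m) j" and k: "i - int n + (j - int m) = k"
  shows "xi_smash A B n i a (l + m) (int l + j) (sig B l m j b) =
    xi_smash A B n i a m j b [^]\<^bsub>grp (D (smash A B)) k\<^esub> ksign (int l * int n + i * int l)"
proof -
  interpret K: comm_group "grp (D (smash A B)) k" by simp
  let ?\<theta> = "box (l + n) m (twist l n) id"
  define q where "q = n + l + m"
  define t where "t = i + int l + j"
  have q: "n + l + m = q" "i + int l + j = t" "n + (l + m) = q" "i + (int l + j) = t" "t - int q = k"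
    "(l + n) + m = q" "(int l + i) + j = t"
    using k by (auto simp: q_def t_def)
  have \<theta>: "?\<theta> permutes {..<q}" using perm_comp_twist[OF permutes_id q(1)] by simp
  have sa: "sig A l n i a \<in> elts (lev A (l + n)) (int l + i)" by (rule A.sig_closed[OF a]) auto
  have c: "smash_elt A B ?\<theta> (l + n) (int l + i) (sig A l n i a) m j b \<in> carrier (smash_grp A B q t)"
    by (rule smash_elt_closed[OF \<theta> q(6,7) sa b])
  have "smash_elt A B id n i a (l + m) (int l + j) (sig B l m j b) =
    smash_elt A B ?\<theta> (l + n) (int l + i) (sig A l n i a) m j b [^]\<^bsub>smash_grp A B q t\<^esub> ksign (i * int l)"
    using smash_elt_sig[OF q(1,2) permutes_id a b] by simp
  then have "xi_smash A B n i a (l + m) (int l + j) (sig B l m j b) =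
     xi (smash A B) q t (smash_elt A B ?\<theta> (l + n) (int l + i) (sig A l n i a) m j b)
       [^]\<^bsub>grp (D (smash A B)) k\<^esub> ksign (i * int l)"
    using hom_int_pow[OF S.xi_hom[OF q(5)], of _ "ksign (i * int l)"] c by (simp add: xi_smash_def q)
  also have "xi (smash A B) q t (smash_elt A B ?\<theta> (l + n) (int l + i) (sig A l n i a) m j b) =
     xi_smash A B n i a m j b [^]\<^bsub>grp (D (smash A B)) k\<^esub> ksign (int l * int n)"
    unfolding xi_smash_elt[OF \<theta> q(6,7,5) sa b] xi_smash_sig1[OF a b]
    using sign_box[OF twist_permutes[OF refl] permutes_id, of l n m] by (simp add: sign_twist)
  finally show ?thesis
    using xi_smash_closed[OF a b k] by (simp add: K.int_pow_pow ksign_add)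
qed

text \<open>The factor (-1)^{ln+il} produced by suspending b is the ratio of
  \<open>phi_sign n i (l + m)\<close> to \<open>phi_sign n i m\<close>. Without the sign in \<phi>
  the suspension relation in b would fail.\<close>

lemma phi_compatible2:
  assumes a: "a \<in> elts (lev A n) i" and k: "i - int n + s = k"
  shows "compatible B (grp (D (smash A B)) k) s
    (\<lambda>m j b. xi_smash A B n i a m j b [^]\<^bsub>grp (D (smash A B)) k\<^esub> phi_sign n i m)"
  unfolding compatible_def
proof (intro allI impI conjI ballI)
  let ?K = "grp (D (smash A B)) k"
  interpret K: comm_group ?K by simp
  fix m j assume "j - int m = s"
  with k have k': "i - int n + (j - int m) = k" by simp
  show "(\<lambda>b. xi_smash A B n i a m j b [^]\<^bsub>?K\<^esub> phi_sign n i m) \<in> hom (grp (lev B m) j) ?K"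
    by (rule hom_pow[OF _ bihom_hom2[OF xi_smash_bihom[OF k'] a]]) simp
  fix b assume b: "b \<in> elts (lev B m) j"
  note c = xi_smash_closed[OF a b k']
  show "xi_smash A B n i a m j (pact B m \<beta> j b) [^]\<^bsub>?K\<^esub> phi_sign n i m =
     (xi_smash A B n i a m j b [^]\<^bsub>?K\<^esub> phi_sign n i m) [^]\<^bsub>?K\<^esub> sign \<beta>" if "\<beta> permutes {..<m}" for \<beta>
    using xi_smash_pact[OF a b k' permutes_id that] c
    by (simp add: A.pact_id[OF a] K.int_pow_pow mult.commute)
  show "xi_smash A B n i a (l + m) (int l + j) (sig B l m j b) [^]\<^bsub>?K\<^esub> phi_sign n i (l + m) =
     xi_smash A B n i a m j b [^]\<^bsub>?K\<^esub> phi_sign n i m" for l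
  proof -
    have "ksign (int l * int n + i * int l) * phi_sign n i (l + m) = phi_sign n i m"
      by (auto simp: phi_sign_def ksign_def)
    then show ?thesis unfolding xi_smash_sig2[OF a b k'] using c by (simp add: K.int_pow_pow)
  qed
qed

text \<open>The inner lift of \<open>phi\<close>, with a fixed, as a function on D(B). Giving it a
  name allows the conditions for the outer lift to be stated as identities between its
  values.\<close>

definition phi_inner where
  "phi_inner k s n i a = D_lift (grp (D (smash A B)) k) s
    (\<lambda>m j b. xi_smash A B n i a m j b [^]\<^bsub>grp (D (smash A B)) k\<^esub> phi_sign n i m)"

lemma phi_inner_hom:
  "a \<in> elts (lev A n) i \<Longrightarrow> i - int n + s = k \<Longrightarrow>
    phi_inner k s n i a \<in> hom (grp (D B) s) (grp (D (smash A B)) k)"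
  unfolding phi_inner_def by (rule B.D_lift_hom[OF _ phi_compatible2]) simp

lemma phi_inner_xi:
  "a \<in> elts (lev A n) i \<Longrightarrow> i - int n + s = k \<Longrightarrow> j - int m = s \<Longrightarrow> b \<in> elts (lev B m) j \<Longrightarrow>
    phi_inner k s n i a (xi B m j b) =
      xi_smash A B n i a m j b [^]\<^bsub>grp (D (smash A B)) k\<^esub> phi_sign n i m"
  unfolding phi_inner_def by (rule B.D_lift_xi[OF _ phi_compatible2]) simp

text \<open>Each condition in the variable a is an identity between homomorphisms in v, so v may be
  taken to be \<xi>(b); there it becomes a property of \<open>xi_smash\<close>.\<close>

lemma phi_compatible1:
  assumes v: "v \<in> elts (D B) s" and k: "r + s = k"
  shows "compatible A (grp (D (smash A B)) k) r (\<lambda>n i a. phi_inner k s n i a v)"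
  unfolding compatible_def
proof (intro allI impI conjI ballI)
  let ?K = "grp (D (smash A B)) k"
  interpret K: comm_group ?K by simp
  fix n i assume "i - int n = r"
  with k have k': "i - int n + s = k" by simp
  show "(\<lambda>a. phi_inner k s n i a v) \<in> hom (grp (lev A n) i) ?K"
  proof (rule homI)
    fix a assume a: "a \<in> elts (lev A n) i"
    show "phi_inner k s n i a v \<in> carrier ?K"
      using hom_carrier[OF phi_inner_hom[OF a k']] v by blast
    fix a' assume a': "a' \<in> elts (lev A n) i"
    interpret L: comm_group "grp (lev A n) i" by simp
    have aa: "a \<otimes>\<^bsub>grp (lev A n) i\<^esub> a' \<in> elts (lev A n) i" using a a' by simp
    show "phi_inner k s n i (a \<otimes>\<^bsub>grp (lev A n) i\<^esub> a') v =
        phi_inner k s n i a v \<otimes>\<^bsub>?K\<^esub> phi_inner k s n i a' v"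
    proof (rule B.D_hom_eq[OF _ phi_inner_hom[OF aa k'] hom_mult_fun[OF _ phi_inner_hom[OF a k'] phi_inner_hom[OF a' k']] _ v])
      fix m j b assume j: "j - int m = s" and b: "b \<in> elts (lev B m) j"
      have k'': "i - int n + (j - int m) = k" using j k' by simp
      show "phi_inner k s n i (a \<otimes>\<^bsub>grp (lev A n) i\<^esub> a') (xi B m j b) =
        phi_inner k s n i a (xi B m j b) \<otimes>\<^bsub>?K\<^esub> phi_inner k s n i a' (xi B m j b)"
        using a a' xi_smash_closed[OF _ b k'']
        by (simp add: phi_inner_xi[OF _ k' j b] aa hom_mult[OF bihom_hom1[OF xi_smash_bihom[OF k''] b]] K.int_pow_distrib)
    qed auto
  qed
  fix a assume a: "a \<in> elts (lev A n) i"
  show "phi_inner k s n i (pact A n \<alpha> i a) v = phi_inner k s n i a v [^]\<^bsub>?K\<^esub> sign \<alpha>"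
    if \<alpha>: "\<alpha> permutes {..<n}" for \<alpha>
  proof (rule B.D_hom_eq[OF _ phi_inner_hom[OF A.pact_closed[OF \<alpha> a] k'] hom_pow[OF _ phi_inner_hom[OF a k']] _ v])
    fix m j b assume j: "j - int m = s" and b: "b \<in> elts (lev B m) j"
    have k'': "i - int n + (j - int m) = k" using j k' by simp
    show "phi_inner k s n i (pact A n \<alpha> i a) (xi B m j b) =
      phi_inner k s n i a (xi B m j b) [^]\<^bsub>?K\<^esub> sign \<alpha>"
      using xi_smash_pact[OF a b k'' \<alpha> permutes_id] xi_smash_closed[OF a b k'']
      by (simp add: phi_inner_xi[OF _ k' j b] a A.pact_closed[OF \<alpha> a] B.pact_id[OF b] K.int_pow_pow mult.commute)
  qed auto
  show "phi_inner k s (l + n) (int l + i) (sig A l n i a) v = phi_inner k s n i a v" for l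
  proof -
    have sa: "sig A l n i a \<in> elts (lev A (l + n)) (int l + i)" by (rule A.sig_closed[OF a]) auto
    have kl: "int l + i - int (l + n) + s = k" using k' by simp
    show ?thesis
    proof (rule B.D_hom_eq[OF _ phi_inner_hom[OF sa kl] phi_inner_hom[OF a k'] _ v])
      fix m j b assume j: "j - int m = s" and b: "b \<in> elts (lev B m) j"
      have "phi_sign (l + n) (int l + i) m = phi_sign n i m" by (auto simp: phi_sign_def ksign_def)
      then show "phi_inner k s (l + n) (int l + i) (sig A l n i a) (xi B m j b) = phi_inner k s n i a (xi B m j b)"
        by (simp add: phi_inner_xi[OF sa kl j b] phi_inner_xi[OF a k' j b] xi_smash_sig1[OF a b])
    qed auto
  qed
qed

definition phi_outer where
  "phi_outer k r s u v = D_lift (grp (D (smash A B)) k) r (\<lambda>n i a. phi_inner k s n i a v) u"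

lemma phi_outer_xi:
  assumes "r + s = k" "i - int n = r" "a \<in> elts (lev A n) i" "v \<in> elts (D B) s"
  shows "phi_outer k r s (xi A n i a) v = phi_inner k s n i a v"
  unfolding phi_outer_def by (rule A.D_lift_xi[OF _ phi_compatible1]) (use assms in auto)

lemma phi_outer_hom1:
  "r + s = k \<Longrightarrow> v \<in> elts (D B) s \<Longrightarrow> (\<lambda>u. phi_outer k r s u v) \<in> hom (grp (D A) r) (grp (D (smash A B)) k)"
  unfolding phi_outer_def by (rule A.D_lift_hom[OF _ phi_compatible1]) auto

text \<open>Additivity in u comes with the outer lift. Additivity in v is an identity between
  homomorphisms in u, and at u = \<xi>(a) it is additivity of the inner lift.\<close>

lemma phi_outer_bihom:
  assumes k: "r + s = k"
  shows "bihom (grp (D A) r) (grp (D B) s) (grp (D (smash A B)) k) (phi_outer k r s)"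
proof -
  interpret V: comm_group "grp (D B) s" by simp
  have "phi_outer k r s u (v \<otimes>\<^bsub>grp (D B) s\<^esub> v') =
      phi_outer k r s u v \<otimes>\<^bsub>grp (D (smash A B)) k\<^esub> phi_outer k r s u v'"
    if u: "u \<in> elts (D A) r" and v: "v \<in> elts (D B) s" "v' \<in> elts (D B) s" for u v v'
  proof (rule A.D_hom_eq[OF _ phi_outer_hom1[OF k] hom_mult_fun[OF _ phi_outer_hom1[OF k] phi_outer_hom1[OF k]] _ u])
    fix n i a assume i: "i - int n = r" and a: "a \<in> elts (lev A n) i"
    have "phi_inner k s n i a \<in> hom (grp (D B) s) (grp (D (smash A B)) k)"
      by (rule phi_inner_hom[OF a]) (use i k in auto)
    then show "phi_outer k r s (xi A n i a) (v \<otimes>\<^bsub>grp (D B) s\<^esub> v') =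
       phi_outer k r s (xi A n i a) v \<otimes>\<^bsub>grp (D (smash A B)) k\<^esub> phi_outer k r s (xi A n i a) v'"
      using v by (simp add: phi_outer_xi[OF k i a] hom_mult)
  qed (use v in auto)
  moreover have "phi_outer k r s u v \<in> elts (D (smash A B)) k" if "u \<in> elts (D A) r" "v \<in> elts (D B) s" for u v
    using hom_carrier[OF phi_outer_hom1[OF k that(2)]] that(1) by blast
  ultimately show ?thesis
    by (intro bihomI) (simp_all add: hom_mult[OF phi_outer_hom1[OF k]])
qed

lemma phi_alt: "phi A B k = ctensor_lift (grp (D (smash A B)) k) k (phi_outer k)"
  by (simp add: phi_def Let_def phi_outer_def[abs_def] phi_inner_def xi_smash_def phi_sign_def)

lemma phi_hom: "phi A B k \<in> hom (ctensor_grp (D A) (D B) k) (grp (D (smash A B)) k)"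
  unfolding phi_alt by (rule ctensor_lift_hom[OF _ _ _ phi_outer_bihom]) auto

lemma phi_ctens_xi:
  assumes "a \<in> elts (lev A n) i" "b \<in> elts (lev B m) j" and "i - int n = r" "j - int m = s" "r + s = k"
  shows "phi A B k (ctens (D A) (D B) r s (xi A n i a) (xi B m j b)) =
    xi_smash A B n i a m j b [^]\<^bsub>grp (D (smash A B)) k\<^esub> phi_sign n i m"
proof -
  have "phi A B k (ctens (D A) (D B) r s (xi A n i a) (xi B m j b)) = phi_outer k r s (xi A n i a) (xi B m j b)"
    unfolding phi_alt
    by (rule ctensor_lift_ctens[OF _ _ _ phi_outer_bihom])
       (use assms A.xi_closed B.xi_closed in auto)
  also have "\<dots> = xi_smash A B n i a m j b [^]\<^bsub>grp (D (smash A B)) k\<^esub> phi_sign n i m"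
    using phi_outer_xi[OF assms(5,3,1)] phi_inner_xi[OF assms(1) _ assms(4,2), of k] assms B.xi_closed by simp
  finally show ?thesis .
qed

lemma DD_hom_eq:
  assumes "group K" "f \<in> hom (ctensor_grp (D A) (D B) k) K" "g \<in> hom (ctensor_grp (D A) (D B) k) K"
    and "\<And>n i a m j b. i - int n + (j - int m) = k \<Longrightarrow> a \<in> elts (lev A n) i \<Longrightarrow> b \<in> elts (lev B m) j \<Longrightarrow>
      f (ctens (D A) (D B) (i - int n) (j - int m) (xi A n i a) (xi B m j b)) =
      g (ctens (D A) (D B) (i - int n) (j - int m) (xi A n i a) (xi B m j b))"
    and "x \<in> carrier (ctensor_grp (D A) (D B) k)"
  shows "f x = g x"
  by (rule ctensor_hom_eq[OF _ _ assms(1-3) A.spans_xi B.spans_xi _ assms(5)]) (use assms(4) in auto)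

lemma S_hom_eq:
  assumes "group K" "f \<in> hom (grp (D (smash A B)) k) K" "g \<in> hom (grp (D (smash A B)) k) K"
    and "\<And>\<theta> n i a m j b. i - int n + (j - int m) = k \<Longrightarrow> \<theta> permutes {..<n + m} \<Longrightarrow>
      a \<in> elts (lev A n) i \<Longrightarrow> b \<in> elts (lev B m) j \<Longrightarrow>
      f (xi (smash A B) (n + m) (i + j) (smash_elt A B \<theta> n i a m j b)) =
      g (xi (smash A B) (n + m) (i + j) (smash_elt A B \<theta> n i a m j b))"
    and "x \<in> elts (D (smash A B)) k"
  shows "f x = g x"
  by (rule hom_eq_on_span[OF _ assms(1) S.spans_D[unfolded grp_smash, OF spans_smash_elt] assms(2,3) _ assms(5)])
     (use assms(4) in auto)

subsection \<open>The inverse\<close>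

definition psi_gen where
  "psi_gen k = (\<lambda>Day_Gen n i a m j b \<theta> \<Rightarrow>
     ctens (D A) (D B) (i - int n) (j - int m) (xi A n i a) (xi B m j b)
       [^]\<^bsub>ctensor_grp (D A) (D B) k\<^esub> (sign \<theta> * phi_sign n i m))"

lemma DD_ctens_closed:
  "a \<in> elts (lev A n) i \<Longrightarrow> b \<in> elts (lev B m) j \<Longrightarrow> i - int n + (j - int m) = k \<Longrightarrow>
    ctens (D A) (D B) (i - int n) (j - int m) (xi A n i a) (xi B m j b) \<in> carrier (ctensor_grp (D A) (D B) k)"
  by (intro ctens_closed A.xi_closed B.xi_closed) auto

lemma DD_ctens_pow:
  "u \<in> elts (D A) r \<Longrightarrow> v \<in> elts (D B) s \<Longrightarrow> r + s = k \<Longrightarrow>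
    ctens (D A) (D B) r s (u [^]\<^bsub>grp (D A) r\<^esub> (c::int)) (v [^]\<^bsub>grp (D B) s\<^esub> (d::int)) =
    ctens (D A) (D B) r s u v [^]\<^bsub>ctensor_grp (D A) (D B) k\<^esub> (c * d)"
proof -
  assume u: "u \<in> elts (D A) r" and v: "v \<in> elts (D B) s" and k: "r + s = k"
  interpret U: comm_group "grp (D A) r" by simp
  interpret K: comm_group "ctensor_grp (D A) (D B) k" by simp
  have b: "bihom (grp (D A) r) (grp (D B) s) (ctensor_grp (D A) (D B) k) (ctens (D A) (D B) r s)"
    by (rule ctens_bihom) (use k in auto)
  show ?thesis
    using hom_int_pow[OF bihom_hom1[OF b v] u, of c] hom_int_pow[OF bihom_hom2[OF b] v, of "u [^]\<^bsub>grp (D A) r\<^esub> c" d]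
      bihom_closed[OF b u v] u by (simp add: K.int_pow_pow)
qed

text \<open>In the coequaliser relation \<xi> forgets both suspensions, so only signs remain:
  (-1)^{mn} from the block twist, (-1)^{im} from the relation and
  \<open>phi_sign (m + n) (int m + i) p\<close> multiply to
  \<open>phi_sign n i (m + p)\<close>.\<close>

lemma psi_balanced:
  assumes k: "t - int q = k"
  shows "smash_balanced A B (ctensor_grp (D A) (D B) k) q t (psi_gen k)"
  unfolding smash_balanced_def day_balanced_def psi_gen_def day_gen.case
proof (intro allI impI conjI ballI)
  let ?K = "ctensor_grp (D A) (D B) k"
  interpret K: comm_group ?K by simp
  fix n m i j \<theta> assume *: "n + m = q" "i + j = t" "\<theta> permutes {..<q}"
  have k': "i - int n + (j - int m) = k" using * k by auto
  show "bihom (grp (lev A n) i) (grp (lev B m) j) ?K (\<lambda>a b.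
      ctens (D A) (D B) (i - int n) (j - int m) (xi A n i a) (xi B m j b) [^]\<^bsub>?K\<^esub> (sign \<theta> * phi_sign n i m))"
    by (intro bihom_pow bihom_compose[where w="\<lambda>x. x", OF ctens_bihom A.xi_hom[OF refl] B.xi_hom[OF refl] hom_id])
       (use k' in auto)
  fix a b \<alpha> \<beta> assume a: "a \<in> elts (lev A n) i" and b: "b \<in> elts (lev B m) j"
    and \<alpha>: "\<alpha> permutes {..<n}" and \<beta>: "\<beta> permutes {..<m}"
  have "sign (\<theta> \<circ> box n m \<alpha> \<beta>) = sign \<theta> * (sign \<alpha> * sign \<beta>)"
    using * by (simp add: sign_compose permutes_permutation[OF *(3)]
        permutes_permutation[OF box_permutes[OF \<alpha> \<beta> refl]] sign_box[OF \<alpha> \<beta>])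
  then show "ctens (D A) (D B) (i - int n) (j - int m) (xi A n i a) (xi B m j b)
      [^]\<^bsub>?K\<^esub> (sign (\<theta> \<circ> box n m \<alpha> \<beta>) * phi_sign n i m) =
    ctens (D A) (D B) (i - int n) (j - int m) (xi A n i (pact A n \<alpha> i a)) (xi B m j (pact B m \<beta> j b))
      [^]\<^bsub>?K\<^esub> (sign \<theta> * phi_sign n i m)"
    using DD_ctens_closed[OF a b k']
    by (simp add: A.xi_pact[OF \<alpha> a refl] B.xi_pact[OF \<beta> b refl]
        DD_ctens_pow[OF A.xi_closed[OF a refl] B.xi_closed[OF b refl] k'] K.int_pow_pow mult_ac)
next
  let ?K = "ctensor_grp (D A) (D B) k"
  interpret K: comm_group ?K by simp
  fix n i m p j \<phi> a b
  assume *: "n + m + p = q" "i + int m + j = t" "\<phi> permutes {..<q}"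
    and a: "a \<in> elts (lev A n) i" and b: "b \<in> elts (lev B p) j"
  have k': "i - int n + (j - int p) = k" using * k by auto
  have mp: "box (m + n) p (twist m n) id permutes {..<q}"
    using perm_comp_twist[OF permutes_id *(1)] by simp
  have "sign (\<phi> \<circ> box (m + n) p (twist m n) id) = sign \<phi> * ksign (int m * int n)"
    by (simp add: sign_compose permutes_permutation[OF *(3)] permutes_permutation[OF mp]
        sign_box[OF twist_permutes[OF refl] permutes_id] sign_twist)
  moreover have "phi_sign n i (m + p) = ksign (int m * int n) * phi_sign (m + n) (int m + i) p * ksign (i * int m)"
    by (auto simp: phi_sign_def ksign_def)
  ultimately show "ctens (D A) (D B) (i - int n) (int m + j - int (m + p)) (xi A n i a)
      (xi B (m + p) (int m + j) (sig B m p j b)) [^]\<^bsub>?K\<^esub> (sign \<phi> * phi_sign n i (m + p)) =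
    (ctens (D A) (D B) (int m + i - int (m + n)) (j - int p) (xi A (m + n) (int m + i) (sig A m n i a)) (xi B p j b)
      [^]\<^bsub>?K\<^esub> (sign (\<phi> \<circ> box (m + n) p (twist m n) id) * phi_sign (m + n) (int m + i) p)) [^]\<^bsub>?K\<^esub> ksign (i * int m)"
    using DD_ctens_closed[OF a b k']
    by (simp add: A.xi_sig[OF a] B.xi_sig[OF b] K.int_pow_pow mult_ac)
qed

definition psi where
  "psi k = D_lift (ctensor_grp (D A) (D B) k) k
     (\<lambda>q t. smash_lift (ctensor_grp (D A) (D B) k) (psi_gen k))"

lemma psi_smash_lift:
  assumes k: "t - int q = k"
  shows "smash_lift (ctensor_grp (D A) (D B) k) (psi_gen k) \<in> hom (smash_grp A B q t) (ctensor_grp (D A) (D B) k)"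
    and "n + m = q \<Longrightarrow> i + j = t \<Longrightarrow> \<theta> permutes {..<q} \<Longrightarrow> a \<in> elts (lev A n) i \<Longrightarrow> b \<in> elts (lev B m) j \<Longrightarrow>
      smash_lift (ctensor_grp (D A) (D B) k) (psi_gen k) (smash_elt A B \<theta> n i a m j b) =
      ctens (D A) (D B) (i - int n) (j - int m) (xi A n i a) (xi B m j b)
       [^]\<^bsub>ctensor_grp (D A) (D B) k\<^esub> (sign \<theta> * phi_sign n i m)"
  using smash_lift_hom[OF _ psi_balanced[OF k]] smash_lift_elt[OF _ psi_balanced[OF k]]
  by (simp_all add: psi_gen_def)

text \<open>Composing \<theta> with \<alpha> multiplies its sign by that of \<alpha>. Suspension
  replaces \<theta> by 1 \<box> \<theta>, of the same sign, and raises level and degree of a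
  equally, which \<open>phi_sign\<close> does not notice.\<close>

lemma psi_compatible:
  "compatible (smash A B) (ctensor_grp (D A) (D B) k) k
     (\<lambda>q t. smash_lift (ctensor_grp (D A) (D B) k) (psi_gen k))"
  unfolding compatible_def
proof (intro allI impI conjI ballI)
  let ?K = "ctensor_grp (D A) (D B) k"
  let ?L = "smash_lift ?K (psi_gen k)"
  interpret K: comm_group ?K by simp
  fix q t assume k: "t - int q = k"
  show "?L \<in> hom (grp (lev (smash A B) q) t) ?K" using psi_smash_lift(1)[OF k] by simp
  fix x assume "x \<in> elts (lev (smash A B) q) t"
  then have x: "x \<in> carrier (smash_grp A B q t)" by simp
  show "?L (pact (smash A B) q \<alpha> t x) = ?L x [^]\<^bsub>?K\<^esub> sign \<alpha>" if \<alpha>: "\<alpha> permutes {..<q}" for \<alpha>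
  proof (rule smash_hom_eq[OF _ hom_compose_fun[OF smash_pact_hom[OF \<alpha>] psi_smash_lift(1)[OF k]]
        hom_pow[OF _ psi_smash_lift(1)[OF k]] _ x])
    fix \<theta> n i a m j b assume *: "n + m = q" "i + j = t" "\<theta> permutes {..<q}"
        and a: "a \<in> elts (lev A n) i" and b: "b \<in> elts (lev B m) j"
    have "i - int n + (j - int m) = k" using * k by auto
    note c = DD_ctens_closed[OF a b this]
    show "?L (pact (smash A B) q \<alpha> t (smash_elt A B \<theta> n i a m j b)) =
        ?L (smash_elt A B \<theta> n i a m j b) [^]\<^bsub>?K\<^esub> sign \<alpha>"
      unfolding smash_pact_elt[OF \<alpha> * a b] psi_smash_lift(2)[OF k * a b]
        psi_smash_lift(2)[OF k *(1,2) permutes_compose[OF *(3) \<alpha>] a b]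
      using c by (simp add: K.int_pow_pow sign_compose permutes_permutation[OF *(3)] permutes_permutation[OF \<alpha>] mult_ac)
  qed auto
  show "?L (sig (smash A B) l q t x) = ?L x" for l
  proof (rule smash_hom_eq[OF _ hom_compose_fun[OF smash_sig_hom psi_smash_lift(1)] psi_smash_lift(1)[OF k] _ x])
    show kl: "int l + t - int (l + q) = k" using k by simp
    fix \<theta> n i a m j b assume *: "n + m = q" "i + j = t" "\<theta> permutes {..<q}"
        and a: "a \<in> elts (lev A n) i" and b: "b \<in> elts (lev B m) j"
    have l\<theta>: "box l q id \<theta> permutes {..<l + q}" by (rule box_permutes[OF permutes_id *(3) refl])
    have sa: "sig A l n i a \<in> elts (lev A (l + n)) (int l + i)" by (rule A.sig_closed[OF a]) auto
    have e: "phi_sign (l + n) (int l + i) m = phi_sign n i m" by (auto simp: phi_sign_def ksign_def)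
    have "l + n + m = l + q" "int l + i + j = int l + t" using * by auto
    from psi_smash_lift(2)[OF kl this l\<theta> sa b]
    show "?L (sig (smash A B) l q t (smash_elt A B \<theta> n i a m j b)) = ?L (smash_elt A B \<theta> n i a m j b)"
      unfolding smash_sig_elt[OF * a b] psi_smash_lift(2)[OF k * a b]
      by (simp add: A.xi_sig[OF a] e sign_box[OF permutes_id *(3)])
  qed auto
qed

lemma psi_hom: "psi k \<in> hom (grp (D (smash A B)) k) (ctensor_grp (D A) (D B) k)"
  unfolding psi_def by (rule S.D_lift_hom[OF _ psi_compatible]) simp

lemma psi_xi:
  assumes "i - int n + (j - int m) = k" "\<theta> permutes {..<n + m}" "a \<in> elts (lev A n) i" "b \<in> elts (lev B m) j"
  shows "psi k (xi (smash A B) (n + m) (i + j) (smash_elt A B \<theta> n i a m j b)) =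
      ctens (D A) (D B) (i - int n) (j - int m) (xi A n i a) (xi B m j b)
       [^]\<^bsub>ctensor_grp (D A) (D B) k\<^esub> (sign \<theta> * phi_sign n i m)"
proof -
  have k: "i + j - int (n + m) = k" using assms(1) by simp
  have "psi k (xi (smash A B) (n + m) (i + j) (smash_elt A B \<theta> n i a m j b)) =
      smash_lift (ctensor_grp (D A) (D B) k) (psi_gen k) (smash_elt A B \<theta> n i a m j b)"
    unfolding psi_def
    by (rule S.D_lift_xi[OF _ psi_compatible k]) (use smash_elt_closed[OF assms(2) refl refl assms(3,4)] in simp_all)
  then show ?thesis using psi_smash_lift(2)[OF k refl refl assms(2-4)] by simp
qed

lemma psi_phi: "x \<in> carrier (ctensor_grp (D A) (D B) k) \<Longrightarrow> psi k (phi A B k x) = x"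
proof (rule DD_hom_eq[OF _ hom_compose_fun[OF phi_hom psi_hom] hom_id])
  interpret K: comm_group "ctensor_grp (D A) (D B) k" by simp
  fix n i a m j b assume k: "i - int n + (j - int m) = k" and a: "a \<in> elts (lev A n) i" and b: "b \<in> elts (lev B m) j"
  show "psi k (phi A B k (ctens (D A) (D B) (i - int n) (j - int m) (xi A n i a) (xi B m j b))) =
     ctens (D A) (D B) (i - int n) (j - int m) (xi A n i a) (xi B m j b)"
    unfolding phi_ctens_xi[OF a b refl refl k]
    using hom_int_pow[OF psi_hom xi_smash_closed[OF a b k], of "phi_sign n i m"]
      psi_xi[OF k permutes_id a b] DD_ctens_closed[OF a b k]
    by (simp add: xi_smash_def K.int_pow_pow)
qed auto

lemma phi_psi: "x \<in> elts (D (smash A B)) k \<Longrightarrow> phi A B k (psi k x) = x"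
proof (rule S_hom_eq[OF _ hom_compose_fun[OF psi_hom phi_hom] hom_id])
  interpret K: comm_group "grp (D (smash A B)) k" by simp
  fix \<theta> n i a m j b assume k: "i - int n + (j - int m) = k" and \<theta>: "\<theta> permutes {..<n + m}"
    and a: "a \<in> elts (lev A n) i" and b: "b \<in> elts (lev B m) j"
  have k': "i + j - int (n + m) = k" using k by simp
  \<comment> \<open>The two factors \<open>phi_sign\<close> cancel; the remaining sign of \<theta>
    is what \<open>xi_smash_elt\<close> produces from \<theta>.\<close>
  have e: "phi_sign n i m * (sign \<theta> * phi_sign n i m) = sign \<theta>"
    by (simp add: mult.left_commute)
  show "phi A B k (psi k (xi (smash A B) (n + m) (i + j) (smash_elt A B \<theta> n i a m j b))) =
     xi (smash A B) (n + m) (i + j) (smash_elt A B \<theta> n i a m j b)"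
    unfolding psi_xi[OF k \<theta> a b] unfolding xi_smash_elt[OF \<theta> refl refl k' a b]
    using hom_int_pow[OF phi_hom DD_ctens_closed[OF a b k], of "sign \<theta> * phi_sign n i m"]
      phi_ctens_xi[OF a b refl refl k] xi_smash_closed[OF a b k]
    by (simp add: K.int_pow_pow e)
qed auto

lemma phi_iso: "phi A B k \<in> iso (ctensor_grp (D A) (D B) k) (grp (D (smash A B)) k)"
  unfolding iso_def
  using phi_hom psi_phi phi_psi hom_carrier[OF phi_hom[of k]] hom_carrier[OF psi_hom[of k]]
  by (auto intro!: bij_betw_byWitness[where f'="psi k"])

lemma bd_xi_smash:
  assumes a: "a \<in> elts (lev A n) i" and b: "b \<in> elts (lev B m) j" and k: "i - int n + (j - int m) = k"
  shows "bd (D (smash A B)) k (xi_smash A B n i a m j b) =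
    (xi_smash A B n (i - 1) (bd (lev A n) i a) m j b \<otimes>\<^bsub>grp (D (smash A B)) (k - 1)\<^esub>
     xi_smash A B n i a m (j - 1) (bd (lev B m) j b) [^]\<^bsub>grp (D (smash A B)) (k - 1)\<^esub> ksign i)
       [^]\<^bsub>grp (D (smash A B)) (k - 1)\<^esub> ksign (int (n + m))"
proof -
  have kk: "i + j - int (n + m) = k" "i + j - 1 - int (n + m) = k - 1" using k by auto
  have da: "bd (lev A n) i a \<in> elts (lev A n) (i - 1)" and db: "bd (lev B m) j b \<in> elts (lev B m) (j - 1)"
    using A.bd_closed[OF a] B.bd_closed[OF b] by auto
  have c: "smash_elt A B id n (i - 1) (bd (lev A n) i a) m j b \<in> carrier (smash_grp A B (n + m) (i + j - 1))"
    "smash_elt A B id n i a m (j - 1) (bd (lev B m) j b) \<in> carrier (smash_grp A B (n + m) (i + j - 1))"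
    using a b da db by (auto intro!: smash_elt_closed permutes_id)
  note X = S.xi_hom[OF kk(2), unfolded grp_smash]
  have d: "i - 1 + j = i + j - 1" "i + (j - 1) = i + j - 1" by auto
  show ?thesis
    unfolding xi_smash_def d
    using S.bd_xi[of "smash_elt A B id n i a m j b" "n + m" "i + j" k]
      smash_bd_elt[OF refl refl permutes_id a b] smash_elt_closed[OF permutes_id refl refl a b] kk(1) c
    by (simp add: hom_mult[OF X] hom_int_pow[OF X] group.int_pow_closed)
qed

text \<open>Here d\<xi>(a) = (-1)^n \<xi>(da), d\<xi>(b) = (-1)^m \<xi>(db), and \<xi>(a) has degree
  i - n; on the other side the total level gives (-1)^{n+m} and the Leibniz rule (-1)^i. The terms
  with da agree because lowering i by one changes \<open>phi_sign n i m\<close> by (-1)^m, those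
  with db because (-1)^m (-1)^{i-n} equals (-1)^i (-1)^{n+m}.\<close>

lemma phi_bd:
  assumes "x \<in> carrier (ctensor_grp (D A) (D B) k)"
  shows "phi A B (k - 1) (bd (ctensor (D A) (D B)) k x) = bd (D (smash A B)) k (phi A B k x)"
proof (rule DD_hom_eq[OF _ hom_compose_fun[OF ctensor_bd_hom phi_hom] hom_compose_fun[OF phi_hom precomplex_bd[OF S.precomplex_D refl]] _ assms])
  let ?K = "ctensor_grp (D A) (D B) (k - 1)" and ?L = "grp (D (smash A B)) (k - 1)"
  interpret K: comm_group ?K by simp
  interpret L: comm_group ?L by simp
  fix n i a m j b assume k: "i - int n + (j - int m) = k" and a: "a \<in> elts (lev A n) i" and b: "b \<in> elts (lev B m) j"
  have da: "bd (lev A n) i a \<in> elts (lev A n) (i - 1)" and db: "bd (lev B m) j b \<in> elts (lev B m) (j - 1)"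
    using A.bd_closed[OF a] B.bd_closed[OF b] by auto
  have e: "i - 1 - int n = i - int n - 1" "j - 1 - int m = j - int m - 1" by auto
  have k1: "i - 1 - int n + (j - int m) = k - 1" "i - int n + (j - 1 - int m) = k - 1" using k by auto
  define X where "X = xi_smash A B n (i - 1) (bd (lev A n) i a) m j b"
  define Y where "Y = xi_smash A B n i a m (j - 1) (bd (lev B m) j b)"
  have XY: "X \<in> carrier ?L" "Y \<in> carrier ?L"
    unfolding X_def Y_def using xi_smash_closed[OF da b k1(1)] xi_smash_closed[OF a db k1(2)] by auto
  define U where "U = ctens (D A) (D B) (i - int n - 1) (j - int m) (xi A n (i - 1) (bd (lev A n) i a)) (xi B m j b)"
  define V where "V = ctens (D A) (D B) (i - int n) (j - int m - 1) (xi A n i a) (xi B m (j - 1) (bd (lev B m) j b))"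
  have UV: "U \<in> carrier ?K" "V \<in> carrier ?K"
    unfolding U_def V_def using DD_ctens_closed[OF da b k1(1)] DD_ctens_closed[OF a db k1(2)] by (auto simp: e)
  have UV': "phi A B (k - 1) U = X [^]\<^bsub>?L\<^esub> phi_sign n (i - 1) m" "phi A B (k - 1) V = Y [^]\<^bsub>?L\<^esub> phi_sign n i m"
    unfolding U_def V_def X_def Y_def
    by (rule phi_ctens_xi[OF da b] phi_ctens_xi[OF a db]; use k in simp)+
  have u: "ctens (D A) (D B) (i - int n - 1) (j - int m) (bd (D A) (i - int n) (xi A n i a)) (xi B m j b) = U [^]\<^bsub>?K\<^esub> ksign (int n)"
  proof -
    \<comment> \<open>The exponent 1 on the second factor brings the term into the form of
      \<open>DD_ctens_pow\<close>.\<close>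
    have "ctens (D A) (D B) (i - int n - 1) (j - int m) (xi A n (i - 1) (bd (lev A n) i a) [^]\<^bsub>grp (D A) (i - int n - 1)\<^esub> ksign (int n))
       (xi B m j b [^]\<^bsub>grp (D B) (j - int m)\<^esub> (1::int)) = U [^]\<^bsub>?K\<^esub> (ksign (int n) * 1)"
      unfolding U_def
      by (rule DD_ctens_pow[OF A.xi_closed[OF da] B.xi_closed[OF b]]) (use k in auto)
    then show ?thesis using B.xi_closed[OF b refl] by (simp add: A.bd_xi[OF a refl] group.int_pow_1)
  qed
  have v: "ctens (D A) (D B) (i - int n) (j - int m - 1) (xi A n i a) (bd (D B) (j - int m) (xi B m j b)) = V [^]\<^bsub>?K\<^esub> ksign (int m)"
  proof -
    have "ctens (D A) (D B) (i - int n) (j - int m - 1) (xi A n i a [^]\<^bsub>grp (D A) (i - int n)\<^esub> (1::int))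
       (xi B m (j - 1) (bd (lev B m) j b) [^]\<^bsub>grp (D B) (j - int m - 1)\<^esub> ksign (int m)) = V [^]\<^bsub>?K\<^esub> (1 * ksign (int m))"
      unfolding V_def
      by (rule DD_ctens_pow[OF A.xi_closed[OF a] B.xi_closed[OF db]]) (use k in auto)
    then show ?thesis using A.xi_closed[OF a refl] by (simp add: B.bd_xi[OF b refl] group.int_pow_1)
  qed
  have "bd (ctensor (D A) (D B)) k (ctens (D A) (D B) (i - int n) (j - int m) (xi A n i a) (xi B m j b))
     = U [^]\<^bsub>?K\<^esub> ksign (int n) \<otimes>\<^bsub>?K\<^esub> (V [^]\<^bsub>?K\<^esub> ksign (int m)) [^]\<^bsub>?K\<^esub> ksign (i - int n)"
    unfolding u[symmetric] v[symmetric]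
    by (rule ctensor_bd) (use k A.xi_closed[OF a] B.xi_closed[OF b] in auto)
  then have "phi A B (k - 1) (bd (ctensor (D A) (D B)) k (ctens (D A) (D B) (i - int n) (j - int m) (xi A n i a) (xi B m j b)))
     = (X [^]\<^bsub>?L\<^esub> phi_sign n (i - 1) m) [^]\<^bsub>?L\<^esub> ksign (int n) \<otimes>\<^bsub>?L\<^esub>
       ((Y [^]\<^bsub>?L\<^esub> phi_sign n i m) [^]\<^bsub>?L\<^esub> ksign (int m)) [^]\<^bsub>?L\<^esub> ksign (i - int n)"
    using UV by (simp add: hom_mult[OF phi_hom] hom_int_pow[OF phi_hom] UV' K.int_pow_pow L.int_pow_pow XY mult.assoc)
  also have "\<dots> = ((X \<otimes>\<^bsub>?L\<^esub> Y [^]\<^bsub>?L\<^esub> ksign i) [^]\<^bsub>?L\<^esub> ksign (int (n + m))) [^]\<^bsub>?L\<^esub> phi_sign n i m"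
  proof -
    have "phi_sign n (i - 1) m * ksign (int n) = ksign (int (n + m)) * phi_sign n i m"
      "phi_sign n i m * ksign (int m) * ksign (i - int n) = ksign i * ksign (int (n + m)) * phi_sign n i m"
      by (auto simp: phi_sign_def ksign_def)
    then show ?thesis using XY by (simp only: L.int_pow_pow L.int_pow_distrib L.int_pow_closed)
  qed
  also have "\<dots> = bd (D (smash A B)) k (xi_smash A B n i a m j b) [^]\<^bsub>?L\<^esub> phi_sign n i m"
    unfolding X_def Y_def bd_xi_smash[OF a b k] ..
  also have "\<dots> = bd (D (smash A B)) k (phi A B k (ctens (D A) (D B) (i - int n) (j - int m) (xi A n i a) (xi B m j b)))"
    unfolding phi_ctens_xi[OF a b refl refl k]
    by (rule hom_int_pow[OF precomplex_bd[OF S.precomplex_D refl] xi_smash_closed[OF a b k], symmetric]) auto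
  finally show "phi A B (k - 1) (bd (ctensor (D A) (D B)) k (ctens (D A) (D B) (i - int n) (j - int m) (xi A n i a) (xi B m j b))) = \<dots>" .
qed auto

lemma phi_chain_iso: "chain_iso (ctensor (D A) (D B)) (D (smash A B)) (phi A B)"
  using phi_hom phi_iso phi_bd by (simp add: chain_iso_def chain_map_def)

end


section \<open>Naturality, symmetry and unit laws\<close>

section \<open>Compatibility with morphisms, twists and units\<close>

lemma premorphism_comp:
  assumes "premorphism A B f" "premorphism B C g"
  shows "premorphism A C (g \<circ>\<^sub>s f)"
proof -
  have "f n i a \<in> elts (lev B n) i" if "a \<in> elts (lev A n) i" for n i a
    using assms(1) that by (auto simp: premorphism_def hom_def)
  then show ?thesis
    using assms unfolding premorphism_def spectrum_comp_def chain_comp_def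
    by (intro conjI allI ballI impI hom_compose[of "f _ _" _ "grp (lev B _) _"]) auto
qed

lemma prespectrum_mapI:
  "prespectrum A \<Longrightarrow> prespectrum B \<Longrightarrow> premorphism A B f \<Longrightarrow> prespectrum_map A B f"
  by (simp add: prespectrum_map_def prespectrum_map_axioms_def)

lemma prespectrum_pairI: "prespectrum A \<Longrightarrow> prespectrum B \<Longrightarrow> prespectrum_pair A B"
  by (simp add: prespectrum_pair_def)

context prespectrum_pair
begin

text \<open>The common criterion for \<open>smash_map\<close>, \<open>sp_twist\<close>,
  \<open>sp_lunit\<close> and \<open>sp_assoc\<close>: all are lifts of values on generators, so
  commutation with permutations and suspensions need only be seen on these values.\<close>

lemma smash_lift_premorphism:
  assumes C: "prespectrum C"
    and bal: "\<And>q t. smash_balanced A B (grp (lev C q) t) q t (F q t)"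
    and pact: "\<And>q t n i a m j b \<theta> \<gamma>. n + m = q \<Longrightarrow> i + j = t \<Longrightarrow> \<theta> permutes {..<q} \<Longrightarrow>
      a \<in> elts (lev A n) i \<Longrightarrow> b \<in> elts (lev B m) j \<Longrightarrow> \<gamma> permutes {..<q} \<Longrightarrow>
      F q t (Day_Gen n i a m j b (\<gamma> \<circ> \<theta>)) = pact C q \<gamma> t (F q t (Day_Gen n i a m j b \<theta>))"
    and sig: "\<And>q t n i a m j b \<theta> l. n + m = q \<Longrightarrow> i + j = t \<Longrightarrow> \<theta> permutes {..<q} \<Longrightarrow>
      a \<in> elts (lev A n) i \<Longrightarrow> b \<in> elts (lev B m) j \<Longrightarrow>
      F (l + q) (int l + t) (Day_Gen (l + n) (int l + i) (sig A l n i a) m j b (box l q id \<theta>)) =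
        sig C l q t (F q t (Day_Gen n i a m j b \<theta>))"
  shows "premorphism (smash A B) C (\<lambda>q t. smash_lift (grp (lev C q) t) (F q t))"
proof -
  interpret C: prespectrum C by fact
  note hom = smash_lift_hom[OF C.lev_group bal] and elt = smash_lift_elt[OF C.lev_group bal]
  have *: "smash_lift (grp (lev C q) t) (F q t) (pact (smash A B) q \<gamma> t x) =
      pact C q \<gamma> t (smash_lift (grp (lev C q) t) (F q t) x)"
    if "x \<in> carrier (smash_grp A B q t)" "\<gamma> permutes {..<q}" for q t x \<gamma>
    by (rule smash_hom_eq[OF _ hom_compose_fun[OF smash_pact_hom hom] hom_compose_fun[OF hom C.pact_hom] _ that(1)])
       (use that(2) in \<open>auto simp: smash_pact_elt elt permutes_compose intro!: pact\<close>)
  have **: "smash_lift (grp (lev C (l + q)) (int l + t)) (F (l + q) (int l + t)) (sig (smash A B) l q t x) =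
      sig C l q t (smash_lift (grp (lev C q) t) (F q t) x)"
    if "x \<in> carrier (smash_grp A B q t)" for l q t x
  proof (rule smash_hom_eq[OF _ hom_compose_fun[OF smash_sig_hom hom] hom_compose_fun[OF hom C.sig_hom'] _ that])
    fix \<theta> n i a m j b assume *: "n + m = q" "i + j = t" "\<theta> permutes {..<q}"
        and a: "a \<in> elts (lev A n) i" and b: "b \<in> elts (lev B m) j"
    have "smash_lift (grp (lev C (l + q)) (int l + t)) (F (l + q) (int l + t))
        (smash_elt A B (box l q id \<theta>) (l + n) (int l + i) (sig A l n i a) m j b) =
      F (l + q) (int l + t) (Day_Gen (l + n) (int l + i) (sig A l n i a) m j b (box l q id \<theta>))"
      by (rule elt) (use * b A.sig_closed[OF a] box_permutes[OF permutes_id *(3) refl] in auto)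
    then show "smash_lift (grp (lev C (l + q)) (int l + t)) (F (l + q) (int l + t))
        (sig (smash A B) l q t (smash_elt A B \<theta> n i a m j b)) =
      sig C l q t (smash_lift (grp (lev C q) t) (F q t) (smash_elt A B \<theta> n i a m j b))"
      unfolding smash_sig_elt[OF * a b] elt[OF * a b] using sig[OF * a b] by simp
  qed auto
  show ?thesis using hom * ** by (simp add: premorphism_def)
qed

lemma D_map_xi_smash:
  assumes C: "prespectrum C" and h: "premorphism (smash A B) C h"
    and "a \<in> elts (lev A n) i" "b \<in> elts (lev B m) j" "i - int n + (j - int m) = k"
  shows "D_map C h k (xi_smash A B n i a m j b) =
    xi C (n + m) (i + j) (h (n + m) (i + j) (smash_elt A B id n i a m j b))"
proof -
  interpret h: prespectrum_map "smash A B" C h by (rule prespectrum_mapI[OF S.prespectrum_axioms C h])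
  show ?thesis unfolding xi_smash_def
    by (rule h.D_map_xi) (use assms smash_elt_closed[OF permutes_id refl refl] in auto)
qed

text \<open>Reduces each coherence law to evaluating \<open>h\<close> at \<iota>_*(a \<otimes> b)
  and comparing signs.\<close>

lemma D_map_phi:
  assumes C: "prespectrum C" and h: "premorphism (smash A B) C h"
    and a: "a \<in> elts (lev A n) i" and b: "b \<in> elts (lev B m) j"
    and k: "i - int n = r" "j - int m = s" "r + s = k"
  shows "D_map C h k (phi A B k (ctens (D A) (D B) r s (xi A n i a) (xi B m j b))) =
    xi C (n + m) (i + j) (h (n + m) (i + j) (smash_elt A B id n i a m j b)) [^]\<^bsub>grp (D C) k\<^esub> phi_sign n i m"
proof -
  interpret h: prespectrum_map "smash A B" C h by (rule prespectrum_mapI[OF S.prespectrum_axioms C h])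
  have k': "i - int n + (j - int m) = k" using k by simp
  show ?thesis
    unfolding phi_ctens_xi[OF a b k] D_map_xi_smash[OF C h a b k', symmetric]
    by (rule hom_int_pow[OF h.D_map_hom xi_smash_closed[OF a b k']]) auto
qed

end

subsection \<open>Naturality\<close>

locale prespectrum_pair_map =
  f: prespectrum_map A A' f + g: prespectrum_map B B' g
  for A :: "'a symspec" and A' :: "'c symspec" and f and B :: "'b symspec" and B' :: "'d symspec" and g
begin

sublocale P: prespectrum_pair A B
  by (rule prespectrum_pairI) unfold_locales

sublocale P': prespectrum_pair A' B'
  by (rule prespectrum_pairI) unfold_locales

lemma smash_map_balanced:
  "smash_balanced A B (smash_grp A' B' q t) q t
     (\<lambda>Day_Gen n i a m j b \<theta> \<Rightarrow> smash_elt A' B' \<theta> n i (f n i a) m j (g m j b))"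
  unfolding smash_balanced_def day_balanced_def day_gen.case
proof (intro allI impI conjI ballI)
  fix n m i j \<theta> assume *: "n + m = q" "i + j = t" "\<theta> permutes {..<q}"
  show "bihom (grp (lev A n) i) (grp (lev B m) j) (smash_grp A' B' q t)
      (\<lambda>a b. smash_elt A' B' \<theta> n i (f n i a) m j (g m j b))"
    by (rule bihom_compose[where w="\<lambda>x. x", OF P'.smash_elt_bihom[OF *(3,1,2)] f.f_hom g.f_hom hom_id])
qed (auto simp: f.f_pact g.f_pact f.f_sig g.f_sig f.f_closed g.f_closed
      P'.smash_elt_box P'.smash_elt_sig[OF refl refl])

lemma smash_map_premorphism: "premorphism (smash A B) (smash A' B') (smash_map A' B' f g)"
proof -
  let ?F = "\<lambda>(q::nat) (t::int). \<lambda>Day_Gen n i a m j b \<theta> \<Rightarrow> smash_elt A' B' \<theta> n i (f n i a) m j (g m j b)"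
  have "premorphism (smash A B) (smash A' B') (\<lambda>q t. smash_lift (grp (lev (smash A' B') q) t) (?F q t))"
    by (rule P.smash_lift_premorphism[OF P'.prespectrum_smash])
       (auto simp: smash_map_balanced P'.smash_pact_elt[OF _ refl refl] P'.smash_sig_elt[OF refl refl]
          f.f_closed g.f_closed f.f_sig)
  then show ?thesis by (simp add: smash_map_def[abs_def])
qed

lemma smash_map_elt:
  assumes "n + m = q" "i + j = t" "\<theta> permutes {..<q}" "a \<in> elts (lev A n) i" "b \<in> elts (lev B m) j"
  shows "smash_map A' B' f g q t (smash_elt A B \<theta> n i a m j b) = smash_elt A' B' \<theta> n i (f n i a) m j (g m j b)"
  using P.smash_lift_elt[OF _ smash_map_balanced assms] by (simp add: smash_map_def)

text \<open>f and g preserve levels and degrees, so both sides carry the same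
  \<open>phi_sign\<close>.\<close>

lemma phi_natural:
  assumes x: "x \<in> carrier (ctensor_grp (D A) (D B) k)"
  shows "D_map (smash A' B') (smash_map A' B' f g) k (phi A B k x) =
    phi A' B' k (ctensor_map (D A') (D B') (D_map A' f) (D_map B' g) k x)"
proof -
  interpret h: prespectrum_map "smash A B" "smash A' B'" "smash_map A' B' f g"
    by (rule prespectrum_mapI[OF P.prespectrum_smash P'.prespectrum_smash smash_map_premorphism])
  have ch: "ctensor_map (D A') (D B') (D_map A' f) (D_map B' g) k
      \<in> hom (ctensor_grp (D A) (D B) k) (ctensor_grp (D A') (D B') k)"
    by (rule ctensor_map_hom) (auto intro: f.D_map_hom g.D_map_hom)
  show ?thesis
  proof (rule P.DD_hom_eq[OF _ hom_compose_fun[OF P.phi_hom h.D_map_hom] hom_compose_fun[OF ch P'.phi_hom] _ x])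
    fix n i a m j b assume k: "i - int n + (j - int m) = k" and a: "a \<in> elts (lev A n) i" and b: "b \<in> elts (lev B m) j"
    have "ctensor_map (D A') (D B') (D_map A' f) (D_map B' g) k
       (ctens (D A) (D B) (i - int n) (j - int m) (xi A n i a) (xi B m j b)) =
      ctens (D A') (D B') (i - int n) (j - int m) (xi A' n i (f n i a)) (xi B' m j (g m j b))"
      by (subst ctensor_map_ctens[of "D A" "D B"])
         (use k a b in \<open>auto simp: f.D_map_xi g.D_map_xi
             intro: f.D_map_hom g.D_map_hom f.A.xi_closed g.A.xi_closed\<close>)
    then show "D_map (smash A' B') (smash_map A' B' f g) k
        (phi A B k (ctens (D A) (D B) (i - int n) (j - int m) (xi A n i a) (xi B m j b))) =
      phi A' B' k (ctensor_map (D A') (D B') (D_map A' f) (D_map B' g) k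
        (ctens (D A) (D B) (i - int n) (j - int m) (xi A n i a) (xi B m j b)))"
      using P.D_map_phi[OF P'.prespectrum_smash smash_map_premorphism a b refl refl k]
        P'.phi_ctens_xi[OF f.f_closed[OF a] g.f_closed[OF b] refl refl k]
      by (simp add: smash_map_elt[OF refl refl permutes_id a b] xi_smash_def)
  qed auto
qed

end

subsection \<open>Symmetry\<close>

lemma box_twist: "\<alpha> permutes {..<n} \<Longrightarrow> \<beta> permutes {..<m} \<Longrightarrow>
    box n m \<alpha> \<beta> \<circ> twist m n = twist m n \<circ> box m n \<beta> \<alpha>"
  by (auto simp: box_def twist_def fun_eq_iff permutes_lessThan trans_less_add1)

text \<open>On blocks m, p, n the left side passes through p, m, n and m, n, p to n, m, p, which is
  the order the right side reaches in one move.\<close>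

lemma twist_twist: "box (m + n) p (twist m n) id \<circ> twist p (m + n) \<circ> box (m + p) n (twist m p) id = twist (m + p) n"
  by (auto simp: box_def twist_def fun_eq_iff)

text \<open>Blocks l, m, n first become m, l, n and then l, n, m: moving l across m and back leaves
  the twist of m and n behind l.\<close>

lemma box_shift_twist_twist:
  "q = n + m \<Longrightarrow> box l q id \<theta> \<circ> twist m (l + n) \<circ> box (l + m) n (twist l m) id = box l q id (\<theta> \<circ> twist m n)"
proof
  fix x assume "q = n + m"
  consider "x < l" | "l \<le> x" "x < l + m" | "l + m \<le> x" "x < l + m + n" | "l + m + n \<le> x" by linarith
  then show "(box l q id \<theta> \<circ> twist m (l + n) \<circ> box (l + m) n (twist l m) id) x = box l q id (\<theta> \<circ> twist m n) x"
    using \<open>q = n + m\<close> by cases (auto simp: box_def twist_def add.commute[of l m])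
qed

context prespectrum_pair
begin

interpretation BA: prespectrum_pair B A
  by (rule prespectrum_pairI[OF B.prespectrum_axioms A.prespectrum_axioms])

text \<open>The twist turns the coequaliser relation for A and B into the one for B and A, read in
  the opposite direction. The signs (-1)^{km} of that relation, (-1)^{(m+i)k} of the twist and
  (-1)^{im} of the original relation multiply to (-1)^{i(m+k)}.\<close>

lemma sp_twist_balanced:
  "smash_balanced A B (smash_grp B A q t) q t
     (\<lambda>Day_Gen n i a m j b \<theta> \<Rightarrow>
          smash_elt B A (\<theta> \<circ> twist m n) m j b n i a [^]\<^bsub>smash_grp B A q t\<^esub> ksign (i * j))"
  unfolding smash_balanced_def day_balanced_def day_gen.case
proof (intro allI impI conjI ballI)
  fix n m i j \<theta> assume *: "n + m = q" "i + j = t" "\<theta> permutes {..<q}"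
  have \<theta>: "\<theta> \<circ> twist m n permutes {..<q}" "m + n = q" "j + i = t"
    using * by (auto intro!: permutes_compose twist_permutes)
  show "bihom (grp (lev A n) i) (grp (lev B m) j) (smash_grp B A q t)
      (\<lambda>a b. smash_elt B A (\<theta> \<circ> twist m n) m j b n i a [^]\<^bsub>smash_grp B A q t\<^esub> ksign (i * j))"
    by (rule bihom_pow[OF _ bihom_swap[OF BA.smash_elt_bihom[OF \<theta>]]]) simp
  fix a b \<alpha> \<beta> assume a: "a \<in> elts (lev A n) i" and b: "b \<in> elts (lev B m) j"
    and \<alpha>: "\<alpha> permutes {..<n}" and \<beta>: "\<beta> permutes {..<m}"
  have "smash_elt B A (\<theta> \<circ> box n m \<alpha> \<beta> \<circ> twist m n) m j b n i a =
      smash_elt B A (\<theta> \<circ> twist m n) m j (pact B m \<beta> j b) n i (pact A n \<alpha> i a)"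
    using BA.smash_elt_box[of "\<theta> \<circ> twist m n" m n, OF _ b a \<beta> \<alpha>] \<theta>
    by (simp add: comp_assoc box_twist[OF \<alpha> \<beta>])
  then show "smash_elt B A (\<theta> \<circ> box n m \<alpha> \<beta> \<circ> twist m n) m j b n i a [^]\<^bsub>smash_grp B A q t\<^esub> ksign (i * j) =
      smash_elt B A (\<theta> \<circ> twist m n) m j (pact B m \<beta> j b) n i (pact A n \<alpha> i a) [^]\<^bsub>smash_grp B A q t\<^esub> ksign (i * j)"
    by simp
next
  interpret G: comm_group "smash_grp B A q t" by simp
  fix n i m p k \<phi> a b assume *: "n + m + p = q" "i + int m + k = t" "\<phi> permutes {..<q}"
    and a: "a \<in> elts (lev A n) i" and b: "b \<in> elts (lev B p) k"
  let ?\<psi> = "\<phi> \<circ> box (m + n) p (twist m n) id \<circ> twist p (m + n)"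
  let ?X = "smash_elt B A (\<phi> \<circ> twist (m + p) n) (m + p) (int m + k) (sig B m p k b) n i a"
  have e: "p + m + n = q" "k + int m + i = t" "p + (m + n) = q" "m + p + n = q" "int m + k + i = t"
    using * by auto
  have \<psi>: "?\<psi> permutes {..<q}"
    by (rule permutes_compose[OF twist_permutes perm_comp_twist[OF *(3,1)]]) (use * in auto)
  have p: "\<phi> \<circ> twist (m + p) n permutes {..<q}"
    by (rule permutes_compose[OF twist_permutes *(3)]) (use * in auto)
  have X: "?X \<in> carrier (smash_grp B A q t)"
    by (rule BA.smash_elt_closed[OF p e(4,5) _ a]) (use B.sig_closed[OF b] in auto)
  have "smash_elt B A ?\<psi> p k b (m + n) (int m + i) (sig A m n i a) = ?X [^]\<^bsub>smash_grp B A q t\<^esub> ksign (k * int m)"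
    using BA.smash_elt_sig[OF e(1,2) \<psi> b a] twist_twist[of m n p] by (simp add: comp_assoc)
  moreover have "ksign (k * int m) * ksign ((int m + i) * k) * ksign (i * int m) = ksign (i * (int m + k))"
    by (auto simp: ksign_def)
  ultimately show "?X [^]\<^bsub>smash_grp B A q t\<^esub> ksign (i * (int m + k)) =
     (smash_elt B A ?\<psi> p k b (m + n) (int m + i) (sig A m n i a)
       [^]\<^bsub>smash_grp B A q t\<^esub> ksign ((int m + i) * k)) [^]\<^bsub>smash_grp B A q t\<^esub> ksign (i * int m)"
    using X by (simp add: G.int_pow_pow)
qed

lemma sp_twist_elt:
  assumes "n + m = q" "i + j = t" "\<theta> permutes {..<q}" "a \<in> elts (lev A n) i" "b \<in> elts (lev B m) j"
  shows "sp_twist A B q t (smash_elt A B \<theta> n i a m j b) =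
    smash_elt B A (\<theta> \<circ> twist m n) m j b n i a [^]\<^bsub>smash_grp B A q t\<^esub> ksign (i * j)"
  unfolding sp_twist_def using smash_lift_elt[OF _ sp_twist_balanced assms] by simp

lemma sp_twist_premorphism: "premorphism (smash A B) (smash B A) (sp_twist A B)"
proof -
  let ?F = "\<lambda>q t. \<lambda>Day_Gen n i a m j b \<theta> \<Rightarrow>
          smash_elt B A (\<theta> \<circ> twist m n) m j b n i a [^]\<^bsub>smash_grp B A q t\<^esub> ksign (i * j)"
  have "premorphism (smash A B) (smash B A) (\<lambda>q t. smash_lift (grp (lev (smash B A) q) t) (?F q t))"
  proof (rule smash_lift_premorphism[OF BA.prespectrum_smash], unfold grp_smash day_gen.case)
    fix q t n i a m j b \<theta>
    assume *: "n + m = q" "i + j = t" "\<theta> permutes {..<q}"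
        and a: "a \<in> elts (lev A n) i" and b: "b \<in> elts (lev B m) j"
    have \<theta>: "\<theta> \<circ> twist m n permutes {..<q}" and e: "m + n = q" "j + i = t"
      using * by (auto intro!: permutes_compose twist_permutes)
    note c = BA.smash_elt_closed[OF \<theta> e b a]
    show "smash_elt B A (\<gamma> \<circ> \<theta> \<circ> twist m n) m j b n i a [^]\<^bsub>smash_grp B A q t\<^esub> ksign (i * j) =
       pact (smash B A) q \<gamma> t (smash_elt B A (\<theta> \<circ> twist m n) m j b n i a [^]\<^bsub>smash_grp B A q t\<^esub> ksign (i * j))"
      if \<gamma>: "\<gamma> permutes {..<q}" for \<gamma>
      using hom_int_pow[OF BA.smash_pact_hom[OF \<gamma>] c] by (simp add: BA.smash_pact_elt[OF \<gamma> e \<theta> b a] comp_assoc)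
    show "smash_elt B A (box l q id \<theta> \<circ> twist m (l + n)) m j b (l + n) (int l + i) (sig A l n i a)
        [^]\<^bsub>smash_grp B A (l + q) (int l + t)\<^esub> ksign ((int l + i) * j) =
       sig (smash B A) l q t (smash_elt B A (\<theta> \<circ> twist m n) m j b n i a [^]\<^bsub>smash_grp B A q t\<^esub> ksign (i * j))" for l
    proof -
      let ?G = "smash_grp B A (l + q) (int l + t)"
      interpret G: comm_group ?G by simp
      let ?X = "smash_elt B A (box l q id (\<theta> \<circ> twist m n)) (l + m) (int l + j) (sig B l m j b) n i a"
      have l\<theta>: "box l q id (\<theta> \<circ> twist m n) permutes {..<l + q}" by (rule box_permutes[OF permutes_id \<theta> refl])
      have \<psi>: "box l q id \<theta> \<circ> twist m (l + n) permutes {..<l + q}"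
        by (rule permutes_compose[OF twist_permutes box_permutes[OF permutes_id *(3) refl]]) (use * in auto)
      have X: "?X \<in> carrier ?G"
        by (rule BA.smash_elt_closed[OF l\<theta> _ _ _ a]) (use * B.sig_closed[OF b] in auto)
      have e': "m + l + n = l + q" "j + int l + i = int l + t" using * by auto
      \<comment> \<open>After the twist the suspended factor a stands on the right, whereas
        suspension of a tensor acts on the left. The coequaliser relation carries e_l over to b, and
        its sign (-1)^{jl} corrects (-1)^{(l+i)j} to (-1)^{ij}.\<close>
      have "smash_elt B A (box l q id \<theta> \<circ> twist m (l + n)) m j b (l + n) (int l + i) (sig A l n i a) =
         ?X [^]\<^bsub>?G\<^esub> ksign (j * int l)"
        unfolding BA.smash_elt_sig[OF e' \<psi> b a] box_shift_twist_twist[OF *(1)[symmetric]] ..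
      moreover have "ksign (j * int l) * ksign ((int l + i) * j) = ksign (i * j)" by (auto simp: ksign_def)
      moreover have "sig (smash B A) l q t (smash_elt B A (\<theta> \<circ> twist m n) m j b n i a [^]\<^bsub>smash_grp B A q t\<^esub> ksign (i * j))
         = ?X [^]\<^bsub>?G\<^esub> ksign (i * j)"
        using hom_int_pow[OF BA.smash_sig_hom c] by (simp add: BA.smash_sig_elt[OF e \<theta> b a])
      ultimately show ?thesis using X by (simp add: G.int_pow_pow)
    qed
  qed (rule sp_twist_balanced)
  then show ?thesis by (simp add: sp_twist_def[abs_def])
qed

lemma ch_twist_bihom:
  "i + j = k \<Longrightarrow> bihom (grp (D A) i) (grp (D B) j) (ctensor_grp (D B) (D A) k)
     (\<lambda>a b. ctens (D B) (D A) j i b a [^]\<^bsub>ctensor_grp (D B) (D A) k\<^esub> ksign (i * j))"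
  by (rule bihom_pow[OF _ bihom_swap[OF ctens_bihom]]) auto

text \<open>The twist of spectra gives (-1)^{ij} and a block twist, of sign (-1)^{mn} in D; the
  twist of complexes gives (-1)^{(i-n)(j-m)}. Together with the signs mn + mi and mn + nj of the two
  maps \<phi>, both exponents have the parity of ij + mi.\<close>

lemma phi_symmetric:
  assumes x: "x \<in> carrier (ctensor_grp (D A) (D B) k)"
  shows "D_map (smash B A) (sp_twist A B) k (phi A B k x) = phi B A k (ch_twist (D A) (D B) k x)"
proof -
  interpret h: prespectrum_map "smash A B" "smash B A" "sp_twist A B"
    by (rule prespectrum_mapI[OF prespectrum_smash BA.prespectrum_smash sp_twist_premorphism])
  interpret K: comm_group "grp (D (smash B A)) k" by simp
  have ch: "ch_twist (D A) (D B) k \<in> hom (ctensor_grp (D A) (D B) k) (ctensor_grp (D B) (D A) k)"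
    unfolding ch_twist_def by (rule ctensor_lift_hom[OF _ _ _ ch_twist_bihom]) auto
  show ?thesis
  proof (rule DD_hom_eq[OF _ hom_compose_fun[OF phi_hom h.D_map_hom] hom_compose_fun[OF ch BA.phi_hom] _ x])
    fix n i a m j b assume k: "i - int n + (j - int m) = k" and a: "a \<in> elts (lev A n) i" and b: "b \<in> elts (lev B m) j"
    have k': "j - int m + (i - int n) = k" "i + j - int (n + m) = k" using k by auto
    have tw: "twist m n permutes {..<n + m}" by (rule twist_permutes) auto
    note X = BA.xi_smash_closed[OF b a k'(1)]
    have s: "smash_elt B A (twist m n) m j b n i a \<in> carrier (smash_grp B A (n + m) (i + j))"
      by (rule BA.smash_elt_closed[OF tw _ _ b a]) auto
    have "D_map (smash B A) (sp_twist A B) k (phi A B k (ctens (D A) (D B) (i - int n) (j - int m) (xi A n i a) (xi B m j b)))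
      = ((xi_smash B A m j b n i a [^]\<^bsub>grp (D (smash B A)) k\<^esub> ksign (int m * int n))
           [^]\<^bsub>grp (D (smash B A)) k\<^esub> ksign (i * j)) [^]\<^bsub>grp (D (smash B A)) k\<^esub> phi_sign n i m"
      unfolding D_map_phi[OF BA.prespectrum_smash sp_twist_premorphism a b refl refl k]
        sp_twist_elt[OF refl refl permutes_id a b] id_comp
      using hom_int_pow[OF BA.S.xi_hom[OF k'(2)], of _ "ksign (i * j)"] s
        BA.xi_smash_elt[OF tw _ _ k'(2) b a] by (simp add: sign_twist add.commute)
    also have "\<dots> = xi_smash B A m j b n i a [^]\<^bsub>grp (D (smash B A)) k\<^esub>
        (phi_sign m j n * ksign ((i - int n) * (j - int m)))"
    proof -
      have "ksign (int m * int n) * ksign (i * j) * phi_sign n i m = phi_sign m j n * ksign ((i - int n) * (j - int m))"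
        by (auto simp: phi_sign_def ksign_def)
      then show ?thesis using X by (simp only: K.int_pow_pow)
    qed
    also have "\<dots> = phi B A k (ch_twist (D A) (D B) k (ctens (D A) (D B) (i - int n) (j - int m) (xi A n i a) (xi B m j b)))"
    proof -
      have "ch_twist (D A) (D B) k (ctens (D A) (D B) (i - int n) (j - int m) (xi A n i a) (xi B m j b))
        = ctens (D B) (D A) (j - int m) (i - int n) (xi B m j b) (xi A n i a)
           [^]\<^bsub>ctensor_grp (D B) (D A) k\<^esub> ksign ((i - int n) * (j - int m))"
        unfolding ch_twist_def
        by (rule ctensor_lift_ctens[OF _ _ _ ch_twist_bihom]) (use k A.xi_closed[OF a] B.xi_closed[OF b] in auto)
      then show ?thesis
        using hom_int_pow[OF BA.phi_hom BA.DD_ctens_closed[OF b a k'(1)], of "ksign ((i - int n) * (j - int m))"]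
          BA.phi_ctens_xi[OF b a refl refl k'(1)] X by (simp add: K.int_pow_pow)
    qed
    finally show "D_map (smash B A) (sp_twist A B) k (phi A B k (ctens (D A) (D B) (i - int n) (j - int m) (xi A n i a) (xi B m j b)))
      = phi B A k (ch_twist (D A) (D B) k (ctens (D A) (D B) (i - int n) (j - int m) (xi A n i a) (xi B m j b)))" .
  qed auto
qed

end


subsection \<open>Units\<close>

lemma chain_id_hom: "chain_id k \<in> hom G G"
  by (simp add: chain_id_def hom_def)
context
  fixes A :: "'a symspec"
  assumes A: "prespectrum A"
    and sact_hom: "\<And>k n t. sact A k n t \<in> hom (ctensor_grp (Zc (int k)) (lev A n) t) (grp (lev A (k + n)) t)"
begin

interpretation A: prespectrum A by (rule A)
interpretation P: prespectrum_pair Zstar A by (rule prespectrum_pairI[OF prespectrum_Zstar A])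
interpretation Q: prespectrum_pair A Zstar by (rule prespectrum_pairI[OF A prespectrum_Zstar])

text \<open>\<open>sig\<close> records \<open>sact\<close> only at e_n \<otimes> a, whereas
  \<open>sp_lunit\<close> applies \<open>sact\<close> to every z \<otimes> a. Additivity of
  \<open>sact\<close> gives the other values as powers, and outside degree n the coefficient z is
  0.\<close>

lemma sact_ctens:
  assumes z: "z \<in> elts (Zc (int n)) i" and a: "a \<in> elts (lev A m) j" and t: "i + j = t"
  shows "sact A n m t (ctens (Zc (int n)) (lev A m) i j z a) = sig A n m j a [^]\<^bsub>grp (lev A (n + m)) t\<^esub> z"
proof (cases "i = int n")
  case True
  have c: "ctens (Zc (int n)) (lev A m) (int n) j 1 a \<in> carrier (ctensor_grp (Zc (int n)) (lev A m) t)"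
    by (rule ctens_closed) (use a t True in auto)
  show ?thesis
    using hom_int_pow[OF sact_hom c] ctens_Zc_pow[of "lev A m" "int n" j t a z] a t True by (simp add: sig_def)
next
  case False
  then have "z = 0" using z by (simp add: elts_Zc)
  have b: "bihom (grp (Zc (int n)) i) (grp (lev A m) j) (grp (lev A (n + m)) t)
      (\<lambda>z a. sact A n m t (ctens (Zc (int n)) (lev A m) i j z a))"
    by (rule bihom_compose[OF ctens_bihom hom_id hom_id sact_hom]) (use t in auto)
  show ?thesis using hom_one[OF bihom_hom1[OF b a]] \<open>z = 0\<close> by simp
qed

lemma lunit_gen_trivial:
  assumes "z \<in> elts (Zc (int n)) i" "i \<noteq> int n" "a \<in> elts (lev A m) j" "i + j = t" "n + m = q" "\<theta> permutes {..<q}"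
  shows "pact A q \<theta> t (sact A n m t (ctens (Zc (int n)) (lev A m) i j z a)) = \<one>\<^bsub>grp (lev A q) t\<^esub>"
proof -
  have "z = 0" using assms by (simp add: elts_Zc)
  then show ?thesis
    using sact_ctens[OF assms(1,3,4)] hom_one[OF A.pact_hom[OF assms(6)]] assms(5) by auto
qed

lemma lunit_gen:
  assumes "a \<in> elts (lev A m) j" "int n + j = t" "n + m = q"
  shows "pact A q \<theta> t (sact A n m t (ctens (Zc (int n)) (lev A m) (int n) j z a)) =
    pact A q \<theta> t (sig A n m j a [^]\<^bsub>grp (lev A q) t\<^esub> z)"
  using sact_ctens[of z n "int n" a m j t] assms by (auto simp: elts_Zc)

text \<open>If z lives in degree n, iterated suspension makes both sides of the coequaliser relation
  suspensions of a by e_{u+n}. The block twist acts on such an element by (-1)^{un}, which cancels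
  the sign of the relation since i = n. In all other degrees both sides are neutral.\<close>

lemma sp_lunit_balanced:
  "smash_balanced Zstar A (grp (lev A q) t) q t
     (\<lambda>Day_Gen n i z m j a \<theta> \<Rightarrow>
          pact A q \<theta> t (sact A n m t (ctens (Zc (int n)) (lev A m) i j z a)))"
  unfolding smash_balanced_def day_balanced_def day_gen.case lev_Zstar
proof (intro allI impI conjI ballI)
  fix n m i j \<theta> assume *: "n + m = q" "i + j = t" "\<theta> permutes {..<q}"
  show "bihom (grp (Zc (int n)) i) (grp (lev A m) j) (grp (lev A q) t)
     (\<lambda>z a. pact A q \<theta> t (sact A n m t (ctens (Zc (int n)) (lev A m) i j z a)))"
    by (rule bihom_compose[OF ctens_bihom hom_id hom_id hom_compose_fun[OF sact_hom[of n m t, unfolded *(1)] A.pact_hom[OF *(3)]]])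
       (use * in auto)
  fix z a \<alpha> \<beta> assume z: "z \<in> elts (Zc (int n)) i" and a: "a \<in> elts (lev A m) j"
    and \<alpha>: "\<alpha> permutes {..<n}" and \<beta>: "\<beta> permutes {..<m}"
  let ?K = "grp (lev A q) t"
  interpret K: comm_group ?K by simp
  have bx: "box n m \<alpha> \<beta> permutes {..<q}" by (rule box_permutes[OF \<alpha> \<beta>]) (use * in simp)
  have \<theta>bx: "\<theta> \<circ> box n m \<alpha> \<beta> permutes {..<q}" by (rule permutes_compose[OF bx *(3)])
  have z': "sign \<alpha> * z \<in> elts (Zc (int n)) i" using z by (auto simp: elts_Zc split: if_splits)
  note \<beta>a = A.pact_closed[OF \<beta> a]
  show "pact A q (\<theta> \<circ> box n m \<alpha> \<beta>) t (sact A n m t (ctens (Zc (int n)) (lev A m) i j z a)) =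
     pact A q \<theta> t (sact A n m t (ctens (Zc (int n)) (lev A m) i j (pact Zstar n \<alpha> i z) (pact A m \<beta> j a)))"
  proof (cases "i = int n")
    case True
    have t: "int n + j = t" using * True by simp
    have sa: "sig A n m j a \<in> carrier ?K" by (rule A.sig_closed[OF a]) (use * t in auto)
    have s\<beta>a: "sig A n m j (pact A m \<beta> j a) \<in> carrier ?K" by (rule A.sig_closed[OF \<beta>a]) (use * t in auto)
    have "pact A q (box n m \<alpha> \<beta>) t (sig A n m j a) = sig A n m j (pact A m \<beta> j a) [^]\<^bsub>?K\<^esub> sign \<alpha>"
      using A.sig_box[OF a \<alpha> \<beta>] * t by simp
    then have "pact A q (\<theta> \<circ> box n m \<alpha> \<beta>) t (sig A n m j a [^]\<^bsub>?K\<^esub> z) =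
       pact A q \<theta> t (sig A n m j (pact A m \<beta> j a) [^]\<^bsub>?K\<^esub> (sign \<alpha> * z))"
      using hom_int_pow[OF A.pact_hom[OF bx] sa, of z] sa s\<beta>a
      by (simp add: A.pact_comp[OF *(3) bx] K.int_pow_pow)
    then show ?thesis
      unfolding True by (simp add: lunit_gen[OF a t *(1)] lunit_gen[OF \<beta>a t *(1)])
  next
    case False
    then show ?thesis
      using lunit_gen_trivial[OF z False a *(2,1) \<theta>bx] lunit_gen_trivial[OF z' False \<beta>a *(2,1,3)] by simp
  qed
next
  fix n i u p k \<phi> z a
  assume *: "n + u + p = q" "i + int u + k = t" "\<phi> permutes {..<q}"
    and z: "z \<in> elts (Zc (int n)) i" and a: "a \<in> elts (lev A p) k"
  let ?K = "grp (lev A q) t"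
  interpret K: comm_group ?K by simp
  let ?\<tau> = "box (u + n) p (twist u n) id"
  have tw: "twist u n permutes {..<u + n}" by (rule twist_permutes) simp
  have \<tau>: "?\<tau> permutes {..<q}" by (rule box_permutes[OF tw permutes_id]) (use * in auto)
  have \<phi>\<tau>: "\<phi> \<circ> ?\<tau> permutes {..<q}" by (rule permutes_compose[OF \<tau> *(3)])
  have sa: "sig A u p k a \<in> elts (lev A (u + p)) (int u + k)" by (rule A.sig_closed[OF a]) auto
  have z': "z \<in> elts (Zc (int (u + n))) (int u + i)" using z by (auto simp: elts_Zc split: if_splits)
  have e: "n + (u + p) = q" "i + (int u + k) = t" "u + n + p = q" "int u + i + k = t" using * by auto
  show "pact A q \<phi> t (sact A n (u + p) t (ctens (Zc (int n)) (lev A (u + p)) i (int u + k) z (sig A u p k a))) =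
     pact A q (\<phi> \<circ> ?\<tau>) t (sact A (u + n) p t (ctens (Zc (int (u + n))) (lev A p) (int u + i) k (sig Zstar u n i z) a))
       [^]\<^bsub>?K\<^esub> ksign (i * int u)"
  proof (cases "i = int n")
    case True
    have t: "int n + (int u + k) = t" "int (u + n) + k = t" using e True by auto
    define x where "x = sig A (u + n) p k a"
    have x: "x \<in> carrier ?K" unfolding x_def by (rule A.sig_closed[OF a]) (use e t in auto)
    have "pact A q ?\<tau> t x = x [^]\<^bsub>?K\<^esub> ksign (int u * int n)"
      using A.sig_box[OF a tw permutes_id] t(2) by (simp add: x_def e sign_twist A.pact_id[OF a])
    then have "pact A q (\<phi> \<circ> ?\<tau>) t (x [^]\<^bsub>?K\<^esub> z) = pact A q \<phi> t (x [^]\<^bsub>?K\<^esub> z) [^]\<^bsub>?K\<^esub> ksign (int n * int u)"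
      using hom_int_pow[OF A.pact_hom[OF \<tau>] x, of z] hom_int_pow[OF A.pact_hom[OF *(3)] x] x
        A.pact_closed[OF *(3), of x t]
      by (simp add: A.pact_comp[OF *(3) \<tau>] K.int_pow_pow mult.commute)
    moreover have "sig A n (u + p) (int u + k) (sig A u p k a) = x"
      using A.sig_sig[OF a, of n u] by (simp add: x_def add.commute)
    moreover have "pact A q \<phi> t (x [^]\<^bsub>?K\<^esub> z) \<in> carrier ?K"
      using A.pact_closed[OF *(3)] x by blast
    moreover have "int u + i = int (u + n)" using True by simp
    ultimately show ?thesis
      using z lunit_gen[OF sa t(1) e(1), of \<phi> z] lunit_gen[OF a t(2) e(3), of "\<phi> \<circ> ?\<tau>" z]
      unfolding True by (simp add: sig_Zstar x_def pow_ksign_ksign of_nat_add[symmetric] del: of_nat_add)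
  next
    case False
    then have "int u + i \<noteq> int (u + n)" by simp
    then show ?thesis
      using lunit_gen_trivial[OF z False sa e(2,1) *(3)] lunit_gen_trivial[OF z' _ a e(4,3) \<phi>\<tau>] z
      by (simp add: sig_Zstar del: of_nat_add)
  qed
qed

lemma sp_lunit_elt:
  assumes "n + m = q" "i + j = t" "\<theta> permutes {..<q}" "z \<in> elts (Zc (int n)) i" "a \<in> elts (lev A m) j"
  shows "sp_lunit A q t (smash_elt Zstar A \<theta> n i z m j a) =
    pact A q \<theta> t (sact A n m t (ctens (Zc (int n)) (lev A m) i j z a))"
  unfolding sp_lunit_def
  using P.smash_lift_elt[OF A.lev_group sp_lunit_balanced assms(1-3), of z a] assms(4,5) by simp

lemma sp_lunit_premorphism: "premorphism (smash Zstar A) A (sp_lunit A)"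
proof -
  let ?F = "\<lambda>q t. \<lambda>Day_Gen n i z m j a \<theta> \<Rightarrow>
          pact A q \<theta> t (sact A n m t (ctens (Zc (int n)) (lev A m) i j z a))"
  have "premorphism (smash Zstar A) A (\<lambda>q t. smash_lift (grp (lev A q) t) (?F q t))"
  proof (rule P.smash_lift_premorphism[OF A sp_lunit_balanced], unfold day_gen.case lev_Zstar)
    fix q t n i z m j a \<theta>
    assume *: "n + m = q" "i + j = t" "\<theta> permutes {..<q}"
        and z: "z \<in> elts (Zc (int n)) i" and a: "a \<in> elts (lev A m) j"
    let ?x = "sact A n m t (ctens (Zc (int n)) (lev A m) i j z a)"
    have "ctens (Zc (int n)) (lev A m) i j z a \<in> carrier (ctensor_grp (Zc (int n)) (lev A m) t)"
      by (rule ctens_closed) (use z a * in auto)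
    then have x: "?x \<in> elts (lev A q) t" using hom_carrier[OF sact_hom[of n m t]] *(1) by auto
    show "pact A q (\<gamma> \<circ> \<theta>) t ?x = pact A q \<gamma> t (pact A q \<theta> t ?x)" if "\<gamma> permutes {..<q}" for \<gamma>
      by (rule A.pact_comp[OF that *(3) x])
    show "pact A (l + q) (box l q id \<theta>) (int l + t) (sact A (l + n) m (int l + t)
        (ctens (Zc (int (l + n))) (lev A m) (int l + i) j (sig Zstar l n i z) a)) = sig A l q t (pact A q \<theta> t ?x)" for l
    proof -
      let ?K = "grp (lev A (l + q)) (int l + t)"
      have l\<theta>: "box l q id \<theta> permutes {..<l + q}" by (rule box_permutes[OF permutes_id *(3) refl])
      have z': "z \<in> elts (Zc (int (l + n))) (int l + i)" using z by (auto simp: elts_Zc split: if_splits)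
      have e: "l + n + m = l + q" "int l + i + j = int l + t" using * by auto
      \<comment> \<open>Equivariance with the identity on the first l points, so the sign is
        1.\<close>
      have s: "sig A l q t (pact A q \<theta> t ?x) = pact A (l + q) (box l q id \<theta>) (int l + t) (sig A l q t ?x)"
        using A.sig_box[OF x permutes_id *(3)] A.sig_closed[OF A.pact_closed[OF *(3) x] refl refl]
        by (simp add: group.int_pow_1)
      have "sact A (l + n) m (int l + t) (ctens (Zc (int (l + n))) (lev A m) (int l + i) j z a) = sig A l q t ?x"
      proof (cases "i = int n")
        case True
        have t: "int n + j = t" using * True by simp
        have sa: "sig A n m j a \<in> elts (lev A q) t" by (rule A.sig_closed[OF a]) (use * t in auto)
        have "sig A l q t (sig A n m j a) = sig A (l + n) m j a"
          using A.sig_sig[OF a, of l n] *(1) t by simp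
        then show ?thesis
          using sact_ctens[OF z' a e(2)] sact_ctens[OF z a *(2)] hom_int_pow[OF A.sig_hom' sa, of l z] e(1) *(1)
          by simp
      next
        case False
        then have "z = 0" using z by (simp add: elts_Zc)
        then show ?thesis
          using sact_ctens[OF z' a e(2)] sact_ctens[OF z a *(2)] hom_one[OF A.sig_hom'[of l q t]] e(1) *(1)
          by simp
      qed
      then show ?thesis using s z by (simp add: sig_Zstar del: of_nat_add)
    qed
  qed
  then show ?thesis by (simp add: sp_lunit_def[abs_def])
qed

lemma sp_runit_premorphism: "premorphism (smash A Zstar) A (sp_runit A)"
  unfolding sp_runit_def by (rule premorphism_comp[OF Q.sp_twist_premorphism sp_lunit_premorphism])

lemma D_unit_hom: "D_unit k \<in> hom (grp (Zc 0) k) (grp (D Zstar) k)"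
proof (cases "k = 0")
  case False
  interpret K: comm_group "grp (D Zstar) k" by simp
  show ?thesis using False unfolding D_unit_def
    by (intro homI) (auto simp: elts_Zc mult_Zc)
next
  case True
  interpret K: comm_group "grp (D Zstar) 0" by simp
  have "xi Zstar 0 0 1 \<in> elts (D Zstar) 0" by (rule P.A.xi_closed) auto
  then show ?thesis unfolding True D_unit_def
    by (intro homI) (auto simp: K.int_pow_mult mult_Zc elts_Zc)
qed

text \<open>e_n is the suspension of e_0 by e_n.\<close>

lemma xi_Zstar: "xi Zstar n (int n) 1 = xi Zstar 0 0 1"
  using P.A.xi_sig[of 1 0 0 n] by (simp add: sig_Zstar)

text \<open>The inverse sends \<xi>(z) to the integer z. It is well defined because on Z[*]
  permutations act by their sign and suspension is the identity on integers.\<close>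

lemma D_unit_iso: "D_unit k \<in> iso (grp (Zc 0) k) (grp (D Zstar) k)"
proof -
  interpret K: comm_group "grp (D Zstar) k" by simp
  \<comment> \<open>A nonzero z forces i = n and hence k = 0, the degree in which Z[0] is
    concentrated.\<close>
  have z: "z \<in> elts (Zc 0) k" if "z \<in> elts (Zc (int n)) i" "i - int n = k" for z n i
    using that by (auto simp: elts_Zc split: if_splits)
  have comp: "compatible Zstar (grp (Zc 0) k) k (\<lambda>n i z. z)"
    unfolding compatible_def lev_Zstar
  proof (intro allI impI conjI ballI)
    fix n i assume k: "i - int n = k"
    show "(\<lambda>z. z) \<in> hom (grp (Zc (int n)) i) (grp (Zc 0) k)"
      using z[OF _ k] by (intro homI) (auto simp: mult_Zc)
    fix x assume x: "x \<in> elts (Zc (int n)) i"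
    show "pact Zstar n \<alpha> i x = x [^]\<^bsub>grp (Zc 0) k\<^esub> sign \<alpha>" for \<alpha>
      using pow_Zc[OF z[OF x k]] by simp
    show "sig Zstar l n i x = x" for l using sig_Zstar[OF x] .
  qed
  define U where "U = D_lift (grp (Zc 0) k) k (\<lambda>n i (z::int). z)"
  have U: "U \<in> hom (grp (D Zstar) k) (grp (Zc 0) k)"
    unfolding U_def by (rule P.A.D_lift_hom[OF _ comp]) simp
  have U_xi: "U (xi Zstar n i z) = z" if "z \<in> elts (Zc (int n)) i" "i - int n = k" for n i z
    unfolding U_def by (rule P.A.D_lift_xi[OF _ comp]) (use that in auto)
  have 1: "U (D_unit k c) = c" if c: "c \<in> elts (Zc 0) k" for c
  proof (cases "k = 0")
    case True
    have "xi Zstar 0 0 1 \<in> elts (D Zstar) k" by (rule P.A.xi_closed) (use True in auto)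
    from hom_int_pow[OF U this, of c] show ?thesis
      using U_xi[of 1 0 0] True by (simp add: D_unit_def pow_Zc)
  next
    case False
    then have "c = 0" using c by (simp add: elts_Zc)
    then show ?thesis using hom_one[OF U] by (simp add: D_unit_def)
  qed
  have 2: "D_unit k (U x) = x" if x: "x \<in> elts (D Zstar) k" for x
  proof (rule P.A.D_hom_eq[OF _ hom_compose_fun[OF U D_unit_hom] hom_id _ x])
    fix n i z assume k: "i - int n = k" and "z \<in> elts (lev Zstar n) i"
    then have z: "z \<in> elts (Zc (int n)) i" by simp
    have "D_unit k z = xi Zstar n i z"
    proof (cases "i = int n")
      case True
      have "xi Zstar n i (1 [^]\<^bsub>grp (Zc (int n)) i\<^esub> z) = xi Zstar n i 1 [^]\<^bsub>grp (D Zstar) k\<^esub> z"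
        using hom_int_pow[OF P.A.xi_hom[OF k], of 1 z] True by simp
      then show ?thesis using True xi_Zstar[of n] by (simp add: pow_Zc D_unit_def)
    next
      case False
      then have "z = 0" using z by (simp add: elts_Zc)
      then show ?thesis using hom_one[OF P.A.xi_hom[OF k]] by (simp add: D_unit_def)
    qed
    then show "D_unit k (U (xi Zstar n i z)) = xi Zstar n i z" using U_xi[OF z k] by simp
  qed auto
  show ?thesis unfolding iso_def
    using D_unit_hom 1 2 hom_carrier[OF D_unit_hom[of k]] hom_carrier[OF U]
    by (auto intro!: bij_betw_byWitness[where f'=U])
qed

lemma D_unit_chain_iso: "chain_iso (Zc 0) (D Zstar) D_unit"
proof -
  have "D_unit (k - 1) (bd (Zc 0) k c) = bd (D Zstar) k (D_unit k c)" if c: "c \<in> elts (Zc 0) k" for k c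
  proof (cases "k = 0")
    case True
    have x: "xi Zstar 0 0 1 \<in> elts (D Zstar) k" by (rule P.A.xi_closed) (use True in auto)
    have "bd (D Zstar) k (xi Zstar 0 0 1) = \<one>\<^bsub>grp (D Zstar) (k - 1)\<^esub>"
      using P.A.bd_xi[of 1 0 0 k] hom_one[OF P.A.xi_hom[of "-1" 0 "k - 1"]] True
      by (simp add: group.int_pow_one)
    then show ?thesis
      using hom_int_pow[OF precomplex_bd[OF P.A.precomplex_D refl] x, of c]
      by (simp add: D_unit_def group.int_pow_one)
  next
    case False
    then have "c = 0" using c by (simp add: elts_Zc)
    then show ?thesis using hom_one[OF precomplex_bd[OF P.A.precomplex_D refl, of k]] by (simp add: D_unit_def)
  qed
  then show ?thesis using D_unit_hom D_unit_iso by (simp add: chain_iso_def chain_map_def)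
qed

lemma D_unit_1: "D_unit 0 1 = xi Zstar 0 0 1"
  using P.A.xi_closed[of 1 0 0 0] by (simp add: D_unit_def group.int_pow_1)

text \<open>\<xi>(e_0) has level and degree 0, so \<phi> contributes no sign, and \<sigma>(e_0
  \<otimes> a) = a.\<close>

lemma phi_lunit:
  assumes x: "x \<in> carrier (ctensor_grp (Zc 0) (D A) k)"
  shows "D_map A (sp_lunit A) k (phi Zstar A k (ctensor_map (D Zstar) (D A) D_unit chain_id k x)) =
    ch_lunit (D A) k x"
proof -
  interpret h: prespectrum_map "smash Zstar A" A "sp_lunit A"
    by (rule prespectrum_mapI[OF P.prespectrum_smash A sp_lunit_premorphism])
  have ch: "ctensor_map (D Zstar) (D A) D_unit chain_id k \<in> hom (ctensor_grp (Zc 0) (D A) k) (ctensor_grp (D Zstar) (D A) k)"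
    by (rule ctensor_map_hom) (auto intro: D_unit_hom chain_id_hom)
  have lu: "ch_lunit (D A) k = Zc_lift (grp (D A) k) k (\<lambda>j x. x)"
    by (simp add: ch_lunit_def Zc_lift_def)
  have lu_hom: "ch_lunit (D A) k \<in> hom (ctensor_grp (Zc 0) (D A) k) (grp (D A) k)"
    unfolding lu by (rule Zc_lift_hom) (auto simp: hom_id)
  show ?thesis
  proof (rule hom_eq_on_span[OF _ _ spans_Zc_ctensor[OF _ A.spans_xi]
        hom_compose_fun[OF hom_compose_fun[OF ch P.phi_hom] h.D_map_hom] lu_hom _ x])
    fix s assume "s \<in> {ctens (Zc 0) (D A) 0 j 1 u |j u. 0 + j = k \<and>
        u \<in> {xi A n i a |n i a. i - int n = j \<and> a \<in> elts (lev A n) i}}"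
    then obtain n i a where s: "s = ctens (Zc 0) (D A) 0 k 1 (xi A n i a)" and k: "i - int n = k"
      and a: "a \<in> elts (lev A n) i" by auto
    have "ctensor_map (D Zstar) (D A) D_unit chain_id k s = ctens (D Zstar) (D A) 0 k (xi Zstar 0 0 1) (xi A n i a)"
      unfolding s using D_unit_hom chain_id_hom A.xi_closed[OF a k]
      by (subst ctensor_map_ctens[of "Zc 0" "D A"]) (auto simp: D_unit_1 chain_id_def[of _ "xi A n i a"])
    moreover have "D_map A (sp_lunit A) k (phi Zstar A k (ctens (D Zstar) (D A) 0 k (xi Zstar 0 0 1) (xi A n i a))) =
       xi A n i (sp_lunit A n i (smash_elt Zstar A id 0 0 1 n i a)) [^]\<^bsub>grp (D A) k\<^esub> phi_sign 0 0 n"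
      using P.D_map_phi[OF A sp_lunit_premorphism, of 1 0 0 a n i 0 k k] a k by simp
    moreover have "sp_lunit A n i (smash_elt Zstar A id 0 0 1 n i a) = a"
      using sp_lunit_elt[of 0 n n 0 i i id 1 a] a sact_ctens[of 1 0 0 a n i i]
      by (simp add: permutes_id A.sig_0[OF a] A.pact_id group.int_pow_1)
    moreover have "phi_sign 0 0 n = 1" by (simp add: phi_sign_def)
    moreover have "ch_lunit (D A) k s = xi A n i a"
      unfolding lu s by (rule Zc_lift_unit) (use A.xi_closed[OF a k] in \<open>auto simp: hom_id\<close>)
    ultimately show "D_map A (sp_lunit A) k (phi Zstar A k (ctensor_map (D Zstar) (D A) D_unit chain_id k s)) = ch_lunit (D A) k s"
      using A.xi_closed[OF a k] by (simp add: group.int_pow_1)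
  qed auto
qed

text \<open>The right factor has level and degree 0. Hence the sign of \<phi> is 1, the block twist
  is the identity and the twist has no Koszul sign, so that the left unit map can be evaluated as
  before.\<close>

lemma phi_runit:
  assumes x: "x \<in> carrier (ctensor_grp (D A) (Zc 0) k)"
  shows "D_map A (sp_runit A) k (phi A Zstar k (ctensor_map (D A) (D Zstar) chain_id D_unit k x)) =
    ch_runit (D A) k x"
proof -
  interpret h: prespectrum_map "smash A Zstar" A "sp_runit A"
    by (rule prespectrum_mapI[OF Q.prespectrum_smash A sp_runit_premorphism])
  have ch: "ctensor_map (D A) (D Zstar) chain_id D_unit k \<in> hom (ctensor_grp (D A) (Zc 0) k) (ctensor_grp (D A) (D Zstar) k)"
    by (rule ctensor_map_hom) (auto intro: D_unit_hom chain_id_hom)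
  have bi: "bihom (grp (D A) i) (grp (Zc 0) j) (grp (D A) k) (\<lambda>x c. x [^]\<^bsub>grp (D A) k\<^esub> c)" if "i + j = k" for i j
    by (rule bihom_swap[OF Zc_ctens_bihom[where h="\<lambda>j x. x" and n=k]]) (use that in \<open>auto simp: hom_id\<close>)
  have ru_hom: "ch_runit (D A) k \<in> hom (ctensor_grp (D A) (Zc 0) k) (grp (D A) k)"
    unfolding ch_runit_def by (rule ctensor_lift_hom[OF _ _ _ bi]) auto
  show ?thesis
  proof (rule ctensor_hom_eq[OF _ _ _ hom_compose_fun[OF hom_compose_fun[OF ch Q.phi_hom] h.D_map_hom] ru_hom
        A.spans_xi spans_Zc _ x])
    fix r r' u and c :: int assume r: "r + r' = k" and u: "u \<in> {xi A n i a |n i a. i - int n = r \<and> a \<in> elts (lev A n) i}"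
      and c: "c \<in> (if r' = 0 then {1} else {})"
    have r': "r' = 0" "c = 1" "r = k" using c r by (auto split: if_splits)
    obtain n i a where u: "u = xi A n i a" and k: "i - int n = k" and a: "a \<in> elts (lev A n) i" using u r' by auto
    have tw: "twist 0 n = id" by (auto simp: twist_def fun_eq_iff)
    have "ctensor_map (D A) (D Zstar) chain_id D_unit k (ctens (D A) (Zc 0) k 0 u 1)
       = ctens (D A) (D Zstar) k 0 (xi A n i a) (xi Zstar 0 0 1)"
      unfolding u using D_unit_hom chain_id_hom A.xi_closed[OF a k]
      by (subst ctensor_map_ctens[of "D A" "Zc 0"]) (auto simp: D_unit_1 chain_id_def[of _ "xi A n i a"])
    moreover have "D_map A (sp_runit A) k (phi A Zstar k (ctens (D A) (D Zstar) k 0 (xi A n i a) (xi Zstar 0 0 1))) =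
       xi A n i (sp_runit A n i (smash_elt A Zstar id n i a 0 0 1)) [^]\<^bsub>grp (D A) k\<^esub> phi_sign n i 0"
      using Q.D_map_phi[OF A sp_runit_premorphism a, of 1 0 0 k 0 k] k by simp
    moreover have "sp_runit A n i (smash_elt A Zstar id n i a 0 0 1) = a"
    proof -
      have "sp_twist A Zstar n i (smash_elt A Zstar id n i a 0 0 1) = smash_elt Zstar A id 0 0 1 n i a"
        using Q.sp_twist_elt[of n 0 n i 0 i id a 1] a P.smash_elt_closed[of id n 0 n 0 i i 1 a]
        by (simp add: permutes_id tw group.int_pow_1)
      then show ?thesis
        using sp_lunit_elt[of 0 n n 0 i i id 1 a] a sact_ctens[of 1 0 0 a n i i]
        by (simp add: sp_runit_def spectrum_comp_def chain_comp_def permutes_id A.sig_0[OF a] A.pact_id group.int_pow_1)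
    qed
    moreover have "phi_sign n i 0 = 1" by (simp add: phi_sign_def)
    moreover have "ch_runit (D A) k (ctens (D A) (Zc 0) k 0 u 1) = xi A n i a"
    proof -
      have "ch_runit (D A) k (ctens (D A) (Zc 0) k 0 u 1) = u [^]\<^bsub>grp (D A) k\<^esub> (1::int)"
        unfolding ch_runit_def by (rule ctensor_lift_ctens[OF _ _ _ bi]) (use A.xi_closed[OF a k] u in auto)
      then show ?thesis using A.xi_closed[OF a k] u by (simp add: group.int_pow_1)
    qed
    ultimately show "D_map A (sp_runit A) k (phi A Zstar k (ctensor_map (D A) (D Zstar) chain_id D_unit k
        (ctens (D A) (Zc 0) r r' u c))) = ch_runit (D A) k (ctens (D A) (Zc 0) r r' u c)"
      using A.xi_closed[OF a k] by (simp add: r' group.int_pow_1)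
  qed auto
qed

end


section \<open>Associativity\<close>

section \<open>Associativity\<close>

lemma box_comp_left:
  "\<alpha> permutes {..<n} \<Longrightarrow> \<beta> permutes {..<m} \<Longrightarrow>
    box (n + m) p (\<theta> \<circ> box n m \<alpha> \<beta>) id = box (n + m) p \<theta> id \<circ> box n (m + p) \<alpha> (box m p \<beta> id)"
proof
  fix x assume ab: "\<alpha> permutes {..<n}" "\<beta> permutes {..<m}"
  consider "x < n" | "n \<le> x" "x < n + m" | "n + m \<le> x" "x < n + m + p" | "n + m + p \<le> x" by linarith
  then show "box (n + m) p (\<theta> \<circ> box n m \<alpha> \<beta>) id x = (box (n + m) p \<theta> id \<circ> box n (m + p) \<alpha> (box m p \<beta> id)) x"
  proof cases
    case 1
    then have "\<alpha> x < n" using permutes_lessThan(1)[OF ab(1)] by auto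
    then show ?thesis using 1 by (auto simp: box_def)
  next
    case 2
    then have "\<beta> (x - n) < m" using permutes_lessThan(1)[OF ab(2), of "x - n"] by auto
    then show ?thesis using 2 by (auto simp: box_def)
  qed (auto simp: box_def)
qed

text \<open>Interchange law: \<beta> acts on the last block and so commutes past \<theta>; it is
  regrouped with the middle block so that it acts inside the right factor.\<close>

lemma box_comp_right:
  "\<theta> permutes {..<n + m} \<Longrightarrow> \<beta> permutes {..<p} \<Longrightarrow>
    box (n + m) p \<alpha> \<beta> \<circ> box (n + m) p \<theta> id = box (n + m) p (\<alpha> \<circ> \<theta>) id \<circ> box n (m + p) id (box m p id \<beta>)"
proof
  fix x assume ab: "\<theta> permutes {..<n + m}" "\<beta> permutes {..<p}"
  consider "x < n + m" | "n + m \<le> x" "x < n + m + p" | "n + m + p \<le> x" by linarith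
  then show "(box (n + m) p \<alpha> \<beta> \<circ> box (n + m) p \<theta> id) x =
      (box (n + m) p (\<alpha> \<circ> \<theta>) id \<circ> box n (m + p) id (box m p id \<beta>)) x"
  proof cases
    case 1
    then have "\<theta> x < n + m" using permutes_lessThan(1)[OF ab(1)] by auto
    then show ?thesis using 1 by (auto simp: box_def)
  next
    case 2
    then have "\<beta> (x - (n + m)) < p" using permutes_lessThan(1)[OF ab(2), of "x - (n + m)"] by auto
    moreover have "x - n - m = x - (n + m)" by simp
    ultimately show ?thesis using 2 by (auto simp: box_def add_ac)
  qed (auto simp: box_def)
qed

text \<open>Moving the block u past n + m at once equals moving it past n and then past m, and
  \<theta> is carried along by naturality of the twist.\<close>

lemma box_assoc_twist:
  assumes "\<theta> permutes {..<n + m}"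
  shows "box (n + m) (u + p) \<theta> id \<circ> box n (u + m + p) id (box (u + m) p (twist u m) id)
      \<circ> box (u + n) (m + p) (twist u n) id =
    box (u + (n + m)) p (twist u (n + m)) id \<circ> box (u + (n + m)) p (box u (n + m) id \<theta>) id"
proof
  fix x
  consider "x < u" | "u \<le> x" "x < u + n" | "u + n \<le> x" "x < u + n + m"
    | "u + n + m \<le> x" "x < u + n + m + p" | "u + n + m + p \<le> x" by linarith
  then show "(box (n + m) (u + p) \<theta> id \<circ> box n (u + m + p) id (box (u + m) p (twist u m) id)
      \<circ> box (u + n) (m + p) (twist u n) id) x =
    (box (u + (n + m)) p (twist u (n + m)) id \<circ> box (u + (n + m)) p (box u (n + m) id \<theta>) id) x"
    using permutes_lessThan(1)[OF assms, of "x - u"]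
    by cases (auto simp: box_def twist_def add_ac)
qed

lemma box_assoc_shift:
  assumes "\<theta> permutes {..<r}"
  shows "box v (r + p) id \<phi> \<circ> box (v + r) p (box v r id \<theta>) id = box v (r + p) id (\<phi> \<circ> box r p \<theta> id)"
proof
  fix x
  consider "x < v" | "v \<le> x" "x < v + r" | "v + r \<le> x" "x < v + r + p" | "v + r + p \<le> x" by linarith
  then show "(box v (r + p) id \<phi> \<circ> box (v + r) p (box v r id \<theta>) id) x = box v (r + p) id (\<phi> \<circ> box r p \<theta> id) x"
    using permutes_lessThan(1)[OF assms, of "x - v"]
    by cases (auto simp: box_def)
qed

text \<open>The inner lift carries c as a parameter. Its additivity in c is an identity between
  homomorphisms in x, tested at a \<otimes> b, where it is additivity of the two nested
  tensors.\<close>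

lemma ch_assoc_hom_ctens:
  assumes A: "graded A" and B: "graded B" and C: "graded C"
  shows "ch_assoc A B C n \<in> hom (ctensor_grp (ctensor A B) C n) (ctensor_grp A (ctensor B C) n)"
    and "\<lbrakk>i + j + k = n; a \<in> elts A i; b \<in> elts B j; c \<in> elts C k\<rbrakk> \<Longrightarrow>
      ch_assoc A B C n (ctens (ctensor A B) C (i + j) k (ctens A B i j a b) c) =
      ctens A (ctensor B C) i (j + k) a (ctens B C j k b c)"
proof -
  let ?K = "ctensor_grp A (ctensor B C) n"
  have BC: "graded (ctensor B C)" and AB: "graded (ctensor A B)" using A B C by auto
  have K: "comm_group ?K" using A BC by simp
  have inner: "bihom (grp A i) (grp B j) ?K (\<lambda>a b. ctens A (ctensor B C) i (j + k) a (ctens B C j k b c))"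
    if "i + j + k = n" "c \<in> elts C k" for i j k c
    by (rule bihom_compose[where w="\<lambda>x. x" and u="\<lambda>x. x", OF ctens_bihom[OF A BC] hom_id _ hom_id])
       (use that bihom_hom1[OF ctens_bihom[OF B C refl] that(2)] in auto)
  define L where "L q k c = ctensor_lift ?K q (\<lambda>i j a b. ctens A (ctensor B C) i (j + k) a (ctens B C j k b c))" for q k c
  have L_hom: "L q k c \<in> hom (ctensor_grp A B q) ?K" if "q + k = n" "c \<in> elts C k" for q k c
    unfolding L_def by (rule ctensor_lift_hom[OF A B K inner]) (use that in auto)
  have L_ctens: "L q k c (ctens A B i j a b) = ctens A (ctensor B C) i (j + k) a (ctens B C j k b c)"
    if "q + k = n" "c \<in> elts C k" "i + j = q" "a \<in> elts A i" "b \<in> elts B j" for q k c i j a b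
    unfolding L_def by (rule ctensor_lift_ctens[OF A B K inner]) (use that in auto)
  have outer: "bihom (grp (ctensor A B) q) (grp C k) ?K (\<lambda>x c. L q k c x)" if q: "q + k = n" for q k
  proof -
    interpret C: comm_group "grp C k" using C by simp
    have "L q k (c \<otimes>\<^bsub>grp C k\<^esub> c') x = L q k c x \<otimes>\<^bsub>?K\<^esub> L q k c' x"
      if x: "x \<in> carrier (ctensor_grp A B q)" and c: "c \<in> elts C k" "c' \<in> elts C k" for x c c'
    proof (rule ctensor_hom_eq[OF A B _ L_hom[OF q] hom_mult_fun[OF K L_hom[OF q c(1)] L_hom[OF q c(2)]]
          spans_carrier spans_carrier _ x])
      fix i j a b assume i: "i + j = q" and a: "a \<in> elts A i" and b: "b \<in> elts B j"
      have bc: "ctens B C j k b c \<in> elts (ctensor B C) (j + k)" "ctens B C j k b c' \<in> elts (ctensor B C) (j + k)"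
        using ctens_closed[OF B C b c(1) refl] ctens_closed[OF B C b c(2) refl] by auto
      have "bihom (grp A i) (grp (ctensor B C) (j + k)) ?K (ctens A (ctensor B C) i (j + k))"
        by (rule ctens_bihom[OF A BC]) (use i q in auto)
      then show "L q k (c \<otimes>\<^bsub>grp C k\<^esub> c') (ctens A B i j a b) =
          L q k c (ctens A B i j a b) \<otimes>\<^bsub>?K\<^esub> L q k c' (ctens A B i j a b)"
        using c hom_mult[OF bihom_hom2[OF ctens_bihom[OF B C refl] b] c] hom_mult[OF bihom_hom2[OF _ a] bc]
        by (simp add: L_ctens[OF q _ i a b])
    qed (use A B K c in auto)
    moreover have "L q k c x \<in> carrier ?K" if "x \<in> carrier (ctensor_grp A B q)" "c \<in> elts C k" for x c
      using hom_carrier[OF L_hom[OF q that(2)]] that(1) by blast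
    ultimately show ?thesis
      by (intro bihomI) (simp_all add: hom_mult[OF L_hom[OF q]])
  qed
  have eq: "ch_assoc A B C n = ctensor_lift ?K n (\<lambda>q k x c. L q k c x)"
    by (simp add: ch_assoc_def Let_def L_def)
  show "ch_assoc A B C n \<in> hom (ctensor_grp (ctensor A B) C n) ?K"
    unfolding eq by (rule ctensor_lift_hom[OF AB C K outer])
  show "ch_assoc A B C n (ctens (ctensor A B) C (i + j) k (ctens A B i j a b) c) =
      ctens A (ctensor B C) i (j + k) a (ctens B C j k b c)"
    if "i + j + k = n" "a \<in> elts A i" "b \<in> elts B j" "c \<in> elts C k"
  proof -
    have "ctens A B i j a b \<in> elts (ctensor A B) (i + j)"
      using ctens_closed[OF A B that(2,3) refl] by simp
    then show ?thesis unfolding eq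
      using ctensor_lift_ctens[OF AB C K outer that(1) _ that(4)] L_ctens[OF that(1,4) refl that(2,3)]
      by simp
  qed
qed

locale prespectrum_triple = A: prespectrum A + B: prespectrum B + C: prespectrum C
  for A :: "'a symspec" and B :: "'b symspec" and C :: "'c symspec"
begin

sublocale AB: prespectrum_pair A B by unfold_locales
sublocale BC: prespectrum_pair B C by unfold_locales
sublocale AB_C: prespectrum_pair "smash A B" C by unfold_locales
sublocale A_BC: prespectrum_pair A "smash B C" by unfold_locales

definition assoc_inner where
  "assoc_inner r p k c \<theta> = (\<lambda>Day_Gen n i a m j b \<theta>' \<Rightarrow>
     smash_elt A (smash B C) (\<theta> \<circ> box r p \<theta>' id) n i a (m + p) (j + k) (smash_elt B C id m j b p k c))"

lemma BC_elt_closed: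
  "b \<in> elts (lev B m) j \<Longrightarrow> c \<in> elts (lev C p) k \<Longrightarrow>
    smash_elt B C id m j b p k c \<in> elts (lev (smash B C) (m + p)) (j + k)"
  using BC.smash_elt_closed[OF permutes_id refl refl] by simp

lemma assoc_perm:
  "\<theta> permutes {..<q} \<Longrightarrow> \<theta>' permutes {..<r} \<Longrightarrow> r + p = q \<Longrightarrow> \<theta> \<circ> box r p \<theta>' id permutes {..<q}"
  by (rule permutes_compose[OF box_permutes[OF _ permutes_id]]) auto

context
  fixes q t r l p k c \<theta>
  assumes r: "r + p = q" and l: "l + k = t" and \<theta>: "\<theta> permutes {..<q}" and c: "c \<in> elts (lev C p) k"
begin

text \<open>Suspension in B \<otimes> C acts through b, so \<sigma>(e_u \<otimes> b) \<otimes> c is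
  the suspension of b \<otimes> c. The relation carrying e_u from b to a thus becomes the
  coequaliser relation for A and \<open>smash B C\<close>.\<close>

lemma assoc_inner_balanced:
  "smash_balanced A B (smash_grp A (smash B C) q t) r l (assoc_inner r p k c \<theta>)"
  unfolding smash_balanced_def day_balanced_def assoc_inner_def day_gen.case
proof (intro allI impI conjI ballI)
  fix n m i j \<theta>' assume *: "n + m = r" "i + j = l" "\<theta>' permutes {..<r}"
  note \<psi> = assoc_perm[OF \<theta> *(3) r]
  have e: "n + (m + p) = q" "i + (j + k) = t" using * r l by auto
  have "(\<lambda>b. smash_elt B C id m j b p k c) \<in> hom (grp (lev B m) j) (grp (lev (smash B C) (m + p)) (j + k))"
    using bihom_hom1[OF BC.smash_elt_bihom[OF permutes_id refl refl] c] by simp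
  then show "bihom (grp (lev A n) i) (grp (lev B m) j) (smash_grp A (smash B C) q t)
     (\<lambda>a b. smash_elt A (smash B C) (\<theta> \<circ> box r p \<theta>' id) n i a (m + p) (j + k) (smash_elt B C id m j b p k c))"
    by (rule bihom_compose[where w="\<lambda>x. x" and u="\<lambda>x. x", OF A_BC.smash_elt_bihom[OF \<psi> e] hom_id _ hom_id])
  fix a b \<alpha> \<beta> assume a: "a \<in> elts (lev A n) i" and b: "b \<in> elts (lev B m) j"
    and \<alpha>: "\<alpha> permutes {..<n}" and \<beta>: "\<beta> permutes {..<m}"
  have \<beta>p: "box m p \<beta> id permutes {..<m + p}" by (rule box_permutes[OF \<beta> permutes_id refl])
  have "pact (smash B C) (m + p) (box m p \<beta> id) (j + k) (smash_elt B C id m j b p k c) =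
      smash_elt B C id m j (pact B m \<beta> j b) p k c"
    using BC.smash_elt_box[OF permutes_id b c \<beta> permutes_id]
      BC.smash_pact_elt[OF \<beta>p refl refl permutes_id b c] by (simp add: C.pact_id[OF c])
  then show "smash_elt A (smash B C) (\<theta> \<circ> box r p (\<theta>' \<circ> box n m \<alpha> \<beta>) id) n i a (m + p) (j + k) (smash_elt B C id m j b p k c)
    = smash_elt A (smash B C) (\<theta> \<circ> box r p \<theta>' id) n i (pact A n \<alpha> i a) (m + p) (j + k)
       (smash_elt B C id m j (pact B m \<beta> j b) p k c)"
    using A_BC.smash_elt_box[of "\<theta> \<circ> box r p \<theta>' id" n "m + p", OF _ a BC_elt_closed[OF b c] \<alpha> \<beta>p] \<psi> e
      box_comp_left[OF \<alpha> \<beta>, of p \<theta>'] * by (simp add: comp_assoc)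
next
  fix n i u m j \<phi> a b assume *: "n + u + m = r" "i + int u + j = l" "\<phi> permutes {..<r}"
    and a: "a \<in> elts (lev A n) i" and b: "b \<in> elts (lev B m) j"
  note \<psi> = assoc_perm[OF \<theta> *(3) r]
  have e: "n + u + (m + p) = q" "i + int u + (j + k) = t" using * r l by auto
  have "sig (smash B C) u (m + p) (j + k) (smash_elt B C id m j b p k c) =
     smash_elt B C id (u + m) (int u + j) (sig B u m j b) p k c"
    using BC.smash_sig_elt[OF refl refl permutes_id b c, of u] by simp
  moreover have "box r p (\<phi> \<circ> box (u + n) m (twist u n) id) id = box r p \<phi> id \<circ> box (u + n) (m + p) (twist u n) id"
    using box_comp_left[OF twist_permutes[OF refl] permutes_id, of u n m p \<phi>] * by (simp add: add.commute[of u n])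
  ultimately show "smash_elt A (smash B C) (\<theta> \<circ> box r p \<phi> id) n i a (u + m + p) (int u + j + k)
      (smash_elt B C id (u + m) (int u + j) (sig B u m j b) p k c) =
    smash_elt A (smash B C) (\<theta> \<circ> box r p (\<phi> \<circ> box (u + n) m (twist u n) id) id) (u + n) (int u + i) (sig A u n i a)
      (m + p) (j + k) (smash_elt B C id m j b p k c) [^]\<^bsub>smash_grp A (smash B C) q t\<^esub> ksign (i * int u)"
    using A_BC.smash_elt_sig[OF e \<psi> a BC_elt_closed[OF b c]] by (simp add: comp_assoc add.assoc)
qed

lemma assoc_inner_hom:
  "smash_lift (smash_grp A (smash B C) q t) (assoc_inner r p k c \<theta>) \<in> hom (smash_grp A B r l) (smash_grp A (smash B C) q t)"
  by (rule AB.smash_lift_hom[OF A_BC.smash_group assoc_inner_balanced])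

lemma assoc_inner_elt:
  assumes "n + m = r" "i + j = l" "\<theta>' permutes {..<r}" "a \<in> elts (lev A n) i" "b \<in> elts (lev B m) j"
  shows "smash_lift (smash_grp A (smash B C) q t) (assoc_inner r p k c \<theta>) (smash_elt A B \<theta>' n i a m j b) =
    smash_elt A (smash B C) (\<theta> \<circ> box r p \<theta>' id) n i a (m + p) (j + k) (smash_elt B C id m j b p k c)"
  using AB.smash_lift_elt[OF A_BC.smash_group assoc_inner_balanced assms] by (simp add: assoc_inner_def)

end

definition assoc_outer where
  "assoc_outer q t = (\<lambda>Day_Gen r l x p k c \<theta> \<Rightarrow>
     smash_lift (smash_grp A (smash B C) q t) (assoc_inner r p k c \<theta>) x)"

lemma assoc_outer_bihom:
  assumes r: "r + p = q" and l: "l + k = t" and \<theta>: "\<theta> permutes {..<q}"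
  shows "bihom (smash_grp A B r l) (grp (lev C p) k) (smash_grp A (smash B C) q t)
    (\<lambda>x c. smash_lift (smash_grp A (smash B C) q t) (assoc_inner r p k c \<theta>) x)"
proof -
  let ?K = "smash_grp A (smash B C) q t"
  let ?L = "\<lambda>c. smash_lift ?K (assoc_inner r p k c \<theta>)"
  interpret L: comm_group "grp (lev C p) k" by simp
  note h = assoc_inner_hom[OF r l \<theta>]
  have "?L (c \<otimes>\<^bsub>grp (lev C p) k\<^esub> c') x = ?L c x \<otimes>\<^bsub>?K\<^esub> ?L c' x"
    if x: "x \<in> carrier (smash_grp A B r l)" and c: "c \<in> elts (lev C p) k" "c' \<in> elts (lev C p) k" for x c c'
  proof (rule AB.smash_hom_eq[OF _ h hom_mult_fun[OF _ h[OF c(1)] h[OF c(2)]] _ x])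
    fix \<theta>' n i a m j b assume *: "n + m = r" "i + j = l" "\<theta>' permutes {..<r}"
      and a: "a \<in> elts (lev A n) i" and b: "b \<in> elts (lev B m) j"
    have e: "n + (m + p) = q" "i + (j + k) = t" using * r l by auto
    note bi = A_BC.smash_elt_bihom[OF assoc_perm[OF \<theta> *(3) r] e, unfolded grp_smash]
    show "?L (c \<otimes>\<^bsub>grp (lev C p) k\<^esub> c') (smash_elt A B \<theta>' n i a m j b) =
       ?L c (smash_elt A B \<theta>' n i a m j b) \<otimes>\<^bsub>?K\<^esub> ?L c' (smash_elt A B \<theta>' n i a m j b)"
      using c BC_elt_closed[OF b c(1)] BC_elt_closed[OF b c(2)]
        hom_mult[OF bihom_hom2[OF BC.smash_elt_bihom[OF permutes_id refl refl] b] c]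
      by (simp add: assoc_inner_elt[OF r l \<theta> _ * a b] hom_mult[OF bihom_hom2[OF bi a]])
  qed (use c in auto)
  moreover have "?L c x \<in> carrier ?K" if "x \<in> carrier (smash_grp A B r l)" "c \<in> elts (lev C p) k" for x c
    using hom_carrier[OF h[OF that(2)]] that(1) by blast
  ultimately show ?thesis by (intro bihomI) (simp_all add: hom_mult[OF h])
qed

text \<open>The suspension on c reaches a in two moves: past b inside B \<otimes> C, at the cost of
  (-1)^{ju}, and then past a, at the cost of (-1)^{iu}. Since l = i + j, this is the sign (-1)^{lu}
  of the single move past a \<otimes> b. Between the moves the block twist of the inner tensor is
  absorbed into the outer permutation.\<close>

lemma assoc_outer_balanced:
  "smash_balanced (smash A B) C (smash_grp A (smash B C) q t) q t (assoc_outer q t)"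
  unfolding smash_balanced_def day_balanced_def assoc_outer_def day_gen.case grp_smash
proof (intro allI impI conjI ballI)
  let ?K = "smash_grp A (smash B C) q t"
  fix r p l k \<theta> assume *: "r + p = q" "l + k = t" "\<theta> permutes {..<q}"
  show "bihom (smash_grp A B r l) (grp (lev C p) k) ?K (\<lambda>x c. smash_lift ?K (assoc_inner r p k c \<theta>) x)"
    by (rule assoc_outer_bihom[OF *])
  fix x c \<alpha> \<beta> assume x: "x \<in> carrier (smash_grp A B r l)" and c: "c \<in> elts (lev C p) k"
    and \<alpha>: "\<alpha> permutes {..<r}" and \<beta>: "\<beta> permutes {..<p}"
  have \<theta>': "\<theta> \<circ> box r p \<alpha> \<beta> permutes {..<q}"
    by (rule permutes_compose[OF box_permutes[OF \<alpha> \<beta>] *(3)]) (use * in auto)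
  note \<beta>c = C.pact_closed[OF \<beta> c]
  show "smash_lift ?K (assoc_inner r p k c (\<theta> \<circ> box r p \<alpha> \<beta>)) x =
    smash_lift ?K (assoc_inner r p k (pact C p \<beta> k c) \<theta>) (pact (smash A B) r \<alpha> l x)"
  proof (rule AB.smash_hom_eq[OF _ assoc_inner_hom[OF *(1,2) \<theta>' c]
        hom_compose_fun[OF AB.smash_pact_hom[OF \<alpha>] assoc_inner_hom[OF * \<beta>c]] _ x])
    fix \<theta>' n i a m j b assume **: "n + m = r" "i + j = l" "\<theta>' permutes {..<r}"
      and a: "a \<in> elts (lev A n) i" and b: "b \<in> elts (lev B m) j"
    have p\<beta>: "box m p id \<beta> permutes {..<m + p}" by (rule box_permutes[OF permutes_id \<beta> refl])
    have e: "n + (m + p) = q" "i + (j + k) = t" using * ** by auto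
    note \<alpha>\<theta>' = permutes_compose[OF **(3) \<alpha>]
    note \<psi> = assoc_perm[OF *(3) \<alpha>\<theta>' *(1)]
    have "pact (smash B C) (m + p) (box m p id \<beta>) (j + k) (smash_elt B C id m j b p k c) =
        smash_elt B C id m j b p k (pact C p \<beta> k c)"
      using BC.smash_elt_box[OF permutes_id b c permutes_id \<beta>]
        BC.smash_pact_elt[OF p\<beta> refl refl permutes_id b c] by (simp add: B.pact_id[OF b])
    then have "smash_elt A (smash B C) (\<theta> \<circ> box r p \<alpha> \<beta> \<circ> box r p \<theta>' id) n i a (m + p) (j + k) (smash_elt B C id m j b p k c)
      = smash_elt A (smash B C) (\<theta> \<circ> box r p (\<alpha> \<circ> \<theta>') id) n i a (m + p) (j + k) (smash_elt B C id m j b p k (pact C p \<beta> k c))"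
      using A_BC.smash_elt_box[of "\<theta> \<circ> box r p (\<alpha> \<circ> \<theta>') id" n "m + p", OF _ a BC_elt_closed[OF b c] permutes_id p\<beta>] \<psi> e
        box_comp_right[of \<theta>' n m \<beta> p \<alpha>] ** \<beta> by (simp add: comp_assoc A.pact_id[OF a])
    then show "smash_lift ?K (assoc_inner r p k c (\<theta> \<circ> box r p \<alpha> \<beta>)) (smash_elt A B \<theta>' n i a m j b) =
       smash_lift ?K (assoc_inner r p k (pact C p \<beta> k c) \<theta>) (pact (smash A B) r \<alpha> l (smash_elt A B \<theta>' n i a m j b))"
      unfolding AB.smash_pact_elt[OF \<alpha> ** a b] assoc_inner_elt[OF *(1,2) \<theta>' c ** a b]
        assoc_inner_elt[OF * \<beta>c **(1,2) \<alpha>\<theta>' a b] .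
  qed auto
next
  let ?K = "smash_grp A (smash B C) q t"
  interpret K: comm_group ?K by simp
  fix r l u p k \<phi> x c assume *: "r + u + p = q" "l + int u + k = t" "\<phi> permutes {..<q}"
    and x: "x \<in> carrier (smash_grp A B r l)" and c: "c \<in> elts (lev C p) k"
  let ?\<phi> = "\<phi> \<circ> box (u + r) p (twist u r) id"
  have ur: "r + (u + p) = q" "l + (int u + k) = t" "u + r + p = q" "int u + l + k = t" using * by auto
  have \<phi>': "?\<phi> permutes {..<q}" by (rule perm_comp_twist[OF *(3,1)])
  have sc: "sig C u p k c \<in> elts (lev C (u + p)) (int u + k)" by (rule C.sig_closed[OF c]) auto
  show "smash_lift ?K (assoc_inner r (u + p) (int u + k) (sig C u p k c) \<phi>) x =
    smash_lift ?K (assoc_inner (u + r) p k c ?\<phi>) (sig (smash A B) u r l x) [^]\<^bsub>?K\<^esub> ksign (l * int u)"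
  proof (rule AB.smash_hom_eq[OF _ assoc_inner_hom[OF ur(1,2) *(3) sc]
        hom_pow[OF _ hom_compose_fun[OF AB.smash_sig_hom assoc_inner_hom[OF ur(3,4) \<phi>' c]]] _ x])
    fix \<theta>' n i a m j b assume **: "n + m = r" "i + j = l" "\<theta>' permutes {..<r}"
      and a: "a \<in> elts (lev A n) i" and b: "b \<in> elts (lev B m) j"
    define y where "y = smash_elt B C id m j b p k c"
    have y: "y \<in> elts (lev (smash B C) (m + p)) (j + k)" unfolding y_def by (rule BC_elt_closed[OF b c])
    define M where "M = u + m + p"
    define J where "J = int u + j + k"
    have MJ: "m + (u + p) = M" "j + (int u + k) = J" "u + (m + p) = M" "int u + (j + k) = J" "(u + m) + p = M"
      "int u + j + k = J" "m + u + p = M" "j + int u + k = J"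
      by (auto simp: M_def J_def)
    have sy: "sig (smash B C) u (m + p) (j + k) y \<in> elts (lev (smash B C) M) J"
      by (rule BC.S.sig_closed[OF y]) (simp_all add: MJ)
    let ?\<beta> = "box (u + m) p (twist u m) id"
    have \<beta>: "?\<beta> permutes {..<M}" by (rule box_permutes[OF twist_permutes permutes_id]) (auto simp: M_def)
    let ?\<psi> = "\<phi> \<circ> box r (u + p) \<theta>' id"
    have \<psi>: "?\<psi> permutes {..<q}" by (rule assoc_perm[OF *(3) **(3) ur(1)])
    have nM: "n + M = q" "i + J = t" "n + u + (m + p) = q" "i + int u + (j + k) = t"
      using ur ** by (auto simp: M_def J_def)
    have nM\<beta>: "box n M id ?\<beta> permutes {..<q}" by (rule box_permutes[OF permutes_id \<beta>]) (use nM in simp)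
    have \<psi>': "?\<psi> \<circ> box n M id ?\<beta> permutes {..<q}" by (rule permutes_compose[OF nM\<beta> \<psi>])
    have sb: "sig B u m j b \<in> elts (lev B (u + m)) (int u + j)" by (rule B.sig_closed[OF b]) auto
    have sy_elt: "sig (smash B C) u (m + p) (j + k) y = smash_elt B C id (u + m) (int u + j) (sig B u m j b) p k c"
      unfolding y_def using BC.smash_sig_elt[OF refl refl permutes_id b c, of u] by simp
    \<comment> \<open>First move: e_u passes from c to b. Writing the block twist as a permutation
      acting on the suspension of \<open>y\<close> allows it to be pulled out of the right
      factor.\<close>
    have bsc: "smash_elt B C id m j b (u + p) (int u + k) (sig C u p k c) =
        pact (smash B C) M ?\<beta> J (sig (smash B C) u (m + p) (j + k) y) [^]\<^bsub>grp (lev (smash B C) M) J\<^esub> ksign (j * int u)"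
      using BC.smash_elt_sig[OF MJ(7,8) permutes_id b c] BC.smash_pact_elt[OF \<beta> MJ(5,6) permutes_id sb c]
      by (simp add: sy_elt)
    have sa: "sig A u n i a \<in> elts (lev A (u + n)) (int u + i)" by (rule A.sig_closed[OF a]) auto
    let ?\<chi> = "?\<psi> \<circ> box n M id ?\<beta> \<circ> box (u + n) (m + p) (twist u n) id"
    have \<chi>: "?\<chi> permutes {..<q}" by (rule perm_comp_twist[OF \<psi>' nM(3)])
    define X where "X = smash_elt A (smash B C) ?\<chi> (u + n) (int u + i) (sig A u n i a) (m + p) (j + k) y"
    have X: "X \<in> carrier ?K" unfolding X_def
      by (rule A_BC.smash_elt_closed[OF \<chi> _ _ sa y]) (use nM in auto)
    have "smash_elt A (smash B C) ?\<psi> n i a M J (pact (smash B C) M ?\<beta> J (sig (smash B C) u (m + p) (j + k) y)) =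
      smash_elt A (smash B C) (?\<psi> \<circ> box n M id ?\<beta>) n i a M J (sig (smash B C) u (m + p) (j + k) y)"
      using A_BC.smash_elt_box[of ?\<psi> n M, OF _ a sy permutes_id \<beta>] \<psi> nM(1) by (simp add: A.pact_id[OF a])
    also have "\<dots> = X [^]\<^bsub>?K\<^esub> ksign (i * int u)"
      using A_BC.smash_elt_sig[OF nM(3,4) \<psi>' a y] unfolding MJ X_def .
    finally have "smash_elt A (smash B C) ?\<psi> n i a M J (smash_elt B C id m j b (u + p) (int u + k) (sig C u p k c)) =
        (X [^]\<^bsub>?K\<^esub> ksign (i * int u)) [^]\<^bsub>?K\<^esub> ksign (j * int u)"
      unfolding bsc A_BC.smash_elt_pow2[OF \<psi> nM(1,2) a BC.S.pact_closed[OF \<beta> sy]] by simp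
    note F = this
    have s: "ksign (i * int u) * ksign (j * int u) = ksign (l * int u)"
      using **(2) by (auto simp: ksign_def)
    \<comment> \<open>The permutations of the two successive moves compose to the one of the single
      move.\<close>
    have \<chi>_eq: "?\<phi> \<circ> box (u + r) p (box u r id \<theta>') id = ?\<chi>"
      using box_assoc_twist[of \<theta>' n m u p] ** by (simp add: comp_assoc M_def)
    have u\<theta>: "box u r id \<theta>' permutes {..<u + r}" by (rule box_permutes[OF permutes_id **(3) refl])
    have ul: "(u + n) + m = u + r" "(int u + i) + j = int u + l" using ** by auto
    have L: "smash_lift ?K (assoc_inner r (u + p) (int u + k) (sig C u p k c) \<phi>) (smash_elt A B \<theta>' n i a m j b) =
        X [^]\<^bsub>?K\<^esub> ksign (l * int u)"
      unfolding assoc_inner_elt[OF ur(1,2) *(3) sc ** a b] MJ F using X by (simp only: K.int_pow_pow s)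
    have R: "smash_lift ?K (assoc_inner (u + r) p k c ?\<phi>) (sig (smash A B) u r l (smash_elt A B \<theta>' n i a m j b)) = X"
      unfolding AB.smash_sig_elt[OF ** a b] assoc_inner_elt[OF ur(3,4) \<phi>' c ul u\<theta> sa b] \<chi>_eq X_def y_def ..
    show "smash_lift ?K (assoc_inner r (u + p) (int u + k) (sig C u p k c) \<phi>) (smash_elt A B \<theta>' n i a m j b) =
      smash_lift ?K (assoc_inner (u + r) p k c ?\<phi>) (sig (smash A B) u r l (smash_elt A B \<theta>' n i a m j b)) [^]\<^bsub>?K\<^esub> ksign (l * int u)"
      unfolding L R ..
  qed auto
qed

lemma sp_assoc_alt: "sp_assoc A B C q t = smash_lift (smash_grp A (smash B C) q t) (assoc_outer q t)"
  unfolding sp_assoc_def Let_def assoc_outer_def assoc_inner_def ..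

lemma sp_assoc_premorphism: "premorphism (smash (smash A B) C) (smash A (smash B C)) (sp_assoc A B C)"
proof -
  have "premorphism (smash (smash A B) C) (smash A (smash B C))
    (\<lambda>q t. smash_lift (grp (lev (smash A (smash B C)) q) t) (assoc_outer q t))"
  proof (rule AB_C.smash_lift_premorphism[OF A_BC.prespectrum_smash], unfold grp_smash)
    fix q t r l x p k c \<theta>
    assume *: "r + p = q" "l + k = t" "\<theta> permutes {..<q}"
      and x: "x \<in> carrier (smash_grp A B r l)" and c: "c \<in> elts (lev C p) k"
    let ?K = "\<lambda>q t. smash_grp A (smash B C) q t"
    show "assoc_outer q t (Day_Gen r l x p k c (\<gamma> \<circ> \<theta>)) =
        pact (smash A (smash B C)) q \<gamma> t (assoc_outer q t (Day_Gen r l x p k c \<theta>))" if \<gamma>: "\<gamma> permutes {..<q}" for \<gamma>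
      unfolding assoc_outer_def day_gen.case
    proof (rule AB.smash_hom_eq[OF _ assoc_inner_hom[OF *(1,2) permutes_compose[OF *(3) \<gamma>] c]
          hom_compose_fun[OF assoc_inner_hom[OF * c] A_BC.smash_pact_hom[OF \<gamma>]] _ x])
      fix \<theta>' n i a m j b assume **: "n + m = r" "i + j = l" "\<theta>' permutes {..<r}"
        and a: "a \<in> elts (lev A n) i" and b: "b \<in> elts (lev B m) j"
      have e: "n + (m + p) = q" "i + (j + k) = t" using * ** by auto
      show "smash_lift (?K q t) (assoc_inner r p k c (\<gamma> \<circ> \<theta>)) (smash_elt A B \<theta>' n i a m j b) =
        pact (smash A (smash B C)) q \<gamma> t (smash_lift (?K q t) (assoc_inner r p k c \<theta>) (smash_elt A B \<theta>' n i a m j b))"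
        unfolding assoc_inner_elt[OF *(1,2) permutes_compose[OF *(3) \<gamma>] c ** a b] assoc_inner_elt[OF * c ** a b]
          A_BC.smash_pact_elt[OF \<gamma> e assoc_perm[OF *(3) **(3) *(1)] a BC_elt_closed[OF b c]]
        by (simp add: comp_assoc)
    qed auto
    show "assoc_outer (v + q) (int v + t) (Day_Gen (v + r) (int v + l) (sig (smash A B) v r l x) p k c (box v q id \<theta>)) =
        sig (smash A (smash B C)) v q t (assoc_outer q t (Day_Gen r l x p k c \<theta>))" for v
      unfolding assoc_outer_def day_gen.case
    proof -
      have e: "v + r + p = v + q" "int v + l + k = int v + t" using * by auto
      have v\<theta>: "box v q id \<theta> permutes {..<v + q}" by (rule box_permutes[OF permutes_id *(3) refl])
      show "smash_lift (?K (v + q) (int v + t)) (assoc_inner (v + r) p k c (box v q id \<theta>)) (sig (smash A B) v r l x) =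
        sig (smash A (smash B C)) v q t (smash_lift (?K q t) (assoc_inner r p k c \<theta>) x)"
      proof (rule AB.smash_hom_eq[OF _ hom_compose_fun[OF AB.smash_sig_hom assoc_inner_hom[OF e v\<theta> c]]
            hom_compose_fun[OF assoc_inner_hom[OF * c] A_BC.smash_sig_hom] _ x])
        fix \<theta>' n i a m j b assume **: "n + m = r" "i + j = l" "\<theta>' permutes {..<r}"
          and a: "a \<in> elts (lev A n) i" and b: "b \<in> elts (lev B m) j"
        have e': "n + (m + p) = q" "i + (j + k) = t" "v + n + m = v + r" "int v + i + j = int v + l" using * ** by auto
        have sa: "sig A v n i a \<in> elts (lev A (v + n)) (int v + i)" by (rule A.sig_closed[OF a]) auto
        show "smash_lift (?K (v + q) (int v + t)) (assoc_inner (v + r) p k c (box v q id \<theta>))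
             (sig (smash A B) v r l (smash_elt A B \<theta>' n i a m j b)) =
          sig (smash A (smash B C)) v q t (smash_lift (?K q t) (assoc_inner r p k c \<theta>) (smash_elt A B \<theta>' n i a m j b))"
          unfolding AB.smash_sig_elt[OF ** a b] assoc_inner_elt[OF * c ** a b]
            A_BC.smash_sig_elt[OF e'(1,2) assoc_perm[OF *(3) **(3) *(1)] a BC_elt_closed[OF b c]]
            assoc_inner_elt[OF e v\<theta> c e'(3,4) box_permutes[OF permutes_id **(3) refl] sa b]
          using box_assoc_shift[OF **(3), of v p \<theta>] * by simp
      qed auto
    qed
  qed (rule assoc_outer_balanced)
  then show ?thesis by (simp add: sp_assoc_alt[abs_def])
qed

lemma sp_assoc_elt:
  assumes a: "a \<in> elts (lev A n) i" and b: "b \<in> elts (lev B m) j" and c: "c \<in> elts (lev C p) k"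
  shows "sp_assoc A B C (n + m + p) (i + j + k)
      (smash_elt (smash A B) C id (n + m) (i + j) (smash_elt A B id n i a m j b) p k c) =
    smash_elt A (smash B C) id n i a (m + p) (j + k) (smash_elt B C id m j b p k c)"
  unfolding sp_assoc_alt
  using AB_C.smash_lift_elt[OF A_BC.smash_group assoc_outer_balanced refl refl permutes_id _ c]
    AB.smash_elt_closed[OF permutes_id refl refl a b]
    assoc_inner_elt[OF refl refl permutes_id c refl refl permutes_id a b]
  by (simp add: assoc_outer_def)

text \<open>Both composites send the triple tensor of \<xi>(a), \<xi>(b), \<xi>(c) to a power of the
  same generator \<open>X\<close>, since the associator of spectra has no sign on identity
  permutations. What remains is the cocycle identity for \<open>phi_sign\<close>.\<close>

lemma phi_assoc:
  assumes x: "x \<in> carrier (ctensor_grp (ctensor (D A) (D B)) (D C) k)"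
  shows "D_map (smash A (smash B C)) (sp_assoc A B C) k
      (phi (smash A B) C k (ctensor_map (D (smash A B)) (D C) (phi A B) chain_id k x)) =
    phi A (smash B C) k (ctensor_map (D A) (D (smash B C)) chain_id (phi B C) k (ch_assoc (D A) (D B) (D C) k x))"
proof -
  interpret h: prespectrum_map "smash (smash A B) C" "smash A (smash B C)" "sp_assoc A B C"
    by (rule prespectrum_mapI[OF AB_C.prespectrum_smash A_BC.prespectrum_smash sp_assoc_premorphism])
  let ?K = "grp (D (smash A (smash B C))) k"
  interpret K: comm_group ?K by simp
  have gr: "graded (ctensor (D A) (D B))" "graded (ctensor (D B) (D C))" by auto
  have m1: "ctensor_map (D (smash A B)) (D C) (phi A B) chain_id k
      \<in> hom (ctensor_grp (ctensor (D A) (D B)) (D C) k) (ctensor_grp (D (smash A B)) (D C) k)"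
    by (rule ctensor_map_hom) (auto intro: AB.phi_hom chain_id_hom)
  have m2: "ctensor_map (D A) (D (smash B C)) chain_id (phi B C) k
      \<in> hom (ctensor_grp (D A) (ctensor (D B) (D C)) k) (ctensor_grp (D A) (D (smash B C)) k)"
    by (rule ctensor_map_hom) (auto intro: BC.phi_hom chain_id_hom)
  note as = ch_assoc_hom_ctens[of "D A" "D B" "D C", simplified]
  show ?thesis
  proof (rule ctensor_hom_eq[OF gr(1) _ _ hom_compose_fun[OF hom_compose_fun[OF m1 AB_C.phi_hom] h.D_map_hom]
        hom_compose_fun[OF hom_compose_fun[OF as(1) m2] A_BC.phi_hom] _ C.spans_xi _ x])
    \<comment> \<open>The left factor is itself a tensor product, so the spanning set is taken one
      layer deeper and the test elements are triple tensors.\<close>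
    show "spans (grp (ctensor (D A) (D B)) r)
      {ctens (D A) (D B) r1 r2 u v |r1 r2 u v. r1 + r2 = r \<and> u \<in> {xi A n i a |n i a. i - int n = r1 \<and> a \<in> elts (lev A n) i}
        \<and> v \<in> {xi B n i a |n i a. i - int n = r2 \<and> a \<in> elts (lev B n) i}}" for r
      using spans_ctensor[OF _ _ A.spans_xi B.spans_xi] by simp
    fix r s w z assume r: "r + s = k" and w: "w \<in> {ctens (D A) (D B) r1 r2 u v |r1 r2 u v. r1 + r2 = r \<and>
        u \<in> {xi A n i a |n i a. i - int n = r1 \<and> a \<in> elts (lev A n) i} \<and>
        v \<in> {xi B n i a |n i a. i - int n = r2 \<and> a \<in> elts (lev B n) i}}"
      and z: "z \<in> {xi C n i a |n i a. i - int n = s \<and> a \<in> elts (lev C n) i}"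
    obtain n i a m j b where w: "w = ctens (D A) (D B) (i - int n) (j - int m) (xi A n i a) (xi B m j b)"
      and r1: "i - int n + (j - int m) = r" and a: "a \<in> elts (lev A n) i" and b: "b \<in> elts (lev B m) j"
      using w by auto
    obtain p l c where z: "z = xi C p l c" and s: "l - int p = s" and c: "c \<in> elts (lev C p) l"
      using z by auto
    have e: "i + j - int (n + m) = r" "j + l - int (m + p) = j - int m + s" "j - int m + (l - int p) = j - int m + s"
      "i - int n + (j - int m + s) = k" using r r1 s by auto
    let ?ab = "smash_elt A B id n i a m j b" and ?bc = "smash_elt B C id m j b p l c"
    have ab: "?ab \<in> elts (lev (smash A B) (n + m)) (i + j)"
      using AB.smash_elt_closed[OF permutes_id refl refl a b] by simp
    note bc = BC_elt_closed[OF b c]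
    define X where "X = xi_smash A (smash B C) n i a (m + p) (j + l) ?bc"
    have X: "X \<in> carrier ?K" unfolding X_def by (rule A_BC.xi_smash_closed[OF a bc]) (use e in auto)
    have w': "w \<in> carrier (ctensor_grp (D A) (D B) r)" unfolding w by (rule AB.DD_ctens_closed[OF a b r1])
    have c': "xi C p l c \<in> elts (D C) s" by (rule C.xi_closed[OF c s])
    have a': "xi A n i a \<in> elts (D A) (i - int n)" by (rule A.xi_closed[OF a refl])
    have ab': "xi_smash A B n i a m j b \<in> elts (D (smash A B)) r" by (rule AB.xi_smash_closed[OF a b r1])
    have bc': "xi_smash B C m j b p l c \<in> elts (D (smash B C)) (j - int m + s)" by (rule BC.xi_smash_closed[OF b c e(3)])

    have "ctensor_map (D (smash A B)) (D C) (phi A B) chain_id k (ctens (ctensor (D A) (D B)) (D C) r s w z) =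
       ctens (D (smash A B)) (D C) r s (phi A B r w) (chain_id s z)"
      by (rule ctensor_map_ctens[OF gr(1)])
         (use r w' c' in \<open>auto simp: z intro: AB.phi_hom chain_id_hom\<close>)
    also have "\<dots> = ctens (D (smash A B)) (D C) r s (xi_smash A B n i a m j b) (xi C p l c)
        [^]\<^bsub>ctensor_grp (D (smash A B)) (D C) k\<^esub> phi_sign n i m"
      unfolding w z chain_id_def AB.phi_ctens_xi[OF a b refl refl r1]
      using AB_C.DD_ctens_pow[OF ab' c' r, of "phi_sign n i m" 1] c' by (simp add: group.int_pow_1)
    finally have l1: "ctensor_map (D (smash A B)) (D C) (phi A B) chain_id k (ctens (ctensor (D A) (D B)) (D C) r s w z) = \<dots>" .
    have l2: "D_map (smash A (smash B C)) (sp_assoc A B C) k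
        (phi (smash A B) C k (ctens (D (smash A B)) (D C) r s (xi_smash A B n i a m j b) (xi C p l c))) =
      X [^]\<^bsub>?K\<^esub> phi_sign (n + m) (i + j) p"
      using AB_C.D_map_phi[OF A_BC.prespectrum_smash sp_assoc_premorphism ab c e(1) s r] sp_assoc_elt[OF a b c]
      by (simp add: X_def xi_smash_def add.assoc)
    have "ctens (D (smash A B)) (D C) r s (xi_smash A B n i a m j b) (xi C p l c) \<in> carrier (ctensor_grp (D (smash A B)) (D C) k)"
      by (rule ctens_closed) (use ab' c' r in auto)
    from hom_int_pow[OF hom_compose_fun[OF AB_C.phi_hom h.D_map_hom] this, of "phi_sign n i m"]
    have L: "D_map (smash A (smash B C)) (sp_assoc A B C) k
      (phi (smash A B) C k (ctensor_map (D (smash A B)) (D C) (phi A B) chain_id k (ctens (ctensor (D A) (D B)) (D C) r s w z)))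
      = X [^]\<^bsub>?K\<^esub> (phi_sign (n + m) (i + j) p * phi_sign n i m)"
      unfolding l1 using X by (simp add: l2 K.int_pow_pow)

    have bcc: "ctens (D B) (D C) (j - int m) s (xi B m j b) (xi C p l c) \<in> carrier (ctensor_grp (D B) (D C) (j - int m + s))"
      by (rule ctens_closed) (use c' B.xi_closed[OF b] in auto)
    have "ch_assoc (D A) (D B) (D C) k (ctens (ctensor (D A) (D B)) (D C) r s w z) =
      ctens (D A) (ctensor (D B) (D C)) (i - int n) (j - int m + s) (xi A n i a) (ctens (D B) (D C) (j - int m) s (xi B m j b) (xi C p l c))"
      unfolding w z r1[symmetric] by (rule as(2)) (use r r1 a' c' B.xi_closed[OF b] in auto)
    then have "ctensor_map (D A) (D (smash B C)) chain_id (phi B C) k (ch_assoc (D A) (D B) (D C) k (ctens (ctensor (D A) (D B)) (D C) r s w z))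
      = ctens (D A) (D (smash B C)) (i - int n) (j - int m + s) (chain_id (i - int n) (xi A n i a))
         (phi B C (j - int m + s) (ctens (D B) (D C) (j - int m) s (xi B m j b) (xi C p l c)))"
      by (simp only:) (rule ctensor_map_ctens[OF _ gr(2)];
         use e a' bcc in \<open>auto intro: BC.phi_hom chain_id_hom\<close>)
    also have "\<dots> = ctens (D A) (D (smash B C)) (i - int n) (j - int m + s) (xi A n i a) (xi_smash B C m j b p l c)
        [^]\<^bsub>ctensor_grp (D A) (D (smash B C)) k\<^esub> phi_sign m j p"
      unfolding chain_id_def BC.phi_ctens_xi[OF b c refl s refl]
      using A_BC.DD_ctens_pow[OF a' bc' e(4), of 1 "phi_sign m j p"] a' by (simp add: group.int_pow_1)
    finally have r1': "ctensor_map (D A) (D (smash B C)) chain_id (phi B C) k (ch_assoc (D A) (D B) (D C) k (ctens (ctensor (D A) (D B)) (D C) r s w z)) = \<dots>" .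
    have r2: "phi A (smash B C) k (ctens (D A) (D (smash B C)) (i - int n) (j - int m + s) (xi A n i a) (xi_smash B C m j b p l c))
       = X [^]\<^bsub>?K\<^esub> phi_sign n i (m + p)"
      unfolding X_def xi_smash_def[of B C] by (rule A_BC.phi_ctens_xi[OF a bc refl e(2,4)])
    have "ctens (D A) (D (smash B C)) (i - int n) (j - int m + s) (xi A n i a) (xi_smash B C m j b p l c)
        \<in> carrier (ctensor_grp (D A) (D (smash B C)) k)"
      by (rule ctens_closed) (use a' bc' e in auto)
    from hom_int_pow[OF A_BC.phi_hom this, of "phi_sign m j p"]
    have R: "phi A (smash B C) k (ctensor_map (D A) (D (smash B C)) chain_id (phi B C) k (ch_assoc (D A) (D B) (D C) k
        (ctens (ctensor (D A) (D B)) (D C) r s w z))) = X [^]\<^bsub>?K\<^esub> (phi_sign n i (m + p) * phi_sign m j p)"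
      unfolding r1' using X by (simp add: r2 K.int_pow_pow)
    \<comment> \<open>Both exponents expand to mn + mi + pn + pm + pi + pj.\<close>
    have "phi_sign (n + m) (i + j) p * phi_sign n i m = phi_sign n i (m + p) * phi_sign m j p"
      by (auto simp: phi_sign_def ksign_def)
    then show "D_map (smash A (smash B C)) (sp_assoc A B C) k
      (phi (smash A B) C k (ctensor_map (D (smash A B)) (D C) (phi A B) chain_id k (ctens (ctensor (D A) (D B)) (D C) r s w z)))
      = phi A (smash B C) k (ctensor_map (D A) (D (smash B C)) chain_id (phi B C) k (ch_assoc (D A) (D B) (D C) k
        (ctens (ctensor (D A) (D B)) (D C) r s w z)))"
      unfolding L R by simp
  qed auto
qed

end


section \<open>Functoriality of D and the symmetric monoidal structure\<close>

section \<open>The main theorem\<close>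

text \<open>Up to sign d\<xi>(a) is \<xi>(da), so the second boundary is a power of \<xi>(dda),
  which is neutral.\<close>

lemma chain_complex_D:
  assumes "prespectrum A" and lev: "\<And>n. chain_complex (lev A n)"
  shows "chain_complex (D A)"
proof -
  interpret A: prespectrum A by fact
  have "bd (D A) (k - 1) (bd (D A) k x) = \<one>\<^bsub>grp (D A) (k - 2)\<^esub>" if x: "x \<in> elts (D A) k" for k x
  proof (rule A.D_hom_eq[OF _ hom_compose_fun[OF precomplex_bd precomplex_bd] hom_trivial _ x])
    fix n i a assume k: "i - int n = k" and a: "a \<in> elts (lev A n) i"
    have k1: "i - 1 - int n = k - 1" "i - 2 - int n = k - 2" using k by auto
    have da: "bd (lev A n) i a \<in> elts (lev A n) (i - 1)" using A.bd_closed[OF a] by simp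
    have "bd (lev A n) (i - 1) (bd (lev A n) i a) = \<one>\<^bsub>grp (lev A n) (i - 2)\<^esub>"
      using lev[of n] a by (simp add: chain_complex_def)
    then have "bd (D A) (k - 1) (xi A n (i - 1) (bd (lev A n) i a)) = \<one>\<^bsub>grp (D A) (k - 2)\<^esub>"
      using A.bd_xi[OF da k1(1)] hom_one[OF A.xi_hom[OF k1(2)]] by (simp add: group.int_pow_one)
    then show "bd (D A) (k - 1) (bd (D A) k (xi A n i a)) = \<one>\<^bsub>grp (D A) (k - 2)\<^esub>"
      unfolding A.bd_xi[OF a k]
      using hom_int_pow[OF precomplex_bd[OF A.precomplex_D, of "k - 2" "k - 1"] A.xi_closed[OF da k1(1)]]
      by (simp add: group.int_pow_one)
  qed auto
  then show ?thesis using precomplex_bd[OF A.precomplex_D refl] by (simp add: chain_complex_def)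
qed

text \<open>On \<xi>(a) both composites give (-1)^n \<xi>(f(da)), because f preserves the level n on
  which the sign depends.\<close>

lemma chain_map_D_map:
  assumes "prespectrum A" "prespectrum B" "premorphism A B f"
    and f: "\<And>n. chain_map (lev A n) (lev B n) (f n)"
  shows "chain_map (D A) (D B) (D_map B f)"
proof -
  interpret f: prespectrum_map A B f by (rule prespectrum_mapI) fact+
  have "D_map B f (k - 1) (bd (D A) k x) = bd (D B) k (D_map B f k x)" if x: "x \<in> elts (D A) k" for k x
  proof (rule f.A.D_hom_eq[OF _ hom_compose_fun[OF precomplex_bd f.D_map_hom] hom_compose_fun[OF f.D_map_hom precomplex_bd] _ x])
    fix n i a assume k: "i - int n = k" and a: "a \<in> elts (lev A n) i"
    have k1: "i - 1 - int n = k - 1" using k by auto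
    have da: "bd (lev A n) i a \<in> elts (lev A n) (i - 1)" using f.A.bd_closed[OF a] by simp
    show "D_map B f (k - 1) (bd (D A) k (xi A n i a)) = bd (D B) k (D_map B f k (xi A n i a))"
      unfolding f.A.bd_xi[OF a k] f.D_map_xi[OF k a] f.B.bd_xi[OF f.f_closed[OF a] k]
      using hom_int_pow[OF f.D_map_hom f.A.xi_closed[OF da k1]] f.D_map_xi[OF k1 da] f[of n] a
      by (simp add: chain_map_def)
  qed auto
  then show ?thesis using f.D_map_hom by (simp add: chain_map_def)
qed

lemma D_map_id:
  assumes "prespectrum A"
  shows "chain_map_eq (D A) (D_map A spectrum_id) chain_id"
proof -
  interpret f: prespectrum_map A A spectrum_id
    by (rule prespectrum_mapI[OF assms assms])
       (simp add: premorphism_def spectrum_id_def chain_id_hom, simp add: chain_id_def)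
  have "D_map A spectrum_id k x = x" if x: "x \<in> elts (D A) k" for k x
    by (rule f.A.D_hom_eq[OF _ f.D_map_hom hom_id _ x])
       (auto simp: f.D_map_xi spectrum_id_def chain_id_def)
  then show ?thesis by (simp add: chain_map_eq_def chain_id_def)
qed

lemma D_map_comp:
  assumes A: "prespectrum A" and B: "prespectrum B" and C: "prespectrum C"
    and f: "premorphism A B f" and g: "premorphism B C g"
  shows "chain_map_eq (D A) (D_map C (g \<circ>\<^sub>s f)) (D_map C g \<circ>\<^sub>c D_map B f)"
proof -
  interpret f: prespectrum_map A B f by (rule prespectrum_mapI[OF A B f])
  interpret g: prespectrum_map B C g by (rule prespectrum_mapI[OF B C g])
  interpret gf: prespectrum_map A C "g \<circ>\<^sub>s f" by (rule prespectrum_mapI[OF A C premorphism_comp[OF f g]])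
  have "D_map C (g \<circ>\<^sub>s f) k x = D_map C g k (D_map B f k x)" if x: "x \<in> elts (D A) k" for k x
    by (rule f.A.D_hom_eq[OF _ gf.D_map_hom hom_compose_fun[OF f.D_map_hom g.D_map_hom] _ x])
       (auto simp: gf.D_map_xi f.D_map_xi g.D_map_xi f.f_closed spectrum_comp_def chain_comp_def)
  then show ?thesis by (simp add: chain_map_eq_def chain_comp_def)
qed

theorem proposition11:
  fixes A :: "'a symspec" and B :: "'b symspec" and C :: "'c symspec"
    and A' :: "'d symspec" and B' :: "'e symspec" and A'' :: "'f symspec"
    and f :: "nat \<Rightarrow> int \<Rightarrow> 'a \<Rightarrow> 'd" and g :: "nat \<Rightarrow> int \<Rightarrow> 'b \<Rightarrow> 'e"
    and f' :: "nat \<Rightarrow> int \<Rightarrow> 'd \<Rightarrow> 'f"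
  assumes "symmetric_spectrum A" and "symmetric_spectrum B" and "symmetric_spectrum C"
    and "symmetric_spectrum A'" and "symmetric_spectrum B'" and "symmetric_spectrum A''"
    and "spectrum_map A A' f" and "spectrum_map B B' g" and "spectrum_map A' A'' f'"
  shows
    "\<comment> \<open>\<open>D\<close> is a functor\<close>
     (chain_complex (D A)
     \<and> chain_map (D A) (D A') (D_map A' f)
     \<and> chain_map_eq (D A) (D_map A spectrum_id) chain_id
     \<and> chain_map_eq (D A) (D_map A'' (f' \<circ>\<^sub>s f)) (D_map A'' f' \<circ>\<^sub>c D_map A' f))
     \<comment> \<open>values of \<open>\<phi>\<close> on generators\<close>
     \<and> (\<forall>n i m j. \<forall>a \<in> elts (lev A n) i. \<forall>b \<in> elts (lev B m) j.
       phi A B ((i - int n) + (j - int m))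
         (ctens (D A) (D B) (i - int n) (j - int m) (xi A n i a) (xi B m j b)) =
       xi (smash A B) (n + m) (i + j) (smash_elt A B id n i a m j b)
         [^]\<^bsub>grp (D (smash A B)) ((i - int n) + (j - int m))\<^esub> ksign (int m * int n + int m * i))
     \<comment> \<open>\<open>\<phi>\<close> is a natural isomorphism\<close>
     \<and> (chain_iso (ctensor (D A) (D B)) (D (smash A B)) (phi A B))
     \<and> (chain_map_eq (ctensor (D A) (D B))
       (D_map (smash A' B') (smash_map A' B' f g) \<circ>\<^sub>c phi A B)
       (phi A' B' \<circ>\<^sub>c ctensor_map (D A') (D B') (D_map A' f) (D_map B' g)))
     \<comment> \<open>the unit isomorphism\<close>
     \<and> (chain_iso (Zc 0) (D Zstar) D_unit)
     \<comment> \<open>associativity\<close>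
     \<and> (chain_map_eq (ctensor (ctensor (D A) (D B)) (D C))
       (D_map (smash A (smash B C)) (sp_assoc A B C)
          \<circ>\<^sub>c phi (smash A B) C
          \<circ>\<^sub>c ctensor_map (D (smash A B)) (D C) (phi A B) chain_id)
       (phi A (smash B C)
          \<circ>\<^sub>c ctensor_map (D A) (D (smash B C)) chain_id (phi B C)
          \<circ>\<^sub>c ch_assoc (D A) (D B) (D C)))
     \<comment> \<open>left and right unit\<close>
     \<and> (chain_map_eq (ctensor (Zc 0) (D A))
       (D_map A (sp_lunit A) \<circ>\<^sub>c phi Zstar A \<circ>\<^sub>c ctensor_map (D Zstar) (D A) D_unit chain_id)
       (ch_lunit (D A)))
     \<and> (chain_map_eq (ctensor (D A) (Zc 0))
       (D_map A (sp_runit A) \<circ>\<^sub>c phi A Zstar \<circ>\<^sub>c ctensor_map (D A) (D Zstar) chain_id D_unit)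
       (ch_runit (D A)))
     \<comment> \<open>symmetry\<close>
     \<and> (chain_map_eq (ctensor (D A) (D B))
       (D_map (smash B A) (sp_twist A B) \<circ>\<^sub>c phi A B)
       (phi B A \<circ>\<^sub>c ch_twist (D A) (D B)))"
proof -
  note pre = assms(1-6)[THEN symmetric_spectrum_prespectrum]
  note mor = assms(7-9)[THEN spectrum_map_premorphism]
  \<comment> \<open>The unit laws use additivity of \<open>sact\<close> on all of Z[k] \<otimes>
    A_n, which \<open>prespectrum\<close> does not record.\<close>
  have act: "sact A k n t \<in> hom (ctensor_grp (Zc (int k)) (lev A n) t) (grp (lev A (k + n)) t)" for k n t
    using assms(1) by (simp add: symmetric_spectrum_def chain_map_def)
  have lev: "chain_complex (lev A n)" for n
    using assms(1) by (simp add: symmetric_spectrum_def symmetric_sequence_def nonneg_complex_def)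
  have f: "chain_map (lev A n) (lev A' n) (f n)" for n
    using assms(7) by (simp add: spectrum_map_def)
  interpret T: prespectrum_triple A B C
    by (intro prespectrum_triple.intro pre)
  interpret N: prespectrum_pair_map A A' f B B' g
    by (intro prespectrum_pair_map.intro prespectrum_mapI pre mor)
  note eq = chain_map_eq_def chain_comp_def comp_def
  show ?thesis
    apply (intro conjI)
             apply (rule chain_complex_D[OF pre(1) lev])
            apply (rule chain_map_D_map[OF pre(1,4) mor(1) f])
           apply (rule D_map_id[OF pre(1)])
          apply (rule D_map_comp[OF pre(1,4,6) mor(1,3)])
         apply (intro allI ballI)
         apply (simp only: T.AB.phi_ctens_xi[OF _ _ refl refl refl] xi_smash_def phi_sign_def)
        apply (rule T.AB.phi_chain_iso)
       apply (simp add: eq N.phi_natural)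
      apply (rule D_unit_chain_iso[OF pre(1) act])
     apply (simp add: eq T.phi_assoc)
    apply (simp add: eq phi_lunit[OF pre(1) act])
   apply (simp add: eq phi_runit[OF pre(1) act])
  apply (simp add: eq T.AB.phi_symmetric)
  done
qed

end
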